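(* Fix an integer $k\ge4$, and let $q=q(n)$ satisfy $$n^{-2/(k-1)}(\log n)^{1/\binom{k-1}{2}}\ll q\ll n^{-2/k}.$$ If $H\sim G(n,q)$, then there is a function $\zeta=\zeta(n)\to0$ such that, with high probability, every maximal $K_k$-matching $\mathcal M$ in $H$ has the following property: the graph $H-V(\mathcal M)$ contains a $K_{k-1}$-matching which leaves at most $\zeta\sqrt{\mu_k(n,q)}$ vertices of $H-V(\mathcal M)$ uncovered.
   Context: All asymptotics are as $n\to\infty$; $f\ll g$ means $f/g\to0$; "with high probability" means with probability tending to $1$. $G(n,q)$ is the binomial random graph on $[n]$. A $K_\ell$-matching in a graph is a collection of pairwise vertex-disjoint copies of $K_\ell$. A $K_k$-matching $\mathcal M$ in $H$ is maximal if no further copy of $K_k$ in $H$ can be added to it (keeping disjointness). $V(\mathcal M)$ is its covered vertex set, and $H-V(\mathcal M):=H[V(H)\setminus V(\mathcal M)]$. $\mu_k(n,q):=\binom nk q^{\binom k2}$. The high-probability statement holds simultaneously for all maximal $\mathcal M$. *)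

theory Defs
  imports
    "HOL-Probability.Probability"
    "HOL-Library.Disjoint_Sets"
    "HOL-Library.Landau_Symbols"
begin

text \<open>A finite simple graph is a pair of a vertex set and a set of two-element vertex sets.\<close>

type_synonym 'a sgraph = "'a set \<times> 'a set set"

abbreviation verts :: "'a sgraph \<Rightarrow> 'a set" where
  "verts G \<equiv> fst G"

abbreviation edges :: "'a sgraph \<Rightarrow> 'a set set" where
  "edges G \<equiv> snd G"

definition induced_subgraph :: "'a sgraph \<Rightarrow> 'a set \<Rightarrow> 'a sgraph" where
  "induced_subgraph G W = (verts G \<inter> W, {e \<in> edges G. e \<subseteq> W})"

definition vertex_pairs :: "nat \<Rightarrow> nat set set" where
  "vertex_pairs n = {e. e \<subseteq> {1..n} \<and> card e = 2}"

definition binomial_random_graph :: "nat \<Rightarrow> real \<Rightarrow> nat sgraph pmf" where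
  "binomial_random_graph n q =
     map_pmf (\<lambda>present. ({1..n}, {e \<in> vertex_pairs n. present e}))
       (Pi_pmf (vertex_pairs n) False (\<lambda>_. bernoulli_pmf q))"

text \<open>A copy of a complete graph in \<open>G\<close> is determined by its vertex set, so it is represented by it.\<close>

definition complete_copy :: "nat \<Rightarrow> 'a sgraph \<Rightarrow> 'a set \<Rightarrow> bool" where
  "complete_copy l G S \<longleftrightarrow>
     S \<subseteq> verts G \<and> finite S \<and> card S = l \<and> (\<forall>u\<in>S. \<forall>v\<in>S. u \<noteq> v \<longrightarrow> {u, v} \<in> edges G)"

definition complete_matching :: "nat \<Rightarrow> 'a sgraph \<Rightarrow> 'a set set \<Rightarrow> bool" where
  "complete_matching l G M \<longleftrightarrow> (\<forall>S\<in>M. complete_copy l G S) \<and> disjoint M"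

definition maximal_complete_matching :: "nat \<Rightarrow> 'a sgraph \<Rightarrow> 'a set set \<Rightarrow> bool" where
  "maximal_complete_matching l G M \<longleftrightarrow>
     complete_matching l G M \<and> (\<forall>S. S \<notin> M \<longrightarrow> \<not> complete_matching l G (insert S M))"

definition covered :: "'a set set \<Rightarrow> 'a set" where
  "covered M = \<Union>M"

definition remove_covered :: "'a sgraph \<Rightarrow> 'a set set \<Rightarrow> 'a sgraph" where
  "remove_covered G M = induced_subgraph G (verts G - covered M)"

text \<open>The expected number of copies of the complete graph on \<open>k\<close> vertices.\<close>

definition mu :: "nat \<Rightarrow> nat \<Rightarrow> real \<Rightarrow> real" where
  "mu k n q = real (n choose k) * q ^ (k choose 2)"

text \<open>
  The relation \<open>f \<lless> g\<close> is rendered by \<open>f \<in> o(g)\<close>. This agrees with \<open>f / g \<longlonglongrightarrow> 0\<close> wherever the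
  quotient is eventually defined, but is not made true by \<open>x / 0 = 0\<close> when \<open>g\<close> vanishes.
\<close>

end

theory Submission
  imports
    Defs
    "HOL-Combinatorics.Permutations"
begin

text \<open>
  Put \<open>s = k - 1\<close>, \<open>A = n q^(s/2)\<close>, \<open>B = n q^((s+1)/2)\<close> and \<open>D = n^(s-1) q^(s choose 2)
  = A^(s-1)\<close>. The two hypotheses on \<open>q\<close> say that \<open>D / log n \<longrightarrow> \<infinity>\<close> and
  \<open>B \<longrightarrow> 0\<close>, and \<open>\<mu>\<close> has the order of \<open>A^k\<close>, which is much smaller than
  \<open>n\<close> because \<open>A^k = n B^s\<close>.

  The proof is a union bound over the \<open>K\<^sub>k\<close>-matchings \<open>M\<close>. Such an \<open>M\<close> is a maximal
  matching of \<open>H\<close> exactly when its edges are present and the graph on the uncovered set \<open>W\<close> contains no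
  \<open>K\<^sub>k\<close>; these two events are independent. It therefore suffices that, conditionally on \<open>H[W]\<close> being
  \<open>K\<^sub>k\<close>-free, a typical \<open>H[W]\<close> fails to have an almost perfect \<open>K\<^sub>s\<close>-matching
  with a probability so small that it beats the sum, over \<open>M\<close>, of P(\<open>M \<subseteq> H\<close>)
  P(\<open>H[W]\<close> is \<open>K\<^sub>k\<close>-free).

  That sum is at most \<open>4^Q\<close> (lemma \<open>matching_sum_bound\<close>): by Harris' inequality its term at
  \<open>M\<close> is, up to a factor \<open>4^Q\<close> with \<open>Q\<close> of order \<open>A^k card M / n\<close>, at most the
  probability that the copies of \<open>K\<^sub>k\<close> in \<open>H\<close> are precisely the members of \<open>M\<close>, and
  these events are disjoint.

  The conditional estimate (lemma \<open>poorly_covered_bound\<close>) is where the two thresholds enter. Conditioning on being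
  \<open>K\<^sub>k\<close>-free destroys independence, but one consequence of independence survives: forcing a disjoint family
  \<open>T\<close> of further \<open>s\<close>-sets to be cliques reduces probabilities by no more than a factor \<open>q^(s choose
  2) / 2\<close> per member (lemma \<open>planting\<close>), again by Harris' inequality, because \<open>B\<close> is small and
  planted cliques rarely create unwanted ones. This is all that the minimal-fragment argument of Park and Pham needs (locale
  \<open>fragment_process\<close>). Split the \<open>s\<close>-cliques of \<open>H[W]\<close> at random into \<open>m\<close>
  rounds, where \<open>m\<close> is a small multiple of \<open>D\<close>. In each round, outside an event of weight at most
  \<open>\<delta> = 2^(-\<rho>)\<close>, the number of cliques that most matchings still miss drops by half. A graph in which every
  matching misses more than \<open>\<rho>\<close> cliques must have all but \<open>J = O(log n)\<close> rounds in that event, which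
  has probability at most \<open>(2 \<delta>)^m / \<delta>^J\<close>. As \<open>D\<close> exceeds \<open>log n\<close>, the exponent
  is of order \<open>\<rho> D\<close>, and it exceeds \<open>Q\<close> for a \<open>\<rho>\<close> that is still negligible against
  \<open>\<surd>\<mu>\<close>.

  The argument needs a probability measure on almost perfect families of disjoint \<open>s\<close>-sets of \<open>W\<close> that is
  spread, in the sense that a given family \<open>T\<close> is contained with probability at most \<open>O(n^(1-s))^(card
  T)\<close>, and supported on plantable families. A uniformly random arrangement of \<open>W\<close> in rows of length
  \<open>s\<close> that avoids the few \<open>s\<close>-sets that are expensive to plant is spread by a switching argument (lemma
  \<open>spread\<close>); blocks that are expensive because of other blocks are dropped (lemma
  \<open>spread_plantable_matchings\<close>). That there are few expensive \<open>s\<close>-sets is the typicality of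
  \<open>H\<close>, shown by a moment of order \<open>log n\<close> (lemma \<open>overlap_typical\<close>) and a first moment (lemma
  \<open>joint_cost_expectation\<close>).
\<close>

section \<open>Random subsets of a finite set\<close>

text \<open>
  The expectation of \<open>h X\<close> when \<open>X\<close> contains each element of \<open>P\<close> independently with
  probability \<open>q\<close>. As a finite sum it turns conditioning and independence into rearrangements of sums.
\<close>

definition rexp :: "'a set \<Rightarrow> real \<Rightarrow> ('a set \<Rightarrow> real) \<Rightarrow> real" where
  "rexp P q h = (\<Sum>X\<in>Pow P. q ^ card X * (1 - q) ^ card (P - X) * h X)"

lemma rexp_empty [simp]: "rexp {} q h = h {}"
  by (simp add: rexp_def)

lemma rexp_insert:
  assumes "finite P" "e \<notin> P"
  shows "rexp (insert e P) q h = q * rexp P q (\<lambda>X. h (insert e X)) + (1 - q) * rexp P q h"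
proof -
  have d: "Pow P \<inter> insert e ` Pow P = {}" using assms by auto
  have i: "inj_on (insert e) (Pow P)" using assms by (auto simp: inj_on_def)
  have c1: "card (insert e X) = Suc (card X)" "P - insert e X = P - X"
    if "X \<in> Pow P" for X
    using that assms(2) finite_subset[OF _ assms(1), of X] by (auto simp: card_insert_if)
  have c2: "card (insert e P - X) = Suc (card (P - X))" if "X \<in> Pow P" for X
  proof -
    have "insert e P - X = insert e (P - X)" using that assms by auto
    then show ?thesis using assms by (simp add: card_insert_if)
  qed
  have "rexp (insert e P) q h =
    (\<Sum>X\<in>Pow P. q ^ card X * (1 - q) ^ card (insert e P - X) * h X) +
    (\<Sum>X\<in>insert e ` Pow P. q ^ card X * (1 - q) ^ card (insert e P - X) * h X)"
    unfolding rexp_def Pow_insert using d assms by (simp add: sum.union_disjoint)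
  also have "(\<Sum>X\<in>insert e ` Pow P. q ^ card X * (1 - q) ^ card (insert e P - X) * h X)
    = q * rexp P q (\<lambda>X. h (insert e X))"
    unfolding rexp_def sum.reindex[OF i] sum_distrib_left
    by (rule sum.cong) (simp_all add: c1)
  also have "(\<Sum>X\<in>Pow P. q ^ card X * (1 - q) ^ card (insert e P - X) * h X) = (1 - q) * rexp P q h"
    unfolding rexp_def sum_distrib_left by (rule sum.cong) (auto simp: c2)
  finally show ?thesis by simp
qed

lemma rexp_cong: "(\<And>X. X \<subseteq> P \<Longrightarrow> f X = g X) \<Longrightarrow> rexp P q f = rexp P q g"
  unfolding rexp_def by (rule sum.cong) auto

lemma rexp_const: "finite P \<Longrightarrow> rexp P q (\<lambda>_. c) = c"
  by (induction P rule: finite_induct) (simp_all add: rexp_insert algebra_simps)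

lemma rexp_add: "rexp P q (\<lambda>X. f X + g X) = rexp P q f + rexp P q g"
  by (simp add: rexp_def sum.distrib algebra_simps)

lemma rexp_cmult: "rexp P q (\<lambda>X. c * f X) = c * rexp P q f"
  by (simp add: rexp_def sum_distrib_left algebra_simps)

lemma rexp_sum: "rexp P q (\<lambda>X. \<Sum>i\<in>I. f i X) = (\<Sum>i\<in>I. rexp P q (f i))"
  unfolding rexp_def by (subst sum.swap) (simp add: sum_distrib_left)

lemma rexp_mono:
  assumes "0 \<le> q" "q \<le> 1" "\<And>X. X \<subseteq> P \<Longrightarrow> f X \<le> g X"
  shows "rexp P q f \<le> rexp P q g"
  unfolding rexp_def using assms by (intro sum_mono mult_left_mono) auto

lemma rexp_nonneg:
  assumes "0 \<le> q" "q \<le> 1" "\<And>X. X \<subseteq> P \<Longrightarrow> 0 \<le> f X"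
  shows "0 \<le> rexp P q f"
  unfolding rexp_def using assms by (intro sum_nonneg) auto

lemma rexp_markov:
  assumes "0 \<le> q" "q \<le> 1" "\<And>X. X \<subseteq> P \<Longrightarrow> 0 \<le> f X" "c > 0"
  shows "rexp P q (\<lambda>X. of_bool (f X \<ge> c)) \<le> rexp P q f / c"
proof -
  have "rexp P q (\<lambda>X. of_bool (f X \<ge> c)) \<le> rexp P q (\<lambda>X. (1/c) * f X)"
    using assms by (intro rexp_mono) (auto simp: field_simps)
  then show ?thesis unfolding rexp_cmult by simp
qed

text \<open>
  Conditioning on \<open>F \<subseteq> X\<close> leaves the elements outside \<open>F\<close> independent.
\<close>

lemma rexp_superset:
  assumes "finite P" "F \<subseteq> P"
  shows "rexp P q (\<lambda>X. of_bool (F \<subseteq> X) * h X) = q ^ card F * rexp (P - F) q (\<lambda>X. h (X \<union> F))"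
proof -
  have inj: "inj_on (\<lambda>X. X \<union> F) (Pow (P - F))" by (auto simp: inj_on_def)
  have im: "(\<lambda>X. X \<union> F) ` Pow (P - F) = {X \<in> Pow P. F \<subseteq> X}"
  proof safe
    fix X assume "X \<subseteq> P" "F \<subseteq> X"
    then show "X \<in> (\<lambda>X. X \<union> F) ` Pow (P - F)" by (intro image_eqI[of _ _ "X - F"]) auto
  qed (use assms in auto)
  have "rexp P q (\<lambda>X. of_bool (F \<subseteq> X) * h X)
     = (\<Sum>X\<in>{X \<in> Pow P. F \<subseteq> X}. q ^ card X * (1 - q) ^ card (P - X) * h X)"
    unfolding rexp_def using assms by (intro sum.mono_neutral_cong_right) auto
  also have "\<dots> = (\<Sum>X\<in>Pow (P - F). q ^ card (X \<union> F) * (1 - q) ^ card (P - (X \<union> F)) * h (X \<union> F))"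
    unfolding im[symmetric] sum.reindex[OF inj] by simp
  also have "\<dots> = (\<Sum>X\<in>Pow (P - F). q ^ card F * (q ^ card X * (1 - q) ^ card (P - F - X) * h (X \<union> F)))"
  proof (rule sum.cong[OF refl])
    fix X assume "X \<in> Pow (P - F)"
    then have "card (X \<union> F) = card X + card F" "P - (X \<union> F) = P - F - X"
      using assms by (auto intro!: card_Un_disjoint dest: finite_subset)
    then show "q ^ card (X \<union> F) * (1 - q) ^ card (P - (X \<union> F)) * h (X \<union> F) =
        q ^ card F * (q ^ card X * (1 - q) ^ card (P - F - X) * h (X \<union> F))"
      by (simp add: power_add)
  qed
  finally show ?thesis by (simp add: rexp_def sum_distrib_left)
qed

text \<open>
  The trace of the random set on \<open>P'\<close> is again a random set with independent elements.
\<close>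

lemma rexp_restrict:
  assumes "finite P" "P' \<subseteq> P"
  shows "rexp P q (\<lambda>X. h (X \<inter> P')) = rexp P' q h"
proof -
  have "rexp (P' \<union> R) q (\<lambda>X. h (X \<inter> P')) = rexp P' q h" if "finite R" "R \<inter> P' = {}" for R
    using that
  proof (induction R rule: finite_induct)
    case empty
    then show ?case by (auto intro!: rexp_cong arg_cong[of _ _ h])
  next
    case (insert e R)
    have f: "finite (P' \<union> R)" using insert.hyps assms by (auto dest: finite_subset)
    have "insert e X \<inter> P' = X \<inter> P'" for X using insert.prems by auto
    then have "rexp (insert e (P' \<union> R)) q (\<lambda>X. h (X \<inter> P')) = rexp (P' \<union> R) q (\<lambda>X. h (X \<inter> P'))"
      using insert f by (subst rexp_insert) (auto simp: algebra_simps)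
    then show ?case using insert by simp
  qed
  from this[of "P - P'"] show ?thesis using assms
    by (simp add: Un_absorb1 Int_commute Diff_Int_distrib)
qed

text \<open>
  Harris' inequality. Splitting off one element \<open>e\<close>, the two sides differ by \<open>q (1 - q)\<close> times the product
  of the effects of \<open>e\<close> on \<open>f\<close> and on \<open>g\<close>, which have the same sign.
\<close>

lemma rexp_Harris:
  assumes "finite P" "0 \<le> q" "q \<le> 1"
    and "\<And>X Y. X \<subseteq> Y \<Longrightarrow> Y \<subseteq> P \<Longrightarrow> f Y \<le> f X"
    and "\<And>X Y. X \<subseteq> Y \<Longrightarrow> Y \<subseteq> P \<Longrightarrow> g Y \<le> g X"
  shows "rexp P q f * rexp P q g \<le> rexp P q (\<lambda>X. f X * g X)"
  using assms(1,4,5)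
proof (induction P arbitrary: f g rule: finite_induct)
  case empty
  then show ?case by simp
next
  case (insert e P)
  define f1 where "f1 = rexp P q (\<lambda>X. f (insert e X))"
  define g1 where "g1 = rexp P q (\<lambda>X. g (insert e X))"
  define f0 where "f0 = rexp P q f"
  define g0 where "g0 = rexp P q g"
  have A: "f1 * g1 \<le> rexp P q (\<lambda>X. f (insert e X) * g (insert e X))"
    unfolding f1_def g1_def
    by (rule insert.IH) (intro insert.prems; auto)+
  have B: "f0 * g0 \<le> rexp P q (\<lambda>X. f X * g X)"
    unfolding f0_def g0_def by (rule insert.IH) (intro insert.prems; auto)+
  have "f1 \<le> f0" "g1 \<le> g0"
    unfolding f1_def f0_def g1_def g0_def using assms(2,3)
    by (auto intro!: rexp_mono insert.prems)
  then have "0 \<le> q * (1 - q) * ((f0 - f1) * (g0 - g1))"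
    using assms(2,3) by (intro mult_nonneg_nonneg) auto
  then have "(q * f1 + (1 - q) * f0) * (q * g1 + (1 - q) * g0) \<le> q * (f1 * g1) + (1 - q) * (f0 * g0)"
    by (simp add: algebra_simps)
  also have "\<dots> \<le> q * rexp P q (\<lambda>X. f (insert e X) * g (insert e X)) + (1 - q) * rexp P q (\<lambda>X. f X * g X)"
    using A B assms(2,3) by (intro add_mono mult_left_mono) auto
  finally show ?case
    using insert.hyps by (simp add: rexp_insert f1_def g1_def f0_def g0_def)
qed

text \<open>
  Avoiding a set is a decreasing event, so by Harris' inequality the events support each other. Sets that do not lie in
  \<open>P\<close> are avoided automatically.
\<close>

lemma rexp_avoid_ge:
  assumes "finite P" "0 \<le> q" "q \<le> 1" "finite I"
  shows "(\<Prod>i\<in>I. 1 - q ^ card (F i)) \<le> rexp P q (\<lambda>X. of_bool (\<forall>i\<in>I. F i \<subseteq> P \<longrightarrow> \<not> F i \<subseteq> X))"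
  using assms(4)
proof (induction I rule: finite_induct)
  case empty
  then show ?case using assms by (simp add: rexp_const)
next
  case (insert i I)
  let ?f = "\<lambda>X. of_bool (\<forall>i\<in>I. F i \<subseteq> P \<longrightarrow> \<not> F i \<subseteq> X) :: real"
  let ?g = "\<lambda>X. of_bool (F i \<subseteq> P \<longrightarrow> \<not> F i \<subseteq> X) :: real"
  have "1 - q ^ card (F i) \<le> rexp P q ?g"
  proof (cases "F i \<subseteq> P")
    case True
    have "rexp P q (\<lambda>X. of_bool (F i \<subseteq> X) * 1) = q ^ card (F i)"
      using True assms by (subst rexp_superset) (auto simp: rexp_const)
    moreover have "rexp P q ?g + rexp P q (\<lambda>X. of_bool (F i \<subseteq> X) * 1) = rexp P q (\<lambda>X. 1)"
      using True unfolding rexp_add[symmetric] by (intro rexp_cong) auto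
    ultimately show ?thesis using assms by (simp add: rexp_const)
  next
    case False
    then show ?thesis using assms by (simp add: rexp_const)
  qed
  moreover have "0 \<le> rexp P q ?f" using assms by (intro rexp_nonneg) auto
  moreover have "0 \<le> 1 - q ^ card (F i)" using assms by (simp add: power_le_one)
  ultimately have "(1 - q ^ card (F i)) * (\<Prod>i\<in>I. 1 - q ^ card (F i)) \<le> rexp P q ?g * rexp P q ?f"
    using insert.IH by (intro mult_mono) (auto intro!: prod_nonneg power_le_one assms)
  also have "\<dots> \<le> rexp P q (\<lambda>X. ?g X * ?f X)"
    using assms by (intro rexp_Harris) (auto simp: of_bool_def dest: order_trans)
  also have "(\<lambda>X. ?g X * ?f X) = (\<lambda>X. of_bool (\<forall>j\<in>insert i I. F j \<subseteq> P \<longrightarrow> \<not> F j \<subseteq> X))"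
    by auto
  finally show ?case using insert.hyps by simp
qed

text \<open>
  On \<open>[0, 1/2]\<close> the convex function \<open>4 powr (- y)\<close> lies below its chord.
\<close>

lemma one_minus_ge_four_powr:
  assumes "0 \<le> y" "y \<le> (1/2::real)"
  shows "1 - y \<ge> 4 powr (- y)"
proof -
  have "convex_on UNIV (\<lambda>x::real. exp (- (ln 4) * x))"
    by (rule f''_ge0_imp_convex[where f' = "\<lambda>x. - ln 4 * exp (- (ln 4) * x)" and f'' = "\<lambda>x. (ln 4)^2 * exp (- (ln 4) * x)"])
       (auto intro!: derivative_eq_intros simp: power2_eq_square)
  from convex_onD[OF this, of "2*y" 0 "1/2"]
  have "exp (- (ln 4) * y) \<le> (1 - 2*y) + 2*y * exp (- (ln 4) / 2)"
    using assms by auto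
  moreover have "exp (- (ln 4) / 2) = (1/2::real)"
  proof -
    have "ln (4::real) = 2 * ln 2" using ln_realpow[of 2 2] by simp
    then show ?thesis by (simp add: exp_minus)
  qed
  ultimately show ?thesis by (simp add: powr_def algebra_simps)
qed

lemma rexp_avoid_ge_powr:
  assumes "finite P" "0 \<le> q" "q \<le> 1/2" "finite I" "\<And>i. i \<in> I \<Longrightarrow> card (F i) \<ge> 1"
  shows "4 powr (- (\<Sum>i\<in>I. q ^ card (F i))) \<le> rexp P q (\<lambda>X. of_bool (\<forall>i\<in>I. F i \<subseteq> P \<longrightarrow> \<not> F i \<subseteq> X))"
proof -
  have "4 powr (- (\<Sum>i\<in>I. q ^ card (F i))) = (\<Prod>i\<in>I. 4 powr (- (q ^ card (F i))))"
    using assms(4) by (simp add: powr_sum sum_negf[symmetric])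
  also have "\<dots> \<le> (\<Prod>i\<in>I. 1 - q ^ card (F i))"
  proof (rule prod_mono, safe)
    fix i assume "i \<in> I"
    then have "q ^ card (F i) \<le> q ^ 1" using assms by (intro power_decreasing) auto
    then show "4 powr (- (q ^ card (F i))) \<le> 1 - q ^ card (F i)"
      using assms by (intro one_minus_ge_four_powr) auto
  qed auto
  also have "\<dots> \<le> rexp P q (\<lambda>X. of_bool (\<forall>i\<in>I. F i \<subseteq> P \<longrightarrow> \<not> F i \<subseteq> X))"
    using assms by (intro rexp_avoid_ge) auto
  finally show ?thesis .
qed

text \<open>
  For an element \<open>e\<close> of \<open>F\<close> the factor has mean \<open>q + (1 - q) q \<le> 2 q\<close>. The quantity
  \<open>q ^ card (F - X)\<close> is the probability, given \<open>X\<close>, that a second independent sample completes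
  \<open>F\<close>; it serves as a smooth version of the indicator of \<open>F \<subseteq> X\<close>.
\<close>

lemma rexp_power_card_diff:
  assumes "finite P" "F \<subseteq> P" "0 \<le> q" "q \<le> 1"
  shows "rexp P q (\<lambda>X. q ^ card (F - X)) \<le> (2 * q) ^ card F"
proof -
  have eq: "rexp F q (\<lambda>X. q ^ card (F - X)) = (q + (1 - q) * q) ^ card F" if "finite F" for F :: "'a set"
    using that
  proof (induction F rule: finite_induct)
    case (insert e F)
    have "rexp F q (\<lambda>X. q ^ card (insert e F - insert e X)) = rexp F q (\<lambda>X. q ^ card (F - X))"
      using insert.hyps by (intro rexp_cong) (metis Diff_insert2 Diff_insert_absorb insert_Diff1 insertI1)
    moreover have "rexp F q (\<lambda>X. q ^ card (insert e F - X)) = q * rexp F q (\<lambda>X. q ^ card (F - X))"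
    proof -
      have "q ^ card (insert e F - X) = q * q ^ card (F - X)" if "X \<subseteq> F" for X
      proof -
        have "insert e F - X = insert e (F - X)" using that insert.hyps by auto
        then show ?thesis using insert.hyps by simp
      qed
      then show ?thesis unfolding rexp_cmult[symmetric] by (intro rexp_cong)
    qed
    ultimately show ?case using insert by (simp add: rexp_insert algebra_simps)
  qed simp
  have "rexp P q (\<lambda>X. q ^ card (F - X)) = rexp P q (\<lambda>X. q ^ card (F - X \<inter> F))"
    by (intro rexp_cong) (metis Diff_Int2 Diff_Int_distrib2 Int_commute inf.idem)
  also have "\<dots> = rexp F q (\<lambda>X. q ^ card (F - X))"
    using rexp_restrict[OF assms(1,2), of q "\<lambda>X. q ^ card (F - X)"] by simp
  also have "\<dots> = (q + (1 - q) * q) ^ card F" using assms eq finite_subset by blast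
  also have "\<dots> \<le> (2 * q) ^ card F" using assms by (intro power_mono) (auto simp: algebra_simps intro: mult_left_mono)
  finally show ?thesis .
qed

section \<open>Iterated minimal fragments\<close>

lemma sum_Pow_binomial:
  fixes a b :: real
  assumes "finite P"
  shows "(\<Sum>X\<in>Pow P. a ^ card X * b ^ card (P - X)) = (a + b) ^ card P"
  using prod_add[OF assms, of "\<lambda>_. a" "\<lambda>_. b"] by simp

lemma sum_UN_le:
  fixes f :: "'a \<Rightarrow> real"
  assumes "finite I" "\<And>i. i \<in> I \<Longrightarrow> finite (A i)" "\<And>x. f x \<ge> 0"
  shows "sum f (\<Union>i\<in>I. A i) \<le> (\<Sum>i\<in>I. sum f (A i))"
  using assms(1,2)
proof (induction I rule: finite_induct)
  case (insert i I)
  have "sum f (A i \<union> (\<Union>i\<in>I. A i)) \<le> sum f (A i) + sum f (\<Union>i\<in>I. A i)"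
    using insert assms(3) by (subst sum_Un) (auto intro!: sum_nonneg)
  then show ?case using insert by auto
qed simp

text \<open>
  The setting abstracts from graphs: \<open>G\<close> is the set of all \<open>s\<close>-sets, \<open>weight C\<close> the
  probability that \<open>C\<close> is the set of \<open>s\<close>-cliques and the graph is \<open>K\<^sub>k\<close>-free, and
  \<open>H\<close> the family of almost perfect matchings. The last assumption is the only trace of independence: a family
  \<open>T\<close> that is admissible relative to \<open>R\<close> can be added to \<open>R\<close> at the cost of a factor
  \<open>kap\<close> per element, even if sets are discounted by \<open>th\<close> per further element.
\<close>

locale fragment_process =
  fixes G :: "'c set" and weight :: "'c set \<Rightarrow> real" and H :: "'c set set"
    and admissible :: "'c set \<Rightarrow> 'c set \<Rightarrow> bool"
    and p kap dl :: real and m J N :: nat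
  assumes fin: "finite G" and weight_nonneg: "\<And>C. weight C \<ge> 0" and H_sub: "H \<subseteq> Pow G"
    and admissible_antimono: "\<And>T T' R R'. T' \<subseteq> T \<Longrightarrow> R' \<subseteq> R \<Longrightarrow> admissible T R \<Longrightarrow> admissible T' R'"
    and p_nonneg: "p \<ge> 0" and kap_pos: "kap > 0" and m_pos: "m > 0" and J_pos: "J > 0"
    and small: "p * real m / kap \<le> 1/64"
    and dl: "2 * real J * (\<Sum>a<J. (1/4) ^ (N div 2 ^ a)) \<le> dl" "dl > 0" "dl \<le> 1"
    and plant: "\<And>th T R. 0 \<le> th \<Longrightarrow> th \<le> 1 \<Longrightarrow> R \<subseteq> G \<Longrightarrow> T \<subseteq> G \<Longrightarrow> T \<inter> R = {} \<Longrightarrow> admissible T R \<Longrightarrow>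
      kap ^ card T * (\<Sum>C\<in>{C\<in>Pow G. R \<subseteq> C}. weight C * th ^ card (C - R))
        \<le> (\<Sum>C\<in>{C\<in>Pow G. R \<union> T \<subseteq> C}. weight C * th ^ card (C - (R \<union> T)))"
begin

text \<open>
  The weight of the sets above \<open>R\<close> all of whose other elements receive an independent mark of probability
  \<open>th\<close>.
\<close>

definition Psi :: "real \<Rightarrow> 'c set \<Rightarrow> real" where
  "Psi th R = (\<Sum>C\<in>{C\<in>Pow G. R \<subseteq> C}. weight C * th ^ card (C - R))"

text \<open>
  The number of elements that may still be missing after \<open>a\<close> successful rounds.
\<close>

definition level :: "nat \<Rightarrow> nat" where "level a = N div 2 ^ a"

text \<open>
  Minimal fragments: what a member of \<open>H\<close> with at most \<open>level a\<close> elements outside \<open>R\<close> still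
  misses once \<open>C'\<close> has been revealed, provided that this is inclusion-minimal and more than half of \<open>level
  a\<close>. Hence the round takes a target from level \<open>a\<close> to level \<open>a + 1\<close> unless the target contains a
  fragment.
\<close>

definition frag :: "nat \<Rightarrow> 'c set \<Rightarrow> 'c set \<Rightarrow> 'c set set" where
  "frag a R C' = {T \<in> Pow G. T \<inter> (R \<union> C') = {} \<and> level a < 2 * card T \<and> admissible T (R \<union> C') \<and>
     (\<exists>S\<in>H. card (S - R) \<le> level a \<and> S - (R \<union> C') = T) \<and>
     (\<forall>S\<in>H. card (S - R) \<le> level a \<and> S - (R \<union> C') \<subseteq> T \<longrightarrow> S - (R \<union> C') = T)}"

text \<open>
  The factor \<open>2 J\<close> makes a cost below 1 bound the measure of the targets lost in one round by \<open>1 / (2 J)\<close>,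
  so that in all \<open>J\<close> levels together at most half of the measure is lost.
\<close>

definition frag_cost :: "'c set \<Rightarrow> 'c set \<Rightarrow> real" where
  "frag_cost R C' = 2 * real J * (\<Sum>a<J. \<Sum>T\<in>frag a R C'. p ^ card T)"

text \<open>
  The elements of \<open>C - R\<close> are distributed uniformly over \<open>m\<close> rounds, and those of \<open>n\<close> rounds
  have to exhaust them. Each round contributes a factor that is of order \<open>dl\<close> on average (lemma
  \<open>marked_upper\<close>) but at least 1 in every round that makes no progress (lemma \<open>marked_lower\<close>).
\<close>

fun marked :: "nat \<Rightarrow> 'c set \<Rightarrow> 'c set \<Rightarrow> real" where
  "marked 0 R C = of_bool (R = C)"
| "marked (Suc n) R C = (\<Sum>C'\<in>Pow (C - R). (1 / real m) ^ card C' * (dl + frag_cost R C') * marked n (R \<union> C') C)"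

lemma fin_sub: "X \<subseteq> G \<Longrightarrow> finite X" using fin finite_subset by blast

lemma finite_frag: "finite (frag a R C')"
  unfolding frag_def using fin by auto

lemma Psi_nonneg: "0 \<le> th \<Longrightarrow> Psi th R \<ge> 0"
  unfolding Psi_def by (intro sum_nonneg mult_nonneg_nonneg weight_nonneg) auto

lemma frag_cost_nonneg: "frag_cost R C' \<ge> 0"
  unfolding frag_cost_def using p_nonneg by (intro mult_nonneg_nonneg sum_nonneg) auto

lemma marked_nonneg: "marked n R C \<ge> 0"
  by (induction n arbitrary: R) (auto intro!: sum_nonneg mult_nonneg_nonneg frag_cost_nonneg add_nonneg_nonneg simp: dl less_imp_le[OF dl(2)])

text \<open>
  First the elements of a round and then the whole set, or the whole set first.
\<close>

lemma swap_rounds: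
  assumes "R \<subseteq> G"
  shows "(\<Sum>C'\<in>Pow (G - R). g C' * (\<Sum>C\<in>{C\<in>Pow G. R \<union> C' \<subseteq> C}. f C' C)) =
    (\<Sum>C\<in>{C\<in>Pow G. R \<subseteq> C}. \<Sum>C'\<in>Pow (C - R). g C' * (f C' C :: real))"
  unfolding sum_distrib_left
  by (subst sum.Sigma, (use fin in \<open>auto intro: fin_sub\<close>)[2])
     (subst sum.Sigma, (use fin in \<open>auto intro: fin_sub\<close>)[2],
      rule sum.reindex_bij_witness[of _ "\<lambda>(x,y). (y,x)" "\<lambda>(x,y). (y,x)"], auto)

text \<open>
  Marking by the current round or by a later one amounts to a single mark of probability \<open>th + 1 / m\<close>.
\<close>

lemma Psi_marginal:
  assumes "R \<subseteq> G"
  shows "(\<Sum>C'\<in>Pow (G - R). (1 / real m) ^ card C' * Psi th (R \<union> C')) = Psi (th + 1 / real m) R"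
proof -
  have "(\<Sum>C'\<in>Pow (G - R). (1 / real m) ^ card C' * Psi th (R \<union> C')) =
    (\<Sum>C\<in>{C\<in>Pow G. R \<subseteq> C}. \<Sum>C'\<in>Pow (C - R). (1 / real m) ^ card C' * (weight C * th ^ card (C - (R \<union> C'))))"
    unfolding Psi_def by (rule swap_rounds[OF assms])
  also have "\<dots> = (\<Sum>C\<in>{C\<in>Pow G. R \<subseteq> C}. weight C * (1 / real m + th) ^ card (C - R))"
  proof (rule sum.cong[OF refl])
    fix C assume "C \<in> {C\<in>Pow G. R \<subseteq> C}"
    then have "finite (C - R)" using fin_sub by auto
    from sum_Pow_binomial[OF this, of "1 / real m" th]
    show "(\<Sum>C'\<in>Pow (C - R). (1 / real m) ^ card C' * (weight C * th ^ card (C - (R \<union> C')))) = weight C * (1 / real m + th) ^ card (C - R)"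
      by (simp add: sum_distrib_left[symmetric] mult.left_commute Diff_eq Int_assoc)
  qed
  finally show ?thesis by (simp add: Psi_def add.commute)
qed

text \<open>
  The key point of the fragment method: a target that is covered by \<open>R \<union> C' \<union> T\<close> contains
  \<open>T\<close>, by minimality of \<open>T\<close>. So \<open>T\<close> can be recovered from the union \<open>C' \<union>
  T\<close> up to the choice of a subset of a single target.
\<close>

lemma frag_covered:
  assumes "R \<subseteq> G" "C' \<subseteq> G - R" "T \<in> frag a R C'" "S \<in> H" "card (S - R) \<le> level a" "S \<subseteq> R \<union> (C' \<union> T)"
  shows "T \<subseteq> S - R"
proof -
  have "S - (R \<union> C') \<subseteq> T" using assms by auto
  then have "S - (R \<union> C') = T" using assms unfolding frag_def by blast
  then show ?thesis by auto
qed

text \<open>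
  Adding \<open>T\<close> to \<open>C'\<close> costs a factor \<open>(p m / kap)^card T \<le> 64^(- card T) \<le> 8^(- level
  a)\<close>, and by lemma \<open>frag_covered\<close> each union arises from at most \<open>2^level a\<close> fragments.
\<close>

lemma one_round:
  assumes "R \<subseteq> G" "0 \<le> th" "th \<le> 1"
  shows "(\<Sum>C'\<in>Pow (G - R). (1 / real m) ^ card C' * Psi th (R \<union> C') * (\<Sum>T\<in>frag a R C'. p ^ card T))
     \<le> (1/4) ^ level a * Psi (th + 1 / real m) R"
proof -
  define x where "x = p * real m / kap"
  have x: "0 \<le> x" "x \<le> 1/64" using small p_nonneg kap_pos by (auto simp: x_def)
  define I where "I = Sigma (Pow (G - R)) (frag a R)"
  have finI: "finite I" unfolding I_def using fin finite_frag by auto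
  define g where "g C = (1 / real m) ^ card C * Psi th (R \<union> C)" for C
  have g0: "g C \<ge> 0" for C unfolding g_def using Psi_nonneg assms by simp
  \<comment> \<open>Plant the fragment, so that the marked set becomes the union of the round and the fragment.\<close>
  have step: "(1 / real m) ^ card C' * Psi th (R \<union> C') * p ^ card T \<le> x ^ card T * g (C' \<union> T)"
    if "(C', T) \<in> I" for C' T
  proof -
    have C': "C' \<subseteq> G" "C' \<inter> R = {}" and T: "T \<in> frag a R C'" using that unfolding I_def by auto
    have T': "T \<subseteq> G" "T \<inter> (R \<union> C') = {}" "admissible T (R \<union> C')" using T unfolding frag_def by auto
    have "kap ^ card T * Psi th (R \<union> C') \<le> Psi th (R \<union> C' \<union> T)"
      unfolding Psi_def using plant[of th "R \<union> C'" T] T' C' assms by auto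
    then have *: "Psi th (R \<union> C') \<le> Psi th (R \<union> C' \<union> T) / kap ^ card T"
      using kap_pos by (simp add: field_simps)
    have c: "card (C' \<union> T) = card C' + card T"
      using T' C' fin_sub by (intro card_Un_disjoint) auto
    have "(1 / real m) ^ card C' * Psi th (R \<union> C') * p ^ card T
      \<le> (1 / real m) ^ card C' * (Psi th (R \<union> C' \<union> T) / kap ^ card T) * p ^ card T"
      using * p_nonneg by (intro mult_right_mono mult_left_mono) auto
    also have "\<dots> = x ^ card T * g (C' \<union> T)"
      unfolding x_def g_def c using m_pos kap_pos
      by (simp add: power_add power_divide power_mult_distrib Un_assoc field_simps)
    finally show ?thesis .
  qed
  have "(\<Sum>C'\<in>Pow (G - R). (1 / real m) ^ card C' * Psi th (R \<union> C') * (\<Sum>T\<in>frag a R C'. p ^ card T))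
    = (\<Sum>(C',T)\<in>I. (1 / real m) ^ card C' * Psi th (R \<union> C') * p ^ card T)"
    unfolding I_def sum_distrib_left using fin finite_frag by (subst sum.Sigma) auto
  also have "\<dots> \<le> (\<Sum>(C',T)\<in>I. x ^ card T * g (C' \<union> T))"
    by (rule sum_mono) (use step in auto)
  also have "\<dots> = (\<Sum>(C,T)\<in>(\<lambda>(C',T). (C' \<union> T, T)) ` I. x ^ card T * g C)"
  proof (subst sum.reindex)
    have "C1 = C2" if "(C1, T) \<in> I" "(C2, T) \<in> I" "C1 \<union> T = C2 \<union> T" for C1 C2 T
      using that unfolding I_def frag_def by auto
    then show "inj_on (\<lambda>(C',T). (C' \<union> T, T)) I" unfolding inj_on_def by fast
  qed (simp add: case_prod_unfold)
  also have "\<dots> = (\<Sum>C\<in>Pow (G - R). \<Sum>T\<in>{T. (C,T) \<in> (\<lambda>(C',T). (C' \<union> T, T)) ` I}. x ^ card T * g C)"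
  proof (subst sum.Sigma)
    show "\<forall>C\<in>Pow (G - R). finite {T. (C, T) \<in> (\<lambda>(C', T). (C' \<union> T, T)) ` I}"
    proof
      fix C show "finite {T. (C, T) \<in> (\<lambda>(C', T). (C' \<union> T, T)) ` I}"
        by (rule finite_subset[of _ "snd ` I"]) (use finI in force)+
    qed
    have "(\<lambda>(C',T). (C' \<union> T, T)) ` I = (SIGMA C:Pow (G - R). {T. (C,T) \<in> (\<lambda>(C',T). (C' \<union> T, T)) ` I})"
      unfolding I_def frag_def by auto
    then show "(\<Sum>(C,T)\<in>(\<lambda>(C',T). (C' \<union> T, T)) ` I. x ^ card T * g C) =
      (\<Sum>(C, T)\<in>(SIGMA C:Pow (G - R). {T. (C,T) \<in> (\<lambda>(C',T). (C' \<union> T, T)) ` I}). x ^ card T * g C)" by simp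
  qed (use fin in auto)
  also have "\<dots> \<le> (\<Sum>C\<in>Pow (G - R). (1/4) ^ level a * g C)"
  proof (rule sum_mono)
    fix C assume "C \<in> Pow (G - R)"
    define F where "F = {T. (C,T) \<in> (\<lambda>(C',T). (C' \<union> T, T)) ` I}"
    have "(\<Sum>T\<in>F. x ^ card T) \<le> (1/4) ^ level a"
    proof (cases "F = {}")
      case False
      then obtain T0 C0 where T0: "(C0, T0) \<in> I" "C = C0 \<union> T0" unfolding F_def by auto
      obtain S where S: "S \<in> H" "card (S - R) \<le> level a" "S - (R \<union> C0) = T0"
        using T0 unfolding I_def frag_def by auto
      have SC: "S \<subseteq> R \<union> C" using S T0 by auto
      have finS: "finite (S - R)" using S H_sub fin_sub by auto
      have sub: "F \<subseteq> {T \<in> Pow (S - R). level a < 2 * card T}"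
      proof
        fix T assume "T \<in> F"
        then obtain C1 where C1: "(C1, T) \<in> I" "C = C1 \<union> T" unfolding F_def by auto
        have "T \<subseteq> S - R"
          by (rule frag_covered[of R C1 T a]) (use C1 S SC assms I_def in auto)
        moreover have "level a < 2 * card T" using C1 unfolding I_def frag_def by auto
        ultimately show "T \<in> {T \<in> Pow (S - R). level a < 2 * card T}" by auto
      qed
      have "(\<Sum>T\<in>F. x ^ card T) \<le> (\<Sum>T\<in>F. (1/8) ^ level a)"
      proof (rule sum_mono)
        fix T assume "T \<in> F"
        then have "level a \<le> 2 * card T" using sub by auto
        have "x ^ card T \<le> (1/64) ^ card T" using x by (intro power_mono) auto
        also have "\<dots> = (1/8) ^ (2 * card T)" by (simp add: power_mult power2_eq_square)
        also have "\<dots> \<le> (1/8) ^ level a" using \<open>level a \<le> 2 * card T\<close> by (intro power_decreasing) auto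
        finally show "x ^ card T \<le> (1/8) ^ level a" .
      qed
      also have "\<dots> = real (card F) * (1/8) ^ level a" by simp
      also have "\<dots> \<le> 2 ^ level a * (1/8) ^ level a"
      proof (rule mult_right_mono)
        have "card F \<le> card (Pow (S - R))" by (rule card_mono) (use finS sub in auto)
        also have "\<dots> = 2 ^ card (S - R)" using finS by (simp add: card_Pow)
        also have "\<dots> \<le> 2 ^ level a" using S by (intro power_increasing) auto
        finally show "real (card F) \<le> 2 ^ level a" by (metis of_nat_le_iff of_nat_numeral of_nat_power)
      qed simp
      also have "\<dots> = (1/4) ^ level a" by (simp add: power_mult_distrib[symmetric])
      finally show ?thesis .
    qed simp
    then have "(\<Sum>T\<in>F. x ^ card T) * g C \<le> (1/4) ^ level a * g C" using g0 by (rule mult_right_mono)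
    then show "(\<Sum>T\<in>{T. (C,T) \<in> (\<lambda>(C',T). (C' \<union> T, T)) ` I}. x ^ card T * g C) \<le> (1/4) ^ level a * g C"
      by (simp add: F_def[symmetric] sum_distrib_right)
  qed
  also have "\<dots> = (1/4) ^ level a * Psi (th + 1 / real m) R"
    unfolding g_def sum_distrib_left[symmetric] Psi_marginal[OF assms(1)] ..
  finally show ?thesis .
qed

lemma one_round_total:
  assumes "R \<subseteq> G" "0 \<le> th" "th \<le> 1"
  shows "(\<Sum>C'\<in>Pow (G - R). (1 / real m) ^ card C' * Psi th (R \<union> C') * frag_cost R C') \<le> dl * Psi (th + 1 / real m) R"
proof -
  have "(\<Sum>C'\<in>Pow (G - R). (1 / real m) ^ card C' * Psi th (R \<union> C') * frag_cost R C') =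
    2 * real J * (\<Sum>a<J. \<Sum>C'\<in>Pow (G - R). (1 / real m) ^ card C' * Psi th (R \<union> C') * (\<Sum>T\<in>frag a R C'. p ^ card T))"
    unfolding frag_cost_def by (subst sum.swap) (simp add: sum_distrib_left mult_ac)
  also have "\<dots> \<le> 2 * real J * (\<Sum>a<J. (1/4) ^ level a * Psi (th + 1 / real m) R)"
    by (intro mult_left_mono sum_mono one_round assms) auto
  also have "\<dots> = 2 * real J * (\<Sum>a<J. (1/4) ^ level a) * Psi (th + 1 / real m) R"
    by (simp add: sum_distrib_right mult.assoc)
  also have "\<dots> \<le> dl * Psi (th + 1 / real m) R"
    using dl(1) Psi_nonneg assms unfolding level_def by (intro mult_right_mono) auto
  finally show ?thesis .
qed

text \<open>
  Induction on the rounds: each contributes \<open>dl\<close> from its constant part and at most \<open>dl\<close> from the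
  fragments.
\<close>

lemma marked_upper:
  assumes "n \<le> m" "R \<subseteq> G"
  shows "(\<Sum>C\<in>{C\<in>Pow G. R \<subseteq> C}. weight C * marked n R C) \<le> (2 * dl) ^ n * Psi (real n / real m) R"
  using assms
proof (induction n arbitrary: R)
  case 0
  have "(\<Sum>C\<in>{C\<in>Pow G. R \<subseteq> C}. weight C * marked 0 R C) = Psi 0 R"
    unfolding Psi_def
  proof (rule sum.cong[OF refl])
    fix C assume C: "C \<in> {C\<in>Pow G. R \<subseteq> C}"
    then have "card (C - R) = 0 \<longleftrightarrow> R = C" using fin_sub by auto
    then show "weight C * marked 0 R C = weight C * 0 ^ card (C - R)" by (simp add: power_0_left)
  qed
  then show ?case by simp
next
  case (Suc n)
  define th where "th = real n / real m"
  have th: "0 \<le> th" "th \<le> 1" "th + 1 / real m = real (Suc n) / real m"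
    using Suc.prems m_pos by (auto simp: th_def field_simps)
  have "(\<Sum>C\<in>{C\<in>Pow G. R \<subseteq> C}. weight C * marked (Suc n) R C) =
    (\<Sum>C\<in>{C\<in>Pow G. R \<subseteq> C}. \<Sum>C'\<in>Pow (C - R). ((1 / real m) ^ card C' * (dl + frag_cost R C')) * (weight C * marked n (R \<union> C') C))"
    by (simp add: sum_distrib_left mult_ac)
  also have "\<dots> = (\<Sum>C'\<in>Pow (G - R). ((1 / real m) ^ card C' * (dl + frag_cost R C')) *
      (\<Sum>C\<in>{C\<in>Pow G. R \<union> C' \<subseteq> C}. weight C * marked n (R \<union> C') C))"
    using swap_rounds[OF Suc.prems(2)] by (rule sym)
  also have "\<dots> \<le> (\<Sum>C'\<in>Pow (G - R). ((1 / real m) ^ card C' * (dl + frag_cost R C')) * ((2 * dl) ^ n * Psi th (R \<union> C')))"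
    unfolding th_def using Suc dl frag_cost_nonneg by (intro sum_mono mult_left_mono Suc.IH) (auto intro!: add_nonneg_nonneg)
  also have "\<dots> = (2 * dl) ^ n * (dl * (\<Sum>C'\<in>Pow (G - R). (1 / real m) ^ card C' * Psi th (R \<union> C')) +
      (\<Sum>C'\<in>Pow (G - R). (1 / real m) ^ card C' * Psi th (R \<union> C') * frag_cost R C'))"
    by (simp add: sum_distrib_left sum.distrib[symmetric] algebra_simps)
  also have "\<dots> \<le> (2 * dl) ^ n * (dl * Psi (th + 1 / real m) R + dl * Psi (th + 1 / real m) R)"
    using dl th Suc.prems by (intro mult_left_mono add_mono one_round_total) (auto simp: Psi_marginal)
  finally show ?case using th by (simp add: algebra_simps)
qed

text \<open>
  The target \<open>S'\<close> near \<open>R\<close> may differ from \<open>S\<close>. Only its missing elements have to lie in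
  \<open>S\<close>, which makes them inherit the admissibility of \<open>S\<close>.
\<close>

definition reach :: "nat \<Rightarrow> 'c set \<Rightarrow> 'c set \<Rightarrow> bool" where
  "reach a R S \<longleftrightarrow> (\<exists>S'\<in>H. S' - R \<subseteq> S \<and> card (S' - R) \<le> level a)"

lemma reach_mono:
  assumes "reach a R S" "R \<subseteq> R'"
  shows "reach a R' S"
proof -
  obtain S' where S': "S' \<in> H" "S' - R \<subseteq> S" "card (S' - R) \<le> level a" using assms unfolding reach_def by auto
  have "card (S' - R') \<le> card (S' - R)"
    using S' H_sub fin_sub assms by (intro card_mono) auto
  then show ?thesis unfolding reach_def using S' assms by (intro bexI[of _ S']) auto
qed

text \<open>
  A round is either costly, and then its factor is at least 1, or the targets that are lost, namely those that contain a fragment,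
  have measure at most \<open>1 / (2 J)\<close> by spreadness; then the level rises and a factor \<open>dl\<close> is conceded. The
  level cannot reach \<open>J\<close>, because then some target would have at most \<open>level J\<close> elements outside
  \<open>C\<close>.
\<close>

lemma marked_lower:
  assumes C: "C \<subseteq> G" "\<And>S. S \<in> H \<Longrightarrow> level J < card (S - C)"
    and w: "\<And>S. w S \<ge> 0" "(\<Sum>S\<in>H. w S) = 1" "\<And>S. S \<in> H \<Longrightarrow> w S > 0 \<Longrightarrow> admissible S C"
      "\<And>T. T \<subseteq> G \<Longrightarrow> (\<Sum>S\<in>{S\<in>H. T \<subseteq> S}. w S) \<le> p ^ card T"
    and "n \<le> m" "R \<subseteq> C" "a \<le> J" "(\<Sum>S\<in>{S\<in>H. \<not> reach a R S}. w S) \<le> real a / (2 * real J)"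
  shows "(real n / real m) ^ card (C - R) * dl ^ (J - a) \<le> marked n R C"
  using assms(7-)
proof (induction n arbitrary: R a)
  case 0
  show ?case
  proof (cases "R = C")
    case True
    then show ?thesis using dl by (simp add: power_le_one)
  next
    case False
    then have "card (C - R) > 0" using 0 C fin_sub by (auto simp: card_gt_0_iff)
    then show ?thesis using False by (simp add: power_0_left)
  qed
next
  case (Suc n)
  have finH: "finite H" using H_sub fin finite_subset by blast
  \<comment> \<open>At level J some target would be within reach of R, hence close to C, although none is.\<close>
  have "a \<noteq> J"
  proof
    assume "a = J"
    then have "(\<Sum>S\<in>{S\<in>H. \<not> reach J R S}. w S) < 1" using Suc.prems J_pos by simp
    moreover have "\<not> reach J R S" if S: "S \<in> H" for S
    proof
      assume "reach J R S"
      then have "reach J C S" using reach_mono Suc.prems by blast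
      then show False unfolding reach_def using C by fastforce
    qed
    then have "{S\<in>H. \<not> reach J R S} = H" by auto
    ultimately show False using w by simp
  qed
  then have aJ: "a < J" using Suc.prems by simp
  have key: "((1/real m) ^ card C' * ((real n / real m) ^ card (C - (R \<union> C')))) * dl ^ (J - a)
     \<le> (1 / real m) ^ card C' * (dl + frag_cost R C') * marked n (R \<union> C') C" if C': "C' \<subseteq> C - R" for C'
  proof -
    let ?f = "(real n / real m) ^ card (C - (R \<union> C'))"
    have "?f * dl ^ (J - a) \<le> (dl + frag_cost R C') * marked n (R \<union> C') C"
    proof (cases "frag_cost R C' \<ge> 1")
      case True
      have "(\<Sum>S\<in>{S\<in>H. \<not> reach a (R \<union> C') S}. w S) \<le> (\<Sum>S\<in>{S\<in>H. \<not> reach a R S}. w S)"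
        using finH w reach_mono[of a R _ "R \<union> C'"] by (intro sum_mono2) auto
      also have "\<dots> \<le> real a / (2 * real J)" by fact
      finally have "?f * dl ^ (J - a) \<le> marked n (R \<union> C') C"
        using Suc.prems C' by (intro Suc.IH) auto
      also have "\<dots> \<le> (dl + frag_cost R C') * marked n (R \<union> C') C"
        using True dl marked_nonneg[of n "R \<union> C'" C] by (simp add: mult_le_cancel_right1)
      finally show ?thesis .
    next
      case False
      have "2 * real J * (\<Sum>T\<in>frag a R C'. p ^ card T) \<le> frag_cost R C'"
        unfolding frag_cost_def using aJ p_nonneg
        by (intro mult_left_mono member_le_sum[where f = "\<lambda>a. \<Sum>T\<in>frag a R C'. p ^ card T"]) (auto intro!: sum_nonneg)
      then have X: "(\<Sum>T\<in>frag a R C'. p ^ card T) \<le> 1 / (2 * real J)"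
        using False J_pos by (simp add: field_simps)
      have sub: "{S\<in>H. \<not> reach (Suc a) (R \<union> C') S \<and> w S > 0} \<subseteq>
         {S\<in>H. \<not> reach a R S} \<union> (\<Union>T\<in>frag a R C'. {S\<in>H. T \<subseteq> S})"
      proof
        fix S assume "S \<in> {S\<in>H. \<not> reach (Suc a) (R \<union> C') S \<and> w S > 0}"
        then have S: "S \<in> H" "\<not> reach (Suc a) (R \<union> C') S" "w S > 0" by auto
        show "S \<in> {S\<in>H. \<not> reach a R S} \<union> (\<Union>T\<in>frag a R C'. {S\<in>H. T \<subseteq> S})"
        proof (cases "reach a R S")
          case True
          define Q where "Q = (\<lambda>S'. S' \<in> H \<and> card (S' - R) \<le> level a \<and> S' - (R \<union> C') \<subseteq> S)"
          obtain S0 where "Q S0" using True unfolding reach_def Q_def by auto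
          then obtain S1 where S1: "Q S1" and min: "\<And>S'. Q S' \<Longrightarrow> card (S1 - (R \<union> C')) \<le> card (S' - (R \<union> C'))"
            using ex_has_least_nat[of Q S0 "\<lambda>S'. card (S' - (R \<union> C'))"] by blast
          \<comment> \<open>A target that is within reach but makes no progress contains a minimal fragment.\<close>
          define T where "T = S1 - (R \<union> C')"
          have T: "T \<subseteq> S" "T \<subseteq> G" "finite T" using S1 H_sub fin_sub unfolding Q_def T_def by auto
          have big: "level a < 2 * card T"
          proof (rule ccontr)
            assume "\<not> level a < 2 * card T"
            then have "card T \<le> level (Suc a)" by (simp add: level_def div_mult2_eq mult.commute[of 2] )
            then have "reach (Suc a) (R \<union> C') S"
              unfolding reach_def using S1 T unfolding Q_def T_def by blast
            then show False using S by blast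
          qed
          have "T \<in> frag a R C'"
            unfolding frag_def
          proof (safe)
            show "x \<in> G" if "x \<in> T" for x using that T by auto
            show "level a < 2 * card T" by (rule big)
            show "admissible T (R \<union> C')"
            proof (rule admissible_antimono[of T S _ C])
              show "R \<union> C' \<subseteq> C" using C' Suc.prems by blast
            qed (use T S w(3) in auto)
            show "\<exists>S\<in>H. card (S - R) \<le> level a \<and> S - (R \<union> C') = T" using S1 unfolding Q_def T_def by blast
          next
            fix S' x assume S': "S' \<in> H" "card (S' - R) \<le> level a" "S' - (R \<union> C') \<subseteq> T"
            have "Q S'" unfolding Q_def using S' T by auto
            then have "card T \<le> card (S' - (R \<union> C'))" using min T_def by auto
            then have eq: "S' - (R \<union> C') = T" using S' T card_seteq by blast
            show "x \<in> S'" if "x \<in> T" using eq that by blast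
          qed (auto simp: T_def)
          then show ?thesis using T S by blast
        qed (use S in auto)
      qed
      have "(\<Sum>S\<in>{S\<in>H. \<not> reach (Suc a) (R \<union> C') S}. w S) = (\<Sum>S\<in>{S\<in>H. \<not> reach (Suc a) (R \<union> C') S \<and> w S > 0}. w S)"
        using finH w(1) by (intro sum.mono_neutral_right) (auto simp: less_le)
      also have "\<dots> \<le> (\<Sum>S\<in>{S\<in>H. \<not> reach a R S} \<union> (\<Union>T\<in>frag a R C'. {S\<in>H. T \<subseteq> S}). w S)"
        using finH w sub finite_frag by (intro sum_mono2) auto
      also have "\<dots> \<le> (\<Sum>S\<in>{S\<in>H. \<not> reach a R S}. w S) + (\<Sum>S\<in>(\<Union>T\<in>frag a R C'. {S\<in>H. T \<subseteq> S}). w S)"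
        using finH w finite_frag by (subst sum_Un) (auto intro!: sum_nonneg)
      also have "(\<Sum>S\<in>(\<Union>T\<in>frag a R C'. {S\<in>H. T \<subseteq> S}). w S) \<le> (\<Sum>T\<in>frag a R C'. \<Sum>S\<in>{S\<in>H. T \<subseteq> S}. w S)"
        using finH w finite_frag by (intro sum_UN_le) auto
      also have "\<dots> \<le> (\<Sum>T\<in>frag a R C'. p ^ card T)"
        by (intro sum_mono w) (auto simp: frag_def)
      finally have "(\<Sum>S\<in>{S\<in>H. \<not> reach (Suc a) (R \<union> C') S}. w S) \<le> real a / (2 * real J) + 1 / (2 * real J)"
        using X Suc.prems(4) by linarith
      also have "\<dots> = real (Suc a) / (2 * real J)" by (simp add: add_divide_distrib)
      finally have "?f * dl ^ (J - Suc a) \<le> marked n (R \<union> C') C"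
        using Suc.prems C' aJ by (intro Suc.IH) auto
      then have "dl * (?f * dl ^ (J - Suc a)) \<le> (dl + frag_cost R C') * marked n (R \<union> C') C"
        using dl frag_cost_nonneg by (intro mult_mono) auto
      moreover have "dl ^ (J - a) = dl * dl ^ (J - Suc a)"
        using aJ by (simp add: power_Suc[symmetric] Suc_diff_Suc)
      ultimately show ?thesis by (simp add: mult_ac)
    qed
    then have "(1/real m) ^ card C' * (?f * dl ^ (J - a)) \<le> (1/real m) ^ card C' * ((dl + frag_cost R C') * marked n (R \<union> C') C)"
      by (intro mult_left_mono) auto
    then show ?thesis by (simp add: mult.assoc)
  qed
  have d: "(C - R) - C' = C - (R \<union> C')" for C' by auto
  have e: "(\<Sum>C'\<in>Pow (C - R). (1/real m) ^ card C' * (real n / real m) ^ card (C - (R \<union> C'))) = (real (Suc n) / real m) ^ card (C - R)"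
    using sum_Pow_binomial[of "C - R" "1 / real m" "real n / real m"] C fin_sub
    by (simp add: d add_divide_distrib)
  have "(real (Suc n) / real m) ^ card (C - R) * dl ^ (J - a) =
      (\<Sum>C'\<in>Pow (C - R). ((1/real m) ^ card C' * (real n / real m) ^ card (C - (R \<union> C'))) * dl ^ (J - a))"
    unfolding e[symmetric] by (rule sum_distrib_right)
  also have "\<dots> \<le> (\<Sum>C'\<in>Pow (C - R). (1 / real m) ^ card C' * (dl + frag_cost R C') * marked n (R \<union> C') C)"
    by (intro sum_mono key) auto
  finally show ?case by simp
qed

text \<open>
  Compare the two estimates of the marked weight of \<open>Bad\<close>: from below by \<open>dl^J\<close> for each set, from above
  by \<open>(2 dl)^m\<close> in total.
\<close>

theorem fragment_bound:
  assumes "Bad \<subseteq> Pow G"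
    and "\<And>C S. C \<in> Bad \<Longrightarrow> S \<in> H \<Longrightarrow> N div 2 ^ J < card (S - C)"
    and "\<And>S. S \<in> H \<Longrightarrow> card S \<le> N"
    and w: "\<And>C. C \<in> Bad \<Longrightarrow> \<exists>w. (\<forall>S. w S \<ge> 0) \<and> (\<Sum>S\<in>H. w S) = 1 \<and> (\<forall>S\<in>H. w S > 0 \<longrightarrow> admissible S C) \<and>
      (\<forall>T\<subseteq>G. (\<Sum>S\<in>{S\<in>H. T \<subseteq> S}. w S) \<le> p ^ card T)"
  shows "(\<Sum>C\<in>Bad. weight C) * dl ^ J \<le> (2 * dl) ^ m * (\<Sum>C\<in>Pow G. weight C)"
proof -
  have "weight C * dl ^ J \<le> weight C * marked m {} C" if C: "C \<in> Bad" for C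
  proof (rule mult_left_mono)
    obtain w where w: "\<And>S. w S \<ge> 0" "(\<Sum>S\<in>H. w S) = 1" "\<And>S. S \<in> H \<Longrightarrow> w S > 0 \<Longrightarrow> admissible S C"
      "\<And>T. T \<subseteq> G \<Longrightarrow> (\<Sum>S\<in>{S\<in>H. T \<subseteq> S}. w S) \<le> p ^ card T" using w[OF C] by blast
    have "reach 0 {} S" if "S \<in> H" for S
      unfolding reach_def level_def using assms(3)[OF that] that by (intro bexI[of _ S]) auto
    then have "{S\<in>H. \<not> reach 0 {} S} = {}" by auto
    then have e: "sum w {S\<in>H. \<not> reach 0 {} S} \<le> real 0 / (2 * real J)" by (simp only: sum.empty)
    have "(real m / real m) ^ card (C - {}) * dl ^ (J - 0) \<le> marked m {} C"
    proof (rule marked_lower[where w = w])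
      show "C \<subseteq> G" using C assms(1) by auto
      show "level J < card (S - C)" if "S \<in> H" for S unfolding level_def by (rule assms(2)[OF C that])
    qed (use w e in auto)
    then show "dl ^ J \<le> marked m {} C" using m_pos by simp
  qed (rule weight_nonneg)
  then have "(\<Sum>C\<in>Bad. weight C) * dl ^ J \<le> (\<Sum>C\<in>Bad. weight C * marked m {} C)"
    by (simp add: sum_distrib_right sum_mono)
  also have "\<dots> \<le> (\<Sum>C\<in>{C\<in>Pow G. {} \<subseteq> C}. weight C * marked m {} C)"
    using assms(1) fin weight_nonneg marked_nonneg by (intro sum_mono2) auto
  also have "\<dots> \<le> (2 * dl) ^ m * Psi (real m / real m) {}"
    by (rule marked_upper) auto
  finally show ?thesis using m_pos by (simp add: Psi_def Pow_def)
qed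

end

section \<open>Planting cliques\<close>

text \<open>
  Cliques, edges and blocks of matchings are all sets of fixed size, and a graph on \<open>W\<close> is a subset of \<open>pairs
  W\<close>.
\<close>

definition ksets :: "'a set \<Rightarrow> nat \<Rightarrow> 'a set set" where
  "ksets A k = {S. S \<subseteq> A \<and> card S = k}"

abbreviation pairs :: "'a set \<Rightarrow> 'a set set" where
  "pairs A \<equiv> ksets A 2"

definition cliques :: "'a set \<Rightarrow> nat \<Rightarrow> 'a set set \<Rightarrow> 'a set set" where
  "cliques W k X = {S \<in> ksets W k. pairs S \<subseteq> X}"

definition edges_of :: "'a set set \<Rightarrow> 'a set set" where
  "edges_of R = (\<Union>\<tau>\<in>R. pairs \<tau>)"

lemma finite_ksets [simp]: "finite A \<Longrightarrow> finite (ksets A k)"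
  unfolding ksets_def by simp

lemma card_ksets: "finite A \<Longrightarrow> card (ksets A k) = card A choose k"
  unfolding ksets_def by (rule n_subsets)

lemma ksets_mono: "A \<subseteq> B \<Longrightarrow> ksets A k \<subseteq> ksets B k"
  unfolding ksets_def by auto

lemma finite_cliques [simp]: "finite W \<Longrightarrow> finite (cliques W k X)"
  unfolding cliques_def by simp

lemma edges_of_mono: "R' \<subseteq> R \<Longrightarrow> edges_of R' \<subseteq> edges_of R"
  unfolding edges_of_def by auto

lemma edges_of_Un: "edges_of (R \<union> T) = edges_of R \<union> edges_of T"
  unfolding edges_of_def by auto

lemma edges_of_subset: "R \<subseteq> ksets W k \<Longrightarrow> edges_of R \<subseteq> pairs W"
  unfolding edges_of_def ksets_def by auto

lemma edges_of_cliques: "edges_of (cliques W k X) \<subseteq> X"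
  unfolding edges_of_def cliques_def by auto

lemma subset_cliques_iff: "R \<subseteq> ksets W k \<Longrightarrow> R \<subseteq> cliques W k X \<longleftrightarrow> edges_of R \<subseteq> X"
  unfolding edges_of_def cliques_def by auto

lemma card_inter_ge_2:
  assumes "finite \<sigma>" "e \<in> pairs \<sigma>" "e \<in> pairs \<tau>"
  shows "card (\<sigma> \<inter> \<tau>) \<ge> 2"
proof -
  have "e \<subseteq> \<sigma> \<inter> \<tau>" "card e = 2" using assms unfolding ksets_def by auto
  then show ?thesis using card_mono[of "\<sigma> \<inter> \<tau>" e] assms by auto
qed

lemma card_edges_of:
  assumes "finite T" "disjoint T" "\<And>\<tau>. \<tau> \<in> T \<Longrightarrow> finite \<tau> \<and> card \<tau> = s"
  shows "card (edges_of T) = card T * (s choose 2)"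
proof -
  have "card (edges_of T) = (\<Sum>\<tau>\<in>T. card (pairs \<tau>))"
    unfolding edges_of_def
  proof (rule card_UN_disjoint)
    show "\<forall>i\<in>T. \<forall>j\<in>T. i \<noteq> j \<longrightarrow> pairs i \<inter> pairs j = {}"
    proof (intro ballI impI)
      fix i j assume ij: "i \<in> T" "j \<in> T" "i \<noteq> j"
      then have "i \<inter> j = {}" using assms(2) by (auto simp: disjoint_def)
      then show "pairs i \<inter> pairs j = {}"
        using card_inter_ge_2[of i _ j] assms(3)[OF ij(1)] by force
    qed
  qed (use assms in auto)
  also have "\<dots> = (\<Sum>\<tau>\<in>T. s choose 2)" using assms by (intro sum.cong) (auto simp: card_ksets)
  finally show ?thesis by simp
qed

text \<open>
  Planting \<open>\<tau>\<close> may complete other \<open>s\<close>-sets \<open>\<sigma>\<close> that share an edge with it. With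
  the edges in \<open>F\<close> present, this sums the probabilities that they become cliques.
\<close>

definition overlap_cost :: "'a set \<Rightarrow> nat \<Rightarrow> real \<Rightarrow> 'a set \<Rightarrow> 'a set set \<Rightarrow> real" where
  "overlap_cost W s q \<tau> F = (\<Sum>\<sigma>\<in>{\<sigma>\<in>ksets W s. \<sigma> \<noteq> \<tau> \<and> card (\<sigma> \<inter> \<tau>) \<ge> 2}. q ^ card (pairs \<sigma> - F))"

definition plantable :: "'a set \<Rightarrow> nat \<Rightarrow> real \<Rightarrow> 'a set set \<Rightarrow> 'a set set \<Rightarrow> bool" where
  "plantable W s q T F \<longleftrightarrow> disjoint T \<and> (\<forall>\<tau>\<in>T. overlap_cost W s q \<tau> (F \<union> edges_of T) \<le> 1/2)"

lemma overlap_cost_mono: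
  assumes "finite W" "0 \<le> q" "q \<le> 1" "F' \<subseteq> F"
  shows "overlap_cost W s q \<tau> F' \<le> overlap_cost W s q \<tau> F"
  unfolding overlap_cost_def
proof (rule sum_mono)
  fix \<sigma> assume "\<sigma> \<in> {\<sigma>\<in>ksets W s. \<sigma> \<noteq> \<tau> \<and> card (\<sigma> \<inter> \<tau>) \<ge> 2}"
  then have "finite \<sigma>" using assms finite_subset unfolding ksets_def by auto
  then show "q ^ card (pairs \<sigma> - F') \<le> q ^ card (pairs \<sigma> - F)"
    using assms by (intro power_decreasing card_mono) auto
qed

lemma plantable_antimono:
  assumes "finite W" "0 \<le> q" "q \<le> 1" "T' \<subseteq> T" "F' \<subseteq> F" "plantable W s q T F"
  shows "plantable W s q T' F'"
  unfolding plantable_def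
proof (intro conjI ballI)
  show "disjoint T'" using assms pairwise_subset unfolding plantable_def by blast
  fix \<tau> assume "\<tau> \<in> T'"
  then have "overlap_cost W s q \<tau> (F \<union> edges_of T) \<le> 1/2" using assms unfolding plantable_def by auto
  moreover have "overlap_cost W s q \<tau> (F' \<union> edges_of T') \<le> overlap_cost W s q \<tau> (F \<union> edges_of T)"
    using assms edges_of_mono[OF assms(4)] by (intro overlap_cost_mono) auto
  ultimately show "overlap_cost W s q \<tau> (F' \<union> edges_of T') \<le> 1/2" by linarith
qed

lemma rexp_fibers:
  assumes "finite A"
  shows "(\<Sum>C\<in>A. rexp P q (\<lambda>X. of_bool (c X = C \<and> Q X)) * g C) = rexp P q (\<lambda>X. of_bool (c X \<in> A) * (of_bool (Q X) * g (c X)))"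
proof -
  have "(\<Sum>C\<in>A. rexp P q (\<lambda>X. of_bool (c X = C \<and> Q X)) * g C)
    = rexp P q (\<lambda>X. \<Sum>C\<in>A. g C * of_bool (c X = C \<and> Q X))"
    unfolding rexp_sum rexp_cmult by (simp add: mult.commute)
  also have "\<dots> = rexp P q (\<lambda>X. of_bool (c X \<in> A) * (of_bool (Q X) * g (c X)))"
  proof (rule rexp_cong)
    fix X
    have "(\<Sum>C\<in>A. g C * of_bool (c X = C \<and> Q X)) = (\<Sum>C\<in>A. if c X = C then g C * of_bool (Q X) else 0)"
      by (rule sum.cong) auto
    also have "\<dots> = of_bool (c X \<in> A) * (of_bool (Q X) * g (c X))"
      using assms by (simp add: sum.delta' mult.commute)
    finally show "(\<Sum>C\<in>A. g C * of_bool (c X = C \<and> Q X)) = of_bool (c X \<in> A) * (of_bool (Q X) * g (c X))" .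
  qed
  finally show ?thesis .
qed

text \<open>
  A new \<open>s\<close>-clique uses a planted edge, so it shares two vertices with a planted clique, which \<open>no\<close>
  excludes. A new clique of size \<open>k > s\<close> contains a planted edge and a vertex outside the planted clique, hence an
  \<open>s\<close>-clique of the excluded kind.
\<close>

lemma planted_cliques:
  assumes W: "finite W" and s: "3 \<le> s" "s < k" and T: "T \<subseteq> ksets W s" "disjoint T"
    and XP: "X \<subseteq> pairs W - ER - edges_of T" and ER: "ER \<subseteq> pairs W" "ER \<inter> edges_of T = {}"
    and no: "\<And>\<sigma>. \<sigma> \<in> ksets W s \<Longrightarrow> \<sigma> \<notin> T \<Longrightarrow> (\<exists>\<tau>\<in>T. card (\<sigma> \<inter> \<tau>) \<ge> 2) \<Longrightarrow> \<not> pairs \<sigma> - ER - edges_of T \<subseteq> X"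
  shows "cliques W s (X \<union> ER \<union> edges_of T) - T = cliques W s (X \<union> ER)"
    and "cliques W k (X \<union> ER) = {} \<Longrightarrow> cliques W k (X \<union> ER \<union> edges_of T) = {}"
proof -
  let ?G = "X \<union> ER \<union> edges_of T" and ?x = "X \<union> ER"
  have few: "\<not> (\<exists>\<tau>\<in>T. card (\<sigma> \<inter> \<tau>) \<ge> 2)" if "\<sigma> \<in> ksets W s" "\<sigma> \<notin> T" "pairs \<sigma> \<subseteq> ?G" for \<sigma>
    using no[OF that(1,2)] that(3) by blast
  have avoid: "pairs \<sigma> \<subseteq> ?x" if "\<sigma> \<subseteq> W" "pairs \<sigma> \<subseteq> ?G" "\<not> (\<exists>\<tau>\<in>T. card (\<sigma> \<inter> \<tau>) \<ge> 2)" for \<sigma>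
  proof
    fix e assume e: "e \<in> pairs \<sigma>"
    have "finite \<sigma>" using that W finite_subset by auto
    then have "e \<notin> edges_of T" using card_inter_ge_2[of \<sigma> e] e that(3) unfolding edges_of_def by auto
    then show "e \<in> ?x" using that e by auto
  qed
  show "cliques W s ?G - T = cliques W s ?x"
  proof (intro equalityI subsetI)
    fix \<sigma> assume "\<sigma> \<in> cliques W s ?G - T"
    then have "\<sigma> \<in> ksets W s" "\<sigma> \<notin> T" "pairs \<sigma> \<subseteq> ?G" unfolding cliques_def by auto
    then show "\<sigma> \<in> cliques W s ?x" using avoid[of \<sigma>] few[of \<sigma>] unfolding cliques_def ksets_def by auto
  next
    fix \<sigma> assume \<sigma>: "\<sigma> \<in> cliques W s ?x"
    then have "finite \<sigma>" "card \<sigma> = s" using W finite_subset unfolding cliques_def ksets_def by auto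
    then have "card (pairs \<sigma>) > 0" using s by (auto simp: card_ksets)
    then obtain e where e: "e \<in> pairs \<sigma>" by (metis all_not_in_conv card.empty less_irrefl)
    have "e \<in> ?x" using \<sigma> e unfolding cliques_def by auto
    then have "e \<notin> edges_of T" using XP ER by auto
    then have "\<sigma> \<notin> T" using e unfolding edges_of_def by auto
    then show "\<sigma> \<in> cliques W s ?G - T" using \<sigma> unfolding cliques_def by auto
  qed
  assume kx: "cliques W k ?x = {}"
  show "cliques W k ?G = {}"
  proof (rule ccontr)
    assume "cliques W k ?G \<noteq> {}"
    then obtain \<kappa> where \<kappa>: "\<kappa> \<subseteq> W" "card \<kappa> = k" "pairs \<kappa> \<subseteq> ?G" unfolding cliques_def ksets_def by auto
    have fin: "finite \<kappa>" using \<kappa> W finite_subset by auto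
    have "\<not> pairs \<kappa> \<subseteq> ?x" using kx \<kappa> unfolding cliques_def ksets_def by auto
    then obtain e \<tau> where e: "e \<in> pairs \<kappa>" "\<tau> \<in> T" "e \<in> pairs \<tau>"
      using \<kappa> unfolding edges_of_def by blast
    have \<tau>: "finite \<tau>" "card \<tau> = s" using e(2) T W finite_subset[of \<tau> W] unfolding ksets_def by auto
    have "\<not> \<kappa> \<subseteq> \<tau>" using card_mono[OF \<tau>(1), of \<kappa>] \<tau> \<kappa> s by auto
    then obtain v where v: "v \<in> \<kappa>" "v \<notin> \<tau>" by auto
    have "e \<subseteq> \<kappa>" "e \<subseteq> \<tau>" "card e = 2" using e unfolding ksets_def by auto
    moreover have "finite e" using \<open>card e = 2\<close> by (metis card.infinite zero_neq_numeral)
    ultimately have "card (insert v e) \<le> s" "insert v e \<subseteq> \<kappa>" using v s by (auto simp: card_insert_if)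
    then obtain \<sigma> where \<sigma>: "insert v e \<subseteq> \<sigma>" "\<sigma> \<subseteq> \<kappa>" "card \<sigma> = s"
      using exists_subset_between[of "insert v e" s \<kappa>] \<kappa> s fin by auto
    have "finite \<sigma>" using \<sigma> fin finite_subset by auto
    have ov: "card (\<sigma> \<inter> \<tau>) \<ge> 2"
      by (rule card_inter_ge_2[of _ e]) (use \<open>finite \<sigma>\<close> \<sigma> e \<open>card e = 2\<close> in \<open>auto simp: ksets_def\<close>)
    have "\<sigma> \<notin> T"
    proof
      assume "\<sigma> \<in> T"
      moreover have "\<sigma> \<noteq> \<tau>" using \<sigma> v by auto
      ultimately have "\<sigma> \<inter> \<tau> = {}" using T e by (auto simp: disjoint_def)
      then show False using ov by simp
    qed
    moreover have "pairs \<sigma> \<subseteq> ?G" using \<sigma> \<kappa> ksets_mono[of \<sigma> \<kappa> 2] by auto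
    moreover have "\<sigma> \<in> ksets W s" using \<sigma> \<kappa> unfolding ksets_def by auto
    ultimately show False using few[of \<sigma>] ov e by blast
  qed
qed

lemma four_powr_minus_half: "(4::real) powr (- (real n / 2)) = (1/2) ^ n"
proof -
  have l: "ln (4::real) = 2 * ln 2" using ln_realpow[of 2 2] by simp
  have "(1/2::real) ^ n = (1/2) powr real n" by (rule powr_realpow[symmetric]) simp
  also have "\<dots> = 4 powr (- (real n / 2))" by (simp add: powr_def l ln_div)
  finally show ?thesis by simp
qed

text \<open>
  Both sides are expectations of a decreasing function after the edges of \<open>R\<close>, respectively of \<open>R \<union>
  T\<close>, have been forced. Forcing the edges of \<open>T\<close> costs \<open>q^(s choose 2)\<close> per clique. Creating no
  unwanted \<open>s\<close>-clique is a decreasing event of probability at least \<open>2^(- card T)\<close>, as each member of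
  \<open>T\<close> has cost at most \<open>1/2\<close>; by Harris' inequality it may be imposed in addition, and then the other
  cliques stay the same.
\<close>

lemma planting:
  assumes W: "finite W" and q: "0 \<le> q" "q \<le> 1/2" and s: "3 \<le> s" "s < k"
    and th: "0 \<le> th" "th \<le> 1" and R: "R \<subseteq> ksets W s" and T: "T \<subseteq> ksets W s" "T \<inter> R = {}"
    and op: "plantable W s q T (edges_of R)"
  defines "weight \<equiv> \<lambda>C. rexp (pairs W) q (\<lambda>X. of_bool (cliques W s X = C \<and> cliques W k X = {}))"
  shows "(q ^ (s choose 2) / 2) ^ card T * (\<Sum>C\<in>{C\<in>Pow (ksets W s). R \<subseteq> C}. weight C * th ^ card (C - R))
     \<le> (\<Sum>C\<in>{C\<in>Pow (ksets W s). R \<union> T \<subseteq> C}. weight C * th ^ card (C - (R \<union> T)))"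
proof -
  define P where "P = pairs W"
  define f where "f = (\<lambda>R X. of_bool (cliques W k X = {}) * th ^ card (cliques W s X - R))"
  have finP: "finite P" using W by (simp add: P_def)
  have conv: "(\<Sum>C\<in>{C\<in>Pow (ksets W s). R \<subseteq> C}. weight C * th ^ card (C - R))
     = rexp P q (\<lambda>X. of_bool (edges_of R \<subseteq> X) * f R X)" if "R \<subseteq> ksets W s" for R
  proof -
    have "(\<Sum>C\<in>{C\<in>Pow (ksets W s). R \<subseteq> C}. weight C * th ^ card (C - R))
      = rexp P q (\<lambda>X. of_bool (cliques W s X \<in> {C\<in>Pow (ksets W s). R \<subseteq> C}) * (of_bool (cliques W k X = {}) * th ^ card (cliques W s X - R)))"
      unfolding weight_def P_def by (rule rexp_fibers) (use W in auto)
    also have "\<dots> = rexp P q (\<lambda>X. of_bool (edges_of R \<subseteq> X) * f R X)"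
    proof (rule rexp_cong)
      fix X
      have "cliques W s X \<in> {C\<in>Pow (ksets W s). R \<subseteq> C} \<longleftrightarrow> edges_of R \<subseteq> X"
        using subset_cliques_iff[OF that] unfolding cliques_def by auto
      then show "of_bool (cliques W s X \<in> {C\<in>Pow (ksets W s). R \<subseteq> C}) * (of_bool (cliques W k X = {}) * th ^ card (cliques W s X - R)) = of_bool (edges_of R \<subseteq> X) * f R X"
        unfolding f_def by simp
    qed
    finally show ?thesis .
  qed
  have f_anti: "f R Y \<le> f R X" if "X \<subseteq> Y" for X Y R
  proof -
    have "cliques W k X \<subseteq> cliques W k Y" "cliques W s X \<subseteq> cliques W s Y" using that unfolding cliques_def by auto
    then have "th ^ card (cliques W s Y - R) \<le> th ^ card (cliques W s X - R)"
      "cliques W k Y = {} \<Longrightarrow> cliques W k X = {}"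
      using th W by (auto intro!: power_decreasing card_mono)
    then show ?thesis using th unfolding f_def by auto
  qed
  define ER where "ER = edges_of R"
  define ET where "ET = edges_of T"
  have sub: "ER \<subseteq> P" "ET \<subseteq> P" unfolding ER_def ET_def P_def using edges_of_subset[OF R] edges_of_subset[OF T(1)] by auto
  have fins: "finite \<sigma>" if "\<sigma> \<in> ksets W s" for \<sigma> using that W finite_subset unfolding ksets_def by auto
  have disjT: "disjoint T" using op unfolding plantable_def by auto
  have cost: "overlap_cost W s q \<tau> (ER \<union> ET) \<le> 1/2" if "\<tau> \<in> T" for \<tau>
    using op that unfolding plantable_def ER_def ET_def by auto
  have small: "q ^ card (pairs \<sigma> - (ER \<union> ET)) \<le> 1/2" if "\<tau> \<in> T" "\<sigma> \<in> ksets W s" "\<sigma> \<noteq> \<tau>" "card (\<sigma> \<inter> \<tau>) \<ge> 2" for \<sigma> \<tau>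
  proof -
    have "q ^ card (pairs \<sigma> - (ER \<union> ET)) \<le> overlap_cost W s q \<tau> (ER \<union> ET)"
      unfolding overlap_cost_def using that W q
      by (intro member_le_sum[where f = "\<lambda>\<sigma>. q ^ card (pairs \<sigma> - (ER \<union> ET))"]) auto
    then show ?thesis using cost[OF that(1)] by linarith
  qed
  have disj: "ER \<inter> ET = {}"
  proof (rule ccontr)
    assume "ER \<inter> ET \<noteq> {}"
    then obtain e \<rho> \<tau> where e: "e \<in> pairs \<rho>" "\<rho> \<in> R" "e \<in> pairs \<tau>" "\<tau> \<in> T"
      unfolding ER_def ET_def edges_of_def by auto
    then have "\<rho> \<in> ksets W s" "\<rho> \<noteq> \<tau>" using R T by auto
    moreover have "card (\<rho> \<inter> \<tau>) \<ge> 2" using card_inter_ge_2 fins e \<open>\<rho> \<in> ksets W s\<close> by blast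
    ultimately have "q ^ card (pairs \<rho> - (ER \<union> ET)) \<le> 1/2" using small e by blast
    moreover have "pairs \<rho> - (ER \<union> ET) = {}" using e unfolding ER_def edges_of_def by auto
    ultimately show False by simp
  qed
  define P' where "P' = P - (ER \<union> ET)"
  have finP': "finite P'" using finP by (simp add: P'_def)
  define I where "I = {\<sigma>\<in>ksets W s. \<sigma> \<notin> T \<and> (\<exists>\<tau>\<in>T. card (\<sigma> \<inter> \<tau>) \<ge> 2)}"
  define F where "F = (\<lambda>\<sigma>. pairs \<sigma> - (ER \<union> ET))"
  define d where "d = (\<lambda>X. of_bool (\<forall>\<sigma>\<in>I. F \<sigma> \<subseteq> P' \<longrightarrow> \<not> F \<sigma> \<subseteq> X) :: real)"
  have finI: "finite I" unfolding I_def using W by auto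
  have d_bound: "(1/2) ^ card T \<le> rexp P' q d"
  proof -
    have "(\<Sum>\<sigma>\<in>I. q ^ card (F \<sigma>)) \<le> (\<Sum>\<sigma>\<in>(\<Union>\<tau>\<in>T. {\<sigma>\<in>ksets W s. \<sigma> \<noteq> \<tau> \<and> card (\<sigma> \<inter> \<tau>) \<ge> 2}). q ^ card (F \<sigma>))"
      using W T q finite_subset[OF T(1)] by (intro sum_mono2) (auto simp: I_def)
    also have "\<dots> \<le> (\<Sum>\<tau>\<in>T. overlap_cost W s q \<tau> (ER \<union> ET))"
      unfolding overlap_cost_def F_def using W T q finite_subset[OF T(1)]
      by (intro sum_UN_le) auto
    also have "\<dots> \<le> (\<Sum>\<tau>\<in>T. 1/2)" by (intro sum_mono cost)
    finally have le: "(\<Sum>\<sigma>\<in>I. q ^ card (F \<sigma>)) \<le> real (card T) / 2" by simp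
    have "(1/2::real) ^ card T = 4 powr (- (real (card T) / 2))"
      by (rule four_powr_minus_half[symmetric])
    also have "\<dots> \<le> 4 powr (- (\<Sum>\<sigma>\<in>I. q ^ card (F \<sigma>)))" using le by (intro powr_mono) auto
    also have "\<dots> \<le> rexp P' q d"
      unfolding d_def
    proof (rule rexp_avoid_ge_powr[OF finP' q finI])
      fix \<sigma> assume "\<sigma> \<in> I"
      then obtain \<tau> where "\<tau> \<in> T" "\<sigma> \<in> ksets W s" "\<sigma> \<noteq> \<tau>" "card (\<sigma> \<inter> \<tau>) \<ge> 2" unfolding I_def by auto
      then have "q ^ card (F \<sigma>) \<le> 1/2" using small unfolding F_def by blast
      then show "card (F \<sigma>) \<ge> 1" by (cases "card (F \<sigma>)") auto
    qed
    finally show ?thesis .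
  qed
  have cardET: "card ET = card T * (s choose 2)"
    unfolding ET_def
  proof (rule card_edges_of[OF _ disjT])
    show "finite T" using T(1) W finite_subset finite_ksets by blast
    show "finite \<tau> \<and> card \<tau> = s" if "\<tau> \<in> T" for \<tau> using that T(1) fins[of \<tau>] by (auto simp: ksets_def)
  qed
  have "rexp P q (\<lambda>X. of_bool (ER \<subseteq> X) * f R X) = q ^ card ER * rexp (P - ER) q (\<lambda>X. f R (X \<union> ER))"
    by (rule rexp_superset[OF finP sub(1)])
  also have "rexp (P - ER) q (\<lambda>X. f R (X \<union> ER)) \<le> rexp (P - ER) q (\<lambda>X. f R (X \<inter> P' \<union> ER))"
    using q by (intro rexp_mono f_anti) auto
  also have "rexp (P - ER) q (\<lambda>X. f R (X \<inter> P' \<union> ER)) = rexp P' q (\<lambda>X. f R (X \<union> ER))"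
    using rexp_restrict[of "P - ER" P' q "\<lambda>X. f R (X \<union> ER)"] finP by (auto simp: P'_def)
  finally have A: "rexp P q (\<lambda>X. of_bool (ER \<subseteq> X) * f R X) \<le> q ^ card ER * rexp P' q (\<lambda>X. f R (X \<union> ER))"
    using q by (simp add: mult_left_mono)
  have f0: "0 \<le> rexp P' q (\<lambda>X. f R (X \<union> ER))" using q th by (intro rexp_nonneg) (auto simp: f_def)
  have "(1/2) ^ card T * rexp P' q (\<lambda>X. f R (X \<union> ER)) \<le> rexp P' q d * rexp P' q (\<lambda>X. f R (X \<union> ER))"
    by (intro mult_right_mono d_bound f0)
  also have "\<dots> \<le> rexp P' q (\<lambda>X. d X * f R (X \<union> ER))"
  proof (rule rexp_Harris[OF finP'])
    show "d Y \<le> d X" if "X \<subseteq> Y" for X Y using that unfolding d_def by (auto simp: of_bool_def dest: order_trans)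
    show "f R (Y \<union> ER) \<le> f R (X \<union> ER)" if "X \<subseteq> Y" for X Y by (rule f_anti) (use that in auto)
  qed (use q in auto)
  also have "\<dots> \<le> rexp P' q (\<lambda>X. f (R \<union> T) (X \<union> (ER \<union> ET)))"
  proof (rule rexp_mono)
    fix X assume X: "X \<subseteq> P'"
    show "d X * f R (X \<union> ER) \<le> f (R \<union> T) (X \<union> (ER \<union> ET))"
    proof (cases "d X = 1 \<and> cliques W k (X \<union> ER) = {}")
      case True
      have XP: "X \<subseteq> pairs W - ER - edges_of T" using X unfolding P'_def P_def ET_def by auto
      have no: "\<not> pairs \<sigma> - ER - edges_of T \<subseteq> X" if "\<sigma> \<in> ksets W s" "\<sigma> \<notin> T" "\<exists>\<tau>\<in>T. card (\<sigma> \<inter> \<tau>) \<ge> 2" for \<sigma>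
      proof -
        have "\<sigma> \<in> I" using that unfolding I_def by auto
        moreover have "F \<sigma> \<subseteq> P'" using that unfolding F_def P'_def P_def ksets_def by auto
        ultimately have "\<not> F \<sigma> \<subseteq> X" using True unfolding d_def by auto
        then show ?thesis unfolding F_def ET_def by auto
      qed
      note pc = planted_cliques[OF W s T(1) disjT XP _ _ no]
      have 1: "cliques W s (X \<union> ER \<union> edges_of T) - T = cliques W s (X \<union> ER)"
        by (rule pc) (use sub disj in \<open>auto simp: P_def ET_def\<close>)
      have 2: "cliques W k (X \<union> ER \<union> edges_of T) = {}"
        by (rule pc) (use sub disj True in \<open>auto simp: P_def ET_def\<close>)
      have "cliques W s (X \<union> (ER \<union> ET)) - (R \<union> T) = cliques W s (X \<union> ER) - R"
        using 1 unfolding ET_def by (auto simp: Un_assoc)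
      then show ?thesis using True 2 unfolding f_def ET_def by (simp add: Un_assoc)
    next
      case False
      then have "d X * f R (X \<union> ER) = 0" unfolding d_def f_def by auto
      moreover have "0 \<le> f (R \<union> T) (X \<union> (ER \<union> ET))" using th unfolding f_def by auto
      ultimately show ?thesis by linarith
    qed
  qed (use q in auto)
  finally have B: "(1/2) ^ card T * rexp P' q (\<lambda>X. f R (X \<union> ER)) \<le> rexp P' q (\<lambda>X. f (R \<union> T) (X \<union> (ER \<union> ET)))" .
  have "rexp P q (\<lambda>X. of_bool (ER \<union> ET \<subseteq> X) * f (R \<union> T) X) = q ^ card (ER \<union> ET) * rexp P' q (\<lambda>X. f (R \<union> T) (X \<union> (ER \<union> ET)))"
    unfolding P'_def using sub finP by (intro rexp_superset) auto
  also have "card (ER \<union> ET) = card ER + card T * (s choose 2)"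
    unfolding cardET[symmetric] using sub finP disj finite_subset by (intro card_Un_disjoint) auto
  finally have C: "rexp P q (\<lambda>X. of_bool (ER \<union> ET \<subseteq> X) * f (R \<union> T) X)
      = q ^ card ER * (q ^ (s choose 2)) ^ card T * rexp P' q (\<lambda>X. f (R \<union> T) (X \<union> (ER \<union> ET)))"
    unfolding mult.commute[of "card T"] power_add power_mult .
  have "(q ^ (s choose 2) / 2) ^ card T * rexp P q (\<lambda>X. of_bool (ER \<subseteq> X) * f R X)
    \<le> (q ^ (s choose 2) / 2) ^ card T * (q ^ card ER * rexp P' q (\<lambda>X. f R (X \<union> ER)))"
    using A q by (intro mult_left_mono) auto
  also have "\<dots> = q ^ card ER * (q ^ (s choose 2)) ^ card T * ((1/2) ^ card T * rexp P' q (\<lambda>X. f R (X \<union> ER)))"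
    by (simp add: power_divide mult_ac)
  also have "\<dots> \<le> q ^ card ER * (q ^ (s choose 2)) ^ card T * rexp P' q (\<lambda>X. f (R \<union> T) (X \<union> (ER \<union> ET)))"
    using B q by (intro mult_left_mono) auto
  also have "\<dots> = rexp P q (\<lambda>X. of_bool (ER \<union> ET \<subseteq> X) * f (R \<union> T) X)" by (rule C[symmetric])
  finally have D: "(q ^ (s choose 2) / 2) ^ card T * rexp P q (\<lambda>X. of_bool (ER \<subseteq> X) * f R X)
    \<le> rexp P q (\<lambda>X. of_bool (ER \<union> ET \<subseteq> X) * f (R \<union> T) X)" .
  have "R \<union> T \<subseteq> ksets W s" using R T by auto
  then show ?thesis using D conv[OF R] conv[of "R \<union> T"] unfolding edges_of_Un ER_def ET_def by (simp only:)
qed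

section \<open>Switchings and spread arrangements\<close>

text \<open>
  Up to \<open>n0^(1-s)\<close>, the probability that a given \<open>s\<close>-set is a row of a random arrangement is at most this
  constant.
\<close>

abbreviation switch_const :: "nat \<Rightarrow> real" where
  "switch_const s \<equiv> 2 * real s ^ s * 4 ^ (s - 1) * exp (5 * real s)"

text \<open>
  The rows listed in \<open>c\<close> form a square block of the grid, which is transposed. Row \<open>c ! i\<close> and column
  \<open>j\<close> exchange roles with row \<open>c ! j\<close> and column \<open>i\<close>.
\<close>

definition transpose_rows :: "nat list \<Rightarrow> nat \<times> nat \<Rightarrow> nat \<times> nat" where
  "transpose_rows c = (\<lambda>(x, y). if x \<in> set c \<and> y < length c
     then (c ! y, THE i. i < length c \<and> c ! i = x) else (x, y))"

lemma transpose_rows_nth: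
  assumes "distinct c" "i < length c" "j < length c"
  shows "transpose_rows c (c ! i, j) = (c ! j, i)"
proof -
  have "(THE k. k < length c \<and> c ! k = c ! i) = i"
    using assms by (intro the_equality) (auto simp: nth_eq_iff_index_eq)
  then show ?thesis using assms unfolding transpose_rows_def by auto
qed

lemma transpose_rows_other: "x \<notin> set c \<Longrightarrow> transpose_rows c (x, y) = (x, y)"
  unfolding transpose_rows_def by auto

lemma transpose_rows_invol:
  assumes "distinct c"
  shows "transpose_rows c (transpose_rows c z) = z"
proof (cases z)
  case (Pair x y)
  show ?thesis
  proof (cases "x \<in> set c \<and> y < length c")
    case True
    then obtain i where "i < length c" "x = c ! i" by (auto simp: in_set_conv_nth)
    then show ?thesis using True assms Pair by (simp add: transpose_rows_nth)
  next
    case False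
    then show ?thesis using Pair unfolding transpose_rows_def by auto
  qed
qed

text \<open>
  The elements of \<open>V\<close> are placed in a grid with \<open>n0\<close> rows of length \<open>s\<close>. A permutation of
  \<open>V\<close> rearranges them, and its rows form a perfect matching by \<open>s\<close>-sets.
\<close>

locale arrangement =
  fixes V :: "'a set" and s n0 :: nat and pos :: "nat \<times> nat \<Rightarrow> 'a"
  assumes pos: "bij_betw pos ({..<n0} \<times> {..<s}) V" and s_pos: "s \<ge> 1"
begin

definition row :: "('a \<Rightarrow> 'a) \<Rightarrow> nat \<Rightarrow> 'a set" where
  "row p x = (\<lambda>y. p (pos (x, y))) ` {..<s}"

definition rows :: "('a \<Rightarrow> 'a) \<Rightarrow> 'a set set" where
  "rows p = row p ` {..<n0}"

definition arrs :: "'a set set \<Rightarrow> 'a set set \<Rightarrow> ('a \<Rightarrow> 'a) set" where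
  "arrs F T = {p. p permutes V \<and> rows p \<inter> F = {} \<and> T \<subseteq> rows p}"

lemma finV: "finite V" using pos bij_betw_finite by blast

lemma finite_arrs: "finite (arrs F T)"
  by (rule finite_subset[OF _ finite_permutations[OF finV]]) (auto simp: arrs_def)

lemma pos_in: "x < n0 \<Longrightarrow> y < s \<Longrightarrow> pos (x, y) \<in> V"
  using pos unfolding bij_betw_def by auto

lemma pos_inj: "x < n0 \<Longrightarrow> y < s \<Longrightarrow> x' < n0 \<Longrightarrow> y' < s \<Longrightarrow> pos (x, y) = pos (x', y') \<longleftrightarrow> x = x' \<and> y = y'"
  using pos unfolding bij_betw_def inj_on_def by auto

lemma p_inj:
  assumes "p permutes V" "x < n0" "y < s" "x' < n0" "y' < s"
  shows "p (pos (x, y)) = p (pos (x', y')) \<longleftrightarrow> x = x' \<and> y = y'"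
  using assms pos_inj permutes_inj[OF assms(1)] by (metis injD)

lemma card_V: "card V = n0 * s"
  using bij_betw_same_card[OF pos] by simp

lemma row_kset:
  assumes "p permutes V" "x < n0"
  shows "row p x \<in> ksets V s"
proof -
  have "card (row p x) = s"
    unfolding row_def using assms p_inj by (subst card_image) (auto simp: inj_on_def)
  moreover have "row p x \<subseteq> V"
    unfolding row_def using assms pos_in permutes_in_image[OF assms(1)] by auto
  ultimately show ?thesis unfolding ksets_def by auto
qed

lemma row_disjoint:
  assumes "p permutes V" "x < n0" "x' < n0" "x \<noteq> x'"
  shows "row p x \<inter> row p x' = {}"
  unfolding row_def using assms p_inj by auto

lemma row_nonempty: "row p x \<noteq> {}" unfolding row_def using s_pos by (auto simp: lessThan_empty_iff)

lemma row_inj: "p permutes V \<Longrightarrow> inj_on (row p) {..<n0}"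
  using row_disjoint row_nonempty unfolding inj_on_def by (metis inf.idem lessThan_iff)

lemma disjoint_rows: "p permutes V \<Longrightarrow> disjoint (rows p)"
  unfolding disjoint_def rows_def using row_disjoint by blast

lemma rows_ksets: "p permutes V \<Longrightarrow> rows p \<subseteq> ksets V s"
  unfolding rows_def using row_kset by auto

lemma card_rows: "p permutes V \<Longrightarrow> card (rows p) = n0"
  unfolding rows_def using row_inj by (simp add: card_image)

definition ipos :: "'a \<Rightarrow> nat \<times> nat" where "ipos = the_inv_into ({..<n0} \<times> {..<s}) pos"

lemma ipos_pos: "x < n0 \<Longrightarrow> y < s \<Longrightarrow> ipos (pos (x, y)) = (x, y)"
  unfolding ipos_def using pos unfolding bij_betw_def by (intro the_inv_into_f_f) auto

lemma V_pos: "v \<in> V \<Longrightarrow> \<exists>x y. x < n0 \<and> y < s \<and> v = pos (x, y)"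
  using pos unfolding bij_betw_def by auto

definition swap :: "nat list \<Rightarrow> 'a \<Rightarrow> 'a" where
  "swap c v = (if v \<in> V then pos (transpose_rows c (ipos v)) else v)"

lemma nth_less: "set c \<subseteq> {..<n0} \<Longrightarrow> i < length c \<Longrightarrow> c ! i < n0"
  by (meson lessThan_iff nth_mem subsetD)

lemma transpose_range:
  assumes "length c = s" "set c \<subseteq> {..<n0}" "distinct c" "x < n0" "y < s"
  shows "\<exists>x' y'. transpose_rows c (x, y) = (x', y') \<and> x' < n0 \<and> y' < s"
proof (cases "x \<in> set c")
  case True
  then obtain i where "i < length c" "x = c ! i" by (auto simp: in_set_conv_nth)
  moreover have "c ! y < n0" using assms nth_less by simp
  ultimately show ?thesis using assms transpose_rows_nth[of c i y] by auto
next
  case False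
  then show ?thesis using assms transpose_rows_other by auto
qed

lemma swap_pos: "x < n0 \<Longrightarrow> y < s \<Longrightarrow> swap c (pos (x, y)) = pos (transpose_rows c (x, y))"
  unfolding swap_def using pos_in ipos_pos by simp

lemma swap_invol:
  assumes "length c = s" "set c \<subseteq> {..<n0}" "distinct c"
  shows "swap c (swap c v) = v"
proof (cases "v \<in> V")
  case True
  then obtain x y where xy: "x < n0" "y < s" "v = pos (x, y)" using V_pos by blast
  obtain x' y' where *: "transpose_rows c (x, y) = (x', y')" "x' < n0" "y' < s"
    using transpose_range[OF assms xy(1,2)] by blast
  have "swap c v = pos (x', y')" using xy swap_pos * by simp
  then have "swap c (swap c v) = pos (transpose_rows c (transpose_rows c (x, y)))" using swap_pos * by simp
  then show ?thesis using transpose_rows_invol[OF assms(3)] xy by simp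
qed (simp add: swap_def)

lemma swap_permutes:
  assumes "length c = s" "set c \<subseteq> {..<n0}" "distinct c"
  shows "swap c permutes V"
proof (rule bij_imp_permutes)
  have "swap c v \<in> V" if vV: "v \<in> V" for v
  proof -
    obtain x y where xy: "x < n0" "y < s" "v = pos (x, y)" using V_pos[OF vV] by blast
    obtain x' y' where *: "transpose_rows c (x, y) = (x', y')" "x' < n0" "y' < s"
      using transpose_range[OF assms xy(1,2)] by blast
    then show ?thesis using xy swap_pos pos_in by simp
  qed
  then show "bij_betw (swap c) V V"
    by (intro bij_betw_byWitness[of _ "swap c"]) (auto simp: swap_invol[OF assms])
qed (simp add: swap_def)

text \<open>
  Double counting of switchings. Choose \<open>s - 1\<close> further rows outside \<open>T\<close> and transpose the block that they
  form with the row \<open>\<tau>\<close>. This destroys \<open>\<tau>\<close>, keeps \<open>T\<close>, and creates a forbidden row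
  for at most \<open>c s^(s-1)\<close> choices per new row, since the first element of the new row is known. The elements of
  \<open>\<tau>\<close> become the first column of the block, so the switching can be undone once their order is known, which gives
  the factor \<open>s^s\<close>.
\<close>

lemma switch:
  assumes F: "F \<subseteq> ksets V s" "\<And>v. v \<in> V \<Longrightarrow> card {\<sigma>\<in>F. v \<in> \<sigma>} \<le> c"
    and T: "finite T" "\<tau> \<notin> T" and \<tau>: "card \<tau> = s" "finite \<tau>" and M: "card T + s \<le> n0"
  shows "card (arrs F (insert \<tau> T)) * ((n0 - card T - s) ^ (s - 1) - s * (c * s ^ (s - 1))) \<le> card (arrs F T) * s ^ s"
proof -
  define a where "a = (\<lambda>p. SOME x. x < n0 \<and> row p x = \<tau>)"
  define U where "U = (\<lambda>p. {x. x < n0 \<and> row p x \<in> T})"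
  define B where "B = (\<lambda>p. {b. length b = s - 1 \<and> distinct b \<and> set b \<subseteq> {..<n0} - U p - {a p}})"
  define nrow where "nrow = (\<lambda>p b i. (\<lambda>j. p (pos ((a p # b) ! j, i))) ` {..<s})"
  define Gd where "Gd = (\<lambda>p. {b\<in>B p. \<forall>i<s. nrow p b i \<notin> F})"
  define lst where "lst = (\<lambda>p. map (\<lambda>j. p (pos (a p, j))) [0..<s])"
  \<comment> \<open>The list of the elements of the destroyed row, in order, is what is needed to undo the switching.\<close>
  define \<Phi> where "\<Phi> = (\<lambda>(p, b). (p \<circ> swap (a p # b), lst p))"
  have finF: "finite F" using F finV finite_subset finite_ksets by blast
  have p: "p permutes V" "a p < n0" "row p (a p) = \<tau>" "T \<subseteq> rows p" "\<And>x. x < n0 \<Longrightarrow> row p x \<notin> F"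
    if "p \<in> arrs F (insert \<tau> T)" for p
  proof -
    have "\<exists>x. x < n0 \<and> row p x = \<tau>" using that unfolding arrs_def rows_def by auto
    then have "a p < n0 \<and> row p (a p) = \<tau>" unfolding a_def by (rule someI_ex)
    then show "a p < n0" "row p (a p) = \<tau>" by auto
  qed (use that in \<open>auto simp: arrs_def rows_def\<close>)
  have c_list: "length (a p # b) = s" "set (a p # b) \<subseteq> {..<n0}" "distinct (a p # b)" "set (a p # b) \<inter> U p = {}"
    if "p \<in> arrs F (insert \<tau> T)" "b \<in> B p" for p b
    using that p[OF that(1)] s_pos T unfolding B_def U_def by auto
  have cardG: "card (Gd p) \<ge> (n0 - card T - s) ^ (s - 1) - s * (c * s ^ (s - 1))"
    if pA: "p \<in> arrs F (insert \<tau> T)" for p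
  proof -
    note P = p[OF pA]
    define A where "A = {..<n0} - U p - {a p}"
    have "row p ` U p = T" unfolding U_def using P(4) unfolding rows_def by auto
    moreover have "inj_on (row p) (U p)" using row_inj[OF P(1)] by (rule inj_on_subset) (auto simp: U_def)
    ultimately have cU: "card (U p) = card T" using card_image by metis
    have Usub: "U p \<subseteq> {..<n0}" "a p \<notin> U p" using P T unfolding U_def by auto
    have cA: "card A = n0 - card T - 1"
      unfolding A_def using Usub P cU finite_subset[OF Usub(1)] by (simp add: card_Diff_subset)
    have finA: "finite A" unfolding A_def by simp
    have finB: "finite (B p)" unfolding B_def
      by (rule finite_subset[OF _ finite_lists_length_eq[OF finA, of "s - 1"]]) (auto simp: A_def)
    have "(n0 - card T - s) ^ (s - 1) \<le> \<Prod>{card A - (s - 1) + 1..card A}"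
    proof -
      have "(n0 - card T - s) ^ (s - 1) = (\<Prod>i\<in>{card A - (s - 1) + 1..card A}. n0 - card T - s)"
        using M cA s_pos by simp
      also have "\<dots> \<le> \<Prod>{card A - (s - 1) + 1..card A}"
        using M cA s_pos by (intro prod_mono) auto
      finally show ?thesis .
    qed
    also have "\<dots> = card (B p)" unfolding B_def A_def[symmetric]
      by (rule card_lists_distinct_length_eq[symmetric, OF finA]) (use cA M s_pos in auto)
    finally have cB: "(n0 - card T - s) ^ (s - 1) \<le> card (B p)" .
    define bad where "bad = (\<lambda>i. {b\<in>B p. nrow p b i \<in> F})"
    have bad: "card (bad i) \<le> c * s ^ (s - 1)" if i: "i < s" for i
    proof -
      define Fi where "Fi = {\<sigma>\<in>F. p (pos (a p, i)) \<in> \<sigma>}"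
      have inV: "p (pos (a p, i)) \<in> V" using P pos_in i permutes_in_image[OF P(1)] by auto
      have finFi: "finite Fi" using finF by (simp add: Fi_def)
      have fs: "finite \<sigma>" "card \<sigma> = s" if "\<sigma> \<in> Fi" for \<sigma>
        using that F finV finite_subset[of \<sigma> V] unfolding Fi_def ksets_def by auto
      have inj: "inj_on (map (\<lambda>x. p (pos (x, i)))) (B p)"
      proof (rule inj_onI)
        fix b b' assume b: "b \<in> B p" "b' \<in> B p" "map (\<lambda>x. p (pos (x, i))) b = map (\<lambda>x. p (pos (x, i))) b'"
        have "inj_on (\<lambda>x. p (pos (x, i))) {..<n0}" using p_inj[OF P(1)] i by (auto simp: inj_on_def)
        moreover have "set b \<subseteq> {..<n0}" "set b' \<subseteq> {..<n0}" using b unfolding B_def by auto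
        ultimately show "b = b'" using b(3) by (metis inj_on_map_eq_map inj_on_subset le_sup_iff)
      qed
      have im: "map (\<lambda>x. p (pos (x, i))) ` bad i \<subseteq> (\<Union>\<sigma>\<in>Fi. {l. set l \<subseteq> \<sigma> \<and> length l = s - 1})"
      proof (rule image_subsetI)
        fix b assume b: "b \<in> bad i"
        have len: "length b = s - 1" using b unfolding bad_def B_def by auto
        have nr: "nrow p b i = insert (p (pos (a p, i))) (set (map (\<lambda>x. p (pos (x, i))) b))"
        proof -
          have "nrow p b i = (\<lambda>x. p (pos (x, i))) ` set (a p # b)"
            unfolding nrow_def using len s_pos by (force simp: set_conv_nth)
          then show ?thesis by simp
        qed
        then have "nrow p b i \<in> Fi" using b unfolding bad_def Fi_def by auto
        then show "map (\<lambda>x. p (pos (x, i))) b \<in> (\<Union>\<sigma>\<in>Fi. {l. set l \<subseteq> \<sigma> \<and> length l = s - 1})"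
          using nr len by auto
      qed
      have "card (bad i) = card (map (\<lambda>x. p (pos (x, i))) ` bad i)"
        using inj by (intro card_image[symmetric] inj_on_subset[OF inj]) (auto simp: bad_def)
      also have "\<dots> \<le> card (\<Union>\<sigma>\<in>Fi. {l. set l \<subseteq> \<sigma> \<and> length l = s - 1})"
        using im finFi finite_lists_length_eq[OF fs(1)] by (intro card_mono finite_UN_I) auto
      also have "\<dots> \<le> (\<Sum>\<sigma>\<in>Fi. card {l. set l \<subseteq> \<sigma> \<and> length l = s - 1})"
        by (rule card_UN_le[OF finFi])
      also have "\<dots> = (\<Sum>\<sigma>\<in>Fi. s ^ (s - 1))" using fs by (intro sum.cong) (auto simp: card_lists_length_eq)
      also have "\<dots> \<le> c * s ^ (s - 1)" using F(2)[OF inV] by (simp add: Fi_def)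
      finally show ?thesis .
    qed
    have "B p - (\<Union>i<s. bad i) \<subseteq> Gd p" unfolding Gd_def bad_def by auto
    moreover have "finite (Gd p)" using finB by (simp add: Gd_def)
    ultimately have "card (B p - (\<Union>i<s. bad i)) \<le> card (Gd p)" by (intro card_mono)
    moreover have "card (B p) - card (\<Union>i<s. bad i) \<le> card (B p - (\<Union>i<s. bad i))"
      by (rule diff_card_le_card_Diff) (use finB in \<open>auto simp: bad_def\<close>)
    moreover have "card (\<Union>i<s. bad i) \<le> s * (c * s ^ (s - 1))"
    proof -
      have "card (\<Union>i<s. bad i) \<le> (\<Sum>i<s. card (bad i))" by (rule card_UN_le) simp
      also have "\<dots> \<le> (\<Sum>i<s. c * s ^ (s - 1))" by (intro sum_mono bad) auto
      finally show ?thesis by simp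
    qed
    ultimately show ?thesis using cB by linarith
  qed
  have finG: "finite (Gd p)" for p
    unfolding Gd_def B_def
    by (rule finite_subset[OF _ finite_lists_length_eq[of "{..<n0}" "s - 1"]]) auto
  have inj: "inj_on \<Phi> (Sigma (arrs F (insert \<tau> T)) Gd)"
  proof (rule inj_onI, safe)
    fix p1 b1 p2 b2
    assume 1: "p1 \<in> arrs F (insert \<tau> T)" "b1 \<in> Gd p1" and 2: "p2 \<in> arrs F (insert \<tau> T)" "b2 \<in> Gd p2"
      and eq: "\<Phi> (p1, b1) = \<Phi> (p2, b2)"
    define c1 where "c1 = a p1 # b1"
    define c2 where "c2 = a p2 # b2"
    have C1: "length c1 = s" "set c1 \<subseteq> {..<n0}" "distinct c1" using c_list[OF 1(1), of b1] 1(2) unfolding c1_def Gd_def by auto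
    have C2: "length c2 = s" "set c2 \<subseteq> {..<n0}" "distinct c2" using c_list[OF 2(1), of b2] 2(2) unfolding c2_def Gd_def by auto
    have e: "p1 \<circ> swap c1 = p2 \<circ> swap c2" "lst p1 = lst p2" using eq unfolding \<Phi>_def c1_def c2_def by auto
    have first: "(p \<circ> swap c) (pos (c ! i, 0)) = lst p ! i"
      if "length c = s" "set c \<subseteq> {..<n0}" "distinct c" "c = a p # b" "i < s" for p c b i
    proof -
      have "c ! i < n0" using that nth_less by auto
      moreover have "transpose_rows c (c ! i, 0) = (c ! 0, i)"
        by (rule transpose_rows_nth) (use that s_pos in auto)
      ultimately show ?thesis using that s_pos swap_pos[of "c ! i" 0 c] unfolding lst_def by auto
    qed
    have pp: "p1 \<circ> swap c1 permutes V" using swap_permutes[OF C1] p(1)[OF 1(1)] permutes_compose by blast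
    have "c1 ! i = c2 ! i" if i: "i < s" for i
    proof -
      have "(p1 \<circ> swap c1) (pos (c1 ! i, 0)) = (p1 \<circ> swap c1) (pos (c2 ! i, 0))"
        using first[OF C1 c1_def i] first[OF C2 c2_def i] e by simp
      moreover have "c1 ! i < n0" "c2 ! i < n0" using C1 C2 i nth_less by auto
      ultimately show ?thesis using p_inj[OF pp] s_pos by auto
    qed
    then have cc: "c1 = c2" using C1 C2 by (intro nth_equalityI) auto
    then have "b1 = b2" unfolding c1_def c2_def by auto
    moreover have "p1 = p2"
    proof
      fix v
      have "p1 v = (p1 \<circ> swap c1) (swap c1 v)" using swap_invol[OF C1] by simp
      also have "\<dots> = (p2 \<circ> swap c1) (swap c1 v)" using e cc by simp
      also have "\<dots> = p2 v" using swap_invol[OF C1] by simp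
      finally show "p1 v = p2 v" .
    qed
    ultimately show "p1 = p2" "b1 = b2" by auto
  qed
  have im: "\<Phi> ` Sigma (arrs F (insert \<tau> T)) Gd \<subseteq> arrs F T \<times> {l. set l \<subseteq> \<tau> \<and> length l = s}"
  proof (rule image_subsetI, safe)
    fix p' b assume pA: "p' \<in> arrs F (insert \<tau> T)" and b: "b \<in> Gd p'"
    note P = p[OF pA]
    define cc where "cc = a p' # b"
    have C: "length cc = s" "set cc \<subseteq> {..<n0}" "distinct cc" "set cc \<inter> U p' = {}"
      using c_list[OF pA, of b] b unfolding cc_def Gd_def by auto
    define p2 where "p2 = p' \<circ> swap cc"
    have pm: "p2 permutes V" unfolding p2_def using swap_permutes[OF C(1-3)] P(1) permutes_compose by blast
    have r1: "row p2 (cc ! i) = nrow p' b i" if "i < s" for i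
    proof -
      have "cc ! i < n0" using that C nth_less by auto
      then have "p2 (pos (cc ! i, j)) = p' (pos (cc ! j, i))" if "j < s" for j
        unfolding p2_def using swap_pos[of "cc ! i" j cc] transpose_rows_nth[of cc i j] C that \<open>i < s\<close> by auto
      then show ?thesis unfolding row_def nrow_def cc_def[symmetric] by auto
    qed
    have r2: "row p2 x = row p' x" if "x < n0" "x \<notin> set cc" for x
      unfolding row_def p2_def using swap_pos[of x _ cc] transpose_rows_other[of x cc] that by auto
    have "row p2 x \<notin> F" if "x < n0" for x
    proof (cases "x \<in> set cc")
      case True
      then obtain i where "i < s" "x = cc ! i" using C by (auto simp: in_set_conv_nth)
      then show ?thesis using r1 b unfolding Gd_def by auto
    qed (use r2 that P in auto)
    moreover have "T \<subseteq> rows p2"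
    proof
      fix t assume t: "t \<in> T"
      then obtain x where x: "x < n0" "t = row p' x" using P(4) unfolding rows_def by auto
      then have "x \<notin> set cc" using C(4) t unfolding U_def by auto
      then show "t \<in> rows p2" using r2 x unfolding rows_def by auto
    qed
    ultimately have "p2 \<in> arrs F T" using pm unfolding arrs_def rows_def by auto
    moreover have "set (lst p') \<subseteq> \<tau> \<and> length (lst p') = s"
      using P(3) unfolding lst_def row_def by auto
    ultimately show "\<Phi> (p', b) \<in> arrs F T \<times> {l. set l \<subseteq> \<tau> \<and> length l = s}"
      unfolding \<Phi>_def p2_def cc_def by auto
  qed
  have "card (arrs F (insert \<tau> T)) * ((n0 - card T - s) ^ (s - 1) - s * (c * s ^ (s - 1)))
     = (\<Sum>p\<in>arrs F (insert \<tau> T). (n0 - card T - s) ^ (s - 1) - s * (c * s ^ (s - 1)))" by simp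
  also have "\<dots> \<le> (\<Sum>p\<in>arrs F (insert \<tau> T). card (Gd p))" by (intro sum_mono cardG)
  also have "\<dots> = card (Sigma (arrs F (insert \<tau> T)) Gd)"
    using finite_arrs finG by (simp add: card_SigmaI)
  also have "\<dots> \<le> card (arrs F T \<times> {l. set l \<subseteq> \<tau> \<and> length l = s})"
    using inj im finite_arrs finite_lists_length_eq[OF \<tau>(2)] by (intro card_inj_on_le) auto
  also have "\<dots> = card (arrs F T) * s ^ s"
    using card_lists_length_eq[OF \<tau>(2), of s] \<tau>(1) by (simp add: card_cartesian_product)
  finally show ?thesis .
qed

lemma arrs_mono: "F' \<subseteq> F \<Longrightarrow> T \<subseteq> T' \<Longrightarrow> arrs F T' \<subseteq> arrs F' T"
  unfolding arrs_def by auto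

lemma switch_real:
  assumes F: "F \<subseteq> ksets V s" "\<And>v. v \<in> V \<Longrightarrow> card {\<sigma>\<in>F. v \<in> \<sigma>} \<le> c"
    and c: "2 * real s ^ s * real c \<le> (real n0 / 4) ^ (s - 1)" and n0: "4 * s \<le> n0"
    and T: "finite T" "\<tau> \<notin> T" and \<tau>: "card \<tau> = s" "finite \<tau>" and M: "2 * card T \<le> n0"
  shows "real (card (arrs F (insert \<tau> T))) \<le> (2 * real s ^ s / (real n0 / 4) ^ (s - 1)) * real (card (arrs F T))"
proof -
  define L where "L = (real n0 / 4) ^ (s - 1)"
  have Lpos: "L > 0" using n0 s_pos by (simp add: L_def)
  have M': "card T + s \<le> n0" using M n0 s_pos by linarith
  have "L \<le> real (n0 - card T - s) ^ (s - 1)"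
    unfolding L_def using M M' n0 by (intro power_mono) (auto simp: of_nat_diff)
  moreover have "real (s * (c * s ^ (s - 1))) = real s ^ s * real c"
    using s_pos by (cases s) (auto simp: algebra_simps)
  moreover have "2 * (real s ^ s * real c) \<le> L" using c unfolding L_def by (simp only: mult.assoc)
  ultimately have "L / 2 \<le> real ((n0 - card T - s) ^ (s - 1)) - real (s * (c * s ^ (s - 1)))"
    unfolding of_nat_power by linarith
  also have "\<dots> \<le> real ((n0 - card T - s) ^ (s - 1) - s * (c * s ^ (s - 1)))" by linarith
  finally have "real (card (arrs F (insert \<tau> T))) * (L / 2) \<le> real (card (arrs F (insert \<tau> T))) * real ((n0 - card T - s) ^ (s - 1) - s * (c * s ^ (s - 1)))"
    by (intro mult_left_mono) auto
  also have "\<dots> \<le> real (card (arrs F T)) * real s ^ s"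
    using switch[OF F T \<tau> M'] by (metis of_nat_le_iff of_nat_mult of_nat_power)
  finally show ?thesis using Lpos unfolding L_def[symmetric] by (simp add: field_simps)
qed

text \<open>
  As long as \<open>T\<close> occupies at most half of the rows, there are enough rows left to switch with.
\<close>

lemma spread_small:
  assumes F: "F \<subseteq> ksets V s" "\<And>v. v \<in> V \<Longrightarrow> card {\<sigma>\<in>F. v \<in> \<sigma>} \<le> c"
    and c: "2 * real s ^ s * real c \<le> (real n0 / 4) ^ (s - 1)" and n0: "4 * s \<le> n0"
    and T: "T \<subseteq> ksets V s" "2 * card T \<le> n0"
  shows "real (card (arrs F T)) \<le> (2 * real s ^ s / (real n0 / 4) ^ (s - 1)) ^ card T * real (card (arrs F {}))"
proof -
  have "finite T" using T(1) finV finite_subset finite_ksets by blast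
  then show ?thesis using T
  proof (induction T rule: finite_induct)
    case (insert \<tau> T)
    have \<tau>: "card \<tau> = s" "finite \<tau>" using insert.prems finV finite_subset[of \<tau> V] unfolding ksets_def by auto
    have "real (card (arrs F (insert \<tau> T))) \<le> (2 * real s ^ s / (real n0 / 4) ^ (s - 1)) * real (card (arrs F T))"
      by (rule switch_real[OF F c n0 insert.hyps \<tau>]) (use insert in auto)
    also have "\<dots> \<le> (2 * real s ^ s / (real n0 / 4) ^ (s - 1)) * ((2 * real s ^ s / (real n0 / 4) ^ (s - 1)) ^ card T * real (card (arrs F {})))"
      using insert by (intro mult_left_mono insert.IH) auto
    finally show ?case using insert.hyps by (simp add: mult.assoc)
  qed simp
qed

text \<open>
  Forbid the members of \<open>F\<close> one at a time; each forbids at most a proportion \<open>\<kappa>\<close> of the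
  arrangements left, and \<open>\<kappa> card F\<close> is at most the number of points.
\<close>

lemma arrs_lower:
  assumes F: "F \<subseteq> ksets V s" "\<And>v. v \<in> V \<Longrightarrow> card {\<sigma>\<in>F. v \<in> \<sigma>} \<le> c"
    and c: "2 * real s ^ s * real c \<le> (real n0 / 4) ^ (s - 1)" and n0: "4 * s \<le> n0"
    and half: "4 * real s ^ s \<le> (real n0 / 4) ^ (s - 1)"
  shows "exp (- 2 * real (n0 * s)) * fact (n0 * s) \<le> real (card (arrs F {}))"
proof -
  define \<kappa> where "\<kappa> = 2 * real s ^ s / (real n0 / 4) ^ (s - 1)"
  have L: "(real n0 / 4) ^ (s - 1) > 0" using n0 s_pos by simp
  have \<kappa>: "0 \<le> \<kappa>" "\<kappa> \<le> 1/2" using half L unfolding \<kappa>_def by (auto simp: field_simps)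
  have finF: "finite F" using F finV finite_subset finite_ksets by blast
  have main: "(1 - \<kappa>) ^ card F' * fact (n0 * s) \<le> real (card (arrs F' {}))" if "finite F'" "F' \<subseteq> F" for F'
    using that
  proof (induction F' rule: finite_induct)
    case empty
    have "arrs {} {} = {p. p permutes V}" unfolding arrs_def by auto
    then show ?case using card_permutations[OF card_V finV] by simp
  next
    case (insert \<sigma> F')
    have F': "F' \<subseteq> ksets V s" "\<And>v. v \<in> V \<Longrightarrow> card {\<sigma>\<in>F'. v \<in> \<sigma>} \<le> c"
    proof -
      fix v assume "v \<in> V"
      have "card {\<sigma>\<in>F'. v \<in> \<sigma>} \<le> card {\<sigma>\<in>F. v \<in> \<sigma>}" using finF insert.prems by (intro card_mono) auto
      then show "card {\<sigma>\<in>F'. v \<in> \<sigma>} \<le> c" using F(2)[OF \<open>v \<in> V\<close>] by linarith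
    qed (use insert.prems F in auto)
    have "real (card (arrs F' {\<sigma>})) \<le> \<kappa> * real (card (arrs F' {}))"
      using spread_small[OF F' c n0, of "{\<sigma>}"] insert.prems F n0 s_pos unfolding \<kappa>_def by auto
    moreover have "arrs (insert \<sigma> F') {} = arrs F' {} - arrs F' {\<sigma>}" "arrs F' {\<sigma>} \<subseteq> arrs F' {}" unfolding arrs_def by auto
    ultimately have "(1 - \<kappa>) * real (card (arrs F' {})) \<le> real (card (arrs (insert \<sigma> F') {}))"
      using finite_arrs by (simp add: card_Diff_subset card_mono of_nat_diff algebra_simps)
    moreover have "(1 - \<kappa>) * ((1 - \<kappa>) ^ card F' * fact (n0 * s)) \<le> (1 - \<kappa>) * real (card (arrs F' {}))"
      using insert \<kappa> by (intro mult_left_mono insert.IH) auto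
    ultimately show ?case using insert.hyps by (simp add: mult.assoc)
  qed
  have cF: "card F \<le> card V * c"
  proof -
    have "F \<subseteq> (\<Union>v\<in>V. {\<sigma>\<in>F. v \<in> \<sigma>})"
    proof
      fix \<sigma> assume "\<sigma> \<in> F"
      then have "\<sigma> \<subseteq> V" "card \<sigma> = s" using F unfolding ksets_def by auto
      then have "\<sigma> \<noteq> {}" using s_pos by auto
      then show "\<sigma> \<in> (\<Union>v\<in>V. {\<sigma>\<in>F. v \<in> \<sigma>})" using \<open>\<sigma> \<subseteq> V\<close> \<open>\<sigma> \<in> F\<close> by auto
    qed
    then have "card F \<le> card (\<Union>v\<in>V. {\<sigma>\<in>F. v \<in> \<sigma>})" using finF finV by (intro card_mono) auto
    also have "\<dots> \<le> (\<Sum>v\<in>V. card {\<sigma>\<in>F. v \<in> \<sigma>})" by (rule card_UN_le[OF finV])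
    also have "\<dots> \<le> (\<Sum>v\<in>V. c)" by (intro sum_mono F)
    finally show ?thesis by simp
  qed
  have "\<kappa> * real c \<le> 1" using c L unfolding \<kappa>_def by (simp add: field_simps)
  have "\<kappa> * real (card F) \<le> \<kappa> * real (card V * c)" using cF \<kappa> by (intro mult_left_mono) linarith+
  also have "\<dots> = (\<kappa> * real c) * real (n0 * s)" by (simp add: card_V mult_ac)
  also have "\<dots> \<le> 1 * real (n0 * s)" using \<open>\<kappa> * real c \<le> 1\<close> by (intro mult_right_mono) auto
  finally have e: "\<kappa> * real (card F) \<le> real (n0 * s)" by simp
  have "exp (- 2 * real (n0 * s)) \<le> exp (- 2 * (\<kappa> * real (card F)))" using e by simp
  also have "\<dots> = exp (- 2 * \<kappa>) ^ card F" by (simp add: exp_of_nat_mult[symmetric] mult_ac)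
  also have "\<dots> \<le> (1 - \<kappa>) ^ card F"
  proof (rule power_mono)
    have "exp (- 2 * \<kappa>) \<le> inverse (1 + 2 * \<kappa>)"
      using exp_ge_add_one_self[of "2 * \<kappa>"] \<kappa> by (simp add: exp_minus le_imp_inverse_le)
    also have "\<dots> \<le> 1 - \<kappa>"
    proof -
      have "1 \<le> (1 - \<kappa>) * (1 + 2 * \<kappa>)" using \<kappa> mult_left_mono[OF \<kappa>(2,1)] by (simp add: algebra_simps)
      then show ?thesis using \<kappa> by (simp add: field_simps)
    qed
    finally show "exp (- 2 * \<kappa>) \<le> 1 - \<kappa>" .
  qed simp
  finally have "exp (- 2 * real (n0 * s)) * fact (n0 * s) \<le> (1 - \<kappa>) ^ card F * fact (n0 * s)"
    by (intro mult_right_mono) auto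
  also have "\<dots> \<le> real (card (arrs F {}))" using main[OF finF] by simp
  finally show ?thesis .
qed

text \<open>
  Prescribe for each member of \<open>T\<close> its row and the order of its elements there; the rest is a permutation of the
  remaining points.
\<close>

lemma card_arrs_le:
  assumes T: "T \<subseteq> ksets V s"
  shows "card (arrs {} T) \<le> (n0 * s ^ s) ^ card T * fact (n0 * s - card T * s)"
proof -
  have finT: "finite T" using T finV finite_subset finite_ksets by blast
  have ft: "finite \<tau>" "card \<tau> = s" if "\<tau> \<in> T" for \<tau>
    using that T finV finite_subset[of \<tau> V] unfolding ksets_def by auto
  define Ls where "Ls = (\<lambda>\<tau>::'a set. {l. set l = \<tau> \<and> length l = s})"
  have Ls: "finite (Ls \<tau>)" "card (Ls \<tau>) \<le> s ^ s" if "\<tau> \<in> T" for \<tau>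
  proof -
    have sub: "Ls \<tau> \<subseteq> {l. set l \<subseteq> \<tau> \<and> length l = s}" unfolding Ls_def by auto
    show "finite (Ls \<tau>)" using sub finite_lists_length_eq[OF ft(1)[OF that]] finite_subset by blast
    show "card (Ls \<tau>) \<le> s ^ s"
      using card_mono[OF finite_lists_length_eq[OF ft(1)[OF that]] sub] card_lists_length_eq[OF ft(1)[OF that], of s] ft(2)[OF that]
      by simp
  qed
  define Q where "Q = (\<lambda>(r, l). {p. p permutes V \<and> (\<forall>\<tau>\<in>T. \<forall>j<s. p (pos (r \<tau>, j)) = l \<tau> ! j)})"
  define I where "I = (T \<rightarrow>\<^sub>E {..<n0}) \<times> (Pi\<^sub>E T Ls)"
  have finI: "finite I" unfolding I_def using finT Ls by (intro finite_cartesian_product finite_PiE) auto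
  have cover: "arrs {} T \<subseteq> (\<Union>i\<in>I. Q i)"
  proof
    fix p assume p: "p \<in> arrs {} T"
    then have ex: "\<forall>\<tau>\<in>T. \<exists>x. x < n0 \<and> row p x = \<tau>" unfolding arrs_def rows_def by auto
    then obtain r where r: "\<And>\<tau>. \<tau> \<in> T \<Longrightarrow> r \<tau> < n0 \<and> row p (r \<tau>) = \<tau>" by metis
    define l where "l = (\<lambda>\<tau>. map (\<lambda>j. p (pos (r \<tau>, j))) [0..<s])"
    have "l \<tau> \<in> Ls \<tau>" if "\<tau> \<in> T" for \<tau>
      using r[OF that] unfolding l_def Ls_def row_def by (auto simp: atLeast0LessThan)
    then have "(restrict r T, restrict l T) \<in> I" unfolding I_def using r by auto
    moreover have "p \<in> Q (restrict r T, restrict l T)" using p unfolding Q_def arrs_def l_def by auto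
    ultimately show "p \<in> (\<Union>i\<in>I. Q i)" by blast
  qed
  have cQ: "card (Q i) \<le> fact (n0 * s - card T * s)" if "i \<in> I" for i
  proof (cases "Q i = {}")
    case False
    obtain r l where i: "i = (r, l)" by (cases i)
    have r: "r \<tau> < n0" "set (l \<tau>) = \<tau>" "length (l \<tau>) = s" if "\<tau> \<in> T" for \<tau>
      using \<open>i \<in> I\<close> that unfolding i I_def Ls_def by (auto dest: PiE_mem)
    obtain p0 where p0: "p0 permutes V" "\<And>\<tau> j. \<tau> \<in> T \<Longrightarrow> j < s \<Longrightarrow> p0 (pos (r \<tau>, j)) = l \<tau> ! j"
      using False unfolding i Q_def by auto
    have inj_r: "inj_on r T"
    proof (rule inj_onI)
      fix \<tau> \<tau>' assume t: "\<tau> \<in> T" "\<tau>' \<in> T" "r \<tau> = r \<tau>'"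
      then have "l \<tau> = l \<tau>'" using p0 r by (intro nth_equalityI) (auto, metis)
      then show "\<tau> = \<tau>'" using r t by metis
    qed
    define A where "A = pos ` (r ` T \<times> {..<s})"
    have AV: "A \<subseteq> V" unfolding A_def using r pos_in by auto
    have "card A = card (r ` T \<times> {..<s})"
      unfolding A_def using pos r by (intro card_image) (auto simp: bij_betw_def intro: inj_on_subset)
    then have cA: "card A = card T * s" using card_image[OF inj_r] by (simp add: card_cartesian_product)
    have "card (Q i) \<le> card {p. p permutes (V - A)}"
    proof (rule card_inj_on_le[of "\<lambda>p. inv p0 \<circ> p"])
      show "inj_on (\<lambda>p. inv p0 \<circ> p) (Q i)"
      proof (rule inj_onI)
        fix p p' assume "inv p0 \<circ> p = inv p0 \<circ> p'"
        then have "p0 \<circ> (inv p0 \<circ> p) = p0 \<circ> (inv p0 \<circ> p')" by simp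
        then show "p = p'" using permutes_inv_o(1)[OF p0(1)] by (simp add: o_assoc)
      qed
      show "(\<lambda>p. inv p0 \<circ> p) ` Q i \<subseteq> {p. p permutes (V - A)}"
      proof (rule image_subsetI, simp)
        fix p assume p: "p \<in> Q i"
        have comp: "inv p0 \<circ> p permutes V" using p p0 permutes_inv permutes_compose unfolding i Q_def by blast
        have "(inv p0 \<circ> p) v = v" if vA: "v \<in> A" for v
        proof -
          obtain \<tau> j where v: "\<tau> \<in> T" "j < s" "v = pos (r \<tau>, j)" using vA unfolding A_def by auto
          then have "p v = p0 v" using p p0 unfolding i Q_def by auto
          then show ?thesis using permutes_inverses(2)[OF p0(1)] by simp
        qed
        then show "inv p0 \<circ> p permutes V - A" using comp AV
          by (intro permutes_superset[OF comp]) auto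
      qed
      show "finite {p. p permutes V - A}" using finV by (intro finite_permutations) auto
    qed
    also have "\<dots> = fact (n0 * s - card T * s)"
      using finV AV cA card_V finite_subset[OF AV finV] by (intro card_permutations) (auto simp: card_Diff_subset)
    finally show ?thesis .
  qed simp
  have "card (arrs {} T) \<le> card (\<Union>i\<in>I. Q i)"
  proof (rule card_mono[OF _ cover])
    show "finite (\<Union>i\<in>I. Q i)"
      by (rule finite_subset[OF _ finite_permutations[OF finV]]) (auto simp: Q_def)
  qed
  also have "\<dots> \<le> (\<Sum>i\<in>I. card (Q i))" by (rule card_UN_le[OF finI])
  also have "\<dots> \<le> (\<Sum>i\<in>I. fact (n0 * s - card T * s))" by (intro sum_mono cQ)
  also have "\<dots> = card I * fact (n0 * s - card T * s)" by simp
  also have "card I \<le> (n0 * s ^ s) ^ card T"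
  proof -
    have "card I = n0 ^ card T * (\<Prod>\<tau>\<in>T. card (Ls \<tau>))"
      unfolding I_def using finT by (simp add: card_cartesian_product card_PiE)
    also have "(\<Prod>\<tau>\<in>T. card (Ls \<tau>)) \<le> (\<Prod>\<tau>\<in>T. s ^ s)" using Ls by (intro prod_mono) auto
    finally show ?thesis by (simp add: power_mult_distrib)
  qed
  finally show ?thesis by simp
qed

end

text \<open>
  From \<open>(n choose j) \<ge> (n/j)^j\<close> and \<open>j! \<ge> (j/e)^j\<close>.
\<close>

lemma fact_ratio:
  assumes "j \<le> n"
  shows "(real n / exp 1) ^ j * fact (n - j) \<le> fact n"
proof (cases "j = 0")
  case False
  have "(real n / exp 1) ^ j = (real n / real j) ^ j * (real j ^ j / exp (real j))"
    using False by (simp add: power_divide exp_of_nat_mult[of j 1, simplified, symmetric] field_simps flip: exp_of_nat_mult)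
  also have "\<dots> \<le> real (n choose j) * fact j"
  proof (rule mult_mono)
    show "(real n / real j) ^ j \<le> real (n choose j)" using binomial_ge_n_over_k_pow_k[OF assms] by blast
    have "real j ^ j / fact j \<le> exp (real j)"
    proof -
      have s: "(\<lambda>n. real j ^ n /\<^sub>R fact n) sums exp (real j)" by (rule exp_converges)
      have "(\<Sum>i\<in>{j}. real j ^ i /\<^sub>R fact i) \<le> exp (real j)"
        using sum_le_suminf[of "\<lambda>n. real j ^ n /\<^sub>R fact n" "{j}"] s by (auto simp: sums_iff)
      then show ?thesis by (simp add: field_simps)
    qed
    then show "real j ^ j / exp (real j) \<le> fact j" by (simp add: field_simps)
  qed auto
  finally have "(real n / exp 1) ^ j * fact (n - j) \<le> real (n choose j) * fact j * fact (n - j)"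
    by (intro mult_right_mono) auto
  also have "\<dots> = fact n" using binomial_fact_lemma[OF assms]
    by (metis (no_types, opaque_lifting) mult.commute mult.left_commute of_nat_fact of_nat_mult)
  finally show ?thesis .
qed simp

context arrangement
begin

text \<open>
  Small \<open>T\<close> are handled by switchings. If \<open>T\<close> occupies more than half of the rows, the exponential loss in
  \<open>arrs_lower\<close> is affordable, being at most \<open>exp (4 s)\<close> per member of \<open>T\<close>, and plain counting
  suffices.
\<close>

lemma spread:
  assumes F: "F \<subseteq> ksets V s" "\<And>v. v \<in> V \<Longrightarrow> card {\<sigma>\<in>F. v \<in> \<sigma>} \<le> c"
    and c: "2 * real s ^ s * real c \<le> (real n0 / 4) ^ (s - 1)" and n0: "4 * s \<le> n0"
    and half: "4 * real s ^ s \<le> (real n0 / 4) ^ (s - 1)"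
    and T: "T \<subseteq> ksets V s"
  shows "real (card (arrs F T)) \<le> (switch_const s / real n0 ^ (s - 1)) ^ card T * real (card (arrs F {}))"
proof -
  define L where "L = real n0 ^ (s - 1)"
  have L: "L > 0" using n0 s_pos by (simp add: L_def)
  have ss: "real s ^ s \<ge> 1" using s_pos by simp
  have eg: "exp (5 * real s) \<ge> 1" by simp
  consider "2 * card T \<le> n0" | "card T > n0" | "n0 < 2 * card T" "card T \<le> n0" by linarith
  then show ?thesis
  proof cases
    case 1
    have "real (card (arrs F T)) \<le> (2 * real s ^ s / (real n0 / 4) ^ (s - 1)) ^ card T * real (card (arrs F {}))"
      by (rule spread_small[OF F c n0 T 1])
    also have "\<dots> \<le> (switch_const s / L) ^ card T * real (card (arrs F {}))"
    proof (intro mult_right_mono power_mono)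
      have "2 * real s ^ s / (real n0 / 4) ^ (s - 1) = 2 * real s ^ s * 4 ^ (s - 1) * 1 / L"
        by (simp add: power_divide L_def)
      also have "\<dots> \<le> 2 * real s ^ s * 4 ^ (s - 1) * exp (5 * real s) / L"
        using L eg by (intro divide_right_mono mult_left_mono) auto
      finally show "2 * real s ^ s / (real n0 / 4) ^ (s - 1) \<le> 2 * real s ^ s * 4 ^ (s - 1) * exp (5 * real s) / L" .
    qed auto
    finally show ?thesis by (simp add: L_def)
  next
    case 2
    have "arrs F T = {}"
    proof (rule ccontr)
      assume "arrs F T \<noteq> {}"
      then obtain p where p: "p permutes V" "T \<subseteq> rows p" unfolding arrs_def by auto
      have "finite (rows p)" unfolding rows_def by simp
      then have "card T \<le> n0" using card_mono[OF _ p(2)] card_rows[OF p(1)] by simp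
      then show False using 2 by simp
    qed
    then show ?thesis by (simp add: field_simps)
  next
    case 3
    define t where "t = card T"
    have tn: "t * s \<le> n0 * s" using 3 by (simp add: t_def)
    have "real (card (arrs F T)) \<le> real (card (arrs {} T))"
      using card_mono[OF finite_arrs arrs_mono[of "{}" F T T]] by simp
    also have "\<dots> \<le> real ((n0 * s ^ s) ^ t * fact (n0 * s - t * s))"
      using card_arrs_le[OF T] unfolding t_def by (metis of_nat_le_iff)
    also have "\<dots> = (real n0 * real s ^ s) ^ t * fact (n0 * s - t * s)" by simp
    also have "\<dots> \<le> (real n0 * real s ^ s) ^ t * (fact (n0 * s) / (real (n0 * s) / exp 1) ^ (t * s))"
    proof (rule mult_left_mono)
      have "(real (n0 * s) / exp 1) ^ (t * s) > 0" using n0 s_pos by simp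
      then show "fact (n0 * s - t * s) \<le> fact (n0 * s) / (real (n0 * s) / exp 1) ^ (t * s)"
        using fact_ratio[OF tn] by (simp add: field_simps)
    qed auto
    also have "\<dots> \<le> (real n0 * real s ^ s) ^ t * ((exp (2 * real (n0 * s)) * real (card (arrs F {}))) / (real (n0 * s) / exp 1) ^ (t * s))"
    proof (intro mult_left_mono divide_right_mono)
      show "fact (n0 * s) \<le> exp (2 * real (n0 * s)) * real (card (arrs F {}))"
        using arrs_lower[OF F c n0 half] by (simp add: exp_minus field_simps)
    qed auto
    also have "\<dots> \<le> (real n0 * real s ^ s) ^ t * ((exp (4 * real s) ^ t * real (card (arrs F {}))) / (real (n0 * s) / exp 1) ^ (t * s))"
    proof (intro mult_left_mono divide_right_mono mult_right_mono)
      have "real n0 \<le> 2 * real t" using 3 by (simp add: t_def)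
      then have "2 * real (n0 * s) \<le> real t * (4 * real s)"
        using mult_right_mono[of "real n0" "2 * real t" "2 * real s"] by (simp add: mult_ac)
      then show "exp (2 * real (n0 * s)) \<le> exp (4 * real s) ^ t" by (simp add: exp_of_nat_mult[symmetric])
    qed auto
    also have "\<dots> = (exp (5 * real s) / L) ^ t * real (card (arrs F {}))"
    proof -
      have e: "exp (5 * real s) = exp (4 * real s) * exp 1 ^ s"
        by (simp add: exp_of_nat_mult[symmetric] exp_add[symmetric])
      have n: "real n0 ^ s = real n0 * L" unfolding L_def using s_pos by (simp add: power_eq_if)
      have b: "(real (n0 * s) / exp 1) ^ (t * s) = ((real n0 * L * real s ^ s) / exp 1 ^ s) ^ t"
        unfolding n[symmetric] by (simp add: power_divide power_mult_distrib mult.commute[of t s] power_mult)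
      have nz: "real n0 > 0" "real s > 0" using n0 s_pos by auto
      have "(real n0 * real s ^ s) ^ t * exp (4 * real s) ^ t / ((real n0 * L * real s ^ s) / exp 1 ^ s) ^ t
         = ((real n0 * real s ^ s) * exp (4 * real s) / ((real n0 * L * real s ^ s) / exp 1 ^ s)) ^ t"
        by (simp add: power_mult_distrib power_divide)
      also have "(real n0 * real s ^ s) * exp (4 * real s) / ((real n0 * L * real s ^ s) / exp 1 ^ s) = exp (5 * real s) / L"
        unfolding e using nz L by (simp add: field_simps)
      finally have q: "(real n0 * real s ^ s) ^ t * exp (4 * real s) ^ t / ((real n0 * L * real s ^ s) / exp 1 ^ s) ^ t
         = (exp (5 * real s) / L) ^ t" .
      show ?thesis unfolding b q[symmetric] by simp
    qed
    also have "\<dots> \<le> (switch_const s / L) ^ t * real (card (arrs F {}))"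
    proof (intro mult_right_mono power_mono divide_right_mono)
      have "1 \<le> 2 * real s ^ s" using ss by linarith
      moreover have "(1::real) \<le> 4 ^ (s - 1)" by simp
      ultimately have "1 * 1 \<le> 2 * real s ^ s * 4 ^ (s - 1)" by (intro mult_mono) auto
      then show "exp (5 * real s) \<le> 2 * real s ^ s * 4 ^ (s - 1) * exp (5 * real s)"
        using mult_right_mono[of 1 "2 * real s ^ s * 4 ^ (s - 1)" "exp (5 * real s)"] by simp
    qed (use L in auto)
    finally show ?thesis by (simp add: L_def t_def)
  qed
qed

lemma arrs_pos:
  assumes F: "F \<subseteq> ksets V s" "\<And>v. v \<in> V \<Longrightarrow> card {\<sigma>\<in>F. v \<in> \<sigma>} \<le> c"
    and c: "2 * real s ^ s * real c \<le> (real n0 / 4) ^ (s - 1)" and n0: "4 * s \<le> n0"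
    and half: "4 * real s ^ s \<le> (real n0 / 4) ^ (s - 1)"
  shows "card (arrs F {}) > 0"
proof -
  have "0 < exp (- 2 * real (n0 * s)) * fact (n0 * s)" by simp
  also have "\<dots> \<le> real (card (arrs F {}))" by (rule arrs_lower[OF F c n0 half])
  finally show ?thesis by simp
qed

end

section \<open>Spread measures on plantable families\<close>

text \<open>
  By Markov's inequality, few \<open>s\<close>-sets at \<open>v\<close> are expensive to plant on their own if this sum is small.
\<close>

abbreviation vertex_cost :: "'a set \<Rightarrow> nat \<Rightarrow> real \<Rightarrow> 'a \<Rightarrow> 'a set set \<Rightarrow> real" where
  "vertex_cost W s q v X \<equiv> \<Sum>\<tau>\<in>{\<tau>\<in>ksets W s. v \<in> \<tau>}. overlap_cost W s q \<tau> (X \<union> pairs \<tau>)"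

definition companions :: "'a set \<Rightarrow> nat \<Rightarrow> 'a set \<Rightarrow> 'a set set set" where
  "companions W s \<sigma> = {T. T \<subseteq> ksets W s \<and> disjoint T \<and> 2 \<le> card T \<and> (\<forall>\<tau>\<in>T. 2 \<le> card (\<sigma> \<inter> \<tau>))}"

text \<open>
  If \<open>\<sigma>\<close> meets several planted blocks, their edges help it jointly to become a clique, an effect that the costs
  of single blocks do not see. With each block present with probability \<open>p\<close>, this bounds the expected number of cliques
  created in this way.
\<close>

definition joint_cost :: "'a set \<Rightarrow> nat \<Rightarrow> real \<Rightarrow> real \<Rightarrow> 'a set set \<Rightarrow> real" where
  "joint_cost W s q p X = (\<Sum>\<sigma>\<in>ksets W s. \<Sum>T\<in>companions W s \<sigma>. p ^ card T * q ^ card (pairs \<sigma> - (X \<union> edges_of T)))"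

lemma finite_companions: "finite W \<Longrightarrow> finite (companions W s \<sigma>)"
  by (rule finite_subset[of _ "Pow (ksets W s)"]) (auto simp: companions_def)

lemma card_disjoint_meeting:
  assumes "finite \<sigma>" "disjoint S" "finite S"
  shows "card {\<tau>\<in>S. 2 \<le> card (\<sigma> \<inter> \<tau>)} \<le> card \<sigma>"
proof (rule card_inj_on_le[of "\<lambda>\<tau>. SOME x. x \<in> \<sigma> \<inter> \<tau>"])
  have ne: "(SOME x. x \<in> \<sigma> \<inter> \<tau>) \<in> \<sigma> \<inter> \<tau>" if "2 \<le> card (\<sigma> \<inter> \<tau>)" for \<tau>
  proof (rule someI_ex)
    have "\<sigma> \<inter> \<tau> \<noteq> {}" using that by auto
    then show "\<exists>x. x \<in> \<sigma> \<inter> \<tau>" by auto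
  qed
  show "inj_on (\<lambda>\<tau>. SOME x. x \<in> \<sigma> \<inter> \<tau>) {\<tau>\<in>S. 2 \<le> card (\<sigma> \<inter> \<tau>)}"
  proof (rule inj_onI, rule ccontr)
    fix a b assume ab: "a \<in> {\<tau>\<in>S. 2 \<le> card (\<sigma> \<inter> \<tau>)}" "b \<in> {\<tau>\<in>S. 2 \<le> card (\<sigma> \<inter> \<tau>)}"
      "(SOME x. x \<in> \<sigma> \<inter> a) = (SOME x. x \<in> \<sigma> \<inter> b)" "a \<noteq> b"
    then have "a \<inter> b = {}" using assms(2) by (auto simp: disjoint_def)
    then show False using ne[of a] ne[of b] ab by auto
  qed
  show "(\<lambda>\<tau>. SOME x. x \<in> \<sigma> \<inter> \<tau>) ` {\<tau>\<in>S. 2 \<le> card (\<sigma> \<inter> \<tau>)} \<subseteq> \<sigma>" using ne by auto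
qed (use assms in auto)

text \<open>
  If \<open>\<tau>\<close> is the only block of \<open>S\<close> that shares an edge with \<open>\<sigma>\<close>, then only the
  edges of \<open>\<tau>\<close> help \<open>\<sigma>\<close>.
\<close>

lemma overlap_cost_split:
  assumes W: "finite W" and q: "0 \<le> q" "q \<le> 1" and S: "S \<subseteq> ksets W s" "disjoint S" "\<tau> \<in> S"
  shows "overlap_cost W s q \<tau> (X \<union> edges_of S) \<le> overlap_cost W s q \<tau> (X \<union> pairs \<tau>) +
    (\<Sum>\<sigma>\<in>{\<sigma>\<in>ksets W s. 2 \<le> card (\<sigma> \<inter> \<tau>) \<and> 2 \<le> card {\<rho>\<in>S. 2 \<le> card (\<sigma> \<inter> \<rho>)}}. q ^ card (pairs \<sigma> - (X \<union> edges_of S)))"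
proof -
  let ?I = "{\<sigma>\<in>ksets W s. \<sigma> \<noteq> \<tau> \<and> 2 \<le> card (\<sigma> \<inter> \<tau>)}"
  let ?M = "{\<sigma>\<in>ksets W s. 2 \<le> card (\<sigma> \<inter> \<tau>) \<and> 2 \<le> card {\<rho>\<in>S. 2 \<le> card (\<sigma> \<inter> \<rho>)}}"
  have finS: "finite S" using S W finite_subset finite_ksets by blast
  have le_term: "q ^ card (pairs \<sigma> - (X \<union> edges_of S)) \<le> q ^ card (pairs \<sigma> - (X \<union> pairs \<tau>))"
    if "\<sigma> \<in> ?I" "\<sigma> \<notin> ?M" for \<sigma>
  proof -
    have fin\<sigma>: "finite \<sigma>" using that W finite_subset unfolding ksets_def by auto
    have "pairs \<sigma> \<inter> edges_of S \<subseteq> pairs \<tau>"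
    proof
      fix e assume e: "e \<in> pairs \<sigma> \<inter> edges_of S"
      then obtain \<rho> where \<rho>: "\<rho> \<in> S" "e \<in> pairs \<rho>" unfolding edges_of_def by auto
      have "2 \<le> card (\<sigma> \<inter> \<rho>)" using card_inter_ge_2[OF fin\<sigma>] e \<rho> by auto
      have "\<rho> = \<tau>"
      proof (rule ccontr)
        assume "\<rho> \<noteq> \<tau>"
        then have "card {\<rho>, \<tau>} \<le> card {\<rho>\<in>S. 2 \<le> card (\<sigma> \<inter> \<rho>)}"
          using \<rho> S that \<open>2 \<le> card (\<sigma> \<inter> \<rho>)\<close> finS by (intro card_mono) auto
        then show False using that \<open>\<rho> \<noteq> \<tau>\<close> by auto
      qed
      then show "e \<in> pairs \<tau>" using \<rho> by simp
    qed
    then have "pairs \<sigma> - (X \<union> pairs \<tau>) \<subseteq> pairs \<sigma> - (X \<union> edges_of S)" by auto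
    then show ?thesis using q fin\<sigma> by (intro power_decreasing card_mono) auto
  qed
  have "overlap_cost W s q \<tau> (X \<union> edges_of S) = (\<Sum>\<sigma>\<in>?I. q ^ card (pairs \<sigma> - (X \<union> edges_of S)))"
    unfolding overlap_cost_def ..
  also have "\<dots> \<le> (\<Sum>\<sigma>\<in>(?I - ?M) \<union> ?M. q ^ card (pairs \<sigma> - (X \<union> edges_of S)))"
    using W q by (intro sum_mono2) auto
  also have "\<dots> = (\<Sum>\<sigma>\<in>?I - ?M. q ^ card (pairs \<sigma> - (X \<union> edges_of S))) + (\<Sum>\<sigma>\<in>?M. q ^ card (pairs \<sigma> - (X \<union> edges_of S)))"
    using W by (intro sum.union_disjoint) auto
  also have "(\<Sum>\<sigma>\<in>?I - ?M. q ^ card (pairs \<sigma> - (X \<union> edges_of S))) \<le> (\<Sum>\<sigma>\<in>?I - ?M. q ^ card (pairs \<sigma> - (X \<union> pairs \<tau>)))"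
    by (intro sum_mono le_term) auto
  also have "\<dots> \<le> overlap_cost W s q \<tau> (X \<union> pairs \<tau>)"
    unfolding overlap_cost_def using W q by (intro sum_mono2) auto
  finally show ?thesis by simp
qed

text \<open>
  The blocks of an arrangement that share an edge with \<open>\<sigma>\<close> form a family of companions, and spreadness bounds
  how often this family occurs.
\<close>

lemma (in arrangement) average_joint_cost:
  assumes W: "finite W" "V \<subseteq> W" and q: "0 \<le> q" "q \<le> 1" and p0: "p0 \<ge> 0"
    and spread: "\<And>T. T \<subseteq> ksets V s \<Longrightarrow> real (card (arrs F T)) \<le> p0 ^ card T * real (card (arrs F {}))"
  shows "(\<Sum>p\<in>arrs F {}. \<Sum>\<sigma>\<in>{\<sigma>\<in>ksets W s. 2 \<le> card {\<rho>\<in>rows p. 2 \<le> card (\<sigma> \<inter> \<rho>)}}. q ^ card (pairs \<sigma> - (X \<union> edges_of (rows p))))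
    \<le> real (card (arrs F {})) * joint_cost W s q p0 X"
proof -
  have single: "(\<Sum>\<sigma>\<in>{\<sigma>\<in>ksets W s. 2 \<le> card {\<rho>\<in>rows p. 2 \<le> card (\<sigma> \<inter> \<rho>)}}. q ^ card (pairs \<sigma> - (X \<union> edges_of (rows p))))
    \<le> (\<Sum>\<sigma>\<in>ksets W s. \<Sum>T\<in>companions W s \<sigma>. of_bool (p \<in> arrs F T) * q ^ card (pairs \<sigma> - (X \<union> edges_of T)))"
    if p: "p \<in> arrs F {}" for p
  proof -
    have pV: "p permutes V" using p unfolding arrs_def by auto
    have rk: "rows p \<subseteq> ksets W s" using rows_ksets[OF pV] ksets_mono[OF W(2)] by blast
    have "q ^ card (pairs \<sigma> - (X \<union> edges_of (rows p))) \<le> (\<Sum>T\<in>companions W s \<sigma>. of_bool (p \<in> arrs F T) * q ^ card (pairs \<sigma> - (X \<union> edges_of T)))"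
      if \<sigma>: "\<sigma> \<in> ksets W s" "2 \<le> card {\<rho>\<in>rows p. 2 \<le> card (\<sigma> \<inter> \<rho>)}" for \<sigma>
    proof -
      define T where "T = {\<rho>\<in>rows p. 2 \<le> card (\<sigma> \<inter> \<rho>)}"
      have T: "T \<in> companions W s \<sigma>"
        using \<sigma> rk disjoint_rows[OF pV] unfolding companions_def T_def by (auto intro: pairwise_subset)
      have "p \<in> arrs F T" using p unfolding arrs_def T_def by auto
      have fin\<sigma>: "finite \<sigma>" using \<sigma> W finite_subset unfolding ksets_def by auto
      have "pairs \<sigma> \<inter> edges_of (rows p) \<subseteq> edges_of T"
        using card_inter_ge_2[OF fin\<sigma>] unfolding edges_of_def T_def by blast
      then have eq: "pairs \<sigma> - (X \<union> edges_of (rows p)) = pairs \<sigma> - (X \<union> edges_of T)"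
        unfolding T_def edges_of_def by auto
      have "of_bool (p \<in> arrs F T) * q ^ card (pairs \<sigma> - (X \<union> edges_of T)) \<le> (\<Sum>T\<in>companions W s \<sigma>. of_bool (p \<in> arrs F T) * q ^ card (pairs \<sigma> - (X \<union> edges_of T)))"
        using T finite_companions[OF W(1)] q
        by (intro member_le_sum[where f = "\<lambda>T. of_bool (p \<in> arrs F T) * q ^ card (pairs \<sigma> - (X \<union> edges_of T))"]) auto
      then show ?thesis using \<open>p \<in> arrs F T\<close> eq by simp
    qed
    then have "(\<Sum>\<sigma>\<in>{\<sigma>\<in>ksets W s. 2 \<le> card {\<rho>\<in>rows p. 2 \<le> card (\<sigma> \<inter> \<rho>)}}. q ^ card (pairs \<sigma> - (X \<union> edges_of (rows p))))
      \<le> (\<Sum>\<sigma>\<in>{\<sigma>\<in>ksets W s. 2 \<le> card {\<rho>\<in>rows p. 2 \<le> card (\<sigma> \<inter> \<rho>)}}. \<Sum>T\<in>companions W s \<sigma>. of_bool (p \<in> arrs F T) * q ^ card (pairs \<sigma> - (X \<union> edges_of T)))"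
      by (intro sum_mono) auto
    also have "\<dots> \<le> (\<Sum>\<sigma>\<in>ksets W s. \<Sum>T\<in>companions W s \<sigma>. of_bool (p \<in> arrs F T) * q ^ card (pairs \<sigma> - (X \<union> edges_of T)))"
      using W q by (intro sum_mono2) (auto intro!: sum_nonneg)
    finally show ?thesis .
  qed
  have "(\<Sum>p\<in>arrs F {}. \<Sum>\<sigma>\<in>{\<sigma>\<in>ksets W s. 2 \<le> card {\<rho>\<in>rows p. 2 \<le> card (\<sigma> \<inter> \<rho>)}}. q ^ card (pairs \<sigma> - (X \<union> edges_of (rows p))))
    \<le> (\<Sum>p\<in>arrs F {}. \<Sum>\<sigma>\<in>ksets W s. \<Sum>T\<in>companions W s \<sigma>. of_bool (p \<in> arrs F T) * q ^ card (pairs \<sigma> - (X \<union> edges_of T)))"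
    by (intro sum_mono single)
  also have "\<dots> = (\<Sum>\<sigma>\<in>ksets W s. \<Sum>p\<in>arrs F {}. \<Sum>T\<in>companions W s \<sigma>. of_bool (p \<in> arrs F T) * q ^ card (pairs \<sigma> - (X \<union> edges_of T)))"
    by (rule sum.swap)
  also have "\<dots> = (\<Sum>\<sigma>\<in>ksets W s. \<Sum>T\<in>companions W s \<sigma>. \<Sum>p\<in>arrs F {}. of_bool (p \<in> arrs F T) * q ^ card (pairs \<sigma> - (X \<union> edges_of T)))"
    by (intro sum.cong refl sum.swap)
  also have "\<dots> = (\<Sum>\<sigma>\<in>ksets W s. \<Sum>T\<in>companions W s \<sigma>. real (card (arrs F T)) * q ^ card (pairs \<sigma> - (X \<union> edges_of T)))"
  proof (intro sum.cong refl)
    fix \<sigma> T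
    have "(\<Sum>p\<in>arrs F {}. of_bool (p \<in> arrs F T) * q ^ card (pairs \<sigma> - (X \<union> edges_of T))) =
      (\<Sum>p\<in>arrs F T. q ^ card (pairs \<sigma> - (X \<union> edges_of T)))"
      using arrs_mono[of F F "{}" T] finite_arrs by (intro sum.mono_neutral_cong_right) auto
    then show "(\<Sum>p\<in>arrs F {}. of_bool (p \<in> arrs F T) * q ^ card (pairs \<sigma> - (X \<union> edges_of T))) = real (card (arrs F T)) * q ^ card (pairs \<sigma> - (X \<union> edges_of T))"
      by simp
  qed
  also have "\<dots> \<le> (\<Sum>\<sigma>\<in>ksets W s. \<Sum>T\<in>companions W s \<sigma>. (p0 ^ card T * real (card (arrs F {}))) * q ^ card (pairs \<sigma> - (X \<union> edges_of T)))"
  proof (intro sum_mono mult_right_mono)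
    fix T
    show "real (card (arrs F T)) \<le> p0 ^ card T * real (card (arrs F {}))"
    proof (cases "arrs F T = {}")
      case False
      then obtain p where "p permutes V" "T \<subseteq> rows p" unfolding arrs_def by auto
      then show ?thesis using spread rows_ksets by blast
    qed (use p0 in auto)
  qed (use q in auto)
  also have "\<dots> = real (card (arrs F {})) * joint_cost W s q p0 X"
    unfolding joint_cost_def by (simp add: sum_distrib_left mult_ac)
  finally show ?thesis .
qed

text \<open>
  Take a random arrangement that avoids the sets of cost above \<open>1/4\<close>. By lemma \<open>average_joint_cost\<close> and
  Markov's inequality at least half of the arrangements have joint cost at most \<open>2 u1\<close>. In these, drop the blocks to
  which the joint cost contributes more than \<open>1/4\<close>; there are at most \<open>8 s u1\<close> of them, as
  \<open>\<sigma>\<close> shares edges with at most \<open>s\<close> disjoint blocks. The measure \<open>w\<close> is the law of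
  what remains, and passing to half of the arrangements only doubles the spread.
\<close>

lemma spread_plantable_matchings:
  fixes W :: "'a set"
  assumes W: "finite W" and q: "0 \<le> q" "q \<le> 1" and s: "1 \<le> s"
    and X: "X \<subseteq> pairs W"
    and t1: "\<And>v. v \<in> W \<Longrightarrow> vertex_cost W s q v X \<le> E"
    and n0: "n0 = card W div s" "4 * s \<le> n0"
    and E: "8 * real s ^ s * E \<le> (real n0 / 4) ^ (s - 1)" "4 * real s ^ s \<le> (real n0 / 4) ^ (s - 1)"
    and p0: "switch_const s / real n0 ^ (s - 1) \<le> p0"
    and t2: "joint_cost W s q p0 X \<le> u1" "u1 > 0"
    and u: "real s + 8 * real s ^ 2 * u1 \<le> u"
  defines "H \<equiv> {S. S \<subseteq> ksets W s \<and> disjoint S \<and> real (card W) \<le> real (s * card S) + u}"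
  shows "\<exists>w. (\<forall>S. w S \<ge> 0) \<and> (\<Sum>S\<in>H. w S) = 1 \<and>
    (\<forall>S\<in>H. w S > 0 \<longrightarrow> plantable W s q S (edges_of (cliques W s X))) \<and>
    (\<forall>T\<subseteq>ksets W s. (\<Sum>S\<in>{S\<in>H. T \<subseteq> S}. w S) \<le> (2 * p0) ^ card T)"
proof -
  have "n0 * s \<le> card W" unfolding n0(1) by simp
  then obtain V where V: "V \<subseteq> W" "card V = n0 * s" using obtain_subset_with_card_n by metis
  have finV: "finite V" using V W finite_subset by blast
  have "card ({..<n0} \<times> {..<s}) = card V" using V by simp
  then obtain pos where pos: "bij_betw pos ({..<n0} \<times> {..<s}) V"
    using finite_same_card_bij[of "{..<n0} \<times> {..<s}" V] finV by auto
  interpret arrangement V s n0 pos using pos s by unfold_locales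
  define F where "F = {\<tau>\<in>ksets V s. overlap_cost W s q \<tau> (X \<union> pairs \<tau>) > 1/4}"
  define c where "c = nat \<lfloor>4 * E\<rfloor>"
  have oc0: "0 \<le> overlap_cost W s q \<tau> Z" for \<tau> Z unfolding overlap_cost_def using q by (intro sum_nonneg) auto
  have E0: "0 \<le> E"
  proof -
    have "W \<noteq> {}" using n0 s by auto
    then obtain v where "v \<in> W" by auto
    have "0 \<le> vertex_cost W s q v X" by (intro sum_nonneg oc0)
    then show ?thesis using t1[OF \<open>v \<in> W\<close>] by linarith
  qed
  have FV: "F \<subseteq> ksets V s" unfolding F_def by auto
  have Fc: "card {\<sigma>\<in>F. v \<in> \<sigma>} \<le> c" if v: "v \<in> V" for v
  proof -
    have "real (card {\<sigma>\<in>F. v \<in> \<sigma>}) * (1/4) = (\<Sum>\<sigma>\<in>{\<sigma>\<in>F. v \<in> \<sigma>}. 1/4)" by simp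
    also have "\<dots> \<le> (\<Sum>\<sigma>\<in>{\<sigma>\<in>F. v \<in> \<sigma>}. overlap_cost W s q \<sigma> (X \<union> pairs \<sigma>))"
      by (intro sum_mono) (auto simp: F_def)
    also have "\<dots> \<le> vertex_cost W s q v X"
      using W FV ksets_mono[OF V(1), of s] oc0 by (intro sum_mono2) auto
    also have "\<dots> \<le> E" using t1 v V by auto
    finally have "real (card {\<sigma>\<in>F. v \<in> \<sigma>}) \<le> 4 * E" by simp
    then show ?thesis unfolding c_def using E0 by linarith
  qed
  have cE: "2 * real s ^ s * real c \<le> (real n0 / 4) ^ (s - 1)"
  proof -
    have "real c \<le> 4 * E" unfolding c_def using E0 by simp
    then have "2 * real s ^ s * real c \<le> 2 * real s ^ s * (4 * E)" by (intro mult_left_mono) auto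
    moreover have "2 * real s ^ s * (4 * E) = 8 * real s ^ s * E" by simp
    ultimately show ?thesis using E(1) by linarith
  qed
  define p1 where "p1 = switch_const s / real n0 ^ (s - 1)"
  have p1: "0 \<le> p1" unfolding p1_def by simp
  have p00: "0 \<le> p0" "p1 \<le> p0" using p0 p1 unfolding p1_def by linarith+
  have spr: "real (card (arrs F T)) \<le> p0 ^ card T * real (card (arrs F {}))" if "T \<subseteq> ksets V s" for T
  proof -
    have "real (card (arrs F T)) \<le> p1 ^ card T * real (card (arrs F {}))"
      unfolding p1_def by (rule spread[OF FV Fc cE n0(2) E(2) that])
    also have "\<dots> \<le> p0 ^ card T * real (card (arrs F {}))"
      using p00 p1 by (intro mult_right_mono power_mono) auto
    finally show ?thesis .
  qed
  define A where "A = arrs F {}"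
  have Apos: "card A > 0" unfolding A_def by (rule arrs_pos[OF FV Fc cE n0(2) E(2)])
  have finA: "finite A" unfolding A_def by (rule finite_arrs)
  define Ms where "Ms = (\<lambda>p. {\<sigma>\<in>ksets W s. 2 \<le> card {\<rho>\<in>rows p. 2 \<le> card (\<sigma> \<inter> \<rho>)}})"
  define M where "M = (\<lambda>p. \<Sum>\<sigma>\<in>Ms p. q ^ card (pairs \<sigma> - (X \<union> edges_of (rows p))))"
  define mul where "mul = (\<lambda>p \<tau>. \<Sum>\<sigma>\<in>{\<sigma>\<in>ksets W s. 2 \<le> card (\<sigma> \<inter> \<tau>) \<and> 2 \<le> card {\<rho>\<in>rows p. 2 \<le> card (\<sigma> \<inter> \<rho>)}}. q ^ card (pairs \<sigma> - (X \<union> edges_of (rows p))))"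
  define So where "So = (\<lambda>p. {\<tau>\<in>rows p. mul p \<tau> \<le> 1/4})"
  define G where "G = {p\<in>A. M p \<le> 2 * u1}"
  have M0: "0 \<le> M p" for p unfolding M_def using q by (intro sum_nonneg) auto
  have mul0: "0 \<le> mul p \<tau>" for p \<tau> unfolding mul_def using q by (intro sum_nonneg) auto
  have avg: "(\<Sum>p\<in>A. M p) \<le> real (card A) * u1"
  proof -
    have "(\<Sum>p\<in>A. M p) \<le> real (card A) * joint_cost W s q p0 X"
      unfolding A_def M_def Ms_def by (rule average_joint_cost[OF W V(1) q p00(1) spr])
    also have "\<dots> \<le> real (card A) * u1" using t2 by (intro mult_left_mono) auto
    finally show ?thesis .
  qed
  have Ghalf: "real (card A) \<le> 2 * real (card G)"
  proof -
    have "real (card (A - G)) * (2 * u1) = (\<Sum>p\<in>A - G. 2 * u1)" by simp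
    also have "\<dots> \<le> (\<Sum>p\<in>A - G. M p)" by (intro sum_mono) (auto simp: G_def)
    also have "\<dots> \<le> (\<Sum>p\<in>A. M p)" using finA M0 by (intro sum_mono2) auto
    finally have "real (card (A - G)) * 2 * u1 \<le> real (card A) * u1" using avg by simp
    then have "real (card (A - G)) * 2 \<le> real (card A)" using t2 by simp
    moreover have "card A = card G + card (A - G)"
      using finA by (metis (no_types, lifting) G_def add.commute card_Diff_subset card_mono finite_subset le_add_diff_inverse2 mem_Collect_eq subsetI)
    ultimately show ?thesis by simp
  qed
  have Gpos: "card G > 0" using Ghalf Apos by simp
  have finG: "finite G" using finA by (simp add: G_def)
  have SoH: "So p \<in> H" "plantable W s q (So p) (edges_of (cliques W s X))" if p: "p \<in> G" for p
  proof -
    have pA: "p \<in> A" "M p \<le> 2 * u1" using p by (auto simp: G_def)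
    then have pV: "p permutes V" "rows p \<inter> F = {}" unfolding A_def arrs_def by auto
    have rk: "rows p \<subseteq> ksets W s" "rows p \<subseteq> ksets V s" using rows_ksets[OF pV(1)] ksets_mono[OF V(1), of s] by auto
    have disj: "disjoint (rows p)" by (rule disjoint_rows[OF pV(1)])
    have fr: "finite (rows p)" unfolding rows_def by simp
    have So: "So p \<subseteq> rows p" unfolding So_def by auto
    have fins: "finite \<sigma>" if "\<sigma> \<in> ksets W s" for \<sigma> using that W finite_subset unfolding ksets_def by auto
    have cost: "overlap_cost W s q \<tau> (X \<union> edges_of (rows p)) \<le> 1/2" if "\<tau> \<in> So p" for \<tau>
    proof -
      have "\<tau> \<in> rows p" "mul p \<tau> \<le> 1/4" using that unfolding So_def by auto
      moreover have "overlap_cost W s q \<tau> (X \<union> pairs \<tau>) \<le> 1/4"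
        using \<open>\<tau> \<in> rows p\<close> pV(2) rk unfolding F_def by force
      ultimately show ?thesis using overlap_cost_split[OF W q rk(1) disj, of \<tau> X] unfolding mul_def by linarith
    qed
    have "plantable W s q (So p) X"
      unfolding plantable_def
    proof (intro conjI ballI)
      show "disjoint (So p)" using disj So pairwise_subset by blast
      fix \<tau> assume t: "\<tau> \<in> So p"
      have "overlap_cost W s q \<tau> (X \<union> edges_of (So p)) \<le> overlap_cost W s q \<tau> (X \<union> edges_of (rows p))"
        using W q edges_of_mono[OF So] by (intro overlap_cost_mono) auto
      then show "overlap_cost W s q \<tau> (X \<union> edges_of (So p)) \<le> 1/2" using cost[OF t] by linarith
    qed
    then show "plantable W s q (So p) (edges_of (cliques W s X))"
      by (rule plantable_antimono[OF W q subset_refl edges_of_cliques])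
    have "real (card (rows p - So p)) * (1/4) = (\<Sum>\<tau>\<in>rows p - So p. 1/4)" by simp
    also have "\<dots> \<le> (\<Sum>\<tau>\<in>rows p - So p. mul p \<tau>)" by (intro sum_mono) (auto simp: So_def)
    also have "\<dots> \<le> (\<Sum>\<tau>\<in>rows p. mul p \<tau>)" using fr mul0 by (intro sum_mono2) auto
    also have "\<dots> = (\<Sum>\<tau>\<in>rows p. \<Sum>\<sigma>\<in>Ms p. of_bool (2 \<le> card (\<sigma> \<inter> \<tau>)) * q ^ card (pairs \<sigma> - (X \<union> edges_of (rows p))))"
      unfolding mul_def Ms_def using W by (intro sum.cong refl sum.mono_neutral_cong_left) auto
    also have "\<dots> = (\<Sum>\<sigma>\<in>Ms p. \<Sum>\<tau>\<in>rows p. of_bool (2 \<le> card (\<sigma> \<inter> \<tau>)) * q ^ card (pairs \<sigma> - (X \<union> edges_of (rows p))))"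
      by (rule sum.swap)
    also have "\<dots> = (\<Sum>\<sigma>\<in>Ms p. real (card {\<tau>\<in>rows p. 2 \<le> card (\<sigma> \<inter> \<tau>)}) * q ^ card (pairs \<sigma> - (X \<union> edges_of (rows p))))"
    proof (intro sum.cong refl)
      fix \<sigma>
      have "(\<Sum>\<tau>\<in>rows p. of_bool (2 \<le> card (\<sigma> \<inter> \<tau>)) * q ^ card (pairs \<sigma> - (X \<union> edges_of (rows p)))) =
        (\<Sum>\<tau>\<in>{\<tau>\<in>rows p. 2 \<le> card (\<sigma> \<inter> \<tau>)}. q ^ card (pairs \<sigma> - (X \<union> edges_of (rows p))))"
        using fr by (intro sum.mono_neutral_cong_right) auto
      then show "(\<Sum>\<tau>\<in>rows p. of_bool (2 \<le> card (\<sigma> \<inter> \<tau>)) * q ^ card (pairs \<sigma> - (X \<union> edges_of (rows p)))) =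
        real (card {\<tau>\<in>rows p. 2 \<le> card (\<sigma> \<inter> \<tau>)}) * q ^ card (pairs \<sigma> - (X \<union> edges_of (rows p)))" by simp
    qed
    also have "\<dots> \<le> (\<Sum>\<sigma>\<in>Ms p. real s * q ^ card (pairs \<sigma> - (X \<union> edges_of (rows p))))"
    proof (intro sum_mono mult_right_mono)
      fix \<sigma> assume "\<sigma> \<in> Ms p"
      then have "\<sigma> \<in> ksets W s" unfolding Ms_def by auto
      then have "finite \<sigma>" "card \<sigma> = s" using fins[of \<sigma>] by (auto simp: ksets_def)
      then show "real (card {\<tau>\<in>rows p. 2 \<le> card (\<sigma> \<inter> \<tau>)}) \<le> real s"
        using card_disjoint_meeting[OF _ disj fr, of \<sigma>] by simp
    qed (use q in auto)
    also have "\<dots> = real s * M p" unfolding M_def by (simp add: sum_distrib_left)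
    also have "\<dots> \<le> real s * (2 * u1)" using pA by (intro mult_left_mono) auto
    finally have drop: "real (card (rows p - So p)) \<le> 8 * real s * u1" by simp
    have "card (rows p) = card (So p) + card (rows p - So p)"
      using fr So by (metis card_Diff_subset card_mono finite_subset le_add_diff_inverse)
    then have cs: "real n0 \<le> real (card (So p)) + 8 * real s * u1"
      using drop card_rows[OF pV(1)] by linarith
    have "card W \<le> n0 * s + s"
      using s mod_less_divisor[of s "card W"] div_mult_mod_eq[of "card W" s] unfolding n0(1) by linarith
    then have "real (card W) \<le> real n0 * real s + real s" by (metis of_nat_add of_nat_le_iff of_nat_mult)
    also have "\<dots> \<le> (real (card (So p)) + 8 * real s * u1) * real s + real s"
      using cs by (intro add_mono mult_right_mono) auto
    also have "\<dots> = real (s * card (So p)) + (real s + 8 * real s ^ 2 * u1)"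
      by (simp add: algebra_simps power2_eq_square)
    also have "\<dots> \<le> real (s * card (So p)) + u" using u by simp
    finally have "real (card W) \<le> real (s * card (So p)) + u" .
    moreover have "disjoint (So p)" using disj So pairwise_subset by blast
    ultimately show "So p \<in> H" unfolding H_def using So rk by auto
  qed
  have finH: "finite H" unfolding H_def by (rule finite_subset[of _ "Pow (ksets W s)"]) (use W in auto)
  define w where "w = (\<lambda>S. real (card {p\<in>G. So p = S}) / real (card G))"
  have wsum: "(\<Sum>S\<in>H'. w S) = real (card {p\<in>G. So p \<in> H'}) / real (card G)" if "finite H'" for H'
  proof -
    have "(\<Sum>S\<in>H'. real (card {p\<in>G. So p = S})) = real (card (\<Union>S\<in>H'. {p\<in>G. So p = S}))"
      using that finG by (subst card_UN_disjoint) auto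
    also have "(\<Union>S\<in>H'. {p\<in>G. So p = S}) = {p\<in>G. So p \<in> H'}" by auto
    finally show ?thesis unfolding w_def by (simp add: sum_divide_distrib[symmetric])
  qed
  show ?thesis
  proof (intro exI[of _ w] conjI allI ballI impI)
    show "w S \<ge> 0" for S unfolding w_def by simp
    have "{p\<in>G. So p \<in> H} = G" using SoH by auto
    then show "(\<Sum>S\<in>H. w S) = 1" using wsum[OF finH] Gpos by simp
    show "plantable W s q S (edges_of (cliques W s X))" if "S \<in> H" "w S > 0" for S
    proof -
      have "{p\<in>G. So p = S} \<noteq> {}" using that unfolding w_def by (metis card.empty div_0 less_irrefl of_nat_0)
      then show ?thesis using SoH by auto
    qed
    show "(\<Sum>S\<in>{S\<in>H. T \<subseteq> S}. w S) \<le> (2 * p0) ^ card T" if T: "T \<subseteq> ksets W s" for T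
    proof (cases "T = {} \<or> {p\<in>G. So p \<in> {S\<in>H. T \<subseteq> S}} = {}")
      case True
      then show ?thesis
      proof
        assume "T = {}"
        moreover have "card {p\<in>G. So p \<in> H} \<le> card G" using finG by (intro card_mono) auto
        ultimately show ?thesis using wsum[of "{S\<in>H. T \<subseteq> S}"] finH Gpos by simp
      next
        assume "{p\<in>G. So p \<in> {S\<in>H. T \<subseteq> S}} = {}"
        then show ?thesis using wsum[of "{S\<in>H. T \<subseteq> S}"] finH p00 by (simp only:) simp
      qed
    next
      case False
      have sub: "{p\<in>G. So p \<in> {S\<in>H. T \<subseteq> S}} \<subseteq> arrs F T"
        unfolding G_def A_def arrs_def So_def by auto
      obtain p where "p permutes V" "T \<subseteq> rows p" using False sub unfolding arrs_def by blast
      then have TV: "T \<subseteq> ksets V s" using rows_ksets by blast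
      have "finite T" using T W finite_subset finite_ksets by blast
      then have T1: "card T \<ge> 1" using False by (simp add: Suc_leI card_gt_0_iff)
      have "real (card {p\<in>G. So p \<in> {S\<in>H. T \<subseteq> S}}) \<le> real (card (arrs F T))"
        using card_mono[OF finite_arrs sub] by simp
      also have "\<dots> \<le> p0 ^ card T * real (card A)" unfolding A_def by (rule spr[OF TV])
      also have "\<dots> \<le> p0 ^ card T * (2 * real (card G))" using Ghalf p00 by (intro mult_left_mono) auto
      finally have le: "real (card {p\<in>G. So p \<in> {S\<in>H. T \<subseteq> S}}) \<le> p0 ^ card T * (2 * real (card G))" .
      have "(\<Sum>S\<in>{S\<in>H. T \<subseteq> S}. w S) = real (card {p\<in>G. So p \<in> {S\<in>H. T \<subseteq> S}}) / real (card G)"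
        using finH by (intro wsum) simp
      also have "\<dots> \<le> (p0 ^ card T * (2 * real (card G))) / real (card G)" by (intro divide_right_mono le) simp
      also have "\<dots> = p0 ^ card T * 2 ^ 1" using Gpos by simp
      finally have "(\<Sum>S\<in>{S\<in>H. T \<subseteq> S}. w S) \<le> p0 ^ card T * 2 ^ 1" .
      also have "\<dots> \<le> p0 ^ card T * 2 ^ card T" using T1 p00 by (intro mult_left_mono power_increasing) auto
      finally show ?thesis by (simp add: power_mult_distrib mult.commute)
    qed
  qed
qed

section \<open>Poorly covered clique-free graphs\<close>

definition typical :: "'a set \<Rightarrow> nat \<Rightarrow> real \<Rightarrow> real \<Rightarrow> real \<Rightarrow> real \<Rightarrow> 'a set set \<Rightarrow> bool" where
  "typical W s q p E u X \<longleftrightarrow>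
     (\<forall>v\<in>W. vertex_cost W s q v X \<le> E) \<and> joint_cost W s q p X \<le> u"

definition poorly_covered :: "'a set \<Rightarrow> nat \<Rightarrow> real \<Rightarrow> 'a set set \<Rightarrow> bool" where
  "poorly_covered W s r X \<longleftrightarrow> (\<forall>N. N \<subseteq> cliques W s X \<and> disjoint N \<longrightarrow> real (s * card N) + r < real (card W))"

text \<open>
  Apply the fragment bound to the law of the set of \<open>s\<close>-cliques of a \<open>K\<^sub>k\<close>-free graph. A family in
  \<open>H\<close> covers all but \<open>u\<close> vertices, so if all but \<open>N div 2^J\<close> of its members are cliques, the
  graph is not poorly covered.
\<close>

lemma poorly_covered_bound:
  fixes W :: "'a set"
  assumes W: "finite W" and q: "0 < q" "q \<le> 1/2" and s: "3 \<le> s" "s < k"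
    and N: "card W \<le> N" and m: "m > 0" "J > 0"
    and small: "2 * p0 * real m / (q ^ (s choose 2) / 2) \<le> 1/64"
    and dl: "2 * real J * (\<Sum>a<J. (1/4) ^ (N div 2 ^ a)) \<le> dl" "dl > 0" "dl \<le> 1"
    and n0: "n0 = card W div s" "4 * s \<le> n0"
    and E: "8 * real s ^ s * E \<le> (real n0 / 4) ^ (s - 1)" "4 * real s ^ s \<le> (real n0 / 4) ^ (s - 1)"
    and p0: "switch_const s / real n0 ^ (s - 1) \<le> p0"
    and u: "u1 > 0" "real s + 8 * real s ^ 2 * u1 \<le> u"
  defines "bad \<equiv> poorly_covered W s (u + real (s * (N div 2 ^ J)))"
  shows "rexp (pairs W) q (\<lambda>X. of_bool (cliques W k X = {} \<and> typical W s q p0 E u1 X \<and> bad X)) * dl ^ J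
    \<le> (2 * dl) ^ m * rexp (pairs W) q (\<lambda>X. of_bool (cliques W k X = {}))"
proof -
  define Gr where "Gr = ksets W s"
  define weight where "weight = (\<lambda>C. rexp (pairs W) q (\<lambda>X. of_bool (cliques W s X = C \<and> cliques W k X = {})))"
  define H where "H = {S. S \<subseteq> ksets W s \<and> disjoint S \<and> real (card W) \<le> real (s * card S) + u}"
  define admissible where "admissible = (\<lambda>T R. plantable W s q T (edges_of R))"
  have fins: "finite \<sigma>" if "\<sigma> \<in> ksets W s" for \<sigma> using that W finite_subset unfolding ksets_def by auto
  have p00: "p0 \<ge> 0"
  proof -
    have "0 \<le> switch_const s / real n0 ^ (s - 1)" by simp
    then show ?thesis using p0 by linarith
  qed
  interpret fragment_process Gr weight H admissible "2 * p0" "q ^ (s choose 2) / 2" dl m J N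
  proof
    show "finite Gr" unfolding Gr_def using W by simp
    show "0 \<le> weight C" for C unfolding weight_def using q by (intro rexp_nonneg) auto
    show "H \<subseteq> Pow Gr" unfolding H_def Gr_def by auto
    show "admissible T' R'" if "T' \<subseteq> T" "R' \<subseteq> R" "admissible T R" for T T' R R'
      unfolding admissible_def
      by (rule plantable_antimono[OF W _ _ that(1) edges_of_mono[OF that(2)]]) (use that q in \<open>auto simp: admissible_def\<close>)
    show "(q ^ (s choose 2) / 2) ^ card T * (\<Sum>C\<in>{C\<in>Pow Gr. R \<subseteq> C}. weight C * th ^ card (C - R))
        \<le> (\<Sum>C\<in>{C\<in>Pow Gr. R \<union> T \<subseteq> C}. weight C * th ^ card (C - (R \<union> T)))"
      if "0 \<le> th" "th \<le> 1" "R \<subseteq> Gr" "T \<subseteq> Gr" "T \<inter> R = {}" "admissible T R" for th T R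
      using that q unfolding Gr_def weight_def admissible_def by (intro planting[OF W _ q(2) s]) auto
  qed (use p00 q m small dl in auto)
  define Bd where "Bd = {C. \<exists>X. X \<subseteq> pairs W \<and> cliques W s X = C \<and> typical W s q p0 E u1 X \<and> bad X}"
  have A: "(\<Sum>C\<in>Bd. weight C) * dl ^ J \<le> (2 * dl) ^ m * (\<Sum>C\<in>Pow Gr. weight C)"
  proof (rule fragment_bound)
    show "Bd \<subseteq> Pow Gr" unfolding Bd_def Gr_def cliques_def by auto
    show "card S \<le> N" if "S \<in> H" for S
    proof -
      have S: "S \<subseteq> ksets W s" "disjoint S" using that unfolding H_def by auto
      have finS: "finite S" using S W finite_subset finite_ksets by blast
      have "card S \<le> (\<Sum>\<tau>\<in>S. card \<tau>)"
      proof -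
        have "(\<Sum>\<tau>\<in>S. 1) \<le> (\<Sum>\<tau>\<in>S. card \<tau>)" by (rule sum_mono) (use S s in \<open>auto simp: ksets_def\<close>)
        then show ?thesis by simp
      qed
      also have "\<dots> = card (\<Union>S)"
      proof (rule card_Union_disjoint[symmetric])
        show "pairwise disjnt S" using S(2) by (simp add: disjoint_def pairwise_def disjnt_def)
        show "finite A" if "A \<in> S" for A using that S fins by blast
      qed
      also have "\<dots> \<le> card W" using S W by (intro card_mono) (auto simp: ksets_def)
      finally show ?thesis using N by simp
    qed
    show "N div 2 ^ J < card (S - C)" if C: "C \<in> Bd" and S: "S \<in> H" for C S
    proof (rule ccontr)
      assume "\<not> N div 2 ^ J < card (S - C)"
      then have le: "card (S - C) \<le> N div 2 ^ J" by simp
      obtain X where X: "cliques W s X = C" "bad X" using C unfolding Bd_def by auto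
      have S': "S \<subseteq> ksets W s" "disjoint S" "real (card W) \<le> real (s * card S) + u" using S unfolding H_def by auto
      have finS: "finite S" using S' W finite_subset finite_ksets by blast
      have "S \<inter> C \<subseteq> cliques W s X" "disjoint (S \<inter> C)"
        using X pairwise_subset[OF S'(2), of "S \<inter> C"] by auto
      then have b: "real (s * card (S \<inter> C)) + u + real (s * (N div 2 ^ J)) < real (card W)" using X(2) unfolding bad_def poorly_covered_def add.assoc by blast
      have "card S = card (S \<inter> C) + card (S - C)" using finS by (simp add: card_Int_Diff)
      then have "s * card S \<le> s * card (S \<inter> C) + s * (N div 2 ^ J)" using le by (simp add: distrib_left)
      then have "real (s * card S) \<le> real (s * card (S \<inter> C)) + real (s * (N div 2 ^ J))"
        by (metis of_nat_add of_nat_le_iff)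
      then show False using b S'(3) by linarith
    qed
    show "\<exists>w. (\<forall>S. w S \<ge> 0) \<and> (\<Sum>S\<in>H. w S) = 1 \<and> (\<forall>S\<in>H. w S > 0 \<longrightarrow> admissible S C) \<and>
      (\<forall>T\<subseteq>Gr. (\<Sum>S\<in>{S\<in>H. T \<subseteq> S}. w S) \<le> (2 * p0) ^ card T)" if C: "C \<in> Bd" for C
    proof -
      obtain X where X: "X \<subseteq> pairs W" "cliques W s X = C" "typical W s q p0 E u1 X" using C unfolding Bd_def by auto
      show ?thesis
        unfolding admissible_def X(2)[symmetric] Gr_def H_def
        by (rule spread_plantable_matchings[OF W _ _ _ X(1) _ n0 E p0 _ u])
           (use q s X(3) in \<open>auto simp: typical_def\<close>)
    qed
  qed
  have B: "(\<Sum>C\<in>Pow Gr. weight C) = rexp (pairs W) q (\<lambda>X. of_bool (cliques W k X = {}))"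
  proof -
    have "(\<Sum>C\<in>Pow Gr. weight C * 1) = rexp (pairs W) q (\<lambda>X. of_bool (cliques W s X \<in> Pow Gr) * (of_bool (cliques W k X = {}) * 1))"
      unfolding weight_def by (rule rexp_fibers) (use W in \<open>simp add: Gr_def\<close>)
    also have "\<dots> = rexp (pairs W) q (\<lambda>X. of_bool (cliques W k X = {}))"
      by (rule rexp_cong) (auto simp: Gr_def cliques_def)
    finally show ?thesis by simp
  qed
  have C: "rexp (pairs W) q (\<lambda>X. of_bool (cliques W k X = {} \<and> typical W s q p0 E u1 X \<and> bad X)) \<le> (\<Sum>C\<in>Bd. weight C)"
  proof -
    have finBd: "finite Bd" by (rule finite_subset[of _ "Pow Gr"]) (use W in \<open>auto simp: Bd_def Gr_def cliques_def\<close>)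
    have "(\<Sum>C\<in>Bd. weight C * 1) = rexp (pairs W) q (\<lambda>X. of_bool (cliques W s X \<in> Bd) * (of_bool (cliques W k X = {}) * 1))"
      unfolding weight_def by (rule rexp_fibers[OF finBd])
    moreover have "rexp (pairs W) q (\<lambda>X. of_bool (cliques W k X = {} \<and> typical W s q p0 E u1 X \<and> bad X))
       \<le> rexp (pairs W) q (\<lambda>X. of_bool (cliques W s X \<in> Bd) * (of_bool (cliques W k X = {}) * 1))"
      using q by (intro rexp_mono) (auto simp: Bd_def)
    ultimately show ?thesis by simp
  qed
  have "rexp (pairs W) q (\<lambda>X. of_bool (cliques W k X = {} \<and> typical W s q p0 E u1 X \<and> bad X)) * dl ^ J \<le> (\<Sum>C\<in>Bd. weight C) * dl ^ J"
    using C dl by (intro mult_right_mono) auto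
  also have "\<dots> \<le> (2 * dl) ^ m * rexp (pairs W) q (\<lambda>X. of_bool (cliques W k X = {}))"
    using A unfolding B .
  finally show ?thesis .
qed

subsection \<open>maximal matchings\<close>

section \<open>The sum over matchings\<close>

lemma card_ksets_le: "finite V \<Longrightarrow> card (ksets V j) \<le> card V ^ j"
  by (cases "j \<le> card V") (auto simp: card_ksets binomial_le_pow binomial_eq_0)

lemma sum_Pow_Un:
  assumes "A \<inter> B = {}"
  shows "(\<Sum>Z\<in>Pow (A \<union> B). f Z) = (\<Sum>Z1\<in>Pow A. \<Sum>Z2\<in>Pow B. f (Z1 \<union> Z2))"
proof -
  have "(\<Sum>Z\<in>Pow (A \<union> B). f Z) = (\<Sum>(Z1, Z2)\<in>Pow A \<times> Pow B. f (Z1 \<union> Z2))"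
    by (rule sum.reindex_bij_witness[of _ "\<lambda>(Z1, Z2). Z1 \<union> Z2" "\<lambda>Z. (Z \<inter> A, Z \<inter> B)"])
       (use assms in \<open>auto intro!: arg_cong[of _ _ f]\<close>)
  then show ?thesis by (simp add: sum.cartesian_product)
qed

text \<open>
  The sum factorises over the blocks: a block contributes 1 if \<open>Z\<close> misses it and \<open>x\<close> for each of the fewer
  than \<open>2^k\<close> other traces.
\<close>

lemma sum_meeting_blocks:
  assumes "finite M" "disjoint M" "\<And>\<tau>. \<tau> \<in> M \<Longrightarrow> finite \<tau> \<and> card \<tau> = k" and "0 \<le> (x::real)"
  shows "(\<Sum>Z\<in>Pow (\<Union>M). x ^ card {\<tau>\<in>M. \<tau> \<inter> Z \<noteq> {}}) \<le> (1 + 2 ^ k * x) ^ card M"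
  using assms(1-3)
proof (induction M rule: finite_induct)
  case (insert \<tau> M)
  have \<tau>: "finite \<tau>" "card \<tau> = k" using insert.prems by auto
  have disj: "\<tau> \<inter> \<Union>M = {}"
  proof -
    have "\<tau> \<inter> \<rho> = {}" if "\<rho> \<in> M" for \<rho>
      using that insert.prems(1) insert.hyps by (metis disjointD insertCI)
    then show ?thesis by auto
  qed
  have dM: "disjoint M" using insert.prems(1) by (auto simp: pairwise_insert)
  have count: "x ^ card {\<rho>\<in>insert \<tau> M. \<rho> \<inter> (Z1 \<union> Z2) \<noteq> {}} = x ^ card {\<rho>\<in>M. \<rho> \<inter> Z2 \<noteq> {}} * (if Z1 = {} then 1 else x)"
    if "Z1 \<subseteq> \<tau>" "Z2 \<subseteq> \<Union>M" for Z1 Z2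
  proof -
    have "{\<rho>\<in>insert \<tau> M. \<rho> \<inter> (Z1 \<union> Z2) \<noteq> {}} = {\<rho>\<in>M. \<rho> \<inter> Z2 \<noteq> {}} \<union> (if Z1 = {} then {} else {\<tau>})"
      using that disj by auto
    moreover have "\<tau> \<notin> {\<rho>\<in>M. \<rho> \<inter> Z2 \<noteq> {}}" using insert.hyps by auto
    ultimately show ?thesis using insert.hyps by auto
  qed
  have one: "(\<Sum>Z1\<in>Pow \<tau>. if Z1 = {} then 1 else x) \<le> 1 + 2 ^ k * x"
  proof -
    have "(\<Sum>Z1\<in>Pow \<tau>. if Z1 = {} then 1 else x) \<le> (\<Sum>Z1\<in>Pow \<tau>. (if Z1 = {} then 1 else 0) + x)"
      using assms(4) by (intro sum_mono) auto
    also have "\<dots> = 1 + 2 ^ k * x" using \<tau> by (simp add: sum.distrib card_Pow)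
    finally show ?thesis .
  qed
  have "(\<Sum>Z\<in>Pow (\<Union>(insert \<tau> M)). x ^ card {\<rho>\<in>insert \<tau> M. \<rho> \<inter> Z \<noteq> {}})
    = (\<Sum>Z1\<in>Pow \<tau>. \<Sum>Z2\<in>Pow (\<Union>M). x ^ card {\<rho>\<in>insert \<tau> M. \<rho> \<inter> (Z1 \<union> Z2) \<noteq> {}})"
    using sum_Pow_Un[OF disj, of "\<lambda>Z. x ^ card {\<rho>\<in>insert \<tau> M. \<rho> \<inter> Z \<noteq> {}}"] by simp
  also have "\<dots> = (\<Sum>Z1\<in>Pow \<tau>. \<Sum>Z2\<in>Pow (\<Union>M). x ^ card {\<rho>\<in>M. \<rho> \<inter> Z2 \<noteq> {}} * (if Z1 = {} then 1 else x))"
    by (intro sum.cong refl count) auto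
  also have "\<dots> = (\<Sum>Z1\<in>Pow \<tau>. if Z1 = {} then 1 else x) * (\<Sum>Z2\<in>Pow (\<Union>M). x ^ card {\<rho>\<in>M. \<rho> \<inter> Z2 \<noteq> {}})"
    by (simp add: sum_product mult.commute)
  also have "\<dots> \<le> (1 + 2 ^ k * x) * (1 + 2 ^ k * x) ^ card M"
    using insert dM assms(4) by (intro mult_mono one insert.IH) (auto intro!: sum_nonneg)
  finally show ?case using insert.hyps by simp
qed simp

text \<open>
  The expected number of unwanted copies of \<open>K\<^sub>k\<close> that meet the vertices of \<open>M\<close> when
  \<open>M\<close> is planted.
\<close>

definition near_cost :: "'a set \<Rightarrow> nat \<Rightarrow> real \<Rightarrow> 'a set set \<Rightarrow> real" where
  "near_cost V k q M = (\<Sum>\<kappa>\<in>{\<kappa>\<in>ksets V k. \<kappa> \<notin> M \<and> \<kappa> \<inter> \<Union>M \<noteq> {}}. q ^ card (pairs \<kappa> - edges_of M))"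

lemma pairs_inter_edges_of_empty:
  assumes "\<kappa> \<inter> \<Union>M = {}"
  shows "pairs \<kappa> \<inter> edges_of M = {}"
proof (rule ccontr)
  assume "pairs \<kappa> \<inter> edges_of M \<noteq> {}"
  then obtain e \<tau> where e: "e \<in> pairs \<kappa>" "\<tau> \<in> M" "e \<in> pairs \<tau>" unfolding edges_of_def by auto
  then have "e \<subseteq> \<kappa> \<inter> \<Union>M" unfolding ksets_def by auto
  then show False using e assms unfolding ksets_def by auto
qed

lemma card_pairs_inter_edges_of:
  assumes "finite \<kappa>" "finite M" "disjoint M"
  shows "card (pairs \<kappa> \<inter> edges_of M) = (\<Sum>\<tau>\<in>M. card (\<kappa> \<inter> \<tau>) choose 2)"
proof -
  have eq: "pairs \<kappa> \<inter> edges_of M = (\<Union>\<tau>\<in>M. pairs (\<kappa> \<inter> \<tau>))" unfolding edges_of_def ksets_def by auto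
  have "card (\<Union>\<tau>\<in>M. pairs (\<kappa> \<inter> \<tau>)) = (\<Sum>\<tau>\<in>M. card (pairs (\<kappa> \<inter> \<tau>)))"
  proof (rule card_UN_disjoint)
    show "\<forall>i\<in>M. \<forall>j\<in>M. i \<noteq> j \<longrightarrow> pairs (\<kappa> \<inter> i) \<inter> pairs (\<kappa> \<inter> j) = {}"
    proof (intro ballI impI)
      fix i j assume "i \<in> M" "j \<in> M" "i \<noteq> j"
      then have ij: "i \<inter> j = {}" by (rule disjointD[OF assms(3)])
      show "pairs (\<kappa> \<inter> i) \<inter> pairs (\<kappa> \<inter> j) = {}"
      proof (rule ccontr)
        assume "pairs (\<kappa> \<inter> i) \<inter> pairs (\<kappa> \<inter> j) \<noteq> {}"
        then obtain e where "e \<subseteq> i" "e \<subseteq> j" "card e = 2" unfolding ksets_def by blast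
        then have "e \<subseteq> {}" using ij by blast
        then show False using \<open>card e = 2\<close> by simp
      qed
    qed
  qed (use assms in auto)
  also have "\<dots> = (\<Sum>\<tau>\<in>M. card (\<kappa> \<inter> \<tau>) choose 2)" using assms by (intro sum.cong) (auto simp: card_ksets)
  finally show ?thesis using eq by simp
qed

text \<open>
  A block that meets \<open>\<kappa>\<close> in \<open>f < k\<close> vertices saves \<open>f choose 2\<close> edges and fixes
  \<open>f\<close> vertices. By the density assumption the net effect is a factor at most \<open>1/n\<close> per block, relative to
  the expected number of all copies of \<open>K\<^sub>k\<close>. Summing over the nonempty traces of \<open>\<kappa>\<close> on the
  vertices of \<open>M\<close> gives at most \<open>(1 + 2^k/n)^card M - 1\<close>.
\<close>

lemma near_cost_bound:
  fixes V :: "'a set"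
  assumes V: "finite V" "n = card V" "n > 0" and q: "0 < q" "q \<le> 1" and k: "2 \<le> k"
    and M: "M \<subseteq> ksets V k" "disjoint M" and sm: "2 ^ k * real (card M) \<le> real n"
    and dense: "\<And>f. 1 \<le> f \<Longrightarrow> f < k \<Longrightarrow> 1 \<le> real n ^ (f - 1) * q ^ (f choose 2)"
  shows "near_cost V k q M \<le> real n ^ k * q ^ (k choose 2) * (2 * 2 ^ k * real (card M) / real n)"
proof -
  define I where "I = {\<kappa>\<in>ksets V k. \<kappa> \<notin> M \<and> \<kappa> \<inter> \<Union>M \<noteq> {}}"
  define U where "U = \<Union>M"
  define l where "l = (\<lambda>Z. card {\<tau>\<in>M. \<tau> \<inter> Z \<noteq> {}})"
  have finM: "finite M" using M V finite_subset finite_ksets by blast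
  have UV: "U \<subseteq> V" using M unfolding U_def ksets_def by auto
  have finU: "finite U" using UV V finite_subset by blast
  have fM: "finite \<tau> \<and> card \<tau> = k" if "\<tau> \<in> M" for \<tau>
    using that M V finite_subset[of \<tau> V] unfolding ksets_def by auto
  have le_term: "q ^ card (pairs \<kappa> - edges_of M) \<le> q ^ (k choose 2) * (real n ^ card (\<kappa> \<inter> U) * (1 / real n) ^ l (\<kappa> \<inter> U))"
    if \<kappa>: "\<kappa> \<in> I" for \<kappa>
  proof -
    have \<kappa>': "\<kappa> \<subseteq> V" "card \<kappa> = k" "\<kappa> \<notin> M" "finite \<kappa>" using \<kappa> V finite_subset unfolding I_def ksets_def by auto
    define Mk where "Mk = {\<tau>\<in>M. \<tau> \<inter> (\<kappa> \<inter> U) \<noteq> {}}"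
    have finMk: "finite Mk" using finM by (simp add: Mk_def)
    have f: "1 \<le> card (\<kappa> \<inter> \<tau>)" "card (\<kappa> \<inter> \<tau>) < k" if "\<tau> \<in> Mk" for \<tau>
    proof -
      have \<tau>: "\<tau> \<in> M" "\<kappa> \<inter> \<tau> \<noteq> {}" using that unfolding Mk_def by auto
      then show "1 \<le> card (\<kappa> \<inter> \<tau>)" using \<kappa>'(4) by (simp add: Suc_leI card_gt_0_iff)
      have "card (\<kappa> \<inter> \<tau>) \<le> k" using card_mono[of \<kappa> "\<kappa> \<inter> \<tau>"] \<kappa>' by auto
      moreover have "card (\<kappa> \<inter> \<tau>) \<noteq> k"
      proof
        assume c: "card (\<kappa> \<inter> \<tau>) = k"
        have "\<kappa> \<inter> \<tau> = \<kappa>" by (rule card_subset_eq) (use \<kappa>' c in auto)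
        moreover have "\<kappa> \<inter> \<tau> = \<tau>" by (rule card_subset_eq) (use fM[OF \<tau>(1)] c in auto)
        ultimately show False using \<tau> \<kappa>' by auto
      qed
      ultimately show "card (\<kappa> \<inter> \<tau>) < k" by simp
    qed
    have e1: "card (pairs \<kappa> \<inter> edges_of M) = (\<Sum>\<tau>\<in>Mk. card (\<kappa> \<inter> \<tau>) choose 2)"
    proof -
      have "\<kappa> \<inter> \<tau> = {}" if "\<tau> \<in> M - Mk" for \<tau> using that unfolding Mk_def U_def by auto
      then have "(\<Sum>\<tau>\<in>M. card (\<kappa> \<inter> \<tau>) choose 2) = (\<Sum>\<tau>\<in>Mk. card (\<kappa> \<inter> \<tau>) choose 2)"
        using finM by (intro sum.mono_neutral_right) (auto simp: Mk_def)
      then show ?thesis using card_pairs_inter_edges_of[OF \<kappa>'(4) finM M(2)] by simp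
    qed
    have e2: "k choose 2 = card (pairs \<kappa> - edges_of M) + (\<Sum>\<tau>\<in>Mk. card (\<kappa> \<inter> \<tau>) choose 2)"
      using \<kappa>' card_ksets[of \<kappa> 2] card_Int_Diff[of "pairs \<kappa>" "edges_of M"] e1 by simp
    have e3: "card (\<kappa> \<inter> U) = (\<Sum>\<tau>\<in>Mk. card (\<kappa> \<inter> \<tau>))"
    proof -
      have "\<kappa> \<inter> U = (\<Union>\<tau>\<in>Mk. \<kappa> \<inter> \<tau>)" unfolding U_def Mk_def by auto
      moreover have "card (\<Union>\<tau>\<in>Mk. \<kappa> \<inter> \<tau>) = (\<Sum>\<tau>\<in>Mk. card (\<kappa> \<inter> \<tau>))"
      proof (rule card_UN_disjoint[OF finMk])
        show "\<forall>i\<in>Mk. \<forall>j\<in>Mk. i \<noteq> j \<longrightarrow> \<kappa> \<inter> i \<inter> (\<kappa> \<inter> j) = {}"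
        proof (intro ballI impI)
          fix i j assume "i \<in> Mk" "j \<in> Mk" "i \<noteq> j"
          then have "i \<inter> j = {}" using M(2) unfolding Mk_def disjoint_def by auto
          then show "\<kappa> \<inter> i \<inter> (\<kappa> \<inter> j) = {}" by auto
        qed
      qed (use \<kappa>' in auto)
      ultimately show ?thesis by simp
    qed
    have "1 \<le> (\<Prod>\<tau>\<in>Mk. real n ^ (card (\<kappa> \<inter> \<tau>) - 1) * q ^ (card (\<kappa> \<inter> \<tau>) choose 2))"
      using f by (intro prod_ge_1 dense) auto
    also have "\<dots> = real n ^ (\<Sum>\<tau>\<in>Mk. card (\<kappa> \<inter> \<tau>) - 1) * q ^ (\<Sum>\<tau>\<in>Mk. card (\<kappa> \<inter> \<tau>) choose 2)"
      by (simp add: prod.distrib power_sum)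
    finally have "q ^ card (pairs \<kappa> - edges_of M) * 1 \<le> q ^ card (pairs \<kappa> - edges_of M) *
       (real n ^ (\<Sum>\<tau>\<in>Mk. card (\<kappa> \<inter> \<tau>) - 1) * q ^ (\<Sum>\<tau>\<in>Mk. card (\<kappa> \<inter> \<tau>) choose 2))"
      using q by (intro mult_left_mono) auto
    also have "\<dots> = q ^ (k choose 2) * real n ^ (\<Sum>\<tau>\<in>Mk. card (\<kappa> \<inter> \<tau>) - 1)"
      unfolding e2 by (simp add: power_add mult_ac)
    also have "real n ^ (\<Sum>\<tau>\<in>Mk. card (\<kappa> \<inter> \<tau>) - 1) = real n ^ card (\<kappa> \<inter> U) * (1 / real n) ^ l (\<kappa> \<inter> U)"
    proof -
      have "(\<Sum>\<tau>\<in>Mk. card (\<kappa> \<inter> \<tau>) - 1) + card Mk = (\<Sum>\<tau>\<in>Mk. card (\<kappa> \<inter> \<tau>) - 1 + 1)"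
        unfolding sum.distrib by simp
      also have "\<dots> = card (\<kappa> \<inter> U)" unfolding e3
      proof (rule sum.cong[OF refl])
        fix \<tau> assume "\<tau> \<in> Mk"
        then show "card (\<kappa> \<inter> \<tau>) - 1 + 1 = card (\<kappa> \<inter> \<tau>)" using f(1)[of \<tau>] by simp
      qed
      finally have "card (\<kappa> \<inter> U) = (\<Sum>\<tau>\<in>Mk. card (\<kappa> \<inter> \<tau>) - 1) + card Mk" by simp
      moreover have "l (\<kappa> \<inter> U) = card Mk" unfolding l_def Mk_def ..
      ultimately show ?thesis using V(3) by (simp add: power_add power_one_over)
    qed
    finally show ?thesis by simp
  qed
  have "(\<Sum>\<kappa>\<in>I. real n ^ card (\<kappa> \<inter> U) * (1 / real n) ^ l (\<kappa> \<inter> U)) \<le> (\<Sum>Z\<in>Pow U - {{}}. real n ^ k * (1 / real n) ^ l Z)"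
  proof -
    define g where "g = (\<lambda>Z. real n ^ card Z * (1 / real n) ^ l Z)"
    have finI: "finite I" unfolding I_def using V by simp
    have "(\<Sum>\<kappa>\<in>I. g (\<kappa> \<inter> U)) = (\<Sum>Z\<in>Pow U - {{}}. \<Sum>\<kappa>\<in>{\<kappa>\<in>I. \<kappa> \<inter> U = Z}. g (\<kappa> \<inter> U))"
      using finI finU by (intro sum.group[symmetric]) (auto simp: I_def U_def)
    also have "\<dots> = (\<Sum>Z\<in>Pow U - {{}}. real (card {\<kappa>\<in>I. \<kappa> \<inter> U = Z}) * g Z)"
      by (intro sum.cong refl) simp
    also have "\<dots> \<le> (\<Sum>Z\<in>Pow U - {{}}. real n ^ k * (1 / real n) ^ l Z)"
    proof (rule sum_mono)
      fix Z assume Z: "Z \<in> Pow U - {{}}"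
      show "real (card {\<kappa>\<in>I. \<kappa> \<inter> U = Z}) * g Z \<le> real n ^ k * (1 / real n) ^ l Z"
      proof (cases "{\<kappa>\<in>I. \<kappa> \<inter> U = Z} = {}")
        case False
        then obtain \<kappa> where "\<kappa> \<in> I" "\<kappa> \<inter> U = Z" by auto
        then have "finite \<kappa>" "card \<kappa> = k" "Z \<subseteq> \<kappa>" using V finite_subset unfolding I_def ksets_def by auto
        then have Zk: "card Z \<le> k" using card_mono by metis
        have "card {\<kappa>\<in>I. \<kappa> \<inter> U = Z} \<le> card (ksets V (k - card Z))"
        proof (rule card_inj_on_le[of "\<lambda>\<kappa>. \<kappa> - U"])
          show "inj_on (\<lambda>\<kappa>. \<kappa> - U) {\<kappa>\<in>I. \<kappa> \<inter> U = Z}" unfolding inj_on_def by blast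
          show "(\<lambda>\<kappa>. \<kappa> - U) ` {\<kappa>\<in>I. \<kappa> \<inter> U = Z} \<subseteq> ksets V (k - card Z)"
          proof (rule image_subsetI)
            fix \<kappa> assume k: "\<kappa> \<in> {\<kappa>\<in>I. \<kappa> \<inter> U = Z}"
            then have "finite \<kappa>" "card \<kappa> = k" "\<kappa> \<subseteq> V" using V finite_subset unfolding I_def ksets_def by auto
            moreover have "card \<kappa> = card Z + card (\<kappa> - U)" using k card_Int_Diff[OF \<open>finite \<kappa>\<close>, of U] by auto
            ultimately show "\<kappa> - U \<in> ksets V (k - card Z)" unfolding ksets_def by auto
          qed
        qed (use V in simp)
        also have "\<dots> \<le> n ^ (k - card Z)" using card_ksets_le[OF V(1)] V(2) by simp
        finally have "real (card {\<kappa>\<in>I. \<kappa> \<inter> U = Z}) * g Z \<le> real n ^ (k - card Z) * g Z"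
          unfolding g_def by (intro mult_right_mono) (auto simp flip: of_nat_power)
        also have "\<dots> = real n ^ k * (1 / real n) ^ l Z"
          unfolding g_def using Zk by (simp add: power_add[symmetric] mult.assoc[symmetric])
        finally show ?thesis .
      next
        case True
        show ?thesis unfolding True by simp
      qed
    qed
    finally show ?thesis by (simp add: g_def)
  qed
  also have "\<dots> \<le> real n ^ k * (2 * 2 ^ k * real (card M) / real n)"
  proof -
    define y where "y = 2 ^ k * real (card M) / real n"
    have y: "0 \<le> y" "y \<le> 1" using sm V unfolding y_def by auto
    have "(\<Sum>Z\<in>Pow U. (1 / real n) ^ l Z) \<le> (1 + 2 ^ k * (1 / real n)) ^ card M"
      unfolding U_def l_def using finM M fM by (intro sum_meeting_blocks) auto
    also have "\<dots> \<le> exp (2 ^ k * (1 / real n)) ^ card M"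
      by (intro power_mono exp_ge_add_one_self) auto
    also have "\<dots> = exp y" unfolding y_def by (simp add: exp_of_nat_mult[symmetric] mult_ac)
    also have "\<dots> \<le> 1 + 2 * y"
    proof -
      have "exp y \<le> 1 + y + y\<^sup>2" using y by (intro exp_bound) auto
      moreover have "y\<^sup>2 \<le> y" using y by (simp add: power2_eq_square mult_left_le)
      ultimately show ?thesis by simp
    qed
    finally have "(\<Sum>Z\<in>Pow U. (1 / real n) ^ l Z) \<le> 1 + 2 * y" .
    moreover have "(\<Sum>Z\<in>Pow U. (1 / real n) ^ l Z) = (1 / real n) ^ l {} + (\<Sum>Z\<in>Pow U - {{}}. (1 / real n) ^ l Z)"
      using finU by (intro sum.remove) auto
    moreover have "l {} = 0" unfolding l_def by simp
    ultimately have "(\<Sum>Z\<in>Pow U - {{}}. (1 / real n) ^ l Z) \<le> 2 * y" by simp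
    then have "real n ^ k * (\<Sum>Z\<in>Pow U - {{}}. (1 / real n) ^ l Z) \<le> real n ^ k * (2 * y)" by (intro mult_left_mono) auto
    then show ?thesis by (simp add: sum_distrib_left y_def)
  qed
  finally have S: "(\<Sum>\<kappa>\<in>I. real n ^ card (\<kappa> \<inter> U) * (1 / real n) ^ l (\<kappa> \<inter> U)) \<le> real n ^ k * (2 * 2 ^ k * real (card M) / real n)" .
  have "near_cost V k q M \<le> (\<Sum>\<kappa>\<in>I. q ^ (k choose 2) * (real n ^ card (\<kappa> \<inter> U) * (1 / real n) ^ l (\<kappa> \<inter> U)))"
    unfolding near_cost_def I_def[symmetric] by (intro sum_mono le_term)
  also have "\<dots> \<le> q ^ (k choose 2) * (real n ^ k * (2 * 2 ^ k * real (card M) / real n))"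
    unfolding sum_distrib_left[symmetric] using S q by (intro mult_left_mono) auto
  finally show ?thesis by (simp add: mult_ac)
qed

text \<open>
  The edges at one vertex of \<open>\<kappa>\<close> lie in the only block that contains this vertex.
\<close>

lemma clique_in_matching:
  assumes "3 \<le> k" "finite \<kappa>" "card \<kappa> = k" "pairs \<kappa> \<subseteq> edges_of M" "disjoint M" "\<And>\<tau>. \<tau> \<in> M \<Longrightarrow> finite \<tau> \<and> card \<tau> = k"
  shows "\<kappa> \<in> M"
proof -
  have "\<kappa> \<noteq> {}" using assms by auto
  then obtain v where v: "v \<in> \<kappa>" by auto
  have ex: "\<exists>\<tau>\<in>M. v \<in> \<tau> \<and> w \<in> \<tau>" if "w \<in> \<kappa>" "w \<noteq> v" for w
  proof -
    have "{v, w} \<in> pairs \<kappa>" using that v unfolding ksets_def by auto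
    then have "{v, w} \<in> edges_of M" using assms(4) by blast
    then obtain \<tau> where "\<tau> \<in> M" "{v, w} \<in> pairs \<tau>" unfolding edges_of_def by blast
    then show ?thesis unfolding ksets_def by blast
  qed
  have "\<not> \<kappa> \<subseteq> {v}" using card_mono[of "{v}" \<kappa>] assms(1,3) by auto
  then obtain w0 where w0: "w0 \<in> \<kappa>" "w0 \<noteq> v" by auto
  obtain \<tau> where \<tau>: "\<tau> \<in> M" "v \<in> \<tau>" using ex[OF w0] by auto
  have "\<kappa> \<subseteq> \<tau>"
  proof
    fix w assume w: "w \<in> \<kappa>"
    show "w \<in> \<tau>"
    proof (cases "w = v")
      case False
      then obtain \<rho> where \<rho>: "\<rho> \<in> M" "v \<in> \<rho>" "w \<in> \<rho>" using ex[OF w] by auto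
      then have "\<rho> = \<tau>" using \<tau> assms(5) by (metis disjointD disjoint_iff)
      then show ?thesis using \<rho> by simp
    qed (use \<tau> in simp)
  qed
  then have "\<kappa> = \<tau>" using assms(3) assms(6)[OF \<tau>(1)] by (metis card_subset_eq)
  then show ?thesis using \<tau> by simp
qed

text \<open>
  Force the edges of \<open>M\<close>. That no \<open>K\<^sub>k\<close> lies outside the vertices of \<open>M\<close>, and that none
  but the blocks meets them, are decreasing events; by Harris' inequality they occur together with at least the product of their
  probabilities, and together they say that \<open>M\<close> is the set of all \<open>k\<close>-cliques.
\<close>

lemma matching_weight:
  fixes V :: "'a set"
  assumes V: "finite V" and q: "0 \<le> q" "q \<le> 1/2" and k: "3 \<le> k" and M: "M \<subseteq> ksets V k" "disjoint M"
  shows "q ^ (card M * (k choose 2)) * rexp (pairs (V - \<Union>M)) q (\<lambda>X. of_bool (cliques (V - \<Union>M) k X = {})) * 4 powr (- near_cost V k q M)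
    \<le> rexp (pairs V) q (\<lambda>X. of_bool (cliques V k X = M))"
proof -
  define P where "P = pairs V"
  define EM where "EM = edges_of M"
  define P' where "P' = P - EM"
  define W where "W = V - \<Union>M"
  define I where "I = {\<kappa>\<in>ksets V k. \<kappa> \<notin> M \<and> \<kappa> \<inter> \<Union>M \<noteq> {}}"
  define F where "F = (\<lambda>\<kappa>. pairs \<kappa> - EM)"
  define d where "d = (\<lambda>X. of_bool (\<forall>\<kappa>\<in>I. F \<kappa> \<subseteq> P' \<longrightarrow> \<not> F \<kappa> \<subseteq> X) :: real)"
  define f where "f = (\<lambda>X. of_bool (cliques W k X = {}) :: real)"
  have finP: "finite P" "finite P'" using V by (auto simp: P_def P'_def)
  have finM: "finite M" using M V finite_subset finite_ksets by blast
  have fM: "finite \<tau> \<and> card \<tau> = k" if "\<tau> \<in> M" for \<tau>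
    using that M V finite_subset[of \<tau> V] unfolding ksets_def by auto
  have EMP: "EM \<subseteq> P" unfolding EM_def P_def by (rule edges_of_subset[OF M(1)])
  have cEM: "card EM = card M * (k choose 2)" unfolding EM_def by (rule card_edges_of[OF finM M(2) fM])
  have WP: "pairs W \<subseteq> P'"
  proof -
    have "pairs W \<inter> EM = {}"
      unfolding EM_def by (rule pairs_inter_edges_of_empty) (auto simp: W_def)
    then show ?thesis unfolding P'_def P_def W_def ksets_def by auto
  qed
  have rf: "rexp P' q f = rexp (pairs W) q f"
  proof -
    have "rexp P' q f = rexp P' q (\<lambda>X. f (X \<inter> pairs W))"
    proof (rule rexp_cong)
      fix X
      have "cliques W k X = cliques W k (X \<inter> pairs W)" unfolding cliques_def ksets_def by fastforce
      then show "f X = f (X \<inter> pairs W)" unfolding f_def by simp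
    qed
    also have "\<dots> = rexp (pairs W) q f" by (rule rexp_restrict[OF finP(2) WP])
    finally show ?thesis .
  qed
  have rd: "4 powr (- near_cost V k q M) \<le> rexp P' q d"
  proof -
    have "4 powr (- (\<Sum>\<kappa>\<in>I. q ^ card (F \<kappa>))) \<le> rexp P' q (\<lambda>X. of_bool (\<forall>\<kappa>\<in>I. F \<kappa> \<subseteq> P' \<longrightarrow> \<not> F \<kappa> \<subseteq> X))"
    proof (rule rexp_avoid_ge_powr[OF finP(2) q])
      show "finite I" unfolding I_def using V by simp
      fix \<kappa> assume \<kappa>: "\<kappa> \<in> I"
      then have fk: "finite \<kappa>" "card \<kappa> = k" "\<kappa> \<notin> M" using V finite_subset unfolding I_def ksets_def by auto
      have "F \<kappa> \<noteq> {}"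
      proof
        assume "F \<kappa> = {}"
        then have "pairs \<kappa> \<subseteq> edges_of M" unfolding F_def EM_def by auto
        then show False using clique_in_matching[OF k fk(1,2) _ M(2) fM] fk(3) by blast
      qed
      then show "card (F \<kappa>) \<ge> 1" using fk unfolding F_def by (simp add: Suc_leI card_gt_0_iff)
    qed
    then show ?thesis by (simp only: near_cost_def I_def F_def EM_def d_def)
  qed
  have rf0: "0 \<le> rexp P' q f" unfolding f_def using q by (intro rexp_nonneg) auto
  have "rexp P' q f * 4 powr (- near_cost V k q M) \<le> rexp P' q f * rexp P' q d"
    by (intro mult_left_mono rd rf0)
  also have "\<dots> \<le> rexp P' q (\<lambda>X. f X * d X)"
  proof (rule rexp_Harris[OF finP(2)])
    show "f Y \<le> f X" if "X \<subseteq> Y" for X Y using that unfolding f_def cliques_def by auto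
    show "d Y \<le> d X" if "X \<subseteq> Y" for X Y using that unfolding d_def by (auto simp: of_bool_def dest: order_trans)
  qed (use q in auto)
  also have "\<dots> \<le> rexp P' q (\<lambda>X. of_bool (cliques V k (X \<union> EM) = M))"
  proof (rule rexp_mono)
    fix X assume X: "X \<subseteq> P'"
    show "f X * d X \<le> of_bool (cliques V k (X \<union> EM) = M)"
    proof (cases "cliques W k X = {} \<and> d X = 1")
      case True
      have "cliques V k (X \<union> EM) \<subseteq> M"
      proof
        fix \<kappa> assume \<kappa>: "\<kappa> \<in> cliques V k (X \<union> EM)"
        show "\<kappa> \<in> M"
        proof (rule ccontr)
          assume n: "\<kappa> \<notin> M"
          show False
          proof (cases "\<kappa> \<inter> \<Union>M = {}")
            case True2: True
            have "pairs \<kappa> \<inter> EM = {}" unfolding EM_def by (rule pairs_inter_edges_of_empty[OF True2])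
            moreover have "pairs \<kappa> \<subseteq> X \<union> EM" "\<kappa> \<subseteq> V" "card \<kappa> = k" using \<kappa> unfolding cliques_def ksets_def[of V] by auto
            ultimately have "pairs \<kappa> \<subseteq> X" "\<kappa> \<subseteq> W" unfolding W_def using True2 by blast+
            then have "\<kappa> \<in> cliques W k X" using \<open>card \<kappa> = k\<close> unfolding cliques_def ksets_def[of W] by auto
            then show False using True by auto
          next
            case False
            then have "\<kappa> \<in> I" using \<kappa> n unfolding I_def cliques_def by auto
            moreover have "F \<kappa> \<subseteq> P'" using \<kappa> unfolding F_def P'_def P_def cliques_def ksets_def by auto
            moreover have "F \<kappa> \<subseteq> X" using \<kappa> unfolding F_def cliques_def by auto
            ultimately show False using True unfolding d_def by auto
          qed
        qed
      qed
      moreover have "M \<subseteq> cliques V k (X \<union> EM)"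
      proof
        fix \<tau> assume "\<tau> \<in> M"
        then have "\<tau> \<in> ksets V k" "pairs \<tau> \<subseteq> EM" using M(1) unfolding EM_def edges_of_def by blast+
        then show "\<tau> \<in> cliques V k (X \<union> EM)" unfolding cliques_def by blast
      qed
      ultimately have "cliques V k (X \<union> EM) = M" by (rule equalityI)
      moreover have "f X * d X \<le> 1" unfolding f_def d_def by simp
      ultimately show ?thesis by simp
    next
      case False
      then have z: "f X * d X = 0" unfolding f_def d_def by auto
      show ?thesis unfolding z by simp
    qed
  qed (use q in auto)
  finally have A: "rexp (pairs W) q f * 4 powr (- near_cost V k q M) \<le> rexp P' q (\<lambda>X. of_bool (cliques V k (X \<union> EM) = M))"
    using rf by simp
  have "q ^ card EM * (rexp (pairs W) q f * 4 powr (- near_cost V k q M)) \<le> q ^ card EM * rexp P' q (\<lambda>X. of_bool (cliques V k (X \<union> EM) = M))"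
    using A q by (intro mult_left_mono) auto
  also have "\<dots> = rexp P q (\<lambda>X. of_bool (EM \<subseteq> X) * of_bool (cliques V k X = M))"
    unfolding P'_def by (rule rexp_superset[OF finP(1) EMP, symmetric])
  also have "\<dots> \<le> rexp P q (\<lambda>X. of_bool (cliques V k X = M))"
    using q by (intro rexp_mono) auto
  finally show ?thesis unfolding cEM P_def W_def f_def by (simp add: mult.assoc)
qed

text \<open>
  The events that the set of all \<open>k\<close>-cliques equals \<open>M\<close> are disjoint for distinct \<open>M\<close>.
\<close>

lemma matching_sum_bound:
  fixes V :: "'a set"
  assumes V: "finite V" and q: "0 \<le> q" "q \<le> 1/2" and k: "3 \<le> k"
    and Ms: "\<And>M. M \<in> Ms \<Longrightarrow> M \<subseteq> ksets V k \<and> disjoint M \<and> near_cost V k q M \<le> Q"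
  shows "(\<Sum>M\<in>Ms. q ^ (card M * (k choose 2)) * rexp (pairs (V - \<Union>M)) q (\<lambda>X. of_bool (cliques (V - \<Union>M) k X = {}))) \<le> 4 powr Q"
proof -
  have finMs: "finite Ms"
    by (rule finite_subset[of _ "Pow (ksets V k)"]) (use Ms V in auto)
  define a where "a = (\<lambda>M. q ^ (card M * (k choose 2)) * rexp (pairs (V - \<Union>M)) q (\<lambda>X. of_bool (cliques (V - \<Union>M) k X = {})))"
  have a0: "0 \<le> a M" for M unfolding a_def using q by (intro mult_nonneg_nonneg rexp_nonneg) auto
  have "(\<Sum>M\<in>Ms. a M) * 4 powr (- Q) = (\<Sum>M\<in>Ms. a M * 4 powr (- Q))" by (simp add: sum_distrib_right)
  also have "\<dots> \<le> (\<Sum>M\<in>Ms. a M * 4 powr (- near_cost V k q M))"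
    using a0 Ms by (intro sum_mono mult_left_mono powr_mono) auto
  also have "\<dots> \<le> (\<Sum>M\<in>Ms. rexp (pairs V) q (\<lambda>X. of_bool (cliques V k X = M)))"
    unfolding a_def using Ms by (intro sum_mono matching_weight[OF V q k]) auto
  also have "\<dots> = rexp (pairs V) q (\<lambda>X. \<Sum>M\<in>Ms. of_bool (cliques V k X = M))" by (rule rexp_sum[symmetric])
  also have "\<dots> \<le> rexp (pairs V) q (\<lambda>X. 1)"
  proof (rule rexp_mono)
    fix X
    have "(\<Sum>M\<in>Ms. of_bool (cliques V k X = M) :: real) = of_bool (cliques V k X \<in> Ms)"
      using finMs by (simp add: of_bool_def)
    then show "(\<Sum>M\<in>Ms. of_bool (cliques V k X = M) :: real) \<le> 1" by simp
  qed (use q in auto)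
  also have "\<dots> = 1" using V by (simp add: rexp_const)
  finally have "(\<Sum>M\<in>Ms. a M) * 4 powr (- Q) \<le> 1" .
  then show ?thesis unfolding a_def by (simp add: powr_minus field_simps)
qed

section \<open>Typicality of the random graph\<close>

lemma card_ksets_containing:
  assumes "finite V" "g \<subseteq> V" "card g \<le> s"
  shows "card {\<tau>\<in>ksets V s. g \<subseteq> \<tau>} \<le> card V ^ (s - card g)"
proof -
  have "card {\<tau>\<in>ksets V s. g \<subseteq> \<tau>} \<le> card (ksets V (s - card g))"
  proof (rule card_inj_on_le[of "\<lambda>\<tau>. \<tau> - g"])
    show "inj_on (\<lambda>\<tau>. \<tau> - g) {\<tau>\<in>ksets V s. g \<subseteq> \<tau>}" unfolding inj_on_def by blast
    show "(\<lambda>\<tau>. \<tau> - g) ` {\<tau>\<in>ksets V s. g \<subseteq> \<tau>} \<subseteq> ksets V (s - card g)"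
      using assms finite_subset[OF assms(2,1)] by (auto simp: ksets_def card_Diff_subset)
  qed (use assms in simp)
  then show ?thesis using card_ksets_le[OF assms(1)] order_trans by blast
qed

text \<open>
  Expand the power one factor at a time. The vertices of the index chosen so far are added to the exposed set \<open>A\<close>; by
  assumption the expected sum stays below \<open>L\<close> even if all pairs within \<open>A\<close> are present.
\<close>

lemma moment_bound:
  fixes V :: "'a set" and wt :: "'i \<Rightarrow> 'a set set"
  assumes V: "finite V" and q: "0 \<le> q" "q \<le> 1/2" and fI: "finite I"
    and wt: "\<And>i. i \<in> I \<Longrightarrow> wt i \<subseteq> pairs (vs i) \<and> vs i \<subseteq> V \<and> card (vs i) \<le> c"
    and L: "\<And>A. v \<in> A \<Longrightarrow> A \<subseteq> V \<Longrightarrow> card A \<le> a0 \<Longrightarrow> (\<Sum>i\<in>I. (2 * q) ^ card (wt i - pairs A)) \<le> L"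
    and "F \<subseteq> pairs A" "v \<in> A" "A \<subseteq> V" "card A + c * j \<le> a0" and L0: "0 \<le> L"
  shows "rexp (pairs V) q (\<lambda>X. q ^ card (F - X) * (\<Sum>i\<in>I. q ^ card (wt i - X)) ^ j) \<le> (2 * q) ^ card F * L ^ j"
  using assms(7-10)
proof (induction j arbitrary: F A)
  case 0
  have "F \<subseteq> pairs V" using 0 ksets_mono by blast
  then show ?case using rexp_power_card_diff[of "pairs V" F q] V q by simp
next
  case (Suc j)
  have finA: "finite A" using Suc.prems V finite_subset by blast
  have finF: "finite F" using Suc.prems(1) finA finite_subset finite_ksets by blast
  have fw: "finite (wt i)" if "i \<in> I" for i
    using wt[OF that] V by (meson finite_ksets finite_subset)
  have "rexp (pairs V) q (\<lambda>X. q ^ card (F - X) * (\<Sum>i\<in>I. q ^ card (wt i - X)) ^ Suc j)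
    \<le> rexp (pairs V) q (\<lambda>X. \<Sum>i\<in>I. q ^ card ((F \<union> wt i) - X) * (\<Sum>i\<in>I. q ^ card (wt i - X)) ^ j)"
  proof (rule rexp_mono)
    fix X
    have "q ^ card (F - X) * (\<Sum>i\<in>I. q ^ card (wt i - X)) ^ Suc j
      = (\<Sum>i\<in>I. q ^ (card (F - X) + card (wt i - X)) * (\<Sum>i\<in>I. q ^ card (wt i - X)) ^ j)"
      by (simp add: sum_distrib_left sum_distrib_right power_add mult_ac)
    also have "\<dots> \<le> (\<Sum>i\<in>I. q ^ card ((F \<union> wt i) - X) * (\<Sum>i\<in>I. q ^ card (wt i - X)) ^ j)"
    proof (intro sum_mono mult_right_mono)
      fix i
      have "card (F \<union> wt i - X) \<le> card (F - X) + card (wt i - X)" unfolding Un_Diff by (rule card_Un_le)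
      then show "q ^ (card (F - X) + card (wt i - X)) \<le> q ^ card (F \<union> wt i - X)"
        using q by (intro power_decreasing) auto
    qed (use q in \<open>auto intro!: zero_le_power sum_nonneg\<close>)
    finally show "q ^ card (F - X) * (\<Sum>i\<in>I. q ^ card (wt i - X)) ^ Suc j \<le> (\<Sum>i\<in>I. q ^ card ((F \<union> wt i) - X) * (\<Sum>i\<in>I. q ^ card (wt i - X)) ^ j)" .
  qed (use q in auto)
  also have "\<dots> = (\<Sum>i\<in>I. rexp (pairs V) q (\<lambda>X. q ^ card ((F \<union> wt i) - X) * (\<Sum>i\<in>I. q ^ card (wt i - X)) ^ j))"
    by (rule rexp_sum)
  also have "\<dots> \<le> (\<Sum>i\<in>I. (2 * q) ^ card (F \<union> wt i) * L ^ j)"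
  proof (rule sum_mono)
    fix i assume i: "i \<in> I"
    show "rexp (pairs V) q (\<lambda>X. q ^ card ((F \<union> wt i) - X) * (\<Sum>i\<in>I. q ^ card (wt i - X)) ^ j) \<le> (2 * q) ^ card (F \<union> wt i) * L ^ j"
    proof (rule Suc.IH)
      show "F \<union> wt i \<subseteq> pairs (A \<union> vs i)"
        using Suc.prems(1) wt[OF i] ksets_mono[of A "A \<union> vs i" 2] ksets_mono[of "vs i" "A \<union> vs i" 2] by auto
      show "card (A \<union> vs i) + c * j \<le> a0"
        using Suc.prems(4) wt[OF i] card_Un_le[of A "vs i"] by simp
    qed (use Suc.prems wt[OF i] in auto)
  qed
  also have "\<dots> \<le> (\<Sum>i\<in>I. ((2 * q) ^ card F * (2 * q) ^ card (wt i - pairs A)) * L ^ j)"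
  proof (intro sum_mono mult_right_mono)
    fix i assume i: "i \<in> I"
    have "card (F \<union> wt i) = card F + card (wt i - F)"
      using finF fw[OF i] by (metis Un_Diff_cancel card_Un_disjoint Diff_disjoint finite_Diff)
    moreover have "card (wt i - pairs A) \<le> card (wt i - F)"
      using Suc.prems(1) fw[OF i] by (intro card_mono) auto
    ultimately have "card F + card (wt i - pairs A) \<le> card (F \<union> wt i)" by simp
    then have "(2 * q) ^ card (F \<union> wt i) \<le> (2 * q) ^ (card F + card (wt i - pairs A))"
      using q by (intro power_decreasing) auto
    then show "(2 * q) ^ card (F \<union> wt i) \<le> (2 * q) ^ card F * (2 * q) ^ card (wt i - pairs A)" by (simp add: power_add)
  qed (use L0 in auto)
  also have "\<dots> = (2 * q) ^ card F * L ^ j * (\<Sum>i\<in>I. (2 * q) ^ card (wt i - pairs A))"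
    by (simp add: sum_distrib_left mult_ac)
  also have "\<dots> \<le> (2 * q) ^ card F * L ^ j * L"
    using q L0 Suc.prems by (intro mult_left_mono L) auto
  finally show ?case by (simp add: mult_ac)
qed

text \<open>
  All pairs with an end in \<open>e\<close> are new, and so is the pair formed by a vertex of \<open>\<sigma>\<close> in
  \<open>A\<close> but not in \<open>\<tau>\<close> and one in \<open>\<tau>\<close> but not in \<open>A\<close>.
\<close>

lemma card_new_pairs:
  assumes fin: "finite \<sigma>" and \<sigma>: "card \<sigma> = s" and e: "e = \<sigma> - \<tau> - A"
  shows "(card e choose 2) + card e * (s - card e) + of_bool ((\<sigma> - \<tau>) \<inter> A \<noteq> {} \<and> \<not> \<sigma> \<inter> \<tau> \<subseteq> A)
     \<le> card (pairs \<sigma> - pairs \<tau> - pairs A)"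
proof -
  define r where "r = \<sigma> - e"
  have fe: "finite e" "finite r" "e \<subseteq> \<sigma>" "r \<inter> e = {}" "\<sigma> = e \<union> r" using fin e by (auto simp: r_def)
  have cr: "card r = s - card e" unfolding r_def using fe \<sigma> by (simp add: card_Diff_subset)
  define S1 where "S1 = pairs e"
  define S2 where "S2 = (\<lambda>(x, y). {x, y}) ` (e \<times> r)"
  have c1: "card S1 = card e choose 2" unfolding S1_def using fe by (simp add: card_ksets)
  have c2: "card S2 = card e * (s - card e)"
  proof -
    have "inj_on (\<lambda>(x, y). {x, y}) (e \<times> r)" using fe(4) by (auto simp: inj_on_def doubleton_eq_iff)
    then show ?thesis unfolding S2_def using cr by (simp add: card_image card_cartesian_product)
  qed
  have d12: "S1 \<inter> S2 = {}" unfolding S1_def S2_def ksets_def using fe(4) by auto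
  have S12: "S1 \<union> S2 \<subseteq> pairs \<sigma> - pairs \<tau> - pairs A"
  proof -
    have *: "z \<in> pairs \<sigma> - pairs \<tau> - pairs A" if "z \<subseteq> \<sigma>" "card z = 2" "x \<in> z" "x \<in> e" for z x
      using that e unfolding ksets_def by auto
    show ?thesis
    proof
      fix z assume "z \<in> S1 \<union> S2"
      then show "z \<in> pairs \<sigma> - pairs \<tau> - pairs A"
      proof
        assume "z \<in> S1"
        then have z: "z \<subseteq> e" "card z = 2" unfolding S1_def ksets_def by auto
        then have "z \<noteq> {}" by auto
        then obtain x where "x \<in> z" by auto
        then show ?thesis using z fe(3) by (intro *) auto
      next
        assume "z \<in> S2"
        then obtain x y where z: "z = {x, y}" "x \<in> e" "y \<in> r" unfolding S2_def by auto
        then have "x \<noteq> y" using fe(4) by auto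
        then show ?thesis using z fe(5) by (intro *[of z x]) auto
      qed
    qed
  qed
  have finS: "finite S1" "finite S2" unfolding S1_def S2_def using fe by auto
  have finR: "finite (pairs \<sigma> - pairs \<tau> - pairs A)" using fin by simp
  show ?thesis
  proof (cases "(\<sigma> - \<tau>) \<inter> A \<noteq> {} \<and> \<not> \<sigma> \<inter> \<tau> \<subseteq> A")
    case True
    then obtain b y where b: "b \<in> \<sigma>" "b \<notin> \<tau>" "b \<in> A" and y: "y \<in> \<sigma>" "y \<in> \<tau>" "y \<notin> A" by auto
    have "b \<noteq> y" using b y by auto
    then have new: "{b, y} \<in> pairs \<sigma> - pairs \<tau> - pairs A" using b y unfolding ksets_def by auto
    have "b \<notin> e" "y \<notin> e" using b y e by auto
    then have notin: "{b, y} \<notin> S1 \<union> S2" unfolding S1_def S2_def ksets_def using fe(4) by (auto simp: doubleton_eq_iff)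
    have "card (insert {b, y} (S1 \<union> S2)) \<le> card (pairs \<sigma> - pairs \<tau> - pairs A)"
      using S12 new finR by (intro card_mono) auto
    moreover have "card (insert {b, y} (S1 \<union> S2)) = card S1 + card S2 + 1"
      using notin finS d12 by (simp add: card_Un_disjoint)
    moreover have "of_bool ((\<sigma> - \<tau>) \<inter> A \<noteq> {} \<and> \<not> \<sigma> \<inter> \<tau> \<subseteq> A) = (1::nat)" using True by simp
    ultimately show ?thesis unfolding c1 c2 by linarith
  next
    case False
    have "card (S1 \<union> S2) \<le> card (pairs \<sigma> - pairs \<tau> - pairs A)" using S12 finR by (intro card_mono)
    moreover have "card (S1 \<union> S2) = card S1 + card S2" using finS d12 by (simp add: card_Un_disjoint)
    moreover have "of_bool ((\<sigma> - \<tau>) \<inter> A \<noteq> {} \<and> \<not> \<sigma> \<inter> \<tau> \<subseteq> A) = (0::nat)" using False by simp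
    ultimately show ?thesis unfolding c1 c2 by linarith
  qed
qed

lemma sum_le_by_inj:
  fixes f :: "'a \<Rightarrow> real" and g :: "'b \<Rightarrow> real"
  assumes "finite B" "inj_on h A" "h ` A \<subseteq> B" "\<And>x. x \<in> A \<Longrightarrow> f x \<le> g (h x)" "\<And>y. y \<in> B \<Longrightarrow> 0 \<le> g y"
  shows "sum f A \<le> sum g B"
proof -
  have "sum f A \<le> sum (g \<circ> h) A" by (rule sum_mono) (use assms in auto)
  also have "\<dots> = sum g (h ` A)" by (rule sum.reindex[symmetric, OF assms(2)])
  also have "\<dots> \<le> sum g B" using assms by (intro sum_mono2) auto
  finally show ?thesis .
qed

text \<open>
  Classify \<open>\<sigma>\<close> by its traces \<open>f\<close> on \<open>\<tau>\<close> and \<open>bb\<close> on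
  \<open>A\<close>, and by the set \<open>e\<close> of its new vertices. If \<open>bb\<close> is empty, there is at least one new
  vertex, whence the bound \<open>b\<close>. Otherwise there are few choices for \<open>bb\<close>, and either an additional pair
  costs \<open>2 q\<close> or \<open>\<tau>\<close> has two vertices in \<open>A\<close>, which is rare when \<open>\<tau>\<close>
  varies.
\<close>

lemma overlap_sum_bound:
  fixes V :: "'a set"
  assumes V: "finite V" "n = card V" and q: "0 \<le> q" "q \<le> 1/2" and s: "3 \<le> s"
    and \<tau>: "\<tau> \<in> ksets V s" and A: "A \<subseteq> V" "card A \<le> a0" "1 \<le> a0"
    and b: "\<And>i. 1 \<le> i \<Longrightarrow> i \<le> s - 2 \<Longrightarrow> real n ^ i * (2 * q) ^ ((i choose 2) + i * (s - i)) \<le> b" and b1: "0 \<le> b" "b \<le> 1"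
  shows "(\<Sum>\<sigma>\<in>{\<sigma>\<in>ksets V s. \<sigma> \<noteq> \<tau> \<and> 2 \<le> card (\<sigma> \<inter> \<tau>)}. (2 * q) ^ card (pairs \<sigma> - pairs \<tau> - pairs A))
    \<le> 2 ^ s * (b + real (Suc s) * real a0 ^ s * (2 * q) + real (Suc s) * real a0 ^ s * of_bool (2 \<le> card (\<tau> \<inter> A)))"
proof -
  define S where "S = {\<sigma>\<in>ksets V s. \<sigma> \<noteq> \<tau> \<and> 2 \<le> card (\<sigma> \<inter> \<tau>)}"
  define G where "G = (\<lambda>i. (2 * q) ^ ((i choose 2) + i * (s - i)))"
  define x :: "'a set \<Rightarrow> 'a set \<Rightarrow> real" where "x = (\<lambda>f bb. if bb = {} then 1 else if f \<subseteq> A then of_bool (2 \<le> card (\<tau> \<inter> A)) else 2 * q)"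
  define B where "B = {bb. bb \<subseteq> A \<and> card bb \<le> s}"
  define \<Phi> where "\<Phi> = {f. f \<subseteq> \<tau> \<and> 2 \<le> card f \<and> card f < s}"
  define I where "I = (SIGMA f:\<Phi>. SIGMA bb:{bb\<in>B. card f + card bb \<le> s}. ksets V (s - card f - card bb))"
  have finA: "finite A" using A V finite_subset by blast
  have fin\<tau>: "finite \<tau>" "card \<tau> = s" using \<tau> V finite_subset unfolding ksets_def by auto
  have finB: "finite B" unfolding B_def using finA by simp
  have fin\<Phi>: "finite \<Phi>" unfolding \<Phi>_def using fin\<tau> by simp
  have x0: "0 \<le> x f bb" for f bb unfolding x_def using q by auto
  have G0: "0 \<le> G i" for i unfolding G_def using q by simp
  have "(\<Sum>\<sigma>\<in>S. (2 * q) ^ card (pairs \<sigma> - pairs \<tau> - pairs A)) \<le> (\<Sum>(f, bb, e)\<in>I. G (s - card f - card bb) * x f bb)"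
  proof (rule sum_le_by_inj[where h = "\<lambda>\<sigma>. (\<sigma> \<inter> \<tau>, (\<sigma> - \<tau>) \<inter> A, \<sigma> - \<tau> - A)"])
    show "finite I" unfolding I_def using fin\<Phi> finB V by auto
    show "inj_on (\<lambda>\<sigma>. (\<sigma> \<inter> \<tau>, (\<sigma> - \<tau>) \<inter> A, \<sigma> - \<tau> - A)) S" unfolding inj_on_def by blast
    have parts: "finite \<sigma>" "card \<sigma> = s" "\<sigma> \<subseteq> V" "card (\<sigma> \<inter> \<tau>) + card ((\<sigma> - \<tau>) \<inter> A) + card (\<sigma> - \<tau> - A) = s"
      "2 \<le> card (\<sigma> \<inter> \<tau>)" "card (\<sigma> \<inter> \<tau>) < s" if "\<sigma> \<in> S" for \<sigma>
    proof -
      show \<sigma>: "finite \<sigma>" "card \<sigma> = s" "\<sigma> \<subseteq> V" "2 \<le> card (\<sigma> \<inter> \<tau>)" using that V finite_subset unfolding S_def ksets_def by auto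
      show "card (\<sigma> \<inter> \<tau>) + card ((\<sigma> - \<tau>) \<inter> A) + card (\<sigma> - \<tau> - A) = s"
        using card_Int_Diff[OF \<sigma>(1), of \<tau>] card_Int_Diff[of "\<sigma> - \<tau>" A] \<sigma> by simp
      have "\<sigma> \<inter> \<tau> \<noteq> \<sigma>"
      proof
        assume "\<sigma> \<inter> \<tau> = \<sigma>"
        then have "\<sigma> = \<tau>" using card_subset_eq[OF fin\<tau>(1), of \<sigma>] \<sigma> fin\<tau> by auto
        then show False using that unfolding S_def by auto
      qed
      then show "card (\<sigma> \<inter> \<tau>) < s" using psubset_card_mono[OF \<sigma>(1), of "\<sigma> \<inter> \<tau>"] \<sigma>(2) by auto
    qed
    show "(\<lambda>\<sigma>. (\<sigma> \<inter> \<tau>, (\<sigma> - \<tau>) \<inter> A, \<sigma> - \<tau> - A)) ` S \<subseteq> I"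
    proof (rule image_subsetI)
      fix \<sigma> assume "\<sigma> \<in> S"
      note P = parts[OF this]
      have "\<sigma> \<inter> \<tau> \<in> \<Phi>" unfolding \<Phi>_def using P by auto
      moreover have "(\<sigma> - \<tau>) \<inter> A \<in> {bb\<in>B. card (\<sigma> \<inter> \<tau>) + card bb \<le> s}" unfolding B_def using P(4) by auto
      moreover have "\<sigma> - \<tau> - A \<in> ksets V (s - card (\<sigma> \<inter> \<tau>) - card ((\<sigma> - \<tau>) \<inter> A))"
        unfolding ksets_def using P(3,4) by auto
      ultimately show "(\<sigma> \<inter> \<tau>, (\<sigma> - \<tau>) \<inter> A, \<sigma> - \<tau> - A) \<in> I" unfolding I_def by blast
    qed
    show "(2 * q) ^ card (pairs \<sigma> - pairs \<tau> - pairs A) \<le> (case (\<sigma> \<inter> \<tau>, (\<sigma> - \<tau>) \<inter> A, \<sigma> - \<tau> - A) of (f, bb, e) \<Rightarrow> G (s - card f - card bb) * x f bb)"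
      if "\<sigma> \<in> S" for \<sigma>
    proof -
      note P = parts[OF that]
      define e where "e = \<sigma> - \<tau> - A"
      define f where "f = \<sigma> \<inter> \<tau>"
      define bb where "bb = (\<sigma> - \<tau>) \<inter> A"
      have ce: "s - card f - card bb = card e" using P(4) unfolding e_def f_def bb_def by simp
      have "(2 * q) ^ card (pairs \<sigma> - pairs \<tau> - pairs A) \<le> (2 * q) ^ ((card e choose 2) + card e * (s - card e) + of_bool (bb \<noteq> {} \<and> \<not> f \<subseteq> A))"
        using card_new_pairs[OF P(1,2) e_def] q unfolding f_def bb_def by (intro power_decreasing) auto
      also have "\<dots> = G (card e) * (2 * q) ^ of_bool (bb \<noteq> {} \<and> \<not> f \<subseteq> A)" unfolding G_def by (rule power_add)
      also have "\<dots> \<le> G (card e) * x f bb"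
      proof (rule mult_left_mono[OF _ G0])
        have "2 \<le> card (\<tau> \<inter> A)" if "f \<subseteq> A"
        proof -
          have "card f \<le> card (\<tau> \<inter> A)" using that finA unfolding f_def by (intro card_mono) auto
          then show ?thesis using P(5) unfolding f_def by simp
        qed
        then show "(2 * q) ^ of_bool (bb \<noteq> {} \<and> \<not> f \<subseteq> A) \<le> x f bb" unfolding x_def by auto
      qed
      finally show ?thesis using ce unfolding e_def f_def bb_def by simp
    qed
    show "0 \<le> (case y of (f, bb, e) \<Rightarrow> G (s - card f - card bb) * x f bb)" for y
      using x0 G0 by (auto split: prod.splits)
  qed
  also have "\<dots> = (\<Sum>f\<in>\<Phi>. \<Sum>(bb, e)\<in>(SIGMA bb:{bb\<in>B. card f + card bb \<le> s}. ksets V (s - card f - card bb)). G (s - card f - card bb) * x f bb)"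
    unfolding I_def using fin\<Phi> finB V by (intro sum.Sigma[symmetric]) auto
  also have "\<dots> = (\<Sum>f\<in>\<Phi>. \<Sum>bb\<in>{bb\<in>B. card f + card bb \<le> s}. \<Sum>e\<in>ksets V (s - card f - card bb). G (s - card f - card bb) * x f bb)"
    using finB V by (intro sum.cong[OF refl] sum.Sigma[symmetric]) auto
  also have "\<dots> \<le> (\<Sum>f\<in>\<Phi>. b + real (Suc s) * real a0 ^ s * (2 * q) + real (Suc s) * real a0 ^ s * of_bool (2 \<le> card (\<tau> \<inter> A)))"
  proof (rule sum_mono)
    fix f assume f: "f \<in> \<Phi>"
    define y where "y = 2 * q + of_bool (2 \<le> card (\<tau> \<inter> A))"
    have y0: "0 \<le> y" using q by (simp add: y_def)
    have inner: "(\<Sum>e\<in>ksets V (s - card f - card bb). G (s - card f - card bb) * x f bb) \<le> (if bb = {} then b else y)"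
      if bb: "bb \<in> {bb\<in>B. card f + card bb \<le> s}" for bb
    proof -
      define i where "i = s - card f - card bb"
      have i2: "i \<le> s - 2" using f unfolding i_def \<Phi>_def by auto
      have "(\<Sum>e\<in>ksets V i. G i * x f bb) = real (card (ksets V i)) * G i * x f bb" by simp
      also have "\<dots> \<le> real n ^ i * G i * x f bb"
      proof (intro mult_right_mono)
        have "card (ksets V i) \<le> n ^ i" using card_ksets_le[OF V(1)] V(2) by simp
        then show "real (card (ksets V i)) \<le> real n ^ i" by (metis of_nat_le_iff of_nat_power)
      qed (use x0 G0 in auto)
      also have "\<dots> \<le> (if bb = {} then b else y)"
      proof (cases "bb = {}")
        case True
        then have "1 \<le> i" using f unfolding i_def \<Phi>_def by auto
        then have "real n ^ i * G i \<le> b" unfolding G_def using b i2 by blast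
        then show ?thesis using True by (simp add: x_def)
      next
        case False
        have "real n ^ i * G i \<le> 1"
        proof (cases "i = 0")
          case True
          then show ?thesis unfolding G_def by (simp add: binomial_eq_0)
        next
          case False
          then have "real n ^ i * G i \<le> b" unfolding G_def using b[of i] i2 by simp
          then show ?thesis using b1 by simp
        qed
        then have "real n ^ i * G i * x f bb \<le> 1 * x f bb" by (intro mult_right_mono x0)
        also have "x f bb \<le> y" using False q unfolding x_def y_def by auto
        finally show ?thesis using False by simp
      qed
      finally show ?thesis unfolding i_def .
    qed
    have cB: "real (card B) \<le> real (Suc s) * real a0 ^ s"
    proof -
      have "B \<subseteq> (\<Union>j\<in>{..s}. ksets A j)" unfolding B_def ksets_def by auto
      then have "card B \<le> card (\<Union>j\<in>{..s}. ksets A j)" using finA by (intro card_mono) auto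
      also have "\<dots> \<le> (\<Sum>j\<in>{..s}. card (ksets A j))" by (rule card_UN_le) simp
      also have "\<dots> \<le> (\<Sum>j\<in>{..s}. a0 ^ s)"
      proof (rule sum_mono)
        fix j assume "j \<in> {..s}"
        then have j: "j \<le> s" by simp
        have "card (ksets A j) \<le> card A ^ j" by (rule card_ksets_le[OF finA])
        also have "\<dots> \<le> a0 ^ j" using A by (intro power_mono) auto
        also have "\<dots> \<le> a0 ^ s" using j A by (intro power_increasing) auto
        finally show "card (ksets A j) \<le> a0 ^ s" .
      qed
      also have "\<dots> = Suc s * a0 ^ s" by simp
      finally show ?thesis by (metis of_nat_le_iff of_nat_mult of_nat_power)
    qed
    have "(\<Sum>bb\<in>{bb\<in>B. card f + card bb \<le> s}. \<Sum>e\<in>ksets V (s - card f - card bb). G (s - card f - card bb) * x f bb)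
      \<le> (\<Sum>bb\<in>{bb\<in>B. card f + card bb \<le> s}. if bb = {} then b else y)"
      by (intro sum_mono inner)
    also have "\<dots> \<le> (\<Sum>bb\<in>B. (if bb = {} then b else 0) + y)"
      using finB b1 y0 by (intro order_trans[OF sum_mono2[of B] sum_mono]) auto
    also have "\<dots> = (\<Sum>bb\<in>B. if bb = {} then b else 0) + real (card B) * y" by (simp add: sum.distrib)
    also have "\<dots> \<le> b + (real (Suc s) * real a0 ^ s) * y"
      using cB y0 b1 finB by (intro add_mono mult_right_mono) (auto simp: sum.delta)
    finally show "(\<Sum>bb\<in>{bb\<in>B. card f + card bb \<le> s}. \<Sum>e\<in>ksets V (s - card f - card bb). G (s - card f - card bb) * x f bb)
      \<le> b + real (Suc s) * real a0 ^ s * (2 * q) + real (Suc s) * real a0 ^ s * of_bool (2 \<le> card (\<tau> \<inter> A))"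
      unfolding y_def by (simp add: algebra_simps)
  qed
  also have "\<dots> = real (card \<Phi>) * (b + real (Suc s) * real a0 ^ s * (2 * q) + real (Suc s) * real a0 ^ s * of_bool (2 \<le> card (\<tau> \<inter> A)))"
    by simp
  also have "\<dots> \<le> 2 ^ s * (b + real (Suc s) * real a0 ^ s * (2 * q) + real (Suc s) * real a0 ^ s * of_bool (2 \<le> card (\<tau> \<inter> A)))"
  proof (rule mult_right_mono)
    have "card \<Phi> \<le> card (Pow \<tau>)" unfolding \<Phi>_def using fin\<tau> by (intro card_mono) auto
    then have "card \<Phi> \<le> 2 ^ s" using fin\<tau> by (simp add: card_Pow)
    then show "real (card \<Phi>) \<le> 2 ^ s" by (metis of_nat_le_iff of_nat_numeral of_nat_power)
  qed (use b1 q in auto)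
  finally show ?thesis unfolding S_def .
qed

text \<open>
  Markov's inequality for the \<open>j\<close>-th moment. For \<open>j\<close> of order \<open>log n\<close> the bound survives a
  union over all vertices, while the exposed set still has only logarithmic size.
\<close>

lemma overlap_typical:
  fixes V :: "'a set"
  assumes V: "finite V" "n = card V" and q: "0 \<le> q" "q \<le> 1/2" and s: "3 \<le> s" and v: "v \<in> V"
    and a0: "1 + 2 * s * j \<le> a0"
    and b: "\<And>i. 1 \<le> i \<Longrightarrow> i \<le> s - 2 \<Longrightarrow> real n ^ i * (2 * q) ^ ((i choose 2) + i * (s - i)) \<le> b" and b1: "0 \<le> b" "b \<le> 1"
    and L: "L = 2 ^ s * (real n ^ (s - 1) * (b + real (Suc s) * real a0 ^ s * (2 * q)) + real (Suc s) * real a0 ^ s * (real a0 * real n ^ (s - 2)))"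
    and E: "0 < E"
  shows "rexp (pairs V) q (\<lambda>X. of_bool (E < vertex_cost V s q v X)) \<le> (L / E) ^ j"
proof -
  define I where "I = (SIGMA \<tau>:{\<tau>\<in>ksets V s. v \<in> \<tau>}. {\<sigma>\<in>ksets V s. \<sigma> \<noteq> \<tau> \<and> 2 \<le> card (\<sigma> \<inter> \<tau>)})"
  define wt where "wt = (\<lambda>(\<tau>::'a set, \<sigma>::'a set). pairs \<sigma> - pairs \<tau>)"
  define Y where "Y = (\<lambda>X. \<Sum>i\<in>I. q ^ card (wt i - X))"
  have finI: "finite I" unfolding I_def using V by auto
  have Yeq: "vertex_cost V s q v X = Y X" for X
  proof -
    have "pairs \<sigma> - (X \<union> pairs \<tau>) = pairs \<sigma> - pairs \<tau> - X" for \<sigma> \<tau> by auto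
    then show ?thesis unfolding Y_def I_def wt_def overlap_cost_def using V by (simp add: sum.Sigma case_prod_unfold)
  qed
  have Y0: "0 \<le> Y X" for X unfolding Y_def using q by (intro sum_nonneg) auto
  have L0: "0 \<le> L" unfolding L using b1 q by auto
  have n1: "1 \<le> a0" using a0 by simp
  have count1: "real (card {\<tau>\<in>ksets V s. v \<in> \<tau>}) \<le> real n ^ (s - 1)"
    using card_ksets_containing[OF V(1), of "{v}" s] v s V(2) by (simp flip: of_nat_power)
  have Lsum: "(\<Sum>i\<in>I. (2 * q) ^ card (wt i - pairs A)) \<le> L" if A: "v \<in> A" "A \<subseteq> V" "card A \<le> a0" for A
  proof -
    have finA: "finite A" using A V finite_subset by blast
    have "(\<Sum>i\<in>I. (2 * q) ^ card (wt i - pairs A)) = (\<Sum>\<tau>\<in>{\<tau>\<in>ksets V s. v \<in> \<tau>}. \<Sum>\<sigma>\<in>{\<sigma>\<in>ksets V s. \<sigma> \<noteq> \<tau> \<and> 2 \<le> card (\<sigma> \<inter> \<tau>)}. (2 * q) ^ card (pairs \<sigma> - pairs \<tau> - pairs A))"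
      unfolding I_def wt_def using V by (simp add: sum.Sigma case_prod_unfold)
    also have "\<dots> \<le> (\<Sum>\<tau>\<in>{\<tau>\<in>ksets V s. v \<in> \<tau>}. 2 ^ s * (b + real (Suc s) * real a0 ^ s * (2 * q) + real (Suc s) * real a0 ^ s * of_bool (2 \<le> card (\<tau> \<inter> A))))"
      by (intro sum_mono overlap_sum_bound[OF V q s _ A(2,3) n1 b b1]) auto
    also have "\<dots> = 2 ^ s * (real (card {\<tau>\<in>ksets V s. v \<in> \<tau>}) * (b + real (Suc s) * real a0 ^ s * (2 * q))
       + real (Suc s) * real a0 ^ s * (\<Sum>\<tau>\<in>{\<tau>\<in>ksets V s. v \<in> \<tau>}. of_bool (2 \<le> card (\<tau> \<inter> A))))"
      by (simp add: sum.distrib sum_distrib_left algebra_simps)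
    also have "\<dots> \<le> L"
      unfolding L
    proof (intro mult_left_mono add_mono mult_right_mono count1)
      have "(\<Sum>\<tau>\<in>{\<tau>\<in>ksets V s. v \<in> \<tau>}. of_bool (2 \<le> card (\<tau> \<inter> A)) :: real) = real (card {\<tau>\<in>ksets V s. v \<in> \<tau> \<and> 2 \<le> card (\<tau> \<inter> A)})"
        using V by (simp add: of_bool_def sum.If_cases Int_def conj_assoc)
      also have "\<dots> \<le> real (card (\<Union>w\<in>A - {v}. {\<tau>\<in>ksets V s. {v, w} \<subseteq> \<tau>}))"
      proof -
        have "{\<tau>\<in>ksets V s. v \<in> \<tau> \<and> 2 \<le> card (\<tau> \<inter> A)} \<subseteq> (\<Union>w\<in>A - {v}. {\<tau>\<in>ksets V s. {v, w} \<subseteq> \<tau>})"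
        proof
          fix \<tau> assume t: "\<tau> \<in> {\<tau>\<in>ksets V s. v \<in> \<tau> \<and> 2 \<le> card (\<tau> \<inter> A)}"
          have "\<not> \<tau> \<inter> A \<subseteq> {v}" using card_mono[of "{v}" "\<tau> \<inter> A"] t by auto
          then show "\<tau> \<in> (\<Union>w\<in>A - {v}. {\<tau>\<in>ksets V s. {v, w} \<subseteq> \<tau>})" using t by auto
        qed
        then show ?thesis using finA V by (intro of_nat_mono card_mono) auto
      qed
      also have "\<dots> \<le> real (\<Sum>w\<in>A - {v}. card {\<tau>\<in>ksets V s. {v, w} \<subseteq> \<tau>})"
        using finA by (intro of_nat_mono card_UN_le) auto
      also have "\<dots> \<le> real (\<Sum>w\<in>A - {v}. n ^ (s - 2))"
      proof (intro of_nat_mono sum_mono)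
        fix w assume "w \<in> A - {v}"
        then have vw: "{v, w} \<subseteq> V" "card {v, w} = 2" using v A(2) by auto
        moreover have "card {v, w} \<le> s" using vw s by simp
        ultimately show "card {\<tau>\<in>ksets V s. {v, w} \<subseteq> \<tau>} \<le> n ^ (s - 2)"
          using card_ksets_containing[OF V(1), of "{v, w}" s] by (simp only: V(2))
      qed
      also have "\<dots> = real (card (A - {v})) * real n ^ (s - 2)" by simp
      also have "\<dots> \<le> real a0 * real n ^ (s - 2)"
        using A finA card_mono[of A "A - {v}"] by (intro mult_right_mono) auto
      finally show "(\<Sum>\<tau>\<in>{\<tau>\<in>ksets V s. v \<in> \<tau>}. of_bool (2 \<le> card (\<tau> \<inter> A)) :: real) \<le> real a0 * real n ^ (s - 2)" .
    qed (use b1 q in auto)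
    finally show ?thesis .
  qed
  have wts: "wt i \<subseteq> pairs (vs i) \<and> vs i \<subseteq> V \<and> card (vs i) \<le> 2 * s" if "i \<in> I" "vs = (\<lambda>(\<tau>, \<sigma>). \<tau> \<union> \<sigma>)" for i vs
  proof -
    obtain \<tau> \<sigma> where i: "i = (\<tau>, \<sigma>)" by (cases i)
    have "\<tau> \<subseteq> V" "\<sigma> \<subseteq> V" "card \<tau> = s" "card \<sigma> = s" using that(1) unfolding i I_def ksets_def by auto
    then show ?thesis unfolding that(2) i wt_def using card_Un_le[of \<tau> \<sigma>] ksets_mono[of \<sigma> "\<tau> \<union> \<sigma>" 2] by auto
  qed
  have "rexp (pairs V) q (\<lambda>X. q ^ card ({} - X) * (\<Sum>i\<in>I. q ^ card (wt i - X)) ^ j) \<le> (2 * q) ^ card ({}::'a set set) * L ^ j"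
  proof (rule moment_bound[OF V(1) q finI, where vs = "\<lambda>(\<tau>, \<sigma>). \<tau> \<union> \<sigma>" and c = "2 * s" and v = v and A = "{v}"])
    show "wt i \<subseteq> pairs ((\<lambda>(\<tau>, \<sigma>). \<tau> \<union> \<sigma>) i) \<and> (\<lambda>(\<tau>, \<sigma>). \<tau> \<union> \<sigma>) i \<subseteq> V \<and> card ((\<lambda>(\<tau>, \<sigma>). \<tau> \<union> \<sigma>) i) \<le> 2 * s" if "i \<in> I" for i
      by (rule wts[OF that refl])
    show "(\<Sum>i\<in>I. (2 * q) ^ card (wt i - pairs A)) \<le> L" if "v \<in> A" "A \<subseteq> V" "card A \<le> a0" for A
      by (rule Lsum[OF that])
  qed (use v a0 L0 in auto)
  then have mom: "rexp (pairs V) q (\<lambda>X. Y X ^ j) \<le> L ^ j" unfolding Y_def by simp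
  have "rexp (pairs V) q (\<lambda>X. of_bool (E < Y X)) \<le> rexp (pairs V) q (\<lambda>X. (1 / E) ^ j * Y X ^ j)"
  proof (rule rexp_mono)
    fix X
    show "of_bool (E < Y X) \<le> (1 / E) ^ j * Y X ^ j"
    proof (cases "E < Y X")
      case True
      then have "1 \<le> (Y X / E) ^ j" using E by (intro one_le_power) simp
      then show ?thesis using True by (simp add: power_divide)
    qed (use Y0 E in auto)
  qed (use q in auto)
  also have "\<dots> \<le> (1 / E) ^ j * L ^ j" unfolding rexp_cmult using mom E by (intro mult_left_mono) auto
  finally show ?thesis unfolding Yeq by (simp add: power_divide)
qed

text \<open>
  The expansion of \<open>\<Prod> (1 + x a)\<close> without its constant and linear terms.
\<close>

lemma sum_large_subsets:
  fixes x :: "'a \<Rightarrow> real"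
  assumes "finite F" "\<And>a. a \<in> F \<Longrightarrow> 0 \<le> x a" "sum x F \<le> 1"
  shows "(\<Sum>T\<in>{T\<in>Pow F. 2 \<le> card T}. prod x T) \<le> (sum x F)\<^sup>2"
proof -
  have "(\<Prod>a\<in>F. x a + 1) = (\<Sum>T\<in>Pow F. prod x T)" using prod_add[OF assms(1), of x "\<lambda>_. 1"] by simp
  also have "Pow F = {T\<in>Pow F. 2 \<le> card T} \<union> ((\<lambda>a. {a}) ` F \<union> {{}})"
  proof (intro equalityI subsetI)
    fix T assume T: "T \<in> Pow F"
    then have fT: "finite T" using assms finite_subset by auto
    show "T \<in> {T\<in>Pow F. 2 \<le> card T} \<union> ((\<lambda>a. {a}) ` F \<union> {{}})"
    proof (cases "2 \<le> card T")
      case False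
      then have "card T = 0 \<or> card T = 1" by auto
      then show ?thesis using fT T by (auto simp: card_1_singleton_iff)
    qed (use T in auto)
  qed auto
  also have "(\<Sum>T\<in>\<dots>. prod x T) = (\<Sum>T\<in>{T\<in>Pow F. 2 \<le> card T}. prod x T) + (\<Sum>T\<in>(\<lambda>a. {a}) ` F \<union> {{}}. prod x T)"
    using assms by (intro sum.union_disjoint) auto
  also have "(\<Sum>T\<in>(\<lambda>a. {a}) ` F \<union> {{}}. prod x T) = (\<Sum>T\<in>(\<lambda>a. {a}) ` F. prod x T) + 1"
    using assms by (subst sum.union_disjoint) auto
  also have "(\<Sum>T\<in>(\<lambda>a. {a}) ` F. prod x T) = sum x F" by (subst sum.reindex) auto
  finally have e: "(\<Sum>T\<in>{T\<in>Pow F. 2 \<le> card T}. prod x T) = (\<Prod>a\<in>F. x a + 1) - 1 - sum x F" by simp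
  have "(\<Prod>a\<in>F. x a + 1) \<le> (\<Prod>a\<in>F. exp (x a))"
    using assms exp_ge_add_one_self by (intro prod_mono) (auto simp: add.commute)
  also have "\<dots> = exp (sum x F)" using assms(1) by (simp add: exp_sum)
  also have "\<dots> \<le> 1 + sum x F + (sum x F)\<^sup>2" using assms by (intro exp_bound) (auto intro!: sum_nonneg)
  finally show ?thesis using e by simp
qed

text \<open>
  Among at least two disjoint blocks that share an edge with \<open>\<sigma>\<close>, each meets \<open>\<sigma>\<close> in at most
  \<open>s - 2\<close> vertices. Blocks that meet \<open>\<sigma>\<close> in a given set of size \<open>f\<close> contribute at most
  \<open>\<eta>\<close>, and a family of companions contributes at least two such factors.
\<close>

lemma joint_cost_expectation:
  fixes V :: "'a set"
  assumes V: "finite V" "n = card V" and q: "0 < q" "q \<le> 1/2" and p: "0 \<le> p"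
    and eta: "\<And>f. 2 \<le> f \<Longrightarrow> f \<le> s - 2 \<Longrightarrow> real n ^ (s - f) * p / (2 * q) ^ (f choose 2) \<le> \<eta>" and e1: "0 \<le> \<eta>" "2 ^ s * \<eta> \<le> 1"
  shows "rexp (pairs V) q (joint_cost V s q p) \<le> real n ^ s * (2 * q) ^ (s choose 2) * (2 ^ s * \<eta>)\<^sup>2"
proof -
  have one: "(\<Sum>T\<in>companions V s \<sigma>. p ^ card T * (2 * q) ^ card (pairs \<sigma> - edges_of T)) \<le> (2 * q) ^ (s choose 2) * (2 ^ s * \<eta>)\<^sup>2"
    if \<sigma>: "\<sigma> \<in> ksets V s" for \<sigma>
  proof -
    have fin\<sigma>: "finite \<sigma>" "card \<sigma> = s" "\<sigma> \<subseteq> V" using \<sigma> V finite_subset unfolding ksets_def by auto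
    define F where "F = {\<tau>\<in>ksets V s. 2 \<le> card (\<sigma> \<inter> \<tau>) \<and> card (\<sigma> \<inter> \<tau>) \<le> s - 2}"
    define x where "x = (\<lambda>\<tau>. p / (2 * q) ^ (card (\<sigma> \<inter> \<tau>) choose 2))"
    have finF: "finite F" unfolding F_def using V by simp
    have x0: "0 \<le> x \<tau>" for \<tau> unfolding x_def using p q by simp
    have sub: "companions V s \<sigma> \<subseteq> {T\<in>Pow F. 2 \<le> card T}"
    proof
      fix T assume T: "T \<in> companions V s \<sigma>"
      have T': "T \<subseteq> ksets V s" "disjoint T" "2 \<le> card T" "\<And>\<tau>. \<tau> \<in> T \<Longrightarrow> 2 \<le> card (\<sigma> \<inter> \<tau>)"
        using T unfolding companions_def by auto
      have "card (\<sigma> \<inter> \<tau>) \<le> s - 2" if t: "\<tau> \<in> T" for \<tau>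
      proof -
        have "\<not> T \<subseteq> {\<tau>}" using card_mono[of "{\<tau>}" T] T'(3) by auto
        then obtain \<rho> where \<rho>: "\<rho> \<in> T" "\<rho> \<noteq> \<tau>" by auto
        then have "\<rho> \<inter> \<tau> = {}" using disjointD[OF T'(2)] t by blast
        then have "card (\<sigma> \<inter> \<rho>) + card (\<sigma> \<inter> \<tau>) = card ((\<sigma> \<inter> \<rho>) \<union> (\<sigma> \<inter> \<tau>))"
          using fin\<sigma> by (intro card_Un_disjoint[symmetric]) auto
        also have "\<dots> \<le> s" using card_mono[OF fin\<sigma>(1), of "(\<sigma> \<inter> \<rho>) \<union> (\<sigma> \<inter> \<tau>)"] fin\<sigma> by auto
        finally show ?thesis using T'(4)[OF \<rho>(1)] by simp
      qed
      then show "T \<in> {T\<in>Pow F. 2 \<le> card T}" using T' unfolding F_def by auto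
    qed
    have term_eq: "p ^ card T * (2 * q) ^ card (pairs \<sigma> - edges_of T) = (2 * q) ^ (s choose 2) * prod x T"
      if T: "T \<in> companions V s \<sigma>" for T
    proof -
      have T': "T \<subseteq> ksets V s" "disjoint T" using T unfolding companions_def by auto
      have finT: "finite T" using T' V finite_subset finite_ksets by blast
      have "card (pairs \<sigma>) = card (pairs \<sigma> \<inter> edges_of T) + card (pairs \<sigma> - edges_of T)"
        using fin\<sigma> by (intro card_Int_Diff) simp
      then have e: "s choose 2 = (\<Sum>\<tau>\<in>T. card (\<sigma> \<inter> \<tau>) choose 2) + card (pairs \<sigma> - edges_of T)"
        using card_pairs_inter_edges_of[OF fin\<sigma>(1) finT T'(2)] fin\<sigma> by (simp add: card_ksets)
      have "prod x T = p ^ card T / (2 * q) ^ (\<Sum>\<tau>\<in>T. card (\<sigma> \<inter> \<tau>) choose 2)"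
        unfolding x_def by (simp add: prod_dividef power_sum)
      then show ?thesis unfolding e using q by (simp add: power_add)
    qed
    have "sum x F \<le> 2 ^ s * \<eta>"
    proof -
      define \<Phi> where "\<Phi> = {g. g \<subseteq> \<sigma> \<and> 2 \<le> card g \<and> card g \<le> s - 2}"
      have fin\<Phi>: "finite \<Phi>" unfolding \<Phi>_def using fin\<sigma> by simp
      have "sum x F = (\<Sum>g\<in>\<Phi>. \<Sum>\<tau>\<in>{\<tau>\<in>F. \<sigma> \<inter> \<tau> = g}. x \<tau>)"
        using finF fin\<Phi> by (intro sum.group[symmetric]) (auto simp: F_def \<Phi>_def)
      also have "\<dots> \<le> (\<Sum>g\<in>\<Phi>. \<eta>)"
      proof (rule sum_mono)
        fix g assume g: "g \<in> \<Phi>"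
        have g': "g \<subseteq> V" "2 \<le> card g" "card g \<le> s - 2" "card g \<le> s" using g fin\<sigma> unfolding \<Phi>_def by auto
        have "(\<Sum>\<tau>\<in>{\<tau>\<in>F. \<sigma> \<inter> \<tau> = g}. x \<tau>) = real (card {\<tau>\<in>F. \<sigma> \<inter> \<tau> = g}) * (p / (2 * q) ^ (card g choose 2))"
          unfolding x_def by simp
        also have "\<dots> \<le> real n ^ (s - card g) * (p / (2 * q) ^ (card g choose 2))"
        proof (rule mult_right_mono)
          have "card {\<tau>\<in>F. \<sigma> \<inter> \<tau> = g} \<le> card {\<tau>\<in>ksets V s. g \<subseteq> \<tau>}"
            using V by (intro card_mono) (auto simp: F_def)
          also have "\<dots> \<le> n ^ (s - card g)" using card_ksets_containing[OF V(1) g'(1,4)] V(2) by simp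
          finally show "real (card {\<tau>\<in>F. \<sigma> \<inter> \<tau> = g}) \<le> real n ^ (s - card g)" by (metis of_nat_le_iff of_nat_power)
        qed (use p q in simp)
        also have "\<dots> \<le> \<eta>" using eta[OF g'(2,3)] by simp
        finally show "(\<Sum>\<tau>\<in>{\<tau>\<in>F. \<sigma> \<inter> \<tau> = g}. x \<tau>) \<le> \<eta>" .
      qed
      also have "\<dots> = real (card \<Phi>) * \<eta>" by simp
      also have "\<dots> \<le> 2 ^ s * \<eta>"
      proof (rule mult_right_mono)
        have "card \<Phi> \<le> card (Pow \<sigma>)" unfolding \<Phi>_def using fin\<sigma> by (intro card_mono) auto
        then have "card \<Phi> \<le> 2 ^ s" using fin\<sigma> by (simp add: card_Pow)
        then show "real (card \<Phi>) \<le> 2 ^ s" by (metis of_nat_le_iff of_nat_numeral of_nat_power)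
      qed (use e1 in simp)
      finally show ?thesis .
    qed
    then have xF: "sum x F \<le> 2 ^ s * \<eta>" "0 \<le> sum x F" using x0 by (auto intro!: sum_nonneg)
    have "(\<Sum>T\<in>companions V s \<sigma>. p ^ card T * (2 * q) ^ card (pairs \<sigma> - edges_of T)) = (2 * q) ^ (s choose 2) * (\<Sum>T\<in>companions V s \<sigma>. prod x T)"
      unfolding sum_distrib_left by (intro sum.cong refl term_eq)
    also have "(\<Sum>T\<in>companions V s \<sigma>. prod x T) \<le> (\<Sum>T\<in>{T\<in>Pow F. 2 \<le> card T}. prod x T)"
      using sub finF x0 by (intro sum_mono2) (auto intro!: prod_nonneg)
    also have "\<dots> \<le> (sum x F)\<^sup>2" using finF x0 xF e1 by (intro sum_large_subsets) auto
    also have "\<dots> \<le> (2 ^ s * \<eta>)\<^sup>2" using xF by (intro power_mono)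
    finally show ?thesis using q by (simp add: mult_left_mono)
  qed
  have "rexp (pairs V) q (joint_cost V s q p) = (\<Sum>\<sigma>\<in>ksets V s. \<Sum>T\<in>companions V s \<sigma>. p ^ card T * rexp (pairs V) q (\<lambda>X. q ^ card ((pairs \<sigma> - edges_of T) - X)))"
  proof -
    have "joint_cost V s q p = (\<lambda>X. \<Sum>\<sigma>\<in>ksets V s. \<Sum>T\<in>companions V s \<sigma>. p ^ card T * q ^ card ((pairs \<sigma> - edges_of T) - X))"
    proof
      fix X :: "'a set set"
      have "pairs \<sigma> - (X \<union> edges_of T) = (pairs \<sigma> - edges_of T) - X" for \<sigma> T by auto
      then show "joint_cost V s q p X = (\<Sum>\<sigma>\<in>ksets V s. \<Sum>T\<in>companions V s \<sigma>. p ^ card T * q ^ card ((pairs \<sigma> - edges_of T) - X))"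
        unfolding joint_cost_def by simp
    qed
    then show ?thesis by (simp add: rexp_sum rexp_cmult)
  qed
  also have "\<dots> \<le> (\<Sum>\<sigma>\<in>ksets V s. \<Sum>T\<in>companions V s \<sigma>. p ^ card T * (2 * q) ^ card (pairs \<sigma> - edges_of T))"
  proof (intro sum_mono mult_left_mono rexp_power_card_diff)
    show "finite (pairs V)" using V by simp
    show "pairs \<sigma> - edges_of T \<subseteq> pairs V" if "\<sigma> \<in> ksets V s" for \<sigma> T using that unfolding ksets_def by auto
  qed (use q p in auto)
  also have "\<dots> \<le> (\<Sum>\<sigma>\<in>ksets V s. (2 * q) ^ (s choose 2) * (2 ^ s * \<eta>)\<^sup>2)" by (intro sum_mono one)
  also have "\<dots> = real (card (ksets V s)) * ((2 * q) ^ (s choose 2) * (2 ^ s * \<eta>)\<^sup>2)" by simp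
  also have "\<dots> \<le> real n ^ s * ((2 * q) ^ (s choose 2) * (2 ^ s * \<eta>)\<^sup>2)"
  proof (rule mult_right_mono)
    have "card (ksets V s) \<le> n ^ s" using card_ksets_le[OF V(1)] V(2) by simp
    then show "real (card (ksets V s)) \<le> real n ^ s" by (metis of_nat_le_iff of_nat_power)
  qed (use q in auto)
  finally show ?thesis by (simp add: mult.assoc)
qed

section \<open>The union bound over matchings\<close>

definition leaves_much :: "'a set \<Rightarrow> nat \<Rightarrow> nat \<Rightarrow> real \<Rightarrow> 'a set set \<Rightarrow> bool" where
  "leaves_much V k s r X \<longleftrightarrow> (\<exists>M. M \<subseteq> cliques V k X \<and> disjoint M \<and>
     cliques (V - \<Union>M) k X = {} \<and> poorly_covered (V - \<Union>M) s r X)"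

lemma cliques_restrict: "W \<subseteq> V \<Longrightarrow> cliques W k (X \<inter> pairs W) = cliques W k X"
  unfolding cliques_def ksets_def by blast

lemma overlap_cost_subset:
  assumes "finite V" "W \<subseteq> V" "0 \<le> q"
  shows "overlap_cost W s q \<tau> (X \<inter> pairs W \<union> F) \<le> overlap_cost V s q \<tau> (X \<union> F)"
proof -
  have "overlap_cost W s q \<tau> (X \<inter> pairs W \<union> F) = (\<Sum>\<sigma>\<in>{\<sigma>\<in>ksets W s. \<sigma> \<noteq> \<tau> \<and> card (\<sigma> \<inter> \<tau>) \<ge> 2}. q ^ card (pairs \<sigma> - (X \<union> F)))"
    unfolding overlap_cost_def
  proof (rule sum.cong[OF refl])
    fix \<sigma> assume "\<sigma> \<in> {\<sigma>\<in>ksets W s. \<sigma> \<noteq> \<tau> \<and> card (\<sigma> \<inter> \<tau>) \<ge> 2}"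
    then have "pairs \<sigma> \<subseteq> pairs W" by (intro ksets_mono) (auto simp: ksets_def)
    then have "pairs \<sigma> - (X \<inter> pairs W \<union> F) = pairs \<sigma> - (X \<union> F)" by blast
    then show "q ^ card (pairs \<sigma> - (X \<inter> pairs W \<union> F)) = q ^ card (pairs \<sigma> - (X \<union> F))" by simp
  qed
  also have "\<dots> \<le> overlap_cost V s q \<tau> (X \<union> F)"
    unfolding overlap_cost_def using assms ksets_mono[OF assms(2)] by (intro sum_mono2) auto
  finally show ?thesis .
qed

lemma joint_cost_subset:
  assumes "finite V" "W \<subseteq> V" "0 \<le> q" "0 \<le> p"
  shows "joint_cost W s q p (X \<inter> pairs W) \<le> joint_cost V s q p X"
proof -
  have sub: "ksets W s \<subseteq> ksets V s" by (rule ksets_mono[OF assms(2)])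
  have comp: "companions W s \<sigma> \<subseteq> companions V s \<sigma>" for \<sigma> unfolding companions_def using sub by blast
  have "joint_cost W s q p (X \<inter> pairs W)
    = (\<Sum>\<sigma>\<in>ksets W s. \<Sum>T\<in>companions W s \<sigma>. p ^ card T * q ^ card (pairs \<sigma> - (X \<union> edges_of T)))"
    unfolding joint_cost_def
  proof (intro sum.cong refl)
    fix \<sigma> T assume "\<sigma> \<in> ksets W s"
    then have "pairs \<sigma> \<subseteq> pairs W" by (intro ksets_mono) (auto simp: ksets_def)
    then have "pairs \<sigma> - (X \<inter> pairs W \<union> edges_of T) = pairs \<sigma> - (X \<union> edges_of T)" by blast
    then show "p ^ card T * q ^ card (pairs \<sigma> - (X \<inter> pairs W \<union> edges_of T)) = p ^ card T * q ^ card (pairs \<sigma> - (X \<union> edges_of T))" by simp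
  qed
  also have "\<dots> \<le> (\<Sum>\<sigma>\<in>ksets W s. \<Sum>T\<in>companions V s \<sigma>. p ^ card T * q ^ card (pairs \<sigma> - (X \<union> edges_of T)))"
    using assms comp finite_companions[OF assms(1)] by (intro sum_mono sum_mono2) auto
  also have "\<dots> \<le> joint_cost V s q p X"
    unfolding joint_cost_def using assms sub by (intro sum_mono2) (auto intro!: sum_nonneg)
  finally show ?thesis .
qed

text \<open>
  All terms are nonnegative, and those of \<open>W\<close> are among those of \<open>V\<close>. Hence typicality has to be ensured
  only once, for the whole vertex set, and not for each uncovered set.
\<close>

lemma typical_subset:
  assumes V: "finite V" "W \<subseteq> V" and q: "0 \<le> q" "0 \<le> p" and ty: "typical V s q p E u X"
  shows "typical W s q p E u (X \<inter> pairs W)"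
  unfolding typical_def
proof (intro conjI ballI)
  fix v assume v: "v \<in> W"
  have "(\<Sum>\<tau>\<in>{\<tau>\<in>ksets W s. v \<in> \<tau>}. overlap_cost W s q \<tau> (X \<inter> pairs W \<union> pairs \<tau>))
     \<le> (\<Sum>\<tau>\<in>{\<tau>\<in>ksets W s. v \<in> \<tau>}. overlap_cost V s q \<tau> (X \<union> pairs \<tau>))"
    by (intro sum_mono overlap_cost_subset V q)
  also have "\<dots> \<le> vertex_cost V s q v X"
  proof (rule sum_mono2)
    show "finite {\<tau>\<in>ksets V s. v \<in> \<tau>}" using V by simp
    show "{\<tau>\<in>ksets W s. v \<in> \<tau>} \<subseteq> {\<tau>\<in>ksets V s. v \<in> \<tau>}" using ksets_mono[OF V(2), of s] by blast
    show "0 \<le> overlap_cost V s q \<tau> (X \<union> pairs \<tau>)" for \<tau> unfolding overlap_cost_def using q by (intro sum_nonneg) simp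
  qed
  also have "\<dots> \<le> E" using ty v V unfolding typical_def by auto
  finally show "(\<Sum>\<tau>\<in>{\<tau>\<in>ksets W s. v \<in> \<tau>}. overlap_cost W s q \<tau> (X \<inter> pairs W \<union> pairs \<tau>)) \<le> E" .
next
  show "joint_cost W s q p (X \<inter> pairs W) \<le> u"
    using joint_cost_subset[OF V q] ty unfolding typical_def by (meson order_trans)
qed

lemma card_edges_of_matching:
  assumes "finite V" "M \<subseteq> ksets V k" "disjoint M"
  shows "card (edges_of M) = card M * (k choose 2)"
proof (rule card_edges_of[OF _ assms(3)])
  show "finite M" using assms(1,2) finite_subset finite_ksets by blast
  show "finite \<tau> \<and> card \<tau> = k" if "\<tau> \<in> M" for \<tau>
  proof -
    have "\<tau> \<in> ksets V k" using that assms(2) by blast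
    then have "\<tau> \<subseteq> V" "card \<tau> = k" unfolding ksets_def by blast+
    then show ?thesis using assms(1) finite_subset by blast
  qed
qed

text \<open>
  The edges of \<open>M\<close> are disjoint from the pairs of uncovered vertices.
\<close>

lemma rexp_matching_and_outside:
  assumes V: "finite V" and M: "M \<subseteq> ksets V k" "disjoint M"
  shows "rexp (pairs V) q (\<lambda>X. of_bool (edges_of M \<subseteq> X) * h (X \<inter> pairs (V - \<Union>M)))
    = q ^ (card M * (k choose 2)) * rexp (pairs (V - \<Union>M)) q h"
proof -
  have sub: "edges_of M \<subseteq> pairs V"
  proof -
    have "pairs \<tau> \<subseteq> pairs V" if "\<tau> \<in> M" for \<tau> using that M(1) by (intro ksets_mono) (auto simp: ksets_def)
    then show ?thesis unfolding edges_of_def by blast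
  qed
  have out: "edges_of M \<inter> pairs (V - \<Union>M) = {}"
  proof (rule ccontr)
    assume "edges_of M \<inter> pairs (V - \<Union>M) \<noteq> {}"
    then obtain e \<tau> where e: "\<tau> \<in> M" "e \<subseteq> \<tau>" "card e = 2" "e \<subseteq> V - \<Union>M" unfolding edges_of_def ksets_def by blast
    then have "e = {}" by blast
    then show False using e by simp
  qed
  have "rexp (pairs V) q (\<lambda>X. of_bool (edges_of M \<subseteq> X) * h (X \<inter> pairs (V - \<Union>M)))
    = q ^ card (edges_of M) * rexp (pairs V - edges_of M) q (\<lambda>X. h ((X \<union> edges_of M) \<inter> pairs (V - \<Union>M)))"
    using V by (intro rexp_superset sub) simp
  also have "(\<lambda>X. h ((X \<union> edges_of M) \<inter> pairs (V - \<Union>M))) = (\<lambda>X. h (X \<inter> pairs (V - \<Union>M)))"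
    using out by (simp add: Int_Un_distrib2)
  also have "rexp (pairs V - edges_of M) q (\<lambda>X. h (X \<inter> pairs (V - \<Union>M))) = rexp (pairs (V - \<Union>M)) q h"
    using V out ksets_mono[of "V - \<Union>M" V 2] by (intro rexp_restrict) auto
  finally show ?thesis using card_edges_of_matching[OF V M] by simp
qed

text \<open>
  Split off the atypical graphs and those with more than \<open>Mx\<close> cliques of size \<open>k\<close>. In the others
  \<open>M\<close> has at most \<open>Mx\<close> members, and the events are summed over all such \<open>M\<close>. The bound
  \<open>\<nu>\<close> for the number of rows serves all uncovered sets at once.
\<close>

lemma failure_bound:
  fixes V :: "'a set"
  assumes V: "finite V" "n = card V" "n > 0" and q: "0 < q" "q \<le> 1/2" and s: "3 \<le> s" "k = Suc s"
    and m: "m > 0" "J > 0"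
    and small: "2 * p0 * real m / (q ^ (s choose 2) / 2) \<le> 1/64"
    and dl: "2 * real J * (\<Sum>a<J. (1/4) ^ (n div 2 ^ a)) \<le> dl" "dl > 0" "dl \<le> 1"
    and Mx: "0 \<le> Mx" "2 ^ k * Mx \<le> real n"
    and nu: "\<And>W. W \<subseteq> V \<Longrightarrow> real n \<le> real (card W) + real k * Mx \<Longrightarrow> \<nu> \<le> real (card W div s)" "4 * real s \<le> \<nu>"
    and E: "8 * real s ^ s * E \<le> (\<nu> / 4) ^ (s - 1)" "4 * real s ^ s \<le> (\<nu> / 4) ^ (s - 1)"
    and p0: "switch_const s / \<nu> ^ (s - 1) \<le> p0"
    and u: "u1 > 0" "real s + 8 * real s ^ 2 * u1 \<le> u"
    and dense: "\<And>f. 1 \<le> f \<Longrightarrow> f < k \<Longrightarrow> 1 \<le> real n ^ (f - 1) * q ^ (f choose 2)"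
  shows "rexp (pairs V) q (\<lambda>X. of_bool (leaves_much V k s (u + real (s * (n div 2 ^ J))) X))
    \<le> (\<Sum>v\<in>V. rexp (pairs V) q (\<lambda>X. of_bool (E < vertex_cost V s q v X)))
     + rexp (pairs V) q (\<lambda>X. of_bool (u1 < joint_cost V s q p0 X))
     + rexp (pairs V) q (\<lambda>X. of_bool (Mx < real (card (cliques V k X))))
     + 4 powr (real n ^ k * q ^ (k choose 2) * (2 * 2 ^ k * Mx / real n)) * ((2 * dl) ^ m / dl ^ J)"
proof -
  define r where "r = u + real (s * (n div 2 ^ J))"
  define T1 where "T1 = (\<lambda>v X. E < vertex_cost V s q v X)"
  define T2 where "T2 = (\<lambda>X. u1 < joint_cost V s q p0 X)"
  define T3 where "T3 = (\<lambda>X. Mx < real (card (cliques V k X)))"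
  define Ms where "Ms = {M. M \<subseteq> ksets V k \<and> disjoint M \<and> real (card M) \<le> Mx}"
  define G where "G = (\<lambda>(W :: 'a set) Y. cliques W k Y = {} \<and> typical W s q p0 E u1 Y \<and> poorly_covered W s r Y)"
  have q': "0 \<le> q" "q \<le> 1" using q by auto
  have nu0: "0 < \<nu>" using nu(2) s by simp
  have p0': "0 \<le> p0"
  proof -
    have "0 \<le> switch_const s / \<nu> ^ (s - 1)" using nu0 by simp
    then show ?thesis using p0 by linarith
  qed
  have finMs: "finite Ms"
  proof -
    have "Ms \<subseteq> Pow (ksets V k)" unfolding Ms_def by blast
    then show ?thesis using V(1) by (meson finite_Pow_iff finite_ksets finite_subset)
  qed
  have cover: "of_bool (leaves_much V k s r X) \<le> (\<Sum>v\<in>V. of_bool (T1 v X)) + of_bool (T2 X) + of_bool (T3 X)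
    + (\<Sum>M\<in>Ms. of_bool (edges_of M \<subseteq> X) * of_bool (G (V - \<Union>M) (X \<inter> pairs (V - \<Union>M))) :: real)" (is "_ \<le> ?R") for X
  proof (cases "leaves_much V k s r X \<and> (\<forall>v\<in>V. \<not> T1 v X) \<and> \<not> T2 X \<and> \<not> T3 X")
    case False
    have nn: "0 \<le> (\<Sum>v\<in>V. of_bool (T1 v X) :: real)"
      "0 \<le> (\<Sum>M\<in>Ms. of_bool (edges_of M \<subseteq> X) * of_bool (G (V - \<Union>M) (X \<inter> pairs (V - \<Union>M))) :: real)"
      by (auto intro!: sum_nonneg)
    consider "\<not> leaves_much V k s r X" | v where "v \<in> V" "T1 v X" | "T2 X" | "T3 X" using False by blast
    then show ?thesis
    proof cases
      case 1
      then show ?thesis using nn by simp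
    next
      case 2
      have "of_bool (T1 v X) \<le> (\<Sum>v\<in>V. of_bool (T1 v X) :: real)" by (rule member_le_sum) (use 2 V in auto)
      then have a: "1 \<le> (\<Sum>v\<in>V. of_bool (T1 v X) :: real)" using 2 by simp
      have b: "of_bool (leaves_much V k s r X) \<le> (1::real)" "0 \<le> (of_bool (T2 X) :: real)" "0 \<le> (of_bool (T3 X) :: real)" by auto
      show ?thesis using a b nn(2) by linarith
    next
      case 3
      have b: "of_bool (leaves_much V k s r X) \<le> (1::real)" "(of_bool (T2 X) :: real) = 1" "0 \<le> (of_bool (T3 X) :: real)" using 3 by auto
      show ?thesis using b nn by linarith
    next
      case 4
      have b: "of_bool (leaves_much V k s r X) \<le> (1::real)" "(of_bool (T3 X) :: real) = 1" "0 \<le> (of_bool (T2 X) :: real)" using 4 by auto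
      show ?thesis using b nn by linarith
    qed
  next
    case True
    then obtain M where M: "M \<subseteq> cliques V k X" "disjoint M" "cliques (V - \<Union>M) k X = {}" "poorly_covered (V - \<Union>M) s r X"
      unfolding leaves_much_def by blast
    define W where "W = V - \<Union>M"
    have WV: "W \<subseteq> V" unfolding W_def by blast
    have fc: "finite (cliques V k X)" unfolding cliques_def using V(1) by simp
    have "card M \<le> card (cliques V k X)" using M(1) fc by (rule card_mono[rotated])
    then have "real (card M) \<le> Mx" using True unfolding T3_def by simp
    moreover have "M \<subseteq> ksets V k" using M(1) unfolding cliques_def by blast
    ultimately have MMs: "M \<in> Ms" unfolding Ms_def using M(2) by blast
    have ed: "edges_of M \<subseteq> X" unfolding edges_of_def using M(1) unfolding cliques_def by blast
    have "typical V s q p0 E u1 X" unfolding typical_def using True unfolding T1_def T2_def by (auto simp: not_less)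
    then have "typical W s q p0 E u1 (X \<inter> pairs W)" by (rule typical_subset[OF V(1) WV q'(1) p0'])
    moreover have "cliques W k (X \<inter> pairs W) = {}" using M(3) cliques_restrict[OF WV] unfolding W_def by metis
    moreover have "poorly_covered W s r (X \<inter> pairs W)" using M(4) cliques_restrict[OF WV] unfolding poorly_covered_def W_def by metis
    ultimately have g: "G W (X \<inter> pairs W)" unfolding G_def by blast
    have "of_bool (edges_of M \<subseteq> X) * of_bool (G (V - \<Union>M) (X \<inter> pairs (V - \<Union>M))) \<le> (\<Sum>M\<in>Ms. of_bool (edges_of M \<subseteq> X) * of_bool (G (V - \<Union>M) (X \<inter> pairs (V - \<Union>M))) :: real)"
      by (rule member_le_sum[OF MMs _ finMs]) auto
    then have a: "1 \<le> (\<Sum>M\<in>Ms. of_bool (edges_of M \<subseteq> X) * of_bool (G (V - \<Union>M) (X \<inter> pairs (V - \<Union>M))) :: real)"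
      using g ed unfolding W_def by simp
    have "0 \<le> (\<Sum>v\<in>V. of_bool (T1 v X) :: real)" by (auto intro!: sum_nonneg)
    moreover have "of_bool (leaves_much V k s r X) \<le> (1::real)" "0 \<le> (of_bool (T2 X) :: real)" "0 \<le> (of_bool (T3 X) :: real)" by auto
    ultimately show ?thesis using a by linarith
  qed
  define Q where "Q = real n ^ k * q ^ (k choose 2) * (2 * 2 ^ k * Mx / real n)"
  have each: "rexp (pairs V) q (\<lambda>X. of_bool (edges_of M \<subseteq> X) * of_bool (G (V - \<Union>M) (X \<inter> pairs (V - \<Union>M))))
     \<le> (q ^ (card M * (k choose 2)) * rexp (pairs (V - \<Union>M)) q (\<lambda>X. of_bool (cliques (V - \<Union>M) k X = {}))) * ((2 * dl) ^ m / dl ^ J)"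
    if "M \<in> Ms" for M
  proof -
    have M: "M \<subseteq> ksets V k" "disjoint M" "real (card M) \<le> Mx" using that unfolding Ms_def by auto
    define W where "W = V - \<Union>M"
    have WV: "W \<subseteq> V" "finite W" unfolding W_def using V(1) by auto
    have "n \<le> card W + k * card M"
    proof -
      have "card (\<Union>M) \<le> (\<Sum>\<tau>\<in>M. card \<tau>)" by (rule card_Union_le_sum_card)
      also have "\<dots> = (\<Sum>\<tau>\<in>M. k)"
      proof (rule sum.cong[OF refl])
        fix \<tau> assume "\<tau> \<in> M"
        then have "\<tau> \<in> ksets V k" using M(1) by blast
        then show "card \<tau> = k" unfolding ksets_def by blast
      qed
      finally have "card (\<Union>M) \<le> k * card M" by (simp add: mult.commute)
      moreover have "n - card (\<Union>M) \<le> card W" unfolding W_def V(2)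
      proof (rule diff_card_le_card_Diff)
        have "\<Union>M \<subseteq> V" using M(1) unfolding ksets_def by blast
        then show "finite (\<Union>M)" using V(1) by (rule finite_subset)
      qed
      ultimately show ?thesis by linarith
    qed
    then have "real n \<le> real (card W) + real k * real (card M)" by (metis of_nat_add of_nat_le_iff of_nat_mult)
    also have "\<dots> \<le> real (card W) + real k * Mx" using M(3) by (intro add_left_mono mult_left_mono) auto
    finally have nuW: "\<nu> \<le> real (card W div s)" by (rule nu(1)[OF WV(1)])
    have pow: "(\<nu> / 4) ^ (s - 1) \<le> (real (card W div s) / 4) ^ (s - 1)" using nuW nu0 by (intro power_mono) auto
    have b: "rexp (pairs W) q (\<lambda>X. of_bool (cliques W k X = {} \<and> typical W s q p0 E u1 X \<and> poorly_covered W s r X)) * dl ^ J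
      \<le> (2 * dl) ^ m * rexp (pairs W) q (\<lambda>X. of_bool (cliques W k X = {}))"
      unfolding r_def
    proof (rule poorly_covered_bound[OF WV(2) q s(1) _ _ m small dl refl])
      show "card W \<le> n" unfolding V(2) using WV V(1) by (intro card_mono)
      show "4 * s \<le> card W div s" using nu(2) nuW by linarith
      show "8 * real s ^ s * E \<le> (real (card W div s) / 4) ^ (s - 1)" using E(1) pow by linarith
      show "4 * real s ^ s \<le> (real (card W div s) / 4) ^ (s - 1)" using E(2) pow by linarith
      have "switch_const s / real (card W div s) ^ (s - 1) \<le> switch_const s / \<nu> ^ (s - 1)"
        using nuW nu0 by (intro divide_left_mono power_mono mult_pos_pos zero_less_power) auto
      then show "switch_const s / real (card W div s) ^ (s - 1) \<le> p0" using p0 by linarith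
    qed (use s u in auto)
    have "rexp (pairs V) q (\<lambda>X. of_bool (edges_of M \<subseteq> X) * of_bool (G W (X \<inter> pairs W)))
      = q ^ (card M * (k choose 2)) * rexp (pairs W) q (\<lambda>X. of_bool (G W X))"
      unfolding W_def by (rule rexp_matching_and_outside[OF V(1) M(1,2)])
    also have "\<dots> \<le> q ^ (card M * (k choose 2)) * (((2 * dl) ^ m * rexp (pairs W) q (\<lambda>X. of_bool (cliques W k X = {}))) / dl ^ J)"
      using b dl(2) q' unfolding G_def by (intro mult_left_mono) (auto simp: field_simps)
    finally show ?thesis unfolding W_def by (simp add: mult_ac)
  qed
  have sumM: "(\<Sum>M\<in>Ms. q ^ (card M * (k choose 2)) * rexp (pairs (V - \<Union>M)) q (\<lambda>X. of_bool (cliques (V - \<Union>M) k X = {}))) \<le> 4 powr Q"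
  proof (rule matching_sum_bound[OF V(1) q'(1) q(2)])
    show "3 \<le> k" using s by simp
    fix M assume "M \<in> Ms"
    then have M: "M \<subseteq> ksets V k" "disjoint M" "real (card M) \<le> Mx" unfolding Ms_def by auto
    have "near_cost V k q M \<le> real n ^ k * q ^ (k choose 2) * (2 * 2 ^ k * real (card M) / real n)"
    proof (rule near_cost_bound[OF V q(1) q'(2) _ M(1,2)])
      have "2 ^ k * real (card M) \<le> 2 ^ k * Mx" using M(3) by (intro mult_left_mono) auto
      then show "2 ^ k * real (card M) \<le> real n" using Mx(2) by linarith
    qed (use s dense in auto)
    also have "\<dots> \<le> Q" unfolding Q_def using M(3) q' by (intro mult_left_mono divide_right_mono) auto
    finally show "M \<subseteq> ksets V k \<and> disjoint M \<and> near_cost V k q M \<le> Q" using M by blast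
  qed
  have "rexp (pairs V) q (\<lambda>X. of_bool (leaves_much V k s r X)) \<le> rexp (pairs V) q (\<lambda>X. (\<Sum>v\<in>V. of_bool (T1 v X)) + of_bool (T2 X) + of_bool (T3 X)
    + (\<Sum>M\<in>Ms. of_bool (edges_of M \<subseteq> X) * of_bool (G (V - \<Union>M) (X \<inter> pairs (V - \<Union>M)))))"
    using q' cover by (intro rexp_mono) auto
  also have "\<dots> = (\<Sum>v\<in>V. rexp (pairs V) q (\<lambda>X. of_bool (T1 v X))) + rexp (pairs V) q (\<lambda>X. of_bool (T2 X)) + rexp (pairs V) q (\<lambda>X. of_bool (T3 X))
    + (\<Sum>M\<in>Ms. rexp (pairs V) q (\<lambda>X. of_bool (edges_of M \<subseteq> X) * of_bool (G (V - \<Union>M) (X \<inter> pairs (V - \<Union>M)))))"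
    by (simp only: rexp_add rexp_sum)
  also have "(\<Sum>M\<in>Ms. rexp (pairs V) q (\<lambda>X. of_bool (edges_of M \<subseteq> X) * of_bool (G (V - \<Union>M) (X \<inter> pairs (V - \<Union>M)))))
    \<le> (\<Sum>M\<in>Ms. (q ^ (card M * (k choose 2)) * rexp (pairs (V - \<Union>M)) q (\<lambda>X. of_bool (cliques (V - \<Union>M) k X = {}))) * ((2 * dl) ^ m / dl ^ J))"
    by (intro sum_mono each)
  also have "\<dots> \<le> 4 powr Q * ((2 * dl) ^ m / dl ^ J)"
    unfolding sum_distrib_right[symmetric] using sumM dl(2) by (intro mult_right_mono) auto
  finally show ?thesis unfolding r_def T1_def T2_def T3_def Q_def by simp
qed

section \<open>The binomial random graph\<close>

text \<open>
  Independent Bernoulli indicators of the elements of \<open>P\<close> describe the same random set.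
\<close>

lemma expectation_random_subset:
  assumes "finite P" "0 \<le> q" "q \<le> 1"
  shows "measure_pmf.expectation (Pi_pmf P False (\<lambda>_. bernoulli_pmf q)) (\<lambda>f. h {e\<in>P. f e}) = rexp P q h"
proof -
  have inj: "inj_on (\<lambda>X e. e \<in> X) (Pow P)" by (rule inj_onI) (metis Collect_mem_eq)
  have "measure_pmf.expectation (Pi_pmf P False (\<lambda>_. bernoulli_pmf q)) (\<lambda>f. h {e\<in>P. f e})
    = (\<Sum>f\<in>(\<lambda>X e. e \<in> X) ` Pow P. h {e\<in>P. f e} * pmf (Pi_pmf P False (\<lambda>_. bernoulli_pmf q)) f)"
  proof (rule integral_measure_pmf_real)
    show "finite ((\<lambda>X e. e \<in> X) ` Pow P)" using assms(1) by simp
    fix f assume "f \<in> set_pmf (Pi_pmf P False (\<lambda>_. bernoulli_pmf q))"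
    then have "f \<in> {f. \<forall>e. e \<notin> P \<longrightarrow> f e = False}" using set_Pi_pmf_subset[OF assms(1)] by (rule subsetD[rotated])
    then have "\<And>e. e \<notin> P \<Longrightarrow> \<not> f e" by simp
    then have "f = (\<lambda>e. e \<in> {e. f e})" "{e. f e} \<in> Pow P" by auto
    then show "f \<in> (\<lambda>X e. e \<in> X) ` Pow P" by (rule image_eqI)
  qed
  also have "\<dots> = (\<Sum>X\<in>Pow P. h {e\<in>P. e \<in> X} * pmf (Pi_pmf P False (\<lambda>_. bernoulli_pmf q)) (\<lambda>e. e \<in> X))"
    by (rule sum.reindex[OF inj, unfolded o_def])
  also have "\<dots> = rexp P q h"
    unfolding rexp_def
  proof (rule sum.cong[OF refl])
    fix X assume X: "X \<in> Pow P"
    have "pmf (Pi_pmf P False (\<lambda>_. bernoulli_pmf q)) (\<lambda>e. e \<in> X) = (\<Prod>e\<in>P. pmf (bernoulli_pmf q) (e \<in> X))"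
      using X by (subst pmf_Pi'[OF assms(1)]) auto
    also have "\<dots> = (\<Prod>e\<in>P. if e \<in> X then q else 1 - q)"
      using assms by (intro prod.cong) auto
    also have "\<dots> = q ^ card X * (1 - q) ^ card (P - X)"
    proof -
      have "P \<inter> {e. e \<in> X} = X" "P \<inter> - {e. e \<in> X} = P - X" using X by auto
      then show ?thesis using assms(1) by (simp add: prod.If_cases)
    qed
    finally show "h {e\<in>P. e \<in> X} * pmf (Pi_pmf P False (\<lambda>_. bernoulli_pmf q)) (\<lambda>e. e \<in> X) = q ^ card X * (1 - q) ^ card (P - X) * h X"
      using X by (simp add: Collect_conj_eq Int_absorb1)
  qed
  finally show ?thesis .
qed

lemma prob_random_graph:
  assumes "0 \<le> q" "q \<le> 1"
  shows "measure_pmf.prob (binomial_random_graph n q) {H. P H} = rexp (pairs {1..n}) q (\<lambda>X. of_bool (P ({1..n}, X)))"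
proof -
  have vp: "vertex_pairs n = pairs {1..n}" unfolding vertex_pairs_def ksets_def ..
  have "measure_pmf.prob (binomial_random_graph n q) {H. P H}
    = measure_pmf.expectation (Pi_pmf (pairs {1..n}) False (\<lambda>_. bernoulli_pmf q)) (\<lambda>f. of_bool (P ({1..n}, {e\<in>pairs {1..n}. f e})))"
  proof -
    let ?N = "Pi_pmf (pairs {1..n}) False (\<lambda>_. bernoulli_pmf q)"
    let ?g = "\<lambda>f. ({1..n}, {e\<in>pairs {1..n}. f e})"
    have "measure_pmf.prob (binomial_random_graph n q) {H. P H} = measure_pmf.prob ?N (?g -` {H. P H})"
      unfolding binomial_random_graph_def vp measure_map_pmf ..
    also have "\<dots> = measure_pmf.expectation ?N (indicator (?g -` {H. P H}))" by simp
    also have "indicator (?g -` {H. P H}) = (\<lambda>f. of_bool (P (?g f)) :: real)" by (auto simp: indicator_def)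
    finally show ?thesis .
  qed
  also have "\<dots> = rexp (pairs {1..n}) q (\<lambda>X. of_bool (P ({1..n}, X)))"
    by (rule expectation_random_subset) (use assms in auto)
  finally show ?thesis .
qed

lemma complete_copy_iff:
  assumes "finite V"
  shows "complete_copy l (V, X) S \<longleftrightarrow> S \<in> cliques V l X"
proof -
  have "(\<forall>u\<in>S. \<forall>v\<in>S. u \<noteq> v \<longrightarrow> {u, v} \<in> X) \<longleftrightarrow> pairs S \<subseteq> X"
  proof
    assume *: "\<forall>u\<in>S. \<forall>v\<in>S. u \<noteq> v \<longrightarrow> {u, v} \<in> X"
    show "pairs S \<subseteq> X"
    proof
      fix e assume "e \<in> pairs S"
      then obtain u v where "e = {u, v}" "u \<noteq> v" "e \<subseteq> S" unfolding ksets_def by (auto simp: card_2_iff)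
      then show "e \<in> X" using * by auto
    qed
  next
    assume *: "pairs S \<subseteq> X"
    show "\<forall>u\<in>S. \<forall>v\<in>S. u \<noteq> v \<longrightarrow> {u, v} \<in> X"
    proof (intro ballI impI)
      fix u v assume "u \<in> S" "v \<in> S" "u \<noteq> v"
      then have "{u, v} \<in> pairs S" unfolding ksets_def by simp
      then show "{u, v} \<in> X" using * by blast
    qed
  qed
  then show ?thesis unfolding complete_copy_def cliques_def ksets_def using assms finite_subset by auto
qed

lemma complete_matching_iff:
  assumes "finite V"
  shows "complete_matching l (V, X) M \<longleftrightarrow> M \<subseteq> cliques V l X \<and> disjoint M"
  unfolding complete_matching_def complete_copy_iff[OF assms] by blast

lemma remove_covered_eq: "remove_covered (V, X) M = (V - \<Union>M, {e\<in>X. e \<subseteq> V - \<Union>M})"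
  unfolding remove_covered_def induced_subgraph_def covered_def by auto

lemma maximal_imp_clique_free:
  assumes V: "finite V" and k: "0 < k" and M: "maximal_complete_matching k (V, X) M"
  shows "cliques (V - \<Union>M) k X = {}"
proof (rule ccontr)
  assume "cliques (V - \<Union>M) k X \<noteq> {}"
  then obtain S where S: "S \<subseteq> V - \<Union>M" "card S = k" "pairs S \<subseteq> X" unfolding cliques_def ksets_def by blast
  have "S \<noteq> {}" using S(2) k by auto
  then have "S \<notin> M" using S(1) by blast
  moreover have "complete_matching k (V, X) (insert S M)"
  proof -
    have m: "M \<subseteq> cliques V k X" "disjoint M"
      using M unfolding maximal_complete_matching_def complete_matching_iff[OF V] by auto
    have "S \<in> cliques V k X" using S unfolding cliques_def ksets_def by blast
    moreover have "disjoint (insert S M)"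
    proof (rule disjointI)
      fix a b assume ab: "a \<in> insert S M" "b \<in> insert S M" "a \<noteq> b"
      show "a \<inter> b = {}"
      proof (cases "a \<in> M \<and> b \<in> M")
        case True
        then show ?thesis using disjointD[OF m(2)] ab(3) by blast
      next
        case False
        then show ?thesis using ab S(1) by blast
      qed
    qed
    ultimately show ?thesis unfolding complete_matching_iff[OF V] using m(1) by blast
  qed
  ultimately show False using M unfolding maximal_complete_matching_def by blast
qed

text \<open>
  By maximality of \<open>M\<close> the uncovered part is \<open>K\<^sub>k\<close>-free, so \<open>M\<close> is one of the matchings
  that \<open>leaves_much\<close> quantifies over.
\<close>

lemma good_completion:
  assumes V: "finite V" and k: "0 < k" and good: "\<not> leaves_much V k s r X" and r: "r \<le> R"
    and M: "maximal_complete_matching k (V, X) M"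
  shows "\<exists>N. complete_matching s (remove_covered (V, X) M) N \<and>
    real (card (verts (remove_covered (V, X) M) - covered N)) \<le> R"
proof -
  define W where "W = V - \<Union>M"
  have W: "finite W" unfolding W_def using V by simp
  have m: "M \<subseteq> cliques V k X" "disjoint M"
    using M unfolding maximal_complete_matching_def complete_matching_iff[OF V] by auto
  have "\<not> poorly_covered W s r X"
    using good m maximal_imp_clique_free[OF V k M] unfolding leaves_much_def W_def by blast
  then obtain N where N: "N \<subseteq> cliques W s X" "disjoint N" "real (card W) \<le> real (s * card N) + r"
    unfolding poorly_covered_def not_all not_less by auto
  have "cliques W s {e\<in>X. e \<subseteq> W} = cliques W s X" unfolding cliques_def ksets_def by blast
  then have 1: "complete_matching s (remove_covered (V, X) M) N"
    unfolding remove_covered_eq W_def[symmetric] complete_matching_iff[OF W] using N by simp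
  have NW: "N \<subseteq> ksets W s" using N(1) unfolding cliques_def by blast
  have cN: "finite \<tau> \<and> card \<tau> = s \<and> \<tau> \<subseteq> W" if "\<tau> \<in> N" for \<tau>
  proof -
    have "\<tau> \<in> ksets W s" using that NW by blast
    then have "\<tau> \<subseteq> W" "card \<tau> = s" unfolding ksets_def by blast+
    then show ?thesis using W finite_subset by blast
  qed
  have "card (\<Union>N) = (\<Sum>\<tau>\<in>N. card \<tau>)"
    by (rule card_Union_disjoint) (use N(2) cN in \<open>auto simp: disjoint_def pairwise_def disjnt_def\<close>)
  also have "\<dots> = s * card N" using cN by simp
  finally have "card (\<Union>N) = s * card N" .
  moreover have "\<Union>N \<subseteq> W" using cN by blast
  ultimately have "card W = card (W - \<Union>N) + s * card N"
    using W by (metis card_Diff_subset card_mono finite_subset le_add_diff_inverse2)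
  then have "real (card (W - \<Union>N)) \<le> R" using N(3) r by simp
  then show ?thesis using 1 unfolding remove_covered_eq W_def covered_def by auto
qed

lemma success_probability:
  assumes "0 \<le> q" "q \<le> 1" "0 < k" "r \<le> R"
  shows "1 - rexp (pairs {1..n}) q (\<lambda>X. of_bool (leaves_much {1..n} k s r X)) \<le>
    measure_pmf.prob (binomial_random_graph n q)
       {H. \<forall>M. maximal_complete_matching k H M \<longrightarrow>
          (\<exists>N. complete_matching s (remove_covered H M) N \<and>
             real (card (verts (remove_covered H M) - covered N)) \<le> R)}"
proof -
  define good where "good = (\<lambda>X. \<forall>M. maximal_complete_matching k ({1..n}, X) M \<longrightarrow>
          (\<exists>N. complete_matching s (remove_covered ({1..n}, X) M) N \<and>
             real (card (verts (remove_covered ({1..n}, X) M) - covered N)) \<le> R))"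
  have fin: "finite (pairs {1..n})" by simp
  have "1 = rexp (pairs {1..n}) q (\<lambda>X. 1)" using rexp_const[OF fin] by simp
  also have "\<dots> \<le> rexp (pairs {1..n}) q (\<lambda>X. of_bool (good X) + of_bool (leaves_much {1..n} k s r X))"
  proof (rule rexp_mono[OF assms(1,2)])
    fix X :: "nat set set"
    have "good X" if "\<not> leaves_much {1..n} k s r X"
      unfolding good_def using good_completion[OF _ assms(3) that assms(4)] by simp
    then show "(1::real) \<le> of_bool (good X) + of_bool (leaves_much {1..n} k s r X)" by auto
  qed
  also have "\<dots> = rexp (pairs {1..n}) q (\<lambda>X. of_bool (good X)) + rexp (pairs {1..n}) q (\<lambda>X. of_bool (leaves_much {1..n} k s r X))"
    by (rule rexp_add)
  finally show ?thesis unfolding prob_random_graph[OF assms(1,2)] good_def by simp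
qed

section \<open>Choice of the parameters\<close>

lemma clique_count_markov:
  fixes V :: "'a set"
  assumes V: "finite V" "n = card V" and q: "0 \<le> q" "q \<le> 1" and c: "0 < c"
  shows "rexp (pairs V) q (\<lambda>X. of_bool (c < real (card (cliques V k X)))) \<le> real n ^ k * q ^ (k choose 2) / c"
proof -
  have "rexp (pairs V) q (\<lambda>X. real (card (cliques V k X))) = rexp (pairs V) q (\<lambda>X. \<Sum>\<kappa>\<in>ksets V k. of_bool (pairs \<kappa> \<subseteq> X) * 1)"
  proof (rule rexp_cong)
    fix X :: "'a set set"
    have "cliques V k X = ksets V k \<inter> {\<kappa>. pairs \<kappa> \<subseteq> X}" unfolding cliques_def by blast
    then show "real (card (cliques V k X)) = (\<Sum>\<kappa>\<in>ksets V k. of_bool (pairs \<kappa> \<subseteq> X) * 1)"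
      using V by (simp only: mult_1_right sum_of_bool_eq finite_ksets)
  qed
  also have "\<dots> = (\<Sum>\<kappa>\<in>ksets V k. q ^ (k choose 2))"
    unfolding rexp_sum
  proof (rule sum.cong[OF refl])
    fix \<kappa> assume "\<kappa> \<in> ksets V k"
    then have \<kappa>: "\<kappa> \<subseteq> V" "card \<kappa> = k" unfolding ksets_def by blast+
    then have "finite \<kappa>" using V finite_subset by blast
    then show "rexp (pairs V) q (\<lambda>X. of_bool (pairs \<kappa> \<subseteq> X) * 1) = q ^ (k choose 2)"
      using V \<kappa> ksets_mono[OF \<kappa>(1), of 2] by (subst rexp_superset) (simp_all add: rexp_const card_ksets)
  qed
  also have "\<dots> = real (card (ksets V k)) * q ^ (k choose 2)" by simp
  also have "\<dots> \<le> real n ^ k * q ^ (k choose 2)"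
  proof (rule mult_right_mono)
    have "card (ksets V k) \<le> n ^ k" using card_ksets_le[OF V(1)] V(2) by simp
    then show "real (card (ksets V k)) \<le> real n ^ k" by (metis of_nat_le_iff of_nat_power)
  qed (use q in simp)
  finally have mean: "rexp (pairs V) q (\<lambda>X. real (card (cliques V k X))) \<le> real n ^ k * q ^ (k choose 2)" .
  have "rexp (pairs V) q (\<lambda>X. of_bool (c < real (card (cliques V k X)))) \<le> rexp (pairs V) q (\<lambda>X. of_bool (real (card (cliques V k X)) \<ge> c))"
    using q by (intro rexp_mono) auto
  also have "\<dots> \<le> rexp (pairs V) q (\<lambda>X. real (card (cliques V k X))) / c"
    using q c by (intro rexp_markov) auto
  also have "\<dots> \<le> real n ^ k * q ^ (k choose 2) / c" using mean c by (intro divide_right_mono) auto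
  finally show ?thesis .
qed

lemma twice_choose_two: "2 * (f choose 2) = f * (f - 1)"
  unfolding choose_two by (cases f) auto

text \<open>
  With \<open>x = n\<close> and \<open>q = y^2\<close>: up to constants, the expected number of copies of \<open>K\<^sub>f\<close>
  per vertex is \<open>(n y^f)^(f-1)\<close>. This form makes powers of \<open>A = n y^s\<close> and \<open>B = n y^(s+1)\<close>
  visible.
\<close>

lemma clique_weight:
  fixes y :: real
  shows "x ^ (f - 1) * (y\<^sup>2) ^ (f choose 2) = (x * y ^ f) ^ (f - 1)"
  unfolding power_mult_distrib power_mult[symmetric] twice_choose_two ..

text \<open>
  The number of levels of the fragment process is logarithmic, as \<open>J\<close> is the first index at which \<open>n div
  2^J\<close> drops to \<open>\<rho>\<close>.
\<close>

lemma halving_steps: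
  assumes \<rho>: "0 < \<rho>" "\<rho> < real n"
  obtains J where "J > 0" "real (n div 2 ^ J) \<le> \<rho>" "\<And>a. a < J \<Longrightarrow> \<rho> < real (n div 2 ^ a)" "real J \<le> 1 + 2 * ln (real n)"
proof -
  define J where "J = (LEAST a. real (n div 2 ^ a) \<le> \<rho>)"
  have ex: "real (n div 2 ^ n) \<le> \<rho>"
  proof -
    have "n < 2 ^ n" by (rule less_exp)
    then show ?thesis using \<rho> by simp
  qed
  have J: "real (n div 2 ^ J) \<le> \<rho>" unfolding J_def by (rule LeastI[of _ n], rule ex)
  have less: "\<rho> < real (n div 2 ^ a)" if "a < J" for a
    using not_less_Least[OF that[unfolded J_def]] by simp
  have J0: "J > 0"
  proof (rule ccontr)
    assume "\<not> J > 0"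
    then show False using J \<rho> by simp
  qed
  have n0: "0 < n" using \<rho> by simp
  have "\<rho> < real (n div 2 ^ (J - 1))" using less[of "J - 1"] J0 by simp
  then have "0 < real (n div 2 ^ (J - 1))" using \<rho> by linarith
  then have "n div 2 ^ (J - 1) \<noteq> 0" by simp
  then have "2 ^ (J - 1) \<le> n" by (metis div_less not_le)
  then have "(2::real) ^ (J - 1) \<le> real n" by (metis of_nat_le_iff of_nat_numeral of_nat_power)
  then have "ln ((2::real) ^ (J - 1)) \<le> ln (real n)" using n0 by (subst ln_le_cancel_iff) auto
  then have "real (J - 1) * ln 2 \<le> ln (real n)" by (simp add: ln_realpow)
  moreover have "real (J - 1) * (1/2) \<le> real (J - 1) * ln 2"
    using ln2_ge_two_thirds by (intro mult_left_mono) auto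
  ultimately have "real (J - 1) \<le> 2 * ln (real n)" by simp
  then have "real J \<le> 1 + 2 * ln (real n)" using J0 by (simp add: of_nat_diff)
  then show ?thesis using that J0 J less by blast
qed

text \<open>
  With \<open>A = x y^s\<close>, \<open>B = x y^(s+1)\<close> and \<open>W = (x y^f)^(f-1)\<close> this reads \<open>A^2 W^2 B^i = x
  A^(s-1) A^j\<close>. Since \<open>A \<ge> 1 \<ge> B\<close> and \<open>i\<close> and \<open>j\<close> are not negative, \<open>x
  A^(s-1) \<le> (A W)^2\<close>, which bounds the joint cost.
\<close>

lemma sparsity_identity:
  fixes x y :: real
  assumes "2 \<le> f" "f + 2 \<le> s"
  shows "(x * y ^ s)\<^sup>2 * ((x * y ^ f) ^ (f - 1))\<^sup>2 * (x * y ^ (s + 1)) ^ (2 * (f - 1) * (s - f) - s)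
    = x * (x * y ^ s) ^ (s - 1) * (x * y ^ s) ^ (2 * (f - 2) * (s - f))"
proof -
  obtain e where f: "f = e + 2" using assms(1) by (metis add.commute le_Suc_ex)
  obtain d where s: "s = e + 4 + d" using assms(2) unfolding f by (metis add.assoc add.commute le_Suc_ex numeral_Bit0)
  have 1: "f - 1 = e + 1" "s - f = d + 2" "s - 1 = e + 3 + d" "f - 2 = e" unfolding f s by auto
  have 2: "2 * (f - 1) * (s - f) - s = 3 * e + d + 2 * e * d" unfolding 1 unfolding s by (simp add: algebra_simps)
  have 3: "x ^ a1 * y ^ b1 * (x ^ a2 * y ^ b2) * (x ^ a3 * y ^ b3) = x * (x ^ a4 * y ^ b4) * (x ^ a5 * y ^ b5)"
    if "a1 + a2 + a3 = Suc (a4 + a5)" "b1 + b2 + b3 = b4 + b5" for a1 a2 a3 a4 a5 b1 b2 b3 b4 b5 :: nat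
  proof -
    have "x ^ a1 * y ^ b1 * (x ^ a2 * y ^ b2) * (x ^ a3 * y ^ b3) = x ^ (a1 + a2 + a3) * y ^ (b1 + b2 + b3)"
      by (simp only: power_add mult_ac)
    also have "\<dots> = x * (x ^ a4 * y ^ b4) * (x ^ a5 * y ^ b5)" unfolding that by (simp only: power_add power_Suc mult_ac)
    finally show ?thesis .
  qed
  show ?thesis
    unfolding 2 unfolding 1 power_mult_distrib power_mult[symmetric]
    by (rule 3) (simp_all add: f s algebra_simps)
qed

text \<open>
  The constant in the spread \<open>spread_const s / n^(s-1)\<close> if there are at least \<open>n / (4 s)\<close> rows.
\<close>

definition spread_const :: "nat \<Rightarrow> real" where
  "spread_const s = switch_const s * (4 * real s) ^ (s - 1)"

text \<open>
  With \<open>n / (4 s)\<close> rows, switchings tolerate vertex costs up to \<open>overlap_const s * n^(s-1)\<close>.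
\<close>

definition overlap_const :: "nat \<Rightarrow> real" where
  "overlap_const s = 1 / (8 * real s ^ s * (16 * real s) ^ (s - 1))"

definition joint_const :: "nat \<Rightarrow> real" where
  "joint_const s = 2 ^ (s choose 2) * 4 ^ s * (spread_const s)\<^sup>2 * (16 * (real s)\<^sup>2)"

lemma spread_const_ge: "1 \<le> s \<Longrightarrow> 1 \<le> spread_const s"
proof -
  assume s: "1 \<le> s"
  have "1 \<le> 4 * real s" using s by simp
  then have "1 \<le> real s ^ s" "(1::real) \<le> 4 ^ (s - 1)" "1 \<le> (4 * real s) ^ (s - 1)" "1 \<le> exp (5 * real s)"
    using s by (simp_all only: one_le_power one_le_numeral) (simp_all add: one_le_power)
  then have "1 * 1 * 1 * 1 \<le> real s ^ s * 4 ^ (s - 1) * exp (5 * real s) * (4 * real s) ^ (s - 1)"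
    by (intro mult_mono) auto
  then show ?thesis unfolding spread_const_def by simp
qed

text \<open>
  For \<open>j \<ge> ln n\<close> the moment bound is at most \<open>exp (- 2 j) \<le> n^(-2)\<close> at each vertex. The exponent
  of \<open>y = \<surd>q\<close> in the expected number of sets with \<open>i\<close> new vertices is \<open>i (2 s - i - 1) \<ge> i
  (s + 1)\<close>, so that number is at most a constant times \<open>B\<close>.
\<close>

lemma overlap_failure:
  fixes V :: "'a set" and q :: real
  assumes V: "finite V" "n = card V" "1 \<le> n" and q: "0 < q" "q \<le> 1/2" and s: "3 \<le> s"
    and B: "B = real n * sqrt q ^ Suc s" "2 ^ (2 * s * s) * B \<le> 1"
    and j: "j = nat \<lceil>ln (real n)\<rceil>" and a0: "a0 = 1 + 2 * s * j"
    and E: "E = e0 * real n ^ (s - 1)" "0 < e0"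
    and small: "2 ^ s * (2 ^ (2 * s * s) * B + real (Suc s) * real a0 ^ s * (2 * q) + real (Suc s) * real a0 ^ Suc s / real n) \<le> e0 * exp (- 2)"
  shows "(\<Sum>v\<in>V. rexp (pairs V) q (\<lambda>X. of_bool (E < vertex_cost V s q v X))) \<le> 1 / real n"
proof -
  define b where "b = 2 ^ (2 * s * s) * B"
  define y where "y = sqrt q"
  have y: "0 < y" "y \<le> 1" "q = y\<^sup>2" unfolding y_def using q by (auto simp: real_sqrt_le_1_iff)
  have B0: "0 \<le> B" unfolding B(1) using q by simp
  have B1: "B \<le> 1"
  proof -
    have "1 * B \<le> 2 ^ (2 * s * s) * B" using B0 by (intro mult_right_mono one_le_power) auto
    then show ?thesis using B(2) by linarith
  qed
  have bi: "real n ^ i * (2 * q) ^ ((i choose 2) + i * (s - i)) \<le> b" if i: "1 \<le> i" "i \<le> s - 2" for i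
  proof -
    have e: "2 * ((i choose 2) + i * (s - i)) = i * (2 * s - i - 1)"
    proof -
      have "2 * ((i choose 2) + i * (s - i)) = i * (i - 1) + 2 * i * (s - i)" using twice_choose_two[of i] by simp
      also have "\<dots> = i * ((i - 1) + 2 * (s - i))" by (simp add: algebra_simps)
      also have "(i - 1) + 2 * (s - i) = 2 * s - i - 1" using i by auto
      finally show ?thesis .
    qed
    have "real n ^ i * q ^ ((i choose 2) + i * (s - i)) = (real n * y ^ (2 * s - i - 1)) ^ i"
      unfolding y(3) power_mult[symmetric] e by (simp add: power_mult_distrib power_mult[symmetric] mult.commute)
    also have "\<dots> \<le> B ^ i"
    proof (rule power_mono)
      have "y ^ (2 * s - i - 1) \<le> y ^ Suc s" using y i s by (intro power_decreasing) auto
      then show "real n * y ^ (2 * s - i - 1) \<le> B" unfolding B(1) y_def[symmetric] by (intro mult_left_mono) auto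
    qed (use y in simp)
    also have "\<dots> \<le> B ^ 1" using i B0 B1 by (intro power_decreasing) auto
    finally have 1: "real n ^ i * q ^ ((i choose 2) + i * (s - i)) \<le> B" by simp
    have "(i choose 2) + i * (s - i) \<le> 2 * s * s"
    proof -
      have "i * (2 * s - i - 1) \<le> s * (2 * s)" using i by (intro mult_mono) auto
      then show ?thesis using e by simp
    qed
    then have 2: "(2::real) ^ ((i choose 2) + i * (s - i)) \<le> 2 ^ (2 * s * s)" by (intro power_increasing) auto
    have "real n ^ i * (2 * q) ^ ((i choose 2) + i * (s - i)) = 2 ^ ((i choose 2) + i * (s - i)) * (real n ^ i * q ^ ((i choose 2) + i * (s - i)))"
      by (simp add: power_mult_distrib mult_ac)
    also have "\<dots> \<le> 2 ^ (2 * s * s) * B" using 1 2 q by (intro mult_mono) auto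
    finally show ?thesis unfolding b_def .
  qed
  have b01: "0 \<le> b" "b \<le> 1" unfolding b_def using B0 B(2) by auto
  have E0: "0 < E" unfolding E using E(2) V by simp
  define L where "L = 2 ^ s * (real n ^ (s - 1) * (b + real (Suc s) * real a0 ^ s * (2 * q)) + real (Suc s) * real a0 ^ s * (real a0 * real n ^ (s - 2)))"
  have npow: "real n ^ (s - 2) = real n ^ (s - 1) / real n"
  proof -
    have "s - 1 = Suc (s - 2)" using s by simp
    then have "real n ^ (s - 1) = real n * real n ^ (s - 2)" by (simp only: power_Suc)
    moreover have "real n \<noteq> 0" using V(3) by linarith
    ultimately show ?thesis by (metis nonzero_mult_div_cancel_left)
  qed
  have "L = real n ^ (s - 1) * (2 ^ s * (b + real (Suc s) * real a0 ^ s * (2 * q) + real (Suc s) * real a0 ^ Suc s / real n))"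
    unfolding L_def npow by (simp add: algebra_simps add_divide_distrib)
  also have "\<dots> \<le> real n ^ (s - 1) * (e0 * exp (- 2))" using small unfolding b_def by (intro mult_left_mono) auto
  also have "\<dots> = E * exp (- 2)" unfolding E by simp
  finally have LE: "L / E \<le> exp (- 2)" using E0 by (simp add: field_simps)
  have L0: "0 \<le> L" unfolding L_def using b01 q by simp
  have each: "rexp (pairs V) q (\<lambda>X. of_bool (E < vertex_cost V s q v X)) \<le> 1 / (real n)\<^sup>2"
    if v: "v \<in> V" for v
  proof -
    have "rexp (pairs V) q (\<lambda>X. of_bool (E < vertex_cost V s q v X)) \<le> (L / E) ^ j"
      by (rule overlap_typical[OF V(1,2) _ q(2) s v _ bi b01 L_def E0]) (use a0 q in auto)
    also have "\<dots> \<le> exp (- 2) ^ j" using LE L0 E0 by (intro power_mono) auto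
    also have "\<dots> = exp (- 2 * real j)" by (simp add: exp_of_nat_mult[symmetric] mult.commute)
    also have "\<dots> \<le> exp (- 2 * ln (real n))"
    proof -
      have "ln (real n) \<le> real j" unfolding j by linarith
      then show ?thesis by simp
    qed
    also have "\<dots> = 1 / (real n)\<^sup>2"
    proof -
      have "exp (2 * ln (real n)) = (exp (ln (real n)))\<^sup>2" by (metis exp_double power2_eq_square mult.commute)
      then show ?thesis using V by (simp add: exp_minus divide_inverse)
    qed
    finally show ?thesis .
  qed
  have "(\<Sum>v\<in>V. rexp (pairs V) q (\<lambda>X. of_bool (E < vertex_cost V s q v X)))
    \<le> (\<Sum>v\<in>V. 1 / (real n)\<^sup>2)" by (intro sum_mono each)
  also have "\<dots> = 1 / real n" using V by (simp add: power2_eq_square)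
  finally show ?thesis .
qed

text \<open>
  By lemma \<open>sparsity_identity\<close> the choice \<open>\<eta> = K A / \<surd>(n A^(s-1))\<close> is admissible, and the
  expected joint cost is of order \<open>n A^(s-1) \<eta>^2\<close>, hence of order \<open>A^2\<close>. For \<open>s = 3\<close> no
  block can meet \<open>\<sigma>\<close> in between 2 and \<open>s - 2\<close> vertices, and the joint cost vanishes. This case is
  kept apart because \<open>A^2\<close> is negligible against \<open>\<rho>\<close> only for \<open>s \<ge> 4\<close>.
\<close>

lemma joint_failure:
  fixes V :: "'a set" and q :: real
  assumes V: "finite V" "n = card V" "1 \<le> n" and q: "0 < q" "q \<le> 1/2" and s: "3 \<le> s"
    and A: "A = real n * sqrt q ^ s" "1 \<le> A" and B: "real n * sqrt q ^ Suc s \<le> 1"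
    and big: "4 ^ s * (spread_const s)\<^sup>2 \<le> real n" and \<rho>: "0 < \<rho>"
  shows "rexp (pairs V) q (\<lambda>X. of_bool (\<rho> / (16 * (real s)\<^sup>2) < joint_cost V s q (spread_const s / real n ^ (s - 1)) X))
     \<le> joint_const s * of_bool (4 \<le> s) * A\<^sup>2 / \<rho>"
proof -
  define y where "y = sqrt q"
  have y: "0 < y" "y \<le> 1" "q = y\<^sup>2" unfolding y_def using q by (auto simp: real_sqrt_le_1_iff)
  define K where "K = spread_const s"
  have K1: "1 \<le> K" unfolding K_def using s by (intro spread_const_ge) simp
  define p where "p = K / real n ^ (s - 1)"
  have p0: "0 \<le> p" unfolding p_def using K1 by simp
  define Z where "Z = real n * A ^ (s - 1)"
  \<comment> \<open>For s = 3 there is no admissible f, and zero is a valid bound.\<close>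
  define \<eta> where "\<eta> = of_bool (4 \<le> s) * (K * A / sqrt Z)"
  have n0: "1 \<le> real n" using V by simp
  have Z0: "0 < Z" unfolding Z_def using n0 A by simp
  have As: "A = real n * y ^ s" using A y_def by simp
  have eta: "real n ^ (s - f) * p / (2 * q) ^ (f choose 2) \<le> \<eta>" if f: "2 \<le> f" "f \<le> s - 2" for f
  proof -
    have s4: "4 \<le> s" using f by simp
    define W where "W = (real n * y ^ f) ^ (f - 1)"
    have W0: "0 < W" unfolding W_def using n0 y by simp
    have W: "W = real n ^ (f - 1) * q ^ (f choose 2)" unfolding W_def y(3) clique_weight ..
    have "Z \<le> Z * A ^ (2 * (f - 2) * (s - f))" using Z0 A by (simp add: one_le_power)
    also have "\<dots> = A\<^sup>2 * W\<^sup>2 * (real n * y ^ (s + 1)) ^ (2 * (f - 1) * (s - f) - s)"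
      unfolding Z_def As W_def using f by (intro sparsity_identity[symmetric]) auto
    also have "\<dots> \<le> A\<^sup>2 * W\<^sup>2 * 1"
      using B y unfolding y_def[symmetric] by (intro mult_left_mono power_le_one) auto
    finally have "Z \<le> (A * W)\<^sup>2" by (simp add: power_mult_distrib)
    then have "sqrt Z \<le> A * W" using A W0 by (intro real_le_lsqrt) auto
    then have "K / W \<le> K * A / sqrt Z" using K1 W0 Z0 by (simp add: field_simps)
    moreover have "real n ^ (s - f) * p / (2 * q) ^ (f choose 2) \<le> K / W"
    proof -
      have "s - 1 = (s - f) + (f - 1)" using f by simp
      then have "real n ^ (s - 1) = real n ^ (s - f) * real n ^ (f - 1)" by (metis power_add)
      then have "real n ^ (s - f) * p = K / real n ^ (f - 1)" unfolding p_def using n0 by (simp add: field_simps)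
      moreover have "q ^ (f choose 2) \<le> (2 * q) ^ (f choose 2)" using q by (intro power_mono) auto
      ultimately show ?thesis unfolding W using K1 n0 q
        by (simp add: divide_divide_eq_left) (intro divide_left_mono mult_left_mono mult_pos_pos, auto)
    qed
    ultimately show ?thesis unfolding \<eta>_def using s4 by simp
  qed
  have e0: "0 \<le> \<eta>" unfolding \<eta>_def using K1 A Z0 by simp
  have e1: "2 ^ s * \<eta> \<le> 1"
  proof -
    have "A ^ 2 \<le> A ^ (s - 1)" using A s by (intro power_increasing) auto
    then have "4 ^ s * K\<^sup>2 * A\<^sup>2 \<le> real n * A ^ (s - 1)" using big K_def n0 by (intro mult_mono) auto
    then have "(2 ^ s * K * A)\<^sup>2 \<le> Z" unfolding Z_def by (simp add: power_mult_distrib power_mult[symmetric] mult.commute[of s] power_mult[of 2 2])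
    then have "2 ^ s * K * A \<le> sqrt Z" by (rule real_le_rsqrt)
    then have "2 ^ s * (K * A / sqrt Z) \<le> 1" using Z0 by (simp add: field_simps)
    then show ?thesis unfolding \<eta>_def by (cases "4 \<le> s") auto
  qed
  define c where "c = \<rho> / (16 * (real s)\<^sup>2)"
  have c0: "0 < c" unfolding c_def using \<rho> s by simp
  have "rexp (pairs V) q (\<lambda>X. of_bool (c < joint_cost V s q p X)) \<le> rexp (pairs V) q (\<lambda>X. of_bool (joint_cost V s q p X \<ge> c))"
    using q by (intro rexp_mono) auto
  also have "\<dots> \<le> rexp (pairs V) q (joint_cost V s q p) / c"
  proof (rule rexp_markov[OF _ _ _ c0])
    show "0 \<le> joint_cost V s q p X" for X unfolding joint_cost_def using p0 q by (intro sum_nonneg) simp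
  qed (use q in auto)
  also have "\<dots> \<le> (real n ^ s * (2 * q) ^ (s choose 2) * (2 ^ s * \<eta>)\<^sup>2) / c"
    using c0 by (intro divide_right_mono joint_cost_expectation[OF V(1,2) q p0 eta e0 e1]) auto
  also have "real n ^ s * (2 * q) ^ (s choose 2) * (2 ^ s * \<eta>)\<^sup>2 = 2 ^ (s choose 2) * 4 ^ s * K\<^sup>2 * of_bool (4 \<le> s) * A\<^sup>2"
  proof -
    have "s = Suc (s - 1)" using s by simp
    then have "real n ^ s = real n * real n ^ (s - 1)" by (metis power_Suc)
    then have "real n ^ s * q ^ (s choose 2) = Z" unfolding Z_def As y(3) clique_weight[symmetric] by simp
    then have "real n ^ s * (2 * q) ^ (s choose 2) = 2 ^ (s choose 2) * Z" by (simp add: power_mult_distrib mult_ac)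
    moreover have "\<eta>\<^sup>2 = of_bool (4 \<le> s) * (K\<^sup>2 * A\<^sup>2 / Z)" unfolding \<eta>_def using Z0 by (simp add: power_mult_distrib power_divide)
    moreover have "(2 ^ s)\<^sup>2 = (4::real) ^ s" by (simp add: power_mult[symmetric] mult.commute[of s] power_mult[of 2 2])
    ultimately have "real n ^ s * (2 * q) ^ (s choose 2) * (2 ^ s * \<eta>)\<^sup>2 = 2 ^ (s choose 2) * Z * (4 ^ s * (of_bool (4 \<le> s) * (K\<^sup>2 * A\<^sup>2 / Z)))"
      by (simp only: power_mult_distrib[of "2 ^ s" \<eta>])
    then show ?thesis using Z0 by (simp add: field_simps)
  qed
  finally show ?thesis unfolding c_def p_def K_def joint_const_def by (simp add: mult_ac)
qed

text \<open>
  With \<open>dl = 2^(-\<rho>)\<close> the logarithm of the left side to base 2 is \<open>2 Q + m - \<rho> (m - J)\<close>, where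
  \<open>\<rho> (m - J) \<ge> \<rho> m / 2\<close> dominates.
\<close>

lemma two_powr_tail:
  assumes \<rho>: "4 \<le> \<rho>" and m: "8 \<le> m" "2 * J \<le> m" and Q: "Q \<le> \<rho> * real m / 16"
  shows "4 powr Q * ((2 * 2 powr (- \<rho>)) ^ m / (2 powr (- \<rho>)) ^ J) \<le> 1 / \<rho>"
proof -
  have a: "(2 * 2 powr (- \<rho>)) ^ m = (2::real) powr (real m - \<rho> * real m)"
  proof -
    have "(2::real) * 2 powr (- \<rho>) = 2 powr (1 - \<rho>)" by (simp add: powr_diff powr_minus divide_inverse)
    then have "(2 * 2 powr (- \<rho>)) ^ m = ((2::real) powr (1 - \<rho>)) powr real m" by (simp add: powr_realpow)
    also have "\<dots> = 2 powr ((1 - \<rho>) * real m)" by (rule powr_powr)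
    finally show ?thesis by (simp add: algebra_simps)
  qed
  have b: "(2 powr (- \<rho>)) ^ J = (2::real) powr (- \<rho> * real J)"
  proof -
    have "(2 powr (- \<rho>)) ^ J = ((2::real) powr (- \<rho>)) powr real J" by (simp add: powr_realpow)
    then show ?thesis by (simp only: powr_powr)
  qed
  have c: "(4::real) powr Q = 2 powr (2 * Q)"
  proof -
    have "(4::real) powr Q = (2 powr 2) powr Q" by simp
    then show ?thesis by (simp only: powr_powr)
  qed
  have "4 powr Q * ((2 * 2 powr (- \<rho>)) ^ m / (2 powr (- \<rho>)) ^ J) = 2 powr (2 * Q + (real m - \<rho> * real m) - (- \<rho> * real J))"
    unfolding a b c by (simp only: powr_add powr_diff times_divide_eq_right)
  also have "\<dots> \<le> 2 powr (- \<rho>)"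
  proof (rule powr_mono)
    have "real J \<le> real m / 2" using m(2) by linarith
    then have 1: "\<rho> * real J \<le> \<rho> * (real m / 2)" using \<rho> by (intro mult_left_mono) auto
    have 2: "4 * real m \<le> \<rho> * real m" using \<rho> by (intro mult_right_mono) auto
    have 3: "\<rho> * 8 \<le> \<rho> * real m" using \<rho> m(1) by (intro mult_left_mono) auto
    show "2 * Q + (real m - \<rho> * real m) - (- \<rho> * real J) \<le> - \<rho>" using 1 2 3 Q by linarith
  qed simp
  also have "\<dots> \<le> 1 / \<rho>"
  proof -
    have "\<rho> \<le> 2 powr \<rho>"
    proof -
      have "1 + \<rho> / 2 * ln 2 \<le> 2 powr (\<rho> / 2)" unfolding powr_def using exp_ge_add_one_self[of "\<rho> / 2 * ln 2"] by simp
      moreover have "\<rho> / 2 * (2/3) \<le> \<rho> / 2 * ln 2" using \<rho> ln2_ge_two_thirds by (intro mult_left_mono) auto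
      ultimately have "1 + \<rho> / 3 \<le> 2 powr (\<rho> / 2)" by linarith
      then have "(1 + \<rho> / 3)\<^sup>2 \<le> (2 powr (\<rho> / 2))\<^sup>2" using \<rho> by (intro power_mono) auto
      also have "(2 powr (\<rho> / 2))\<^sup>2 = 2 powr \<rho>" by (simp add: power2_eq_square powr_add[symmetric])
      finally have "(1 + \<rho> / 3)\<^sup>2 \<le> 2 powr \<rho>" .
      moreover have "\<rho> \<le> (1 + \<rho> / 3)\<^sup>2"
      proof -
        have "0 \<le> (\<rho> / 3 - 1 / 2)\<^sup>2" by simp
        then show ?thesis by (simp add: power2_eq_square algebra_simps)
      qed
      ultimately show ?thesis by linarith
    qed
    then show ?thesis using \<rho> by (simp add: powr_minus field_simps)
  qed
  finally show ?thesis .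
qed

text \<open>
  The parameters are chosen as follows, with \<open>g = A^(1/4)\<close> and \<open>b = B^(s/4)\<close>; the fourth roots keep all
  exponents integral. The exceptional set has size of order \<open>\<rho> = (b + 1/g) \<surd>(A^k)\<close>. The number of copies of
  \<open>K\<^sub>k\<close> has mean at most \<open>A^k\<close> and exceeds \<open>A^k / b^2\<close> with probability at most
  \<open>b^2\<close>; then \<open>Q\<close> is of order \<open>b^2 A^k\<close>, whereas \<open>\<rho> m\<close> is at least of order
  \<open>b A^(k/2 + s - 1)\<close>, which is larger as \<open>k/2 \<le> s - 1\<close> and \<open>b\<close> is small. The term
  \<open>1/g\<close> in \<open>\<rho>\<close> makes \<open>\<rho>\<close> exceed multiples of \<open>log log n\<close> and, for
  \<open>s \<ge> 4\<close>, \<open>A^2\<close>.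
\<close>

lemma failure_estimate:
  fixes V :: "'a set" and q g b :: real and n s :: nat
  defines "\<rho> \<equiv> (b + 1 / g) * g ^ (2 * Suc s)"
  defines "K \<equiv> spread_const s"
  assumes V: "finite V" "n = card V" and q: "0 < q" "q \<le> 1/2" and s: "3 \<le> s"
    and A: "g ^ 4 = real n * sqrt q ^ s" and B: "b ^ 4 = (real n * sqrt q ^ Suc s) ^ s"
    and g: "4 \<le> g" "2 * real s \<le> g" "2 * g ^ (8 * (s - 1)) \<le> 2 powr g"
    and b: "0 < b" "2 ^ Suc (Suc s) * (8192 * K) * b \<le> 1"
    and B1: "2 ^ (2 * s * s) * (real n * sqrt q ^ Suc s) \<le> 1"
    and D: "4096 * K \<le> g ^ (4 * (s - 1))" "3072 * K * ln (real n) \<le> g ^ (4 * (s - 1))"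
    and n: "16 * (real s)\<^sup>2 \<le> real n" "4 * real s ^ s \<le> (real n / (16 * real s)) ^ (s - 1)" "4 ^ s * K\<^sup>2 \<le> real n"
    and small: "2 ^ s * (2 ^ (2 * s * s) * (real n * sqrt q ^ Suc s) + real (Suc s) * real (1 + 2 * s * nat \<lceil>ln (real n)\<rceil>) ^ s * (2 * q)
       + real (Suc s) * real (1 + 2 * s * nat \<lceil>ln (real n)\<rceil>) ^ Suc s / real n) \<le> overlap_const s * exp (- 2)"
  shows "\<exists>r. r \<le> real (Suc s) * \<rho> \<and>
    rexp (pairs V) q (\<lambda>X. of_bool (leaves_much V (Suc s) s r X)) \<le> 1 / real n + joint_const s / g + b\<^sup>2 + 1 / g"
proof -
  define k where "k = Suc s"
  define y where "y = sqrt q"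
  have y: "0 < y" "y \<le> 1" "q = y\<^sup>2" unfolding y_def using q by (auto simp: real_sqrt_le_1_iff)
  have K1: "1 \<le> K" unfolding K_def using s by (intro spread_const_ge) simp
  have n144: "144 \<le> real n"
  proof -
    have "(3::real)\<^sup>2 \<le> (real s)\<^sup>2" using s by (intro power_mono) auto
    then show ?thesis using n(1) by simp
  qed
  have n0: "0 < real n" "1 \<le> n" "0 < n" using n144 by linarith+
  have ln1: "1 \<le> ln (real n)"
  proof -
    have "exp 1 \<le> (3::real)" by (rule exp_le)
    then have "exp 1 \<le> real n" using n144 by linarith
    then show ?thesis using n0 by (simp add: ln_ge_iff)
  qed
  have As: "g ^ 4 = real n * y ^ s" using A y_def by simp
  have A1: "1 \<le> real n * y ^ s" unfolding As[symmetric] using g by (intro one_le_power) simp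
  have gp: "g ^ i \<le> g ^ l" if "i \<le> l" for i l using g that by (intro power_increasing) auto
  have gi: "0 < 1 / g" "1 / g \<le> 1" "0 < g" using g by auto
  have b2: "2 ^ k * b \<le> 1/2" "b \<le> 1/2" "b\<^sup>2 \<le> b"
  proof -
    have "1 * b \<le> (8192 * K) * b" using K1 b(1) by (intro mult_right_mono) auto
    then have "2 ^ Suc k * b \<le> 2 ^ Suc k * ((8192 * K) * b)" by (intro mult_left_mono) auto
    also have "\<dots> \<le> 1" using b(2) unfolding k_def by (simp only: mult.assoc)
    finally show 1: "2 ^ k * b \<le> 1/2" by simp
    have "1 * b \<le> 2 ^ k * b" using b(1) by (intro mult_right_mono one_le_power) auto
    then show "b \<le> 1/2" using 1 by linarith
    then show "b\<^sup>2 \<le> b" using b(1) by (simp add: power2_eq_square mult_le_cancel_left1)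
  qed
  \<comment> \<open>The expected number of k-cliques is at most g^(4k), which is n b^4.\<close>
  have mu: "real n ^ k * q ^ (k choose 2) = g ^ (4 * k)"
  proof -
    have "real n ^ k * q ^ (k choose 2) = real n * (real n ^ (k - 1) * (y\<^sup>2) ^ (k choose 2))" unfolding k_def y(3) by simp
    also have "\<dots> = real n * (real n * y ^ k) ^ s" unfolding clique_weight by (simp add: k_def)
    also have "\<dots> = (real n * y ^ s) ^ k" unfolding k_def by (simp add: power_mult_distrib power_mult[symmetric] mult.commute mult.left_commute power_add[symmetric])
    finally show ?thesis unfolding As[symmetric] by (simp add: power_mult)
  qed
  have mun: "g ^ (4 * k) = real n * b ^ 4"
  proof -
    have "g ^ (4 * k) = (real n * y ^ s) ^ k" unfolding As[symmetric] by (simp add: power_mult)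
    also have "\<dots> = real n * (real n * y ^ Suc s) ^ s" unfolding k_def by (simp add: power_mult_distrib power_mult[symmetric] mult.commute mult.left_commute power_add[symmetric])
    finally show ?thesis unfolding B y_def by simp
  qed
  have Dq: "real n ^ (s - 1) * q ^ (s choose 2) = g ^ (4 * (s - 1))"
    unfolding y(3) clique_weight As[symmetric] by (simp add: power_mult)
  have \<rho>g: "g \<le> \<rho>" "b * g ^ (2 * k) \<le> \<rho>" "4 \<le> s \<Longrightarrow> g ^ 9 \<le> \<rho>"
  proof -
    have e: "\<rho> = b * g ^ (2 * k) + g ^ (2 * k - 1)"
    proof -
      have "2 * k = Suc (2 * k - 1)" unfolding k_def by simp
      then have "g ^ (2 * k) = g * g ^ (2 * k - 1)" by (metis power_Suc)
      then show ?thesis unfolding \<rho>_def k_def[symmetric] using g by (simp add: distrib_right)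
    qed
    have p: "0 \<le> b * g ^ (2 * k)" using b g by simp
    have p2: "0 \<le> g ^ (2 * k - 1)" using g by simp
    have "g ^ 1 \<le> g ^ (2 * k - 1)" unfolding k_def using s by (intro gp) simp
    then show "g \<le> \<rho>" using e p by simp
    show "b * g ^ (2 * k) \<le> \<rho>" using e p2 by linarith
    assume "4 \<le> s"
    then have "g ^ 9 \<le> g ^ (2 * k - 1)" unfolding k_def by (intro gp) simp
    then show "g ^ 9 \<le> \<rho>" using e p by linarith
  qed
  have \<rho>n: "0 < \<rho>" "\<rho> < real n"
  proof -
    show "0 < \<rho>" using \<rho>g(1) g by linarith
    have "\<rho> \<le> 2 * g ^ (2 * k)" unfolding \<rho>_def k_def[symmetric]
    proof (rule mult_right_mono)
      show "b + 1 / g \<le> 2" using b2(2) gi(2) by linarith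
    qed (use g in auto)
    also have "\<dots> \<le> 2 * g ^ (4 * k)" using gp[of "2 * k" "4 * k"] by simp
    also have "\<dots> = 2 * (real n * b ^ 4)" using mun by simp
    also have "\<dots> \<le> 2 * (real n * (1/2) ^ 4)" using b b2(2) by (intro mult_left_mono power_mono) auto
    also have "\<dots> < real n" using n0 by (simp add: power4_eq_xxxx)
    finally show "\<rho> < real n" .
  qed
  obtain J where J: "J > 0" "real (n div 2 ^ J) \<le> \<rho>" "\<And>a. a < J \<Longrightarrow> \<rho> < real (n div 2 ^ a)" "real J \<le> 1 + 2 * ln (real n)"
    by (rule halving_steps[OF \<rho>n]) blast
  have J3: "real J \<le> 3 * ln (real n)" using J(4) ln1 by linarith
  \<comment> \<open>The number m of rounds is the largest that the fragment process allows for the spread of the arrangements.\<close>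
  define x where "x = g ^ (4 * (s - 1)) / (256 * K)"
  define m where "m = nat \<lfloor>x\<rfloor>"
  have x16: "16 \<le> x" unfolding x_def using D(1) K1 by (simp add: field_simps)
  have mx: "real m \<le> x" "x / 2 \<le> real m" unfolding m_def using x16 by linarith+
  have m8: "8 \<le> m" using mx x16 by linarith
  have xJ: "12 * ln (real n) \<le> x" unfolding x_def using D(2) K1 by (simp add: field_simps)
  have mJ: "2 * J \<le> m" using xJ J3 mx by linarith
  define dl where "dl = 2 powr (- \<rho>)"
  have dl: "2 * real J * (\<Sum>a<J. (1/4) ^ (n div 2 ^ a)) \<le> dl" "dl > 0" "dl \<le> 1"
  proof -
    have "(\<Sum>a<J. (1/4::real) ^ (n div 2 ^ a)) \<le> (\<Sum>a<J. 4 powr (- \<rho>))"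
    proof (rule sum_mono)
      fix a assume "a \<in> {..<J}"
      then have "\<rho> \<le> real (n div 2 ^ a)" using J(3)[of a] by simp
      then have "4 powr (- real (n div 2 ^ a)) \<le> (4::real) powr (- \<rho>)" by (intro powr_mono) auto
      then show "(1/4::real) ^ (n div 2 ^ a) \<le> 4 powr (- \<rho>)" by (simp only: power_one_over powr_minus_divide powr_realpow zero_less_numeral)
    qed
    then have "2 * real J * (\<Sum>a<J. (1/4) ^ (n div 2 ^ a)) \<le> 2 * real J * (real J * 4 powr (- \<rho>))" by (intro mult_left_mono) auto
    also have "\<dots> = 2 * (real J)\<^sup>2 * 4 powr (- \<rho>)" by (simp add: power2_eq_square)
    also have "(4::real) powr (- \<rho>) = dl * dl"
    proof -
      have "(4::real) powr (- \<rho>) = (2 powr 2) powr (- \<rho>)" by simp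
      also have "\<dots> = 2 powr (- \<rho> + - \<rho>)" unfolding powr_powr by simp
      finally show ?thesis unfolding dl_def powr_add .
    qed
    also have "2 * (real J)\<^sup>2 * (dl * dl) \<le> dl"
    proof -
      have "real J \<le> g ^ (4 * (s - 1))"
      proof -
        have "1 * x \<le> 256 * K * x" using K1 x16 by (intro mult_right_mono) auto
        then have "x \<le> g ^ (4 * (s - 1))" unfolding x_def using K1 by simp
        then show ?thesis using J3 xJ ln1 by linarith
      qed
      then have "2 * (real J)\<^sup>2 \<le> 2 * (g ^ (4 * (s - 1)))\<^sup>2" by (intro mult_left_mono power_mono) auto
      also have "\<dots> = 2 * g ^ (8 * (s - 1))" by (simp add: power_mult[symmetric])
      also have "\<dots> \<le> 2 powr g" by (rule g(3))
      also have "\<dots> \<le> 2 powr \<rho>" using \<rho>g(1) by (intro powr_mono) auto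
      finally have "2 * (real J)\<^sup>2 * dl \<le> 2 powr \<rho> * dl" unfolding dl_def by (intro mult_right_mono) auto
      also have "\<dots> = 1" unfolding dl_def by (simp add: powr_minus)
      finally have "2 * (real J)\<^sup>2 * dl * dl \<le> 1 * dl" unfolding dl_def by (intro mult_right_mono) auto
      then show ?thesis by (simp add: mult.assoc)
    qed
    finally show "2 * real J * (\<Sum>a<J. (1/4) ^ (n div 2 ^ a)) \<le> dl" .
    show "dl > 0" unfolding dl_def by simp
    have "(2::real) powr (- \<rho>) \<le> 2 powr 0" using \<rho>n by (intro powr_mono) auto
    then show "dl \<le> 1" unfolding dl_def by simp
  qed
  define p0 where "p0 = K / real n ^ (s - 1)"
  have small': "2 * p0 * real m / (q ^ (s choose 2) / 2) \<le> 1/64"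
  proof -
    have "2 * p0 * real m / (q ^ (s choose 2) / 2) = 4 * K * real m / g ^ (4 * (s - 1))"
      unfolding p0_def Dq[symmetric] by simp
    also have "\<dots> \<le> 4 * K * x / g ^ (4 * (s - 1))" using mx K1 g by (intro divide_right_mono mult_left_mono) auto
    also have "\<dots> = 1 / 64" unfolding x_def using K1 g by simp
    finally show ?thesis .
  qed
  \<comment> \<open>This is the mean bound g^(4k) = n b^4 divided by b^2.\<close>
  define Mx where "Mx = real n * b\<^sup>2"
  have Mx: "0 < Mx" "2 ^ k * Mx \<le> real n / 2"
  proof -
    show "0 < Mx" unfolding Mx_def using n0 b by simp
    have "2 ^ k * b\<^sup>2 \<le> 2 ^ k * b" using b2(3) by (intro mult_left_mono) auto
    then have "2 ^ k * b\<^sup>2 \<le> 1/2" using b2(1) by linarith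
    then have "real n * (2 ^ k * b\<^sup>2) \<le> real n * (1/2)" using n0 by (intro mult_left_mono) auto
    then show "2 ^ k * Mx \<le> real n / 2" unfolding Mx_def by (simp add: mult_ac)
  qed
  define \<nu> where "\<nu> = real n / (4 * real s)"
  have s0: "0 < real s" using s by simp
  have nu1: "\<nu> \<le> real (card W div s)" if "W \<subseteq> V" "real n \<le> real (card W) + real k * Mx" for W
  proof -
    have "real k \<le> 2 ^ k" by (rule of_nat_less_two_power[THEN less_imp_le])
    then have "real k * Mx \<le> 2 ^ k * Mx" using Mx by (intro mult_right_mono) auto
    then have "real n / 2 \<le> real (card W)" using that(2) Mx by linarith
    then have "real n / 2 / real s \<le> real (card W) / real s" using s0 by (intro divide_right_mono) auto
    moreover have "real (card W) / real s \<le> real (card W div s) + 1"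
    proof -
      have "card W < s * (card W div s) + s" using s by (metis mult_div_mod_eq add_less_cancel_left mod_less_divisor le_zero_eq not_numeral_le_zero zero_less_iff_neq_zero)
      then have "real (card W) \<le> real s * (real (card W div s) + 1)" by (simp add: algebra_simps flip: of_nat_mult of_nat_add)
      then show ?thesis using s0 by (simp add: field_simps)
    qed
    moreover have "real n / 2 / real s = 2 * \<nu>" unfolding \<nu>_def by simp
    moreover have "1 \<le> \<nu>"
    proof -
      have "real s * 1 \<le> real s * (real s)" using s by (intro mult_left_mono) auto
      then have "4 * real s \<le> 16 * (real s)\<^sup>2" by (simp add: power2_eq_square)
      then show ?thesis unfolding \<nu>_def using n(1) s0 by (simp add: field_simps)
    qed
    ultimately show ?thesis by linarith
  qed
  have nu2: "4 * real s \<le> \<nu>" unfolding \<nu>_def using n(1) s0 by (simp add: field_simps power2_eq_square)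
  have nu4: "\<nu> / 4 = real n / (16 * real s)" unfolding \<nu>_def by simp
  define E where "E = overlap_const s * real n ^ (s - 1)"
  have E1: "8 * real s ^ s * E \<le> (\<nu> / 4) ^ (s - 1)"
    unfolding E_def overlap_const_def nu4 power_divide using s0 by simp
  have p0': "switch_const s / \<nu> ^ (s - 1) \<le> p0"
    unfolding p0_def K_def spread_const_def \<nu>_def power_divide by simp
  \<comment> \<open>Half of the budget is for the incomplete last row, the other half for the dropped blocks.\<close>
  define u1 where "u1 = \<rho> / (16 * (real s)\<^sup>2)"
  have u1: "u1 > 0" "real s + 8 * real s ^ 2 * u1 \<le> \<rho>"
  proof -
    show "u1 > 0" unfolding u1_def using \<rho>n s0 by simp
    have "8 * real s ^ 2 * u1 = \<rho> / 2" unfolding u1_def using s0 by (simp add: power2_eq_square)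
    then show "real s + 8 * real s ^ 2 * u1 \<le> \<rho>" using \<rho>g(1) g(2) by linarith
  qed
  have dense: "1 \<le> real n ^ (f - 1) * q ^ (f choose 2)" if f: "1 \<le> f" "f < k" for f
  proof -
    have "y ^ s \<le> y ^ f" using f y unfolding k_def by (intro power_decreasing) auto
    then have "real n * y ^ s \<le> real n * y ^ f" by (intro mult_left_mono) auto
    then have "1 \<le> real n * y ^ f" using A1 by linarith
    then show ?thesis unfolding y(3) clique_weight by (rule one_le_power)
  qed
  define r where "r = \<rho> + real (s * (n div 2 ^ J))"
  have "rexp (pairs V) q (\<lambda>X. of_bool (leaves_much V k s r X))
    \<le> (\<Sum>v\<in>V. rexp (pairs V) q (\<lambda>X. of_bool (E < vertex_cost V s q v X)))
     + rexp (pairs V) q (\<lambda>X. of_bool (u1 < joint_cost V s q p0 X))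
     + rexp (pairs V) q (\<lambda>X. of_bool (Mx < real (card (cliques V k X))))
     + 4 powr (real n ^ k * q ^ (k choose 2) * (2 * 2 ^ k * Mx / real n)) * ((2 * dl) ^ m / dl ^ J)"
    unfolding r_def
  proof (rule failure_bound[OF V n0(3) q s k_def _ J(1) small' dl _ _ nu1 nu2 E1 _ p0' u1 dense])
    show "4 * real s ^ s \<le> (\<nu> / 4) ^ (s - 1)" unfolding nu4 by (rule n(2))
    show "2 ^ k * Mx \<le> real n" using Mx n0 by linarith
  qed (use m8 Mx in auto)
  also have "\<dots> \<le> 1 / real n + joint_const s / g + b\<^sup>2 + 1 / g"
  proof (intro add_mono)
    show "(\<Sum>v\<in>V. rexp (pairs V) q (\<lambda>X. of_bool (E < vertex_cost V s q v X))) \<le> 1 / real n"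
      by (rule overlap_failure[OF V n0(2) q s refl B1 refl refl E_def _ small]) (use s0 in \<open>simp add: overlap_const_def\<close>)
    have jc: "0 \<le> joint_const s" unfolding joint_const_def by simp
    have "rexp (pairs V) q (\<lambda>X. of_bool (u1 < joint_cost V s q p0 X)) \<le> joint_const s * of_bool (4 \<le> s) * (real n * y ^ s)\<^sup>2 / \<rho>"
      unfolding u1_def p0_def K_def
    proof (rule joint_failure[OF V n0(2) q s _ A1 _ _ \<rho>n(1)])
      have "1 * (real n * sqrt q ^ Suc s) \<le> 2 ^ (2 * s * s) * (real n * sqrt q ^ Suc s)"
        using q by (intro mult_right_mono one_le_power) auto
      then show "real n * sqrt q ^ Suc s \<le> 1" using B1 by linarith
    qed (use n(3) in \<open>auto simp: y_def K_def\<close>)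
    also have "\<dots> \<le> joint_const s / g"
    proof (cases "4 \<le> s")
      case True
      have "(real n * y ^ s)\<^sup>2 * g = g ^ 9" unfolding As[symmetric] by (simp add: power_mult[symmetric] power_Suc2[symmetric] del: power_Suc)
      also have "\<dots> \<le> \<rho>" by (rule \<rho>g(3)[OF True])
      finally have "(real n * y ^ s)\<^sup>2 / \<rho> \<le> 1 / g" using \<rho>n gi by (simp add: field_simps)
      then have "joint_const s * ((real n * y ^ s)\<^sup>2 / \<rho>) \<le> joint_const s * (1 / g)" using jc by (intro mult_left_mono)
      then show ?thesis using True by simp
    next
      case False
      then show ?thesis using jc gi by simp
    qed
    finally show "rexp (pairs V) q (\<lambda>X. of_bool (u1 < joint_cost V s q p0 X)) \<le> joint_const s / g" .
    have "rexp (pairs V) q (\<lambda>X. of_bool (Mx < real (card (cliques V k X)))) \<le> real n ^ k * q ^ (k choose 2) / Mx"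
      using q Mx by (intro clique_count_markov V) auto
    also have "\<dots> = b\<^sup>2" unfolding mu mun Mx_def using n0 b by (simp add: power2_eq_square power4_eq_xxxx)
    finally show "rexp (pairs V) q (\<lambda>X. of_bool (Mx < real (card (cliques V k X)))) \<le> b\<^sup>2" .
    have "4 powr (real n ^ k * q ^ (k choose 2) * (2 * 2 ^ k * Mx / real n)) * ((2 * dl) ^ m / dl ^ J) \<le> 1 / \<rho>"
      unfolding dl_def
    proof (rule two_powr_tail[OF _ m8 mJ])
      show "4 \<le> \<rho>" using \<rho>g(1) g(1) by linarith
      have "real n ^ k * q ^ (k choose 2) * (2 * 2 ^ k * Mx / real n) = (2 ^ Suc k * b) * b * g ^ (4 * k)"
        unfolding mu Mx_def using n0 by (simp add: power2_eq_square)
      also have "\<dots> \<le> (1 / (8192 * K)) * b * g ^ (4 * k)"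
      proof (intro mult_right_mono)
        show "2 ^ Suc k * b \<le> 1 / (8192 * K)" using b(2) K1 unfolding k_def by (simp add: field_simps)
      qed (use b g in auto)
      also have "\<dots> \<le> (1 / (8192 * K)) * b * (g ^ (2 * k) * g ^ (4 * (s - 1)))"
      proof (rule mult_left_mono)
        show "g ^ (4 * k) \<le> g ^ (2 * k) * g ^ (4 * (s - 1))" unfolding power_add[symmetric] k_def using s by (intro gp) simp
      qed (use b K1 in auto)
      also have "\<dots> = (b * g ^ (2 * k)) * (x / 2) / 16" unfolding x_def using K1 by (simp add: field_simps)
      also have "\<dots> \<le> \<rho> * real m / 16"
        using \<rho>g(2) mx \<rho>n x16 by (intro divide_right_mono mult_mono) auto
      finally show "real n ^ k * q ^ (k choose 2) * (2 * 2 ^ k * Mx / real n) \<le> \<rho> * real m / 16" .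
    qed
    also have "\<dots> \<le> 1 / g" using \<rho>g(1) gi by (intro divide_left_mono mult_pos_pos) auto
    finally show "4 powr (real n ^ k * q ^ (k choose 2) * (2 * 2 ^ k * Mx / real n)) * ((2 * dl) ^ m / dl ^ J) \<le> 1 / g" .
  qed
  finally have fin: "rexp (pairs V) q (\<lambda>X. of_bool (leaves_much V (Suc s) s r X)) \<le> 1 / real n + joint_const s / g + b\<^sup>2 + 1 / g"
    unfolding k_def .
  have "real (s * (n div 2 ^ J)) \<le> real s * \<rho>" using J(2) s0 by (simp add: mult_left_mono)
  then have "r \<le> real (Suc s) * \<rho>" unfolding r_def by (simp add: algebra_simps)
  then show ?thesis using fin by blast
qed

section \<open>Asymptotics\<close>

lemma clique_expectation:
  fixes q :: real
  assumes "0 \<le> q"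
  shows "real n ^ Suc s * q ^ (Suc s choose 2) = (real n * sqrt q ^ s) ^ Suc s"
proof -
  have q: "q = (sqrt q)\<^sup>2" using assms by simp
  have "real n ^ Suc s * q ^ (Suc s choose 2) = real n * (real n ^ (Suc s - 1) * ((sqrt q)\<^sup>2) ^ (Suc s choose 2))" using q by simp
  also have "\<dots> = real n * (real n * sqrt q ^ Suc s) ^ s" unfolding clique_weight by simp
  also have "\<dots> = (real n * sqrt q ^ s) ^ Suc s"
    by (simp add: power_mult_distrib power_mult[symmetric] mult.commute mult.left_commute power_add[symmetric])
  finally show ?thesis .
qed

lemma powr_power_eq: "0 < x \<Longrightarrow> (x powr a) ^ t = x powr (a * real t)" for x :: real
proof -
  assume "0 < x"
  then have "(x powr a) ^ t = (x powr a) powr real t" by (intro powr_realpow[symmetric]) simp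
  then show ?thesis by (simp only: powr_powr)
qed

text \<open>
  Raise the hypothesis to the power \<open>s choose 2\<close>.
\<close>

lemma density_lower:
  assumes s: "3 \<le> s" and q: "\<And>n. 0 \<le> q n"
    and o: "(\<lambda>n. real n powr (- 2 / real s) * ln (real n) powr (1 / real (s choose 2))) \<in> o(q)"
  shows "\<forall>\<^sub>F n in sequentially. C * ln (real n) \<le> real n ^ (s - 1) * q n ^ (s choose 2)"
proof -
  define t where "t = s choose 2"
  have t0: "t > 0" unfolding t_def using s by (simp add: zero_less_binomial_iff)
  have ts: "real t * 2 = real s * real (s - 1)" unfolding t_def using twice_choose_two[of s] by (metis mult.commute of_nat_mult of_nat_numeral)
  define c where "c = 1 / max 1 C"
  have c: "0 < c" "c \<le> 1" "c * C \<le> 1" unfolding c_def by (auto simp: field_simps)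
  have "\<forall>\<^sub>F n in sequentially. norm (real n powr (- 2 / real s) * ln (real n) powr (1 / real t)) \<le> c * norm (q n)"
    using landau_o.smallD[OF o c(1)] unfolding t_def .
  moreover have "\<forall>\<^sub>F n in sequentially. 2 \<le> n" by (rule eventually_ge_at_top)
  ultimately show ?thesis
  proof eventually_elim
    case (elim n)
    have n0: "0 < real n" "0 < ln (real n)" using elim(2) by auto
    have "real n powr (- 2 / real s) * ln (real n) powr (1 / real t) \<le> c * q n" using elim(1) q[of n] by simp
    then have "(real n powr (- 2 / real s) * ln (real n) powr (1 / real t)) ^ t \<le> (c * q n) ^ t"
      by (intro power_mono) auto
    moreover have "(real n powr (- 2 / real s) * ln (real n) powr (1 / real t)) ^ t = ln (real n) / real n ^ (s - 1)"
    proof -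
      have "(real n powr (- 2 / real s)) ^ t = real n powr (- 2 / real s * real t)"
        by (rule powr_power_eq[OF n0(1)])
      also have "- 2 / real s * real t = - real (s - 1)" using ts s by (simp add: field_simps)
      also have "real n powr (- real (s - 1)) = 1 / real n ^ (s - 1)" using n0 by (simp only: powr_minus_divide powr_realpow)
      finally have 1: "(real n powr (- 2 / real s)) ^ t = 1 / real n ^ (s - 1)" .
      have "(ln (real n) powr (1 / real t)) ^ t = ln (real n) powr (1 / real t * real t)"
        by (rule powr_power_eq[OF n0(2)])
      also have "\<dots> = ln (real n)" using t0 n0 by simp
      finally show ?thesis using 1 by (simp add: power_mult_distrib)
    qed
    ultimately have "ln (real n) / real n ^ (s - 1) \<le> (c * q n) ^ t" by simp
    then have "ln (real n) \<le> real n ^ (s - 1) * (c * q n) ^ t"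
      using n0 by (simp only: pos_divide_le_eq zero_less_power mult.commute)
    also have "\<dots> \<le> real n ^ (s - 1) * (c * q n ^ t)"
    proof (rule mult_left_mono)
      have "c ^ t \<le> c ^ 1" using c t0 by (intro power_decreasing) auto
      then show "(c * q n) ^ t \<le> c * q n ^ t" unfolding power_mult_distrib using q[of n] by (intro mult_right_mono) auto
    qed simp
    finally have 2: "ln (real n) \<le> c * (real n ^ (s - 1) * q n ^ t)" by (simp add: mult_ac)
    have "C * ln (real n) \<le> max 1 C * ln (real n)" using n0 by (intro mult_right_mono) auto
    also have "\<dots> \<le> max 1 C * (c * (real n ^ (s - 1) * q n ^ t))" using 2 by (intro mult_left_mono) auto
    also have "\<dots> = real n ^ (s - 1) * q n ^ t" unfolding c_def by simp
    finally show ?case unfolding t_def .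
  qed
qed

text \<open>
  Raise the hypothesis to the power \<open>s + 1\<close> and take the square root.
\<close>

lemma density_upper:
  assumes q: "\<And>n. 0 \<le> q n" and o: "q \<in> o(\<lambda>n. real n powr (- 2 / real (Suc s)))" and \<epsilon>: "0 < \<epsilon>"
  shows "\<forall>\<^sub>F n in sequentially. real n * sqrt (q n) ^ Suc s \<le> \<epsilon>"
proof -
  define c where "c = min 1 (\<epsilon>\<^sup>2)"
  have c: "0 < c" "c \<le> 1" "c \<le> \<epsilon>\<^sup>2" unfolding c_def using \<epsilon> by auto
  have "\<forall>\<^sub>F n in sequentially. norm (q n) \<le> c * norm (real n powr (- 2 / real (Suc s)))"
    by (rule landau_o.smallD[OF o c(1)])
  moreover have "\<forall>\<^sub>F n in sequentially. 1 \<le> n" by (rule eventually_ge_at_top)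
  ultimately show ?thesis
  proof eventually_elim
    case (elim n)
    have n0: "0 < real n" using elim(2) by simp
    have "q n \<le> c * real n powr (- 2 / real (Suc s))" using elim(1) q[of n] by simp
    then have "q n ^ Suc s \<le> (c * real n powr (- 2 / real (Suc s))) ^ Suc s" using q[of n] by (intro power_mono)
    also have "\<dots> = c ^ Suc s * (1 / (real n)\<^sup>2)"
    proof -
      have "(real n powr (- 2 / real (Suc s))) ^ Suc s = (real n powr (- 2 / real (Suc s))) powr real (Suc s)"
        using n0 by (intro powr_realpow[symmetric]) simp
      also have "\<dots> = real n powr (- 2 / real (Suc s) * real (Suc s))" by (rule powr_powr)
      also have "- 2 / real (Suc s) * real (Suc s) = - real 2" by (simp add: field_simps)
      also have "real n powr (- real 2) = 1 / (real n)\<^sup>2" using n0 by (simp only: powr_minus_divide powr_realpow)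
      finally show ?thesis by (simp only: power_mult_distrib)
    qed
    also have "\<dots> \<le> \<epsilon>\<^sup>2 * (1 / (real n)\<^sup>2)"
    proof (rule mult_right_mono)
      have "c ^ Suc s \<le> c ^ 1" using c by (intro power_decreasing) auto
      then have "c ^ Suc s \<le> c" by (simp only: power_one_right)
      then show "c ^ Suc s \<le> \<epsilon>\<^sup>2" using c(3) by (rule order_trans)
    qed simp
    finally have "(real n)\<^sup>2 * q n ^ Suc s \<le> \<epsilon>\<^sup>2" using n0 by (simp add: field_simps)
    moreover have "(real n * sqrt (q n) ^ Suc s)\<^sup>2 = (real n)\<^sup>2 * q n ^ Suc s"
    proof -
      have "(sqrt (q n) ^ Suc s)\<^sup>2 = ((sqrt (q n))\<^sup>2) ^ Suc s" by (simp only: power_mult[symmetric] mult.commute)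
      then show ?thesis using q[of n] by (simp only: power_mult_distrib real_sqrt_pow2)
    qed
    ultimately have "(real n * sqrt (q n) ^ Suc s)\<^sup>2 \<le> \<epsilon>\<^sup>2" by simp
    then show ?case by (rule power2_le_imp_le) (use \<epsilon> in simp)
  qed
qed

lemma ln_power_negligible:
  assumes "0 < c" "0 < p"
  shows "(\<lambda>n. ln (real n) ^ p * real n powr (- c)) \<longlonglongrightarrow> 0"
proof -
  have "(\<lambda>n. (ln (real n) / real n powr (c / real p)) ^ p) \<longlonglongrightarrow> 0 ^ p"
    using assms by (intro tendsto_power lim_ln_over_power) simp
  moreover have "(ln (real n) / real n powr (c / real p)) ^ p = ln (real n) ^ p * real n powr (- c)" for n
  proof (cases "n = 0")
    case False
    then have "(real n powr (c / real p)) ^ p = real n powr (c / real p * real p)" by (intro powr_power_eq) simp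
    also have "\<dots> = real n powr c" using assms by simp
    finally show ?thesis by (simp only: power_divide powr_minus_divide times_divide_eq_right mult_1_right)
  qed (use assms in simp)
  ultimately show ?thesis using assms by (simp add: power_0_left)
qed

lemma power_le_two_powr: "\<forall>\<^sub>F x in at_top. 2 * x ^ p \<le> (2::real) powr x"
proof -
  have "filterlim (\<lambda>x::real. ln 2 * x) at_top at_top"
    by (intro filterlim_tendsto_pos_mult_at_top[OF tendsto_const] filterlim_ident) simp
  then have "((\<lambda>x::real. (ln 2 * x) ^ p / exp (ln 2 * x)) \<longlongrightarrow> 0) at_top"
    by (rule filterlim_compose[OF tendsto_power_div_exp_0])
  then have "\<forall>\<^sub>F x in at_top. (ln 2 * x) ^ p / exp (ln 2 * x) < (ln 2) ^ p / (2::real)"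
    by (rule order_tendstoD) simp
  then show ?thesis
  proof eventually_elim
    case (elim x)
    then have "(ln 2) ^ p * (2 * x ^ p) < (ln 2) ^ p * exp (ln 2 * x)" by (simp add: field_simps power_mult_distrib)
    then have "2 * x ^ p < exp (ln 2 * x)" by (simp only: mult_less_cancel_left_pos zero_less_power ln_gt_zero one_less_numeral_iff semiring_norm)
    then show ?case by (simp add: powr_def mult.commute)
  qed
qed

text \<open>
  The first term is of order \<open>B\<close>; in the others the powers of \<open>log n\<close> are beaten by \<open>q \<le>
  n^(-2/k)\<close> and by \<open>1/n\<close>.
\<close>

lemma overlap_terms_vanish:
  assumes s: "3 \<le> s" and q: "\<And>n. 0 \<le> q n" and o: "q \<in> o(\<lambda>n. real n powr (- 2 / real (Suc s)))" and e: "0 < e"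
  shows "\<forall>\<^sub>F n in sequentially. 2 ^ s * (2 ^ (2 * s * s) * (real n * sqrt (q n) ^ Suc s) + real (Suc s) * real (1 + 2 * s * nat \<lceil>ln (real n)\<rceil>) ^ s * (2 * q n)
       + real (Suc s) * real (1 + 2 * s * nat \<lceil>ln (real n)\<rceil>) ^ Suc s / real n) \<le> e"
proof -
  define \<epsilon> where "\<epsilon> = e / (2 ^ s * 3)"
  have \<epsilon>: "0 < \<epsilon>" unfolding \<epsilon>_def using e by simp
  define C where "C = (5 * real s)"
  have "\<forall>\<^sub>F n in sequentially. real n * sqrt (q n) ^ Suc s \<le> \<epsilon> / 2 ^ (2 * s * s)"
    by (rule density_upper[OF q o]) (use \<epsilon> in simp)
  moreover have "\<forall>\<^sub>F n in sequentially. norm (q n) \<le> 1 * norm (real n powr (- 2 / real (Suc s)))"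
    by (rule landau_o.smallD[OF o]) simp
  moreover have "\<forall>\<^sub>F n in sequentially. real (Suc s) * C ^ s * 2 * (ln (real n) ^ s * real n powr (- (2 / real (Suc s)))) < \<epsilon>"
    using s \<epsilon> by (intro order_tendstoD[OF tendsto_mult_right_zero[OF ln_power_negligible]]) auto
  moreover have "\<forall>\<^sub>F n in sequentially. real (Suc s) * C ^ Suc s * (ln (real n) ^ Suc s * real n powr (- 1)) < \<epsilon>"
    using \<epsilon> by (intro order_tendstoD[OF tendsto_mult_right_zero[OF ln_power_negligible]]) auto
  moreover have "\<forall>\<^sub>F n in sequentially. 3 \<le> n" by (rule eventually_ge_at_top)
  ultimately show ?thesis
  proof eventually_elim
    case (elim n)
    have n3: "3 \<le> real n" using elim(5) by simp
    have "exp 1 \<le> real n" using exp_le n3 by linarith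
    then have ln1: "1 \<le> ln (real n)" using n3 by (simp add: ln_ge_iff)
    define a0 where "a0 = real (1 + 2 * s * nat \<lceil>ln (real n)\<rceil>)"
    have a0: "0 \<le> a0" "a0 \<le> C * ln (real n)"
    proof -
      have "real (nat \<lceil>ln (real n)\<rceil>) \<le> 2 * ln (real n)" using ln1 by linarith
      then have "real s * real (nat \<lceil>ln (real n)\<rceil>) \<le> real s * (2 * ln (real n))" by (intro mult_left_mono) auto
      moreover have "1 * 1 \<le> real s * ln (real n)" using s ln1 by (intro mult_mono) auto
      ultimately show "a0 \<le> C * ln (real n)" unfolding a0_def C_def by simp
    qed (simp add: a0_def)
    have ap: "a0 ^ i \<le> C ^ i * ln (real n) ^ i" for i
      unfolding power_mult_distrib[symmetric] using a0 by (intro power_mono)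
    have qn: "q n \<le> real n powr (- (2 / real (Suc s)))" using elim(2) q[of n] by simp
    have C0: "0 \<le> C" unfolding C_def by simp
    have t1: "2 ^ (2 * s * s) * (real n * sqrt (q n) ^ Suc s) \<le> \<epsilon>" using elim(1) by (simp add: field_simps)
    have "real (Suc s) * a0 ^ s * (2 * q n) \<le> real (Suc s) * (C ^ s * ln (real n) ^ s) * (2 * real n powr (- (2 / real (Suc s))))"
      using ap[of s] qn q[of n] a0 C0 ln1 by (intro mult_mono mult_nonneg_nonneg zero_le_power) auto
    also have "\<dots> \<le> \<epsilon>" using elim(3) by (simp add: mult_ac)
    finally have t2: "real (Suc s) * a0 ^ s * (2 * q n) \<le> \<epsilon>" .
    have "real (Suc s) * a0 ^ Suc s / real n \<le> real (Suc s) * (C ^ Suc s * ln (real n) ^ Suc s) / real n"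
      using ap[of "Suc s"] by (intro divide_right_mono mult_left_mono) auto
    also have "\<dots> = real (Suc s) * C ^ Suc s * (ln (real n) ^ Suc s * real n powr (- 1))"
      using n3 by (simp add: powr_minus divide_inverse mult_ac)
    also have "\<dots> \<le> \<epsilon>" using elim(4) by linarith
    finally have t3: "real (Suc s) * a0 ^ Suc s / real n \<le> \<epsilon>" .
    have "2 ^ s * (2 ^ (2 * s * s) * (real n * sqrt (q n) ^ Suc s) + real (Suc s) * a0 ^ s * (2 * q n) + real (Suc s) * a0 ^ Suc s / real n) \<le> 2 ^ s * (3 * \<epsilon>)"
      using t1 t2 t3 by (intro mult_left_mono) auto
    also have "\<dots> = e" unfolding \<epsilon>_def by simp
    finally show ?case unfolding a0_def .
  qed
qed

text \<open>
  With \<open>\<zeta> = k \<surd>(k^k) (b + 1/g)\<close>, the error bounds of lemma \<open>failure_estimate\<close> tend to 0; the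
  factor \<open>\<surd>(k^k)\<close> comes from \<open>(n choose k) \<ge> (n/k)^k\<close>.
\<close>

theorem theorem1p3:
  fixes k :: nat and q :: "nat \<Rightarrow> real"
  assumes "k \<ge> 4"
    and "\<And>n. 0 \<le> q n \<and> q n \<le> 1"
    and "(\<lambda>n. real n powr (- 2 / (real k - 1)) * ln (real n) powr (1 / real ((k - 1) choose 2))) \<in> o(q)"
    and "q \<in> o(\<lambda>n. real n powr (- 2 / real k))"
  shows "\<exists>\<zeta> :: nat \<Rightarrow> real. \<zeta> \<longlonglongrightarrow> 0 \<and>
    (\<lambda>n. measure_pmf.prob (binomial_random_graph n (q n))
       {H. \<forall>M. maximal_complete_matching k H M \<longrightarrow>
          (\<exists>N. complete_matching (k - 1) (remove_covered H M) N \<and>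
             real (card (verts (remove_covered H M) - covered N)) \<le> \<zeta> n * sqrt (mu k n (q n)))})
    \<longlonglongrightarrow> 1"
proof -
  define s where "s = k - 1"
  have k: "k = Suc s" and s: "3 \<le> s" unfolding s_def using assms(1) by auto
  have q0: "0 \<le> q n" "q n \<le> 1" for n using assms(2) by auto
  have ks: "real k - 1 = real s" unfolding k by simp
  have lower: "\<forall>\<^sub>F n in sequentially. C * ln (real n) \<le> real n ^ (s - 1) * q n ^ (s choose 2)" for C
    by (rule density_lower[OF s q0(1)]) (use assms(3) in \<open>simp only: ks s_def[symmetric]\<close>)
  have upper: "\<forall>\<^sub>F n in sequentially. real n * sqrt (q n) ^ Suc s \<le> \<epsilon>" if "0 < \<epsilon>" for \<epsilon>
    by (rule density_upper[OF q0(1) _ that]) (use assms(4) in \<open>simp only: k\<close>)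
  define g where "g = (\<lambda>n. root 4 (real n * sqrt (q n) ^ s))"
  define b where "b = (\<lambda>n. root 4 ((real n * sqrt (q n) ^ Suc s) ^ s))"
  have g0: "0 \<le> g n" and g4: "g n ^ 4 = real n * sqrt (q n) ^ s" for n
    unfolding g_def using q0 by (auto intro!: real_root_pow_pos2)
  have b0: "0 \<le> b n" and b4: "b n ^ 4 = (real n * sqrt (q n) ^ Suc s) ^ s" for n
    unfolding b_def using q0 by (auto intro!: real_root_pow_pos2 zero_le_power)
  have D: "real n ^ (s - 1) * q n ^ (s choose 2) = g n ^ (4 * (s - 1))" for n
  proof -
    have "real n ^ (s - 1) * q n ^ (s choose 2) = real n ^ (s - 1) * ((sqrt (q n))\<^sup>2) ^ (s choose 2)" using q0 by simp
    also have "\<dots> = g n ^ (4 * (s - 1))" unfolding clique_weight g4[symmetric] power_mult ..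
    finally show ?thesis .
  qed
  have lnC: "\<forall>\<^sub>F n in sequentially. C \<le> ln (real n)" for C
    using filterlim_compose[OF ln_at_top filterlim_real_sequentially] by (simp add: filterlim_at_top)
  have gC: "\<forall>\<^sub>F n in sequentially. C \<le> g n" for C
    using lower[of 1] lnC[of "max 0 C ^ (4 * (s - 1))"]
  proof eventually_elim
    case (elim n)
    then have "max 0 C ^ (4 * (s - 1)) \<le> g n ^ (4 * (s - 1))" unfolding D by simp
    then have "max 0 C \<le> g n" by (subst (asm) power_mono_iff) (use g0[of n] s in auto)
    then show ?case by simp
  qed
  then have gtop: "filterlim g at_top sequentially" by (simp add: filterlim_at_top)
  have bE: "\<forall>\<^sub>F n in sequentially. b n \<le> \<epsilon>" if \<epsilon>: "0 < \<epsilon>" for \<epsilon>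
  proof -
    have "\<forall>\<^sub>F n in sequentially. real n * sqrt (q n) ^ Suc s \<le> min 1 (\<epsilon> ^ 4)" by (rule upper) (use \<epsilon> in auto)
    then show ?thesis
    proof eventually_elim
      case (elim n)
      have "b n ^ 4 \<le> (real n * sqrt (q n) ^ Suc s) ^ 1"
        unfolding b4 using elim q0 s by (intro power_decreasing) auto
      then have "b n ^ 4 \<le> \<epsilon> ^ 4" using elim by simp
      then show ?case using b0[of n] \<epsilon> by (simp add: power_mono_iff)
    qed
  qed
  have blim: "b \<longlonglongrightarrow> 0"
  proof (rule LIMSEQ_I)
    fix r :: real assume "0 < r"
    then have "\<forall>\<^sub>F n in sequentially. b n \<le> r / 2" by (intro bE) simp
    then obtain n0 where "\<And>n. n0 \<le> n \<Longrightarrow> b n \<le> r / 2" unfolding eventually_sequentially by blast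
    then show "\<exists>no. \<forall>n\<ge>no. norm (b n - 0) < r" using b0 \<open>0 < r\<close> by (intro exI[of _ n0]) (force simp: field_simps)
  qed
  have glim: "(\<lambda>n. 1 / g n) \<longlonglongrightarrow> 0"
    using tendsto_inverse_0_at_top[OF gtop] by (simp add: inverse_eq_divide)
  define K where "K = spread_const s"
  have K1: "1 \<le> K" unfolding K_def using s by (intro spread_const_ge) simp
  define \<zeta> where "\<zeta> = (\<lambda>n. real k * sqrt (real k ^ k) * (b n + 1 / g n))"
  define err where "err = (\<lambda>n. 1 / real n + joint_const s / g n + (b n)\<^sup>2 + 1 / g n)"
  define P where "P = (\<lambda>n. measure_pmf.prob (binomial_random_graph n (q n))
       {H. \<forall>M. maximal_complete_matching k H M \<longrightarrow>
          (\<exists>N. complete_matching (k - 1) (remove_covered H M) N \<and>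
             real (card (verts (remove_covered H M) - covered N)) \<le> \<zeta> n * sqrt (mu k n (q n)))})"
  have nC: "\<forall>\<^sub>F n in sequentially. C \<le> real n" for C
    using filterlim_real_sequentially by (simp add: filterlim_at_top)
  have ev_small: "\<forall>\<^sub>F n in sequentially. 2 ^ s * (2 ^ (2 * s * s) * (real n * sqrt (q n) ^ Suc s) + real (Suc s) * real (1 + 2 * s * nat \<lceil>ln (real n)\<rceil>) ^ s * (2 * q n)
       + real (Suc s) * real (1 + 2 * s * nat \<lceil>ln (real n)\<rceil>) ^ Suc s / real n) \<le> overlap_const s * exp (- 2)"
    by (rule overlap_terms_vanish[OF s q0(1)]) (use assms(4) s in \<open>auto simp: k overlap_const_def\<close>)
  have ev_pow: "\<forall>\<^sub>F n in sequentially. 2 * g n ^ (8 * (s - 1)) \<le> 2 powr g n"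
    using gtop power_le_two_powr unfolding filterlim_iff by blast
  have ev_b: "\<forall>\<^sub>F n in sequentially. b n \<le> 1 / (2 ^ Suc (Suc s) * (8192 * K))" using K1 by (intro bE) simp
  have ev_B: "\<forall>\<^sub>F n in sequentially. real n * sqrt (q n) ^ Suc s \<le> 1 / 2 ^ (2 * s * s)" by (rule upper) simp
  have ev_q: "\<forall>\<^sub>F n in sequentially. q n \<le> 1/2"
  proof -
    have "\<forall>\<^sub>F n in sequentially. norm (q n) \<le> (1/2) * norm (real n powr (- 2 / real k))"
      by (rule landau_o.smallD[OF assms(4)]) simp
    then show ?thesis using nC[of 1]
    proof eventually_elim
      case (elim n)
      have "real n powr (- 2 / real k) \<le> real n powr 0" using elim(2) by (intro powr_mono) auto
      then show ?case using elim q0(1)[of n] by simp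
    qed
  qed
  have ev_n: "\<forall>\<^sub>F n in sequentially. 4 * real s ^ s \<le> (real n / (16 * real s)) ^ (s - 1)"
    using nC[of "16 * real s * (4 * real s ^ s)"]
  proof eventually_elim
    case (elim n)
    have "1 \<le> real s ^ s" using s by (intro one_le_power) simp
    then have c: "1 \<le> 4 * real s ^ s" by linarith
    have d: "4 * real s ^ s \<le> real n / (16 * real s)" using elim s by (simp add: field_simps)
    have e: "1 \<le> real n / (16 * real s)" using c d by linarith
    have "(real n / (16 * real s)) ^ 1 \<le> (real n / (16 * real s)) ^ (s - 1)" using s by (intro power_increasing e) auto
    then show ?case using d by simp
  qed
  have main: "\<forall>\<^sub>F n in sequentially. 1 - err n \<le> P n"
    using ev_small ev_pow ev_b ev_B ev_q ev_n gC[of 4] gC[of "2 * real s"] gC[of "4096 * K"] lower[of "3072 * K"]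
      nC[of "16 * (real s)\<^sup>2"] nC[of "4 ^ s * K\<^sup>2"] nC[of "real k"]
  proof eventually_elim
    case (elim n)
    have gn: "0 < g n" "1 \<le> g n" using elim(7) by linarith+
    have "0 < g n ^ 4" using gn by simp
    then have nq: "0 < real n * sqrt (q n) ^ s" unfolding g4 .
    have "q n \<noteq> 0"
    proof
      assume "q n = 0"
      then show False using nq s by (simp add: power_0_left)
    qed
    then have qn: "0 < q n" using q0(1)[of n] by linarith
    have n0: "0 < real n"
    proof (rule ccontr)
      assume "\<not> 0 < real n"
      then show False using nq by simp
    qed
    have "0 < b n ^ 4" unfolding b4 using qn n0 by simp
    then have bn: "0 < b n" using b0[of n] by (auto simp: less_le)
    have "\<exists>r. r \<le> real (Suc s) * ((b n + 1 / g n) * g n ^ (2 * Suc s)) \<and>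
      rexp (pairs {1..n}) (q n) (\<lambda>X. of_bool (leaves_much {1..n} (Suc s) s r X)) \<le> 1 / real n + joint_const s / g n + (b n)\<^sup>2 + 1 / g n"
    proof (rule failure_estimate[OF _ _ qn elim(5) s g4 b4 elim(7) elim(8) elim(2) bn])
      show "2 ^ Suc (Suc s) * (8192 * spread_const s) * b n \<le> 1" using elim(3) K1 unfolding K_def by (simp add: field_simps)
      show "2 ^ (2 * s * s) * (real n * sqrt (q n) ^ Suc s) \<le> 1" using elim(4) by (simp add: field_simps)
      have "g n ^ 1 \<le> g n ^ (4 * (s - 1))" using gn s by (intro power_increasing) auto
      then show "4096 * spread_const s \<le> g n ^ (4 * (s - 1))" using elim(9) unfolding K_def by simp
      show "3072 * spread_const s * ln (real n) \<le> g n ^ (4 * (s - 1))" using elim(10) unfolding D K_def .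
      show "4 ^ s * (spread_const s)\<^sup>2 \<le> real n" using elim(12) unfolding K_def .
    qed (use elim in auto)
    then obtain r where r: "r \<le> real (Suc s) * ((b n + 1 / g n) * g n ^ (2 * Suc s))"
      "rexp (pairs {1..n}) (q n) (\<lambda>X. of_bool (leaves_much {1..n} (Suc s) s r X)) \<le> err n" unfolding err_def by blast
    have "r \<le> \<zeta> n * sqrt (mu k n (q n))"
    proof -
      have kn: "k \<le> n" using elim(13) by simp
      have k0: "0 < real k" unfolding k by simp
      have "(real n / real k) ^ k \<le> real (n choose k)" by (rule binomial_ge_n_over_k_pow_k[OF kn])
      then have "(real n / real k) ^ k * q n ^ (k choose 2) \<le> mu k n (q n)"
        unfolding mu_def using q0 by (intro mult_right_mono) auto
      moreover have "(real n / real k) ^ k * q n ^ (k choose 2) = (g n ^ (2 * k))\<^sup>2 / real k ^ k"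
      proof -
        have "real n ^ k * q n ^ (k choose 2) = (g n ^ 4) ^ k" unfolding g4 k by (rule clique_expectation[OF q0(1)])
        also have "\<dots> = (g n ^ (2 * k))\<^sup>2" by (simp add: power_mult[symmetric] mult.commute)
        finally show ?thesis by (simp add: power_divide)
      qed
      ultimately have "(g n ^ (2 * k))\<^sup>2 / real k ^ k \<le> mu k n (q n)" by simp
      then have "sqrt ((g n ^ (2 * k))\<^sup>2 / real k ^ k) \<le> sqrt (mu k n (q n))" by (rule real_sqrt_le_mono)
      then have "g n ^ (2 * k) / sqrt (real k ^ k) \<le> sqrt (mu k n (q n))" using gn by (simp add: real_sqrt_divide)
      then have "g n ^ (2 * k) \<le> sqrt (real k ^ k) * sqrt (mu k n (q n))" using k0 by (simp add: field_simps)
      then have "(real k * (b n + 1 / g n)) * g n ^ (2 * k) \<le> (real k * (b n + 1 / g n)) * (sqrt (real k ^ k) * sqrt (mu k n (q n)))"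
        using bn gn by (intro mult_left_mono) auto
      then show ?thesis using r(1) unfolding \<zeta>_def k[symmetric] by (simp add: mult_ac)
    qed
    then have "1 - rexp (pairs {1..n}) (q n) (\<lambda>X. of_bool (leaves_much {1..n} k s r X)) \<le> P n"
      unfolding P_def s_def by (intro success_probability q0) (use assms(1) in auto)
    then show ?case using r(2) unfolding k by linarith
  qed
  have z: "\<zeta> \<longlonglongrightarrow> 0"
    unfolding \<zeta>_def by (intro tendsto_mult_right_zero tendsto_add_zero blim glim)
  have "err \<longlonglongrightarrow> 0 + joint_const s * 0 + 0\<^sup>2 + 0"
    unfolding err_def divide_inverse[of "joint_const s"]
    using glim by (intro tendsto_add tendsto_mult tendsto_power tendsto_const blim glim lim_1_over_n) (simp add: inverse_eq_divide)
  then have "(\<lambda>n. 1 - err n) \<longlonglongrightarrow> 1 - (0 + joint_const s * 0 + 0\<^sup>2 + 0)" by (intro tendsto_diff tendsto_const)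
  then have lo: "(\<lambda>n. 1 - err n) \<longlonglongrightarrow> 1" by simp
  have "P \<longlonglongrightarrow> 1"
    by (rule tendsto_sandwich[OF main _ lo tendsto_const]) (simp add: P_def)
  then show ?thesis using z unfolding P_def by blast
qed

end
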